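(* Let $c > 0$ be a constant. The WSAT$^-[t]$ ($t \geq 2$) problem on circuits of genus $g(n) =\Omega(n^c)$, where $n$ is the number of variables in the circuit, is $W[t]$-complete for odd $t$ and $W[t-1]$-complete for even $t$.
   Context: A $\Pi_t$ circuit is a Boolean circuit in normalized form of depth at most $t$: the output gate is an AND-gate, every non-variable gate has outdegree at most 1, and starting from the output gate the gates alternate between AND-gates and OR-gates (no NOT-gates; input vertices are literals). A circuit is antimonotone if all its input literals are negative. The weight of an assignment is the number of variables set to 1. WSAT$^-[t]$ (weighted antimonotone $\Pi_t$-circuit satisfiability) is the problem: given an antimonotone $\Pi_t$ circuit $C$ and a parameter $k$, decide whether $C$ has a satisfying assignment of weight exactly $k$. The genus of a circuit is the genus of its underlying undirected graph after the output gate is removed. It is known that WSAT$^-[t]$ (without genus restriction) is $W[t]$-complete for odd $t$ and $W[t-1]$-complete for even $t$. *)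

theory Defs
  imports
    "HOL-Combinatorics.Combinatorics"
    "HOL-Library.Landau_Symbols"
begin

section \<open>Computation model\<close>

text \<open>
  Algorithms are while-programs over finitely many registers holding finite binary trees. An
  assignment is charged the size of the tree it stores (and not unit cost), so that the total size
  of all registers is at most the size of the input plus the elapsed time, up to a constant. With
  this cost measure the model and deterministic Turing machines simulate each other with
  polynomial overhead, for output-producing programs as well as for decision programs.
\<close>

datatype data = Leaf | Pair data data

fun dsize :: "data \<Rightarrow> nat" where
  "dsize Leaf = 1"
| "dsize (Pair a b) = 1 + dsize a + dsize b"

fun dfst :: "data \<Rightarrow> data" where
  "dfst Leaf = Leaf"
| "dfst (Pair a b) = a"

fun dsnd :: "data \<Rightarrow> data" where
  "dsnd Leaf = Leaf"
| "dsnd (Pair a b) = b"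

datatype exp = ELeaf | EVar nat | EPair nat nat | EFst nat | ESnd nat

type_synonym store = "nat \<Rightarrow> data"

fun eval_exp :: "store \<Rightarrow> exp \<Rightarrow> data" where
  "eval_exp s ELeaf = Leaf"
| "eval_exp s (EVar x) = s x"
| "eval_exp s (EPair x y) = Pair (s x) (s y)"
| "eval_exp s (EFst x) = dfst (s x)"
| "eval_exp s (ESnd x) = dsnd (s x)"

datatype com =
    Assign nat exp
  | Seq com com
  | IfPair nat com com
  | WhilePair nat com

text \<open>\<open>exec p s T s'\<close>: program \<open>p\<close> started in \<open>s\<close> terminates in \<open>s'\<close> after time \<open>T\<close>.\<close>

inductive exec :: "com \<Rightarrow> store \<Rightarrow> nat \<Rightarrow> store \<Rightarrow> bool" where
  "exec (Assign x e) s (1 + dsize (eval_exp s e)) (s(x := eval_exp s e))"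
| "\<lbrakk>exec p s T1 s'; exec q s' T2 s''\<rbrakk> \<Longrightarrow> exec (Seq p q) s (T1 + T2) s''"
| "\<lbrakk>s x \<noteq> Leaf; exec p s T s'\<rbrakk> \<Longrightarrow> exec (IfPair x p q) s (1 + T) s'"
| "\<lbrakk>s x = Leaf; exec q s T s'\<rbrakk> \<Longrightarrow> exec (IfPair x p q) s (1 + T) s'"
| "s x = Leaf \<Longrightarrow> exec (WhilePair x p) s 1 s"
| "\<lbrakk>s x \<noteq> Leaf; exec p s T1 s'; exec (WhilePair x p) s' T2 s''\<rbrakk>
    \<Longrightarrow> exec (WhilePair x p) s (1 + T1 + T2) s''"

definition computes_in :: "com \<Rightarrow> data \<Rightarrow> data \<Rightarrow> nat \<Rightarrow> bool" where
  "computes_in p a b T \<longleftrightarrow> (\<exists>s'. exec p ((\<lambda>_. Leaf)(0 := a)) T s' \<and> s' 0 = b)"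

fun enc_nat :: "nat \<Rightarrow> data" where
  "enc_nat 0 = Leaf"
| "enc_nat (Suc n) = Pair Leaf (enc_nat n)"

fun enc_list :: "('a \<Rightarrow> data) \<Rightarrow> 'a list \<Rightarrow> data" where
  "enc_list f [] = Leaf"
| "enc_list f (x # xs) = Pair (f x) (enc_list f xs)"

definition computable :: "(nat \<Rightarrow> nat) \<Rightarrow> bool" where
  "computable f \<longleftrightarrow> (\<exists>p. \<forall>n. \<exists>T. computes_in p (enc_nat n) (enc_nat (f n)) T)"


section \<open>Parameterized problems and fpt-reductions\<close>

text \<open>
  A parameterized problem consists of its admissible instances \<open>(x, k)\<close> (input and parameter) and
  of the yes-instances among them. Problems on a restricted class of inputs have that class as
  their admissible instances; an algorithm is not required to recognize admissibility.
\<close>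

record pproblem =
  instances :: "(data \<times> nat) set"
  yes_instances :: "(data \<times> nat) set"

text \<open>Since \<open>dsize x \<ge> 1\<close>, the time bounds \<open>f k * dsize x ^ d\<close> cover all bounds \<open>f(k) p(|x|)\<close> with
  a polynomial \<open>p\<close>.\<close>

definition fpt_reducible :: "pproblem \<Rightarrow> pproblem \<Rightarrow> bool" (infix "\<le>\<^sub>f\<^sub>p\<^sub>t" 50) where
  "P \<le>\<^sub>f\<^sub>p\<^sub>t Q \<longleftrightarrow>
    (\<exists>p f h d. computable f \<and> computable h \<and>
      (\<forall>(x, k) \<in> instances P. \<exists>x' k' T.
         computes_in p (Pair x (enc_nat k)) (Pair x' (enc_nat k')) T \<and>
         T \<le> f k * dsize x ^ d \<and>
         k' \<le> h k \<and>
         (x', k') \<in> instances Q \<and>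
         ((x, k) \<in> yes_instances P \<longleftrightarrow> (x', k') \<in> yes_instances Q)))"


section \<open>Boolean circuits\<close>

text \<open>
  A circuit is the list of its vertices in a topological order. A gate refers to its
  in-neighbours by their positions, and the last vertex is the output. A literal is a pair of a
  sign (\<open>True\<close> for positive) and a variable.
\<close>

datatype vertex =
    Literal bool nat
  | NotGate nat
  | AndGate "nat list"
  | OrGate "nat list"

type_synonym circuit = "vertex list"

fun in_nbrs :: "vertex \<Rightarrow> nat set" where
  "in_nbrs (Literal b x) = {}"
| "in_nbrs (NotGate i) = {i}"
| "in_nbrs (AndGate is) = set is"
| "in_nbrs (OrGate is) = set is"

fun is_literal :: "vertex \<Rightarrow> bool" where
  "is_literal (Literal b x) = True"
| "is_literal _ = False"

fun is_not :: "vertex \<Rightarrow> bool" where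
  "is_not (NotGate i) = True"
| "is_not _ = False"

fun is_and :: "vertex \<Rightarrow> bool" where
  "is_and (AndGate is) = True"
| "is_and _ = False"

text \<open>Every literal labels at most one vertex. Otherwise every circuit with gates of outdegree at
  most 1 could be unfolded into a tree, and its genus would carry no information.\<close>

definition is_circuit :: "circuit \<Rightarrow> bool" where
  "is_circuit C \<longleftrightarrow> C \<noteq> [] \<and>
    (\<forall>j < length C. in_nbrs (C ! j) \<subseteq> {..<j}) \<and>
    (\<forall>v \<in> set C. \<not> is_literal v \<longrightarrow> in_nbrs v \<noteq> {}) \<and>
    distinct (filter is_literal C)"

definition vars :: "circuit \<Rightarrow> nat set" where
  "vars C = {x. \<exists>b. Literal b x \<in> set C}"

text \<open>\<open>sweep f C\<close> evaluates \<open>f\<close> along the topological order; \<open>f\<close> receives the list of results for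
  all preceding vertices.\<close>

definition sweep :: "('a list \<Rightarrow> vertex \<Rightarrow> 'a) \<Rightarrow> circuit \<Rightarrow> 'a list" where
  "sweep f C = foldl (\<lambda>rs v. rs @ [f rs v]) [] C"

text \<open>Assignments are identified with the set of variables they set to 1.\<close>

fun vertex_value :: "nat set \<Rightarrow> bool list \<Rightarrow> vertex \<Rightarrow> bool" where
  "vertex_value A rs (Literal b x) = ((x \<in> A) = b)"
| "vertex_value A rs (NotGate i) = (\<not> rs ! i)"
| "vertex_value A rs (AndGate is) = (\<forall>i \<in> set is. rs ! i)"
| "vertex_value A rs (OrGate is) = (\<exists>i \<in> set is. rs ! i)"

definition satisfies :: "nat set \<Rightarrow> circuit \<Rightarrow> bool" where
  "satisfies A C \<longleftrightarrow> last (sweep (vertex_value A) C)"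

definition weighted_satisfiable :: "circuit \<Rightarrow> nat \<Rightarrow> bool" where
  "weighted_satisfiable C k \<longleftrightarrow> (\<exists>A \<subseteq> vars C. card A = k \<and> satisfies A C)"

text \<open>Maximum number of gates on a path from an input vertex to the output.\<close>

definition depth :: "circuit \<Rightarrow> nat" where
  "depth C = last (sweep (\<lambda>rs v. if is_literal v then 0 else 1 + Max ((!) rs ` in_nbrs v)) C)"

text \<open>Maximum number of large gates, i.e. gates of indegree greater than 2, on a path from an input
  vertex to the output.\<close>

definition weft :: "circuit \<Rightarrow> nat" where
  "weft C = last (sweep (\<lambda>rs v. if is_literal v then 0
     else (if card (in_nbrs v) > 2 then 1 else 0) + Max ((!) rs ` in_nbrs v)) C)"

definition outdegree :: "circuit \<Rightarrow> nat \<Rightarrow> nat" where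
  "outdegree C i = card {j. j < length C \<and> i \<in> in_nbrs (C ! j)}"

definition Pi_circuit :: "nat \<Rightarrow> circuit \<Rightarrow> bool" where
  "Pi_circuit t C \<longleftrightarrow> is_circuit C \<and> depth C \<le> t \<and>
    is_and (last C) \<and>
    (\<forall>v \<in> set C. \<not> is_not v) \<and>
    (\<forall>i < length C. \<not> is_literal (C ! i) \<longrightarrow> outdegree C i \<le> 1) \<and>
    (\<forall>j < length C. \<forall>i \<in> in_nbrs (C ! j).
       \<not> is_literal (C ! i) \<longrightarrow> is_and (C ! i) \<noteq> is_and (C ! j))"

definition antimonotone :: "circuit \<Rightarrow> bool" where
  "antimonotone C \<longleftrightarrow> (\<forall>b x. Literal b x \<in> set C \<longrightarrow> \<not> b)"

fun enc_vertex :: "vertex \<Rightarrow> data" where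
  "enc_vertex (Literal b x) = Pair (enc_nat (if b then 0 else 1)) (enc_nat x)"
| "enc_vertex (NotGate i) = Pair (enc_nat 2) (enc_nat i)"
| "enc_vertex (AndGate is) = Pair (enc_nat 3) (enc_list enc_nat is)"
| "enc_vertex (OrGate is) = Pair (enc_nat 4) (enc_list enc_nat is)"

definition enc_circuit :: "circuit \<Rightarrow> data" where
  "enc_circuit C = enc_list enc_vertex C"

text \<open>Weighted satisfiability, parameterized by the weight, of the circuits satisfying \<open>Q\<close>.\<close>

definition WSAT_on :: "(circuit \<Rightarrow> bool) \<Rightarrow> pproblem" where
  "WSAT_on Q =
    \<lparr>instances = {(enc_circuit C, k) | C k. Q C},
     yes_instances = {(enc_circuit C, k) | C k. Q C \<and> weighted_satisfiable C k}\<rparr>"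


section \<open>The W-hierarchy\<close>

text \<open>Here circuits have variables as inputs and may contain NOT-gates.\<close>

definition weft_circuit :: "nat \<Rightarrow> nat \<Rightarrow> circuit \<Rightarrow> bool" where
  "weft_circuit t d C \<longleftrightarrow> is_circuit C \<and> (\<forall>b x. Literal b x \<in> set C \<longrightarrow> b) \<and>
    weft C \<le> t \<and> depth C \<le> d"

definition W_class :: "nat \<Rightarrow> pproblem set" where
  "W_class t = {P. \<exists>d. P \<le>\<^sub>f\<^sub>p\<^sub>t WSAT_on (weft_circuit t d)}"

definition W_hard :: "nat \<Rightarrow> pproblem \<Rightarrow> bool" where
  "W_hard t P \<longleftrightarrow> (\<forall>Q \<in> W_class t. Q \<le>\<^sub>f\<^sub>p\<^sub>t P)"

definition W_complete :: "nat \<Rightarrow> pproblem \<Rightarrow> bool" where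
  "W_complete t P \<longleftrightarrow> P \<in> W_class t \<and> W_hard t P"


section \<open>Genus\<close>

text \<open>
  A finite simple undirected graph is given by its vertex set \<open>V\<close> and the symmetric irreflexive set
  \<open>D\<close> of its darts (every edge occurs in both directions). Its cellular embeddings into oriented
  closed surfaces, one surface per connected component, are given by the rotation systems: a cyclic
  order of the darts leaving each vertex. The faces are the orbits of the permutation that reverses a
  dart and then rotates; an isolated vertex has one face, which is not represented by a dart.
\<close>

definition rotation_system :: "('v \<times> 'v) set \<Rightarrow> ('v \<times> 'v \<Rightarrow> 'v \<times> 'v) \<Rightarrow> bool" where
  "rotation_system D r \<longleftrightarrow> r permutes D \<and> (\<forall>d \<in> D. orbit r d = {e \<in> D. fst e = fst d})"

definition num_faces :: "'v set \<Rightarrow> ('v \<times> 'v) set \<Rightarrow> ('v \<times> 'v \<Rightarrow> 'v \<times> 'v) \<Rightarrow> nat" where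
  "num_faces V D r = card (orbit (r \<circ> prod.swap) ` D) + card (V - fst ` D)"

definition num_components :: "'v set \<Rightarrow> ('v \<times> 'v) set \<Rightarrow> nat" where
  "num_components V D = card (V // (D\<^sup>* \<inter> V \<times> V))"

text \<open>The equation is the sum of Euler's formulas \<open>|V| - |E| + |F| = 2 - 2g\<close> over all connected
  components; the genus of a graph is the sum of the genera of its components.\<close>

definition genus :: "'v set \<Rightarrow> ('v \<times> 'v) set \<Rightarrow> nat" where
  "genus V D = (LEAST g. \<exists>r. rotation_system D r \<and>
     int (card V) - int (card D div 2) + int (num_faces V D r)
       = 2 * int (num_components V D) - 2 * int g)"

text \<open>The output gate, i.e. the last vertex, is removed.\<close>

definition circuit_genus :: "circuit \<Rightarrow> nat" where
  "circuit_genus C = (let V = {..<length C - 1} in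
     genus V {(i, j) \<in> V \<times> V. i \<in> in_nbrs (C ! j) \<or> j \<in> in_nbrs (C ! i)})"


section \<open>Weighted antimonotone satisfiability of circuits of bounded genus\<close>

definition WSAT_anti_genus :: "nat \<Rightarrow> (nat \<Rightarrow> real) \<Rightarrow> pproblem" where
  "WSAT_anti_genus t g = WSAT_on (\<lambda>C. Pi_circuit t C \<and> antimonotone C \<and>
     real (circuit_genus C) \<le> g (card (vars C)))"


section \<open>Sanity checks\<close>

lemma enc_nat_inject [simp]: "enc_nat m = enc_nat n \<longleftrightarrow> m = n"
proof (induction m arbitrary: n)
  case 0 show ?case by (cases n) auto
next
  case (Suc m) then show ?case by (cases n) auto
qed

lemma enc_list_inject:
  assumes "inj f"
  shows "enc_list f xs = enc_list f ys \<longleftrightarrow> xs = ys"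
proof (induction xs arbitrary: ys)
  case Nil show ?case by (cases ys) auto
next
  case (Cons x xs) then show ?case by (cases ys) (simp_all add: inj_eq[OF assms])
qed

lemma inj_enc_nat: "inj enc_nat"
  by (rule injI) simp

lemma enc_vertex_inject: "enc_vertex v = enc_vertex w \<longleftrightarrow> v = w"
  by (induction v; induction w)
    (simp_all add: enc_list_inject[OF inj_enc_nat] del: enc_nat.simps)

lemma inj_enc_vertex: "inj enc_vertex"
  by (rule injI) (simp add: enc_vertex_inject)

lemma inj_enc_circuit: "inj enc_circuit"
  by (rule injI) (simp add: enc_circuit_def enc_list_inject[OF inj_enc_vertex])

lemma yes_instance_WSAT_on_iff:
  "(enc_circuit C, k) \<in> yes_instances (WSAT_on Q) \<longleftrightarrow> Q C \<and> weighted_satisfiable C k"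
  by (auto simp: WSAT_on_def inj_eq[OF inj_enc_circuit])

inductive_cases AssignE: "exec (Assign x e) s T s'"
inductive_cases SeqE: "exec (Seq p q) s T s'"
inductive_cases IfPairE: "exec (IfPair x p q) s T s'"
inductive_cases WhilePairE: "exec (WhilePair x p) s T s'"

lemma exec_deterministic:
  assumes "exec p s T s'" "exec p s T' s''"
  shows "T = T' \<and> s' = s''"
  using assms
proof (induction arbitrary: T' s'' rule: exec.induct)
  case (1 x e s)
  from "1.prems" show ?case by (rule AssignE) simp
next
  case (2 p s T1 s1 q T2 s2)
  from "2.prems" obtain U1 r U2 where U: "T' = U1 + U2" "exec p s U1 r" "exec q r U2 s''"
    by (rule SeqE)
  have "T1 = U1 \<and> s1 = r" by (rule "2.IH"(1)[OF U(2)])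
  moreover from this U(3) have "T2 = U2 \<and> s2 = s''" by (intro "2.IH"(2)) simp
  ultimately show ?case using U(1) by simp
next
  case (3 s x p T s1 q)
  from "3.prems" "3.hyps"(1) obtain U where U: "T' = Suc U" "exec p s U s''"
    by (blast elim: IfPairE)
  from "3.IH"[OF U(2)] U(1) show ?case by simp
next
  case (4 s x q T s1 p)
  from "4.prems" "4.hyps"(1) obtain U where U: "T' = Suc U" "exec q s U s''"
    by (blast elim: IfPairE)
  from "4.IH"[OF U(2)] U(1) show ?case by simp
next
  case (5 s x p)
  from "5.prems" "5.hyps" have "T' = Suc 0 \<and> s'' = s" by (blast elim: WhilePairE)
  then show ?case by simp
next
  case (6 s x p T1 s1 T2 s2)
  from "6.prems" "6.hyps"(1) obtain U1 r U2
    where U: "T' = Suc (U1 + U2)" "exec p s U1 r" "exec (WhilePair x p) r U2 s''"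
    by (blast elim: WhilePairE)
  have "T1 = U1 \<and> s1 = r" by (rule "6.IH"(1)[OF U(2)])
  moreover from this U(3) have "T2 = U2 \<and> s2 = s''" by (intro "6.IH"(2)) simp
  ultimately show ?case using U(1) by simp
qed

end

theory Submission
  imports Defs
begin

text \<open>
  Let \<open>T\<close> be \<open>t\<close> for odd \<open>t\<close> and \<open>t - 1\<close> for even \<open>t\<close>; in both cases \<open>T\<close> is odd.

  \<^bold>\<open>Hardness.\<close> A circuit of weft \<open>T\<close> and depth \<open>d\<close> is equivalent to a disjunction of alternating formulas of
  depth \<open>T + 1\<close> whose bottom gates are disjunctions of at most \<open>2 ^ d + 1\<close> literals. A weight-\<open>k\<close> assignment
  is described by its \<open>k + 1\<close> gaps between consecutive true variables, together with the chosen disjunct: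
  a false variable is one that lies in a gap and a true one is the end point of a gap, so that a literal of
  either sign is refuted by a single gap. Taking tuples of gaps as new variables, a bottom disjunction fails iff
  some selected tuple refutes all its literals. Hence the bottom gates are absorbed into
  conjunctions of negative literals, and binary clauses of negative literals enforce that the selected tuples
  are exactly those over one assignment. Finally the circuit is padded by dummy variables that are forced to be
  false. They increase the number of variables polynomially without creating genus, as the genus is bounded by the
  square of the number of the vertices that matter. The padding also contains a dense bipartite part, which
  makes the crude estimate through the number of edges sufficient.

  \<^bold>\<open>Membership.\<close> A bottom clause of an antimonotone circuit says that some set \<open>S\<close> of variables is not contained
  in the assignment \<open>x 0 < \<dots> < x (k - 1)\<close>. The new variables describe, for each of the \<open>2 ^ k - 1\<close> nonempty
  index sets \<open>J\<close>, the walk of the word \<open>(x j | j \<in> J)\<close> through the trie of all bottom clauses. Consistency of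
  these walks is checked on pairs, and a clause becomes a conjunction of negated variables, which saves one level.
\<close>

section \<open>Programs as subroutines\<close>

text \<open>The genus condition is met by making the number of variables large and not by a clever
  drawing: dummy variables are wired to the output gate only, and since the genus is taken after its
  removal they become isolated vertices. What is left is a bound for an arbitrary graph in terms of
  its non-isolated vertices. As \<open>genus\<close> is the least natural number solving Euler's
  equation for some rotation system, such a bound must exhibit a solution, and for this edges minus
  non-isolated vertices minus faces with darts has to be even and nonnegative. Parity comes from
  signs of permutations, nonnegativity from an abundance of edges. Nothing is computed from
  \<open>g\<close>: two constants extracted from its growth are built into the reduction.
  Consistency of a selection of new variables can only be enforced by binary clauses and by the
  weight. In both reductions the weight is therefore the largest size that a consistent selection
  can have, so that reaching it forces a complete description of one assignment:
  \<open>(k + 2) ^ r\<close> tuples in the hardness part, \<open>2 ^ k - 1\<close> walks in the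
  membership part.\<close>

class enc = fixes enc :: "'a \<Rightarrow> data"

instantiation unit :: enc begin
definition enc_unit_inst: "enc (u :: unit) = Leaf"
instance ..
end

instantiation bool :: enc begin
definition enc_bool_inst: "enc b = (if b then Pair Leaf Leaf else Leaf)"
instance ..
end

instantiation nat :: enc begin
definition enc_nat_inst: "enc = enc_nat"
instance ..
end

instantiation prod :: (enc, enc) enc begin
definition enc_prod_inst: "enc p = Pair (enc (fst p)) (enc (snd p))"
instance ..
end

instantiation list :: (enc) enc begin
definition enc_list_inst: "enc = enc_list enc"
instance ..
end

instantiation vertex :: enc begin
definition enc_vertex_inst: "enc = enc_vertex"
instance ..
end

lemma enc_simps [simp]:
  "enc (u :: unit) = Leaf"
  "enc True = Pair Leaf Leaf" "enc False = Leaf"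
  "enc (0 :: nat) = Leaf" "enc (Suc n) = Pair Leaf (enc n)"
  "enc (x, y) = Pair (enc x) (enc y)"
  "enc [] = Leaf" "enc (z # zs) = Pair (enc z) (enc zs)"
  by (simp_all add: enc_unit_inst enc_bool_inst enc_nat_inst enc_prod_inst enc_list_inst)

lemma enc_circuit_conv: "enc_circuit C = enc C"
  by (simp add: enc_circuit_def enc_list_inst enc_vertex_inst)

abbreviation sz :: "'a::enc \<Rightarrow> nat" where "sz x \<equiv> dsize (enc x)"

lemma dsize_pos [simp]: "0 < dsize x" by (cases x) auto

lemma sz_nat [simp]: "sz (n :: nat) = 2 * n + 1"
  by (induction n) auto

text \<open>Total correctness from one start store with a time budget. The exact times of
  \<open>exec\<close> are relaxed to upper bounds, so that budgets can be added and
  weakened.\<close>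

definition hoare :: "com \<Rightarrow> store \<Rightarrow> nat \<Rightarrow> (store \<Rightarrow> bool) \<Rightarrow> bool" where
  "hoare q s n \<Phi> \<longleftrightarrow> (\<exists>T s'. exec q s T s' \<and> T \<le> n \<and> \<Phi> s')"

lemma hoare_mono: "hoare q s n \<Phi> \<Longrightarrow> n \<le> m \<Longrightarrow> (\<And>s'. \<Phi> s' \<Longrightarrow> \<Psi> s') \<Longrightarrow> hoare q s m \<Psi>"
  unfolding hoare_def by (meson le_trans)

lemma hoare_assign:
  "\<Phi> (s(x := eval_exp s e)) \<Longrightarrow> 1 + dsize (eval_exp s e) \<le> n \<Longrightarrow> hoare (Assign x e) s n \<Phi>"
  unfolding hoare_def using exec.intros(1) by blast

lemma hoare_seq:
  "hoare p s n1 \<Psi> \<Longrightarrow> (\<And>s'. \<Psi> s' \<Longrightarrow> hoare q s' n2 \<Phi>) \<Longrightarrow> n1 + n2 \<le> n \<Longrightarrow> hoare (Seq p q) s n \<Phi>"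
  unfolding hoare_def by (meson add_mono exec.intros(2) le_trans)

lemma hoare_if:
  assumes "s x \<noteq> Leaf \<Longrightarrow> hoare p s n \<Phi>" "s x = Leaf \<Longrightarrow> hoare q s n \<Phi>" "1 + n \<le> m"
  shows "hoare (IfPair x p q) s m \<Phi>"
proof (cases "s x = Leaf")
  case True
  with assms obtain T s' where "exec q s T s'" "T \<le> n" "\<Phi> s'" by (auto simp: hoare_def)
  with True exec.intros(4)[OF True this(1), of p] assms(3) show ?thesis
    unfolding hoare_def by (meson add_left_mono le_trans)
next
  case False
  with assms obtain T s' where "exec p s T s'" "T \<le> n" "\<Phi> s'" by (auto simp: hoare_def)
  with False exec.intros(3)[OF False this(1), of q] assms(3) show ?thesis
    unfolding hoare_def by (meson add_left_mono le_trans)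
qed

lemma hoare_while_stop: "s x = Leaf \<Longrightarrow> \<Phi> s \<Longrightarrow> 1 \<le> n \<Longrightarrow> hoare (WhilePair x p) s n \<Phi>"
  unfolding hoare_def using exec.intros(5) by blast

lemma hoare_while_step:
  assumes "s x \<noteq> Leaf" "hoare p s n1 \<Psi>" "\<And>s'. \<Psi> s' \<Longrightarrow> hoare (WhilePair x p) s' n2 \<Phi>"
    "1 + n1 + n2 \<le> n"
  shows "hoare (WhilePair x p) s n \<Phi>"
proof -
  from assms(2) obtain T1 s1 where 1: "exec p s T1 s1" "T1 \<le> n1" "\<Psi> s1" by (auto simp: hoare_def)
  from assms(3)[OF 1(3)] obtain T2 s2
    where 2: "exec (WhilePair x p) s1 T2 s2" "T2 \<le> n2" "\<Phi> s2" by (auto simp: hoare_def)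
  from exec.intros(6)[of s, OF assms(1) 1(1) 2(1)] 1 2 assms(4) show ?thesis
    unfolding hoare_def by (intro exI[of _ "1 + T1 + T2"] exI[of _ s2]) auto
qed

text \<open>The program transforms register \<open>b\<close> in place and may overwrite all registers above \<open>b\<close>.\<close>

definition runs :: "('a::enc \<Rightarrow> 'b::enc) \<Rightarrow> ('a \<Rightarrow> nat) \<Rightarrow> bool" where
  "runs f \<tau> \<longleftrightarrow> (\<forall>b. \<exists>q. \<forall>s x. s b = enc x \<longrightarrow>
     hoare q s (\<tau> x) (\<lambda>s'. s' b = enc (f x) \<and> (\<forall>i<b. s' i = s i)))"

lemma runsD: "runs f \<tau> \<Longrightarrow> \<exists>q. \<forall>s x. s b = enc x \<longrightarrow>
    hoare q s (\<tau> x) (\<lambda>s'. s' b = enc (f x) \<and> (\<forall>i<b. s' i = s i))"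
  by (simp add: runs_def)

lemma runsI:
  assumes "\<And>b. \<exists>q. \<forall>s x. s b = enc x \<longrightarrow>
    hoare q s (\<tau> x) (\<lambda>s'. s' b = enc (f x) \<and> (\<forall>i<b. s' i = s i))"
  shows "runs f \<tau>"
  using assms unfolding runs_def by blast

lemma runs_mono: "runs f \<tau> \<Longrightarrow> (\<And>x. \<tau> x \<le> \<sigma> x) \<Longrightarrow> runs f \<sigma>"
  unfolding runs_def by (meson hoare_mono)

text \<open>An assignment is charged the size of the tree that it stores, so a register that has
  changed is no larger than the elapsed time. This turns time bounds into bounds on the output
  size.\<close>

lemma exec_reg_size:
  assumes "exec p s T s'" shows "s' i = s i \<or> dsize (s' i) \<le> T"
  using assms by (induction rule: exec.induct) auto

lemma runs_size:
  assumes "runs f \<tau>" shows "sz (f x) \<le> sz x + \<tau> x"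
proof -
  obtain q where q: "\<And>s x. s 0 = enc x \<Longrightarrow>
    hoare q s (\<tau> x) (\<lambda>s'. s' 0 = enc (f x) \<and> (\<forall>i<0. s' i = s i))"
    using runsD[OF assms, of "0"] by blast
  from q[of "\<lambda>_. enc x" x] obtain T s' where
    *: "exec q (\<lambda>_. enc x) T s'" "T \<le> \<tau> x" "s' 0 = enc (f x)" by (auto simp: hoare_def)
  from exec_reg_size[OF *(1), of 0] * show ?thesis by auto
qed

lemma runs_comp:
  assumes "runs f \<tau>" "runs g \<sigma>"
  shows "runs (\<lambda>x. g (f x)) (\<lambda>x. \<tau> x + \<sigma> (f x))"
proof (rule runsI)
  fix b
  obtain q1 where q1: "\<And>s x. s b = enc x \<Longrightarrow>
    hoare q1 s (\<tau> x) (\<lambda>s'. s' b = enc (f x) \<and> (\<forall>i<b. s' i = s i))" using runsD[OF assms(1), of "b"] by blast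
  obtain q2 where q2: "\<And>s x. s b = enc x \<Longrightarrow>
    hoare q2 s (\<sigma> x) (\<lambda>s'. s' b = enc (g x) \<and> (\<forall>i<b. s' i = s i))" using runsD[OF assms(2), of "b"] by blast
  have "hoare (Seq q1 q2) s (\<tau> x + \<sigma> (f x)) (\<lambda>s'. s' b = enc (g (f x)) \<and> (\<forall>i<b. s' i = s i))"
    if "s b = enc x" for s x
    by (rule hoare_seq[OF q1[of s x, OF that] hoare_mono[OF q2[of _ "f x"] le_refl]]) auto
  then show "\<exists>q. \<forall>s x. s b = enc x \<longrightarrow>
    hoare q s (\<tau> x + \<sigma> (f x)) (\<lambda>s'. s' b = enc (g (f x)) \<and> (\<forall>i<b. s' i = s i))" by blast
qed

text \<open>\<open>f\<close> and \<open>g\<close> run on copies of the input at the bases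
  \<open>b + 1\<close> and \<open>b + 2\<close>. The second run preserves all registers below its
  base, hence also the result of the first.\<close>

lemma runs_pair:
  assumes "runs f \<tau>" "runs g \<sigma>"
  shows "runs (\<lambda>x. (f x, g x)) (\<lambda>x. 4 + 2 * sz x + \<tau> x + \<sigma> x + sz (f x) + sz (g x))"
proof (rule runsI)
  fix b
  obtain q1 where q1: "\<And>s x. s (b+1) = enc x \<Longrightarrow>
    hoare q1 s (\<tau> x) (\<lambda>s'. s' (b+1) = enc (f x) \<and> (\<forall>i<b+1. s' i = s i))" using runsD[OF assms(1), of "b+1"] by blast
  obtain q2 where q2: "\<And>s x. s (b+2) = enc x \<Longrightarrow>
    hoare q2 s (\<sigma> x) (\<lambda>s'. s' (b+2) = enc (g x) \<and> (\<forall>i<b+2. s' i = s i))" using runsD[OF assms(2), of "b+2"] by blast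
  let ?q = "Seq (Assign (b+1) (EVar b)) (Seq q1 (Seq (Assign (b+2) (EVar b)) (Seq q2 (Assign b (EPair (b+1) (b+2))))))"
  have "hoare ?q s (4 + 2 * sz x + \<tau> x + \<sigma> x + sz (f x) + sz (g x))
     (\<lambda>s'. s' b = enc (f x, g x) \<and> (\<forall>i<b. s' i = s i))" if "s b = enc x" for s x
  proof -
    let ?\<Phi> = "\<lambda>s'. s' b = enc (f x, g x) \<and> (\<forall>i<b. s' i = s i)"
    have 4: "hoare (Assign b (EPair (b+1) (b+2))) t (2 + sz (f x) + sz (g x)) ?\<Phi>"
      if "t (b+1) = enc (f x)" "t (b+2) = enc (g x)" "\<forall>i<b. t i = s i" for t
      by (rule hoare_assign) (use that in auto)
    have 3: "hoare (Seq q2 (Assign b (EPair (b+1) (b+2)))) t (\<sigma> x + (2 + sz (f x) + sz (g x))) ?\<Phi>"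
      if "t (b+1) = enc (f x)" "t (b+2) = enc x" "\<forall>i<b. t i = s i" for t
      by (rule hoare_seq[OF q2[of t x, OF that(2)] 4 order_refl]) (use that in auto)
    have 2: "hoare (Seq (Assign (b+2) (EVar b)) (Seq q2 (Assign b (EPair (b+1) (b+2))))) t
        ((1 + sz x) + (\<sigma> x + (2 + sz (f x) + sz (g x)))) ?\<Phi>"
      if "t (b+1) = enc (f x)" "t b = enc x" "\<forall>i<b. t i = s i" for t
      by (rule hoare_seq[OF hoare_assign[of "\<lambda>t. t (b+1) = enc (f x) \<and> t (b+2) = enc x \<and> (\<forall>i<b. t i = s i)"] 3 order_refl])
        (use that in auto)
    have 1: "hoare (Seq q1 (Seq (Assign (b+2) (EVar b)) (Seq q2 (Assign b (EPair (b+1) (b+2)))))) t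
        (\<tau> x + ((1 + sz x) + (\<sigma> x + (2 + sz (f x) + sz (g x))))) ?\<Phi>"
      if "t (b+1) = enc x" "t b = enc x" "\<forall>i<b. t i = s i" for t
      by (rule hoare_seq[OF q1[of t x, OF that(1)] 2 order_refl]) (use that in auto)
    show ?thesis
      by (rule hoare_seq[OF hoare_assign[of "\<lambda>t. t (b+1) = enc x \<and> t b = enc x \<and> (\<forall>i<b. t i = s i)" _ _ _ "1 + sz x"] 1])
        (use that in auto)
  qed
  then show "\<exists>q. \<forall>s x. s b = enc x \<longrightarrow>
    hoare q s (4 + 2 * sz x + \<tau> x + \<sigma> x + sz (f x) + sz (g x))
     (\<lambda>s'. s' b = enc (f x, g x) \<and> (\<forall>i<b. s' i = s i))" by blast
qed

lemma runs_exp: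
  assumes "\<And>b s x. s b = enc x \<Longrightarrow> eval_exp s (e b) = enc (f x)"
  shows "runs f (\<lambda>x. 1 + sz (f x))"
proof (rule runsI)
  fix b
  have "hoare (Assign b (e b)) s (1 + sz (f x)) (\<lambda>s'. s' b = enc (f x) \<and> (\<forall>i<b. s' i = s i))"
    if "s b = enc x" for s x
    by (rule hoare_assign) (simp_all add: assms[of s b x] that)
  then show "\<exists>q. \<forall>s x. s b = enc x \<longrightarrow>
     hoare q s (1 + sz (f x)) (\<lambda>s'. s' b = enc (f x) \<and> (\<forall>i<b. s' i = s i))" by blast
qed

lemma runs_const: "\<exists>n. runs (\<lambda>x. c) (\<lambda>x. n)"
proof -
  \<comment> \<open>the time must be bounded uniformly in the base register\<close>
  have "\<exists>n. \<forall>b. \<exists>q. \<forall>s. hoare q s n (\<lambda>s'. s' b = d \<and> (\<forall>i<b. s' i = s i))" for d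
  proof (induction d)
    case Leaf
    have "hoare (Assign b ELeaf) s 2 (\<lambda>s'. s' b = Leaf \<and> (\<forall>i<b. s' i = s i))" for b s
      by (rule hoare_assign) auto
    then show ?case by blast
  next
    case (Pair d1 d2)
    obtain n1 where 1: "\<And>b. \<exists>q. \<forall>s. hoare q s n1 (\<lambda>s'. s' b = d1 \<and> (\<forall>i<b. s' i = s i))"
      using Pair.IH(1) by blast
    obtain n2 where 2: "\<And>b. \<exists>q. \<forall>s. hoare q s n2 (\<lambda>s'. s' b = d2 \<and> (\<forall>i<b. s' i = s i))"
      using Pair.IH(2) by blast
    have "\<exists>q. \<forall>s. hoare q s (n1 + (n2 + (2 + dsize d1 + dsize d2)))
       (\<lambda>s'. s' b = Pair d1 d2 \<and> (\<forall>i<b. s' i = s i))" for b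
    proof -
      obtain q1 where 1: "\<And>s. hoare q1 s n1 (\<lambda>s'. s' b = d1 \<and> (\<forall>i<b. s' i = s i))"
        using 1[of b] by blast
      obtain q2 where 2: "\<And>s. hoare q2 s n2 (\<lambda>s'. s' (b+1) = d2 \<and> (\<forall>i<b+1. s' i = s i))"
        using 2[of "b+1"] by blast
      have "hoare (Assign b (EPair b (b+1))) t (2 + dsize d1 + dsize d2)
         (\<lambda>s'. s' b = Pair d1 d2 \<and> (\<forall>i<b. s' i = s i))"
        if "t b = d1" "t (b+1) = d2" "\<forall>i<b. t i = s i" for s t
        by (rule hoare_assign) (use that in auto)
      note 3 = hoare_seq[OF 2 this order_refl]
      have "hoare (Seq q1 (Seq q2 (Assign b (EPair b (b+1))))) s (n1 + (n2 + (2 + dsize d1 + dsize d2)))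
         (\<lambda>s'. s' b = Pair d1 d2 \<and> (\<forall>i<b. s' i = s i))" for s
        by (rule hoare_seq[OF 1 3]) auto
      then show ?thesis by blast
    qed
    then show ?case by blast
  qed
  from this[of "enc c"] obtain n where
    "\<forall>b. \<exists>q. \<forall>s. hoare q s n (\<lambda>s'. s' b = enc c \<and> (\<forall>i<b. s' i = s i))" by blast
  then have "runs (\<lambda>x. c) (\<lambda>x. n)" unfolding runs_def by blast
  then show ?thesis ..
qed

text \<open>One rule behind all case distinctions. In the second case the trees of \<open>x\<close>
  and \<open>l x\<close> are paired without being inspected, and \<open>p\<close> gives this pair a
  type that suits \<open>g\<close>, for instance one that exposes head and tail or a
  predecessor.\<close>

lemma runs_branch:
  fixes l :: "'a::enc \<Rightarrow> 'c::enc" and g :: "'d::enc \<Rightarrow> 'b::enc"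
  assumes l: "runs l \<rho>" and f: "runs f \<tau>" and g: "runs g \<sigma>"
    and leaf: "\<And>x. enc (l x) = Leaf \<Longrightarrow> h x = f x"
    and pair: "\<And>x. enc (l x) \<noteq> Leaf \<Longrightarrow> enc (p x) = Pair (enc x) (enc (l x)) \<and> h x = g (p x)"
  shows "runs h (\<lambda>x. 5 + 2 * sz x + \<rho> x + sz (l x) + (if enc (l x) = Leaf then \<tau> x else \<sigma> (p x)))"
proof (rule runsI)
  fix b
  obtain q0 where q0: "\<And>s x. s (b+1) = enc x \<Longrightarrow>
    hoare q0 s (\<rho> x) (\<lambda>s'. s' (b+1) = enc (l x) \<and> (\<forall>i<b+1. s' i = s i))" using runsD[OF l, of "b+1"] by blast
  obtain q1 where q1: "\<And>s x. s b = enc x \<Longrightarrow>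
    hoare q1 s (\<tau> x) (\<lambda>s'. s' b = enc (f x) \<and> (\<forall>i<b. s' i = s i))" using runsD[OF f, of "b"] by blast
  obtain q2 where q2: "\<And>s x. s b = enc x \<Longrightarrow>
    hoare q2 s (\<sigma> x) (\<lambda>s'. s' b = enc (g x) \<and> (\<forall>i<b. s' i = s i))" using runsD[OF g, of "b"] by blast
  let ?if = "IfPair (b+1) (Seq (Assign b (EPair b (b+1))) q2) q1"
  let ?q = "Seq (Assign (b+1) (EVar b)) (Seq q0 ?if)"
  have "hoare ?q s (5 + 2 * sz x + \<rho> x + sz (l x) + (if enc (l x) = Leaf then \<tau> x else \<sigma> (p x)))
     (\<lambda>s'. s' b = enc (h x) \<and> (\<forall>i<b. s' i = s i))" if sx: "s b = enc x" for s x
  proof -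
    let ?m = "2 + sz x + sz (l x) + (if enc (l x) = Leaf then \<tau> x else \<sigma> (p x))"
    have if1: "hoare ?if t (1 + ?m) (\<lambda>s'. s' b = enc (h x) \<and> (\<forall>i<b. s' i = s i))"
      if t: "t (b+1) = enc (l x)" "t b = enc x" "\<forall>i<b. t i = s i" for t
    proof (rule hoare_if)
      assume "t (b+1) \<noteq> Leaf"
      with t have nl: "enc (l x) \<noteq> Leaf" by simp
      show "hoare (Seq (Assign b (EPair b (b+1))) q2) t ?m (\<lambda>s'. s' b = enc (h x) \<and> (\<forall>i<b. s' i = s i))"
        by (rule hoare_seq[OF hoare_assign[of "\<lambda>t. t b = enc (p x) \<and> (\<forall>i<b. t i = s i)"] hoare_mono[OF q2[of _ "p x"]]])
          (use t pair[OF nl] nl in auto)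
    next
      assume "t (b+1) = Leaf"
      with t have nl: "enc (l x) = Leaf" by simp
      show "hoare q1 t ?m (\<lambda>s'. s' b = enc (h x) \<and> (\<forall>i<b. s' i = s i))"
        by (rule hoare_mono[OF q1[of t x]]) (use t leaf[OF nl] nl in auto)
    qed simp
    have if2: "hoare (Seq q0 ?if) t (\<rho> x + (1 + ?m)) (\<lambda>s'. s' b = enc (h x) \<and> (\<forall>i<b. s' i = s i))"
      if t: "t (b+1) = enc x" "t b = enc x" "\<forall>i<b. t i = s i" for t
      by (rule hoare_seq[OF q0[of t x, OF t(1)] if1 order_refl]) (use t in auto)
    show ?thesis
      by (rule hoare_seq[OF hoare_assign[of "\<lambda>t. t (b+1) = enc x \<and> t b = enc x \<and> (\<forall>i<b. t i = s i)" _ _ _ "1 + sz x"] if2])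
        (use sx in auto)
  qed
  then show "\<exists>q. \<forall>s x. s b = enc x \<longrightarrow>
    hoare q s (5 + 2 * sz x + \<rho> x + sz (l x) + (if enc (l x) = Leaf then \<tau> x else \<sigma> (p x)))
     (\<lambda>s'. s' b = enc (h x) \<and> (\<forall>i<b. s' i = s i))" by blast
qed

text \<open>The accumulator is copied in every round, so the time depends on all intermediate
  results and is kept as a recursion until these are bounded. The environment \<open>e\<close>
  supplies the outer values that the loop body refers to.\<close>

primrec loop_time :: "('e::enc \<times> 'y::enc \<times> 'a::enc \<Rightarrow> 'a) \<Rightarrow> ('e \<times> 'y \<times> 'a \<Rightarrow> nat) \<Rightarrow> 'e \<Rightarrow> 'y list \<Rightarrow> 'a \<Rightarrow> nat" where
  "loop_time f \<tau> e [] a = 1"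
| "loop_time f \<tau> e (y # l) a = 10 + sz e + 3 * sz y + sz l + 2 * sz a + \<tau> (e, y, a) + sz (f (e, y, a))
     + loop_time f \<tau> e l (f (e, y, a))"

text \<open>Register \<open>b\<close> keeps the environment, \<open>b + 1\<close> the rest of the
  list and \<open>b + 2\<close> the accumulator; the body runs at base \<open>b + 3\<close> and so
  leaves them intact.\<close>

lemma runs_fold:
  assumes "runs f \<tau>"
  shows "runs (\<lambda>(e, l, a). fold (\<lambda>y a. f (e, y, a)) l a)
    (\<lambda>(e, l, a). 10 + sz e + 2 * sz l + 2 * sz a + loop_time f \<tau> e l a
       + sz (fold (\<lambda>y a. f (e, y, a)) l a))"
proof (rule runsI)
  fix b
  obtain q where q: "\<And>s x. s (b+3) = enc x \<Longrightarrow>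
    hoare q s (\<tau> x) (\<lambda>s'. s' (b+3) = enc (f x) \<and> (\<forall>i<b+3. s' i = s i))" using runsD[OF assms, of "b+3"] by blast
  let ?B6 = "Assign (b+2) (EVar (b+3))"
  let ?B5 = "Seq q ?B6"
  let ?B4 = "Seq (Assign (b+3) (EPair b (b+3))) ?B5"
  let ?B3 = "Seq (Assign (b+3) (EPair (b+3) (b+2))) ?B4"
  let ?B2 = "Seq (Assign (b+1) (ESnd (b+1))) ?B3"
  let ?B = "Seq (Assign (b+3) (EFst (b+1))) ?B2"
  let ?W = "WhilePair (b+1) ?B"
  have loop: "hoare ?W t (loop_time f \<tau> e l a)
     (\<lambda>s'. s' (b+2) = enc (fold (\<lambda>y a. f (e, y, a)) l a) \<and> (\<forall>i<b. s' i = t i))"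
    if "t b = enc e" "t (b+1) = enc l" "t (b+2) = enc a" for t e l a
    using that
  proof (induction l arbitrary: t a)
    case Nil
    then show ?case by (intro hoare_while_stop) auto
  next
    case (Cons y l)
    let ?I = "\<lambda>s'. s' b = enc e \<and> (\<forall>i<b. s' i = t i)"
    have 6: "hoare ?B6 u (1 + sz (f (e, y, a)))
       (\<lambda>s'. ?I s' \<and> s' (b+1) = enc l \<and> s' (b+2) = enc (f (e, y, a)))"
      if "?I u" "u (b+1) = enc l" "u (b+3) = enc (f (e, y, a))" for u
      by (rule hoare_assign) (use that in auto)
    have 5: "hoare ?B5 u (\<tau> (e, y, a) + (1 + sz (f (e, y, a))))
       (\<lambda>s'. ?I s' \<and> s' (b+1) = enc l \<and> s' (b+2) = enc (f (e, y, a)))"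
      if "?I u" "u (b+1) = enc l" "u (b+3) = enc (e, y, a)" for u
      by (rule hoare_seq[OF q[of u "(e, y, a)", OF that(3)] 6]) (use that in auto)
    have 4: "hoare ?B4 u (3 + sz e + sz y + sz a + (\<tau> (e, y, a) + (1 + sz (f (e, y, a)))))
       (\<lambda>s'. ?I s' \<and> s' (b+1) = enc l \<and> s' (b+2) = enc (f (e, y, a)))"
      if "?I u" "u (b+1) = enc l" "u (b+3) = enc (y, a)" for u
      by (rule hoare_seq[OF hoare_assign[of "\<lambda>u. ?I u \<and> u (b+1) = enc l \<and> u (b+3) = enc (e, y, a)"] 5])
        (use that in auto)
    have 3: "hoare ?B3 u (2 + sz y + sz a + (3 + sz e + sz y + sz a + (\<tau> (e, y, a) + (1 + sz (f (e, y, a))))))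
       (\<lambda>s'. ?I s' \<and> s' (b+1) = enc l \<and> s' (b+2) = enc (f (e, y, a)))"
      if "?I u" "u (b+1) = enc l" "u (b+2) = enc a" "u (b+3) = enc y" for u
      by (rule hoare_seq[OF hoare_assign[of "\<lambda>u. ?I u \<and> u (b+1) = enc l \<and> u (b+3) = enc (y, a)"] 4])
        (use that in auto)
    have 2: "hoare ?B2 u (1 + sz l + (2 + sz y + sz a + (3 + sz e + sz y + sz a + (\<tau> (e, y, a) + (1 + sz (f (e, y, a)))))))
       (\<lambda>s'. ?I s' \<and> s' (b+1) = enc l \<and> s' (b+2) = enc (f (e, y, a)))"
      if "?I u" "u (b+1) = enc (y # l)" "u (b+2) = enc a" "u (b+3) = enc y" for u
      by (rule hoare_seq[OF hoare_assign[of "\<lambda>u. ?I u \<and> u (b+1) = enc l \<and> u (b+2) = enc a \<and> u (b+3) = enc y"] 3])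
        (use that in auto)
    have 1: "hoare ?B t (1 + sz y + (1 + sz l + (2 + sz y + sz a + (3 + sz e + sz y + sz a + (\<tau> (e, y, a) + (1 + sz (f (e, y, a))))))))
       (\<lambda>s'. ?I s' \<and> s' (b+1) = enc l \<and> s' (b+2) = enc (f (e, y, a)))"
      by (rule hoare_seq[OF hoare_assign[of "\<lambda>u. ?I u \<and> u (b+1) = enc (y # l) \<and> u (b+2) = enc a \<and> u (b+3) = enc y"] 2])
        (use Cons.prems in auto)
    show ?case
      by (rule hoare_while_step[OF _ 1 hoare_mono[OF Cons.IH[of _ "f (e, y, a)"]]])
        (use Cons.prems in auto)
  qed
  let ?q = "Seq (Assign (b+2) (ESnd b)) (Seq (Assign (b+1) (EFst (b+2))) (Seq (Assign (b+2) (ESnd (b+2)))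
    (Seq (Assign b (EFst b)) (Seq ?W (Assign b (EVar (b+2)))))))"
  have "hoare ?q s (10 + sz e + 2 * sz l + 2 * sz a + loop_time f \<tau> e l a
       + sz (fold (\<lambda>y a. f (e, y, a)) l a))
     (\<lambda>s'. s' b = enc (fold (\<lambda>y a. f (e, y, a)) l a) \<and> (\<forall>i<b. s' i = s i))"
    if "s b = enc (e, l, a)" for s e l a
  proof -
    let ?R = "fold (\<lambda>y a. f (e, y, a)) l a"
    let ?\<Phi> = "\<lambda>s'. s' b = enc ?R \<and> (\<forall>i<b. s' i = s i)"
    have 5: "hoare (Seq ?W (Assign b (EVar (b+2)))) u (loop_time f \<tau> e l a + (1 + sz ?R)) ?\<Phi>"
      if "u b = enc e" "u (b+1) = enc l" "u (b+2) = enc a" "\<forall>i<b. u i = s i" for u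
      by (rule hoare_seq[OF loop[OF that(1-3)] hoare_assign]) (use that in auto)
    have 4: "hoare (Seq (Assign b (EFst b)) (Seq ?W (Assign b (EVar (b+2))))) u
       ((1 + sz e) + (loop_time f \<tau> e l a + (1 + sz ?R))) ?\<Phi>"
      if "u b = enc (e, l, a)" "u (b+1) = enc l" "u (b+2) = enc a" "\<forall>i<b. u i = s i" for u
      by (rule hoare_seq[OF hoare_assign[of "\<lambda>u. u b = enc e \<and> u (b+1) = enc l \<and> u (b+2) = enc a \<and> (\<forall>i<b. u i = s i)"] 5])
         (use that in auto)
    have 3: "hoare (Seq (Assign (b+2) (ESnd (b+2))) (Seq (Assign b (EFst b)) (Seq ?W (Assign b (EVar (b+2)))))) u
       ((1 + sz a) + ((1 + sz e) + (loop_time f \<tau> e l a + (1 + sz ?R)))) ?\<Phi>"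
      if "u b = enc (e, l, a)" "u (b+1) = enc l" "u (b+2) = enc (l, a)" "\<forall>i<b. u i = s i" for u
      by (rule hoare_seq[OF hoare_assign[of "\<lambda>u. u b = enc (e, l, a) \<and> u (b+1) = enc l \<and> u (b+2) = enc a \<and> (\<forall>i<b. u i = s i)"] 4])
         (use that in auto)
    have 2: "hoare (Seq (Assign (b+1) (EFst (b+2))) (Seq (Assign (b+2) (ESnd (b+2))) (Seq (Assign b (EFst b)) (Seq ?W (Assign b (EVar (b+2))))))) u
       ((1 + sz l) + ((1 + sz a) + ((1 + sz e) + (loop_time f \<tau> e l a + (1 + sz ?R))))) ?\<Phi>"
      if "u b = enc (e, l, a)" "u (b+2) = enc (l, a)" "\<forall>i<b. u i = s i" for u
      by (rule hoare_seq[OF hoare_assign[of "\<lambda>u. u b = enc (e, l, a) \<and> u (b+1) = enc l \<and> u (b+2) = enc (l, a) \<and> (\<forall>i<b. u i = s i)"] 3])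
         (use that in auto)
    show ?thesis
      by (rule hoare_seq[OF hoare_assign[of "\<lambda>u. u b = enc (e, l, a) \<and> u (b+2) = enc (l, a) \<and> (\<forall>i<b. u i = s i)"] 2])
         (use that in auto)
  qed
  then show "\<exists>q. \<forall>s x. s b = enc x \<longrightarrow>
    hoare q s (case x of (e, l, a) \<Rightarrow> 10 + sz e + 2 * sz l + 2 * sz a + loop_time f \<tau> e l a
       + sz (fold (\<lambda>y a. f (e, y, a)) l a))
     (\<lambda>s'. s' b = enc (case x of (e, l, a) \<Rightarrow> fold (\<lambda>y a. f (e, y, a)) l a) \<and> (\<forall>i<b. s' i = s i))"
    by (intro exI[of _ ?q]) (auto simp del: enc_simps)
qed

section \<open>Polynomial time\<close>

text \<open>A single power suffices as normal form: its base is at least 2, so it absorbs constants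
  and the doubling caused by a sum.\<close>

definition polyb :: "('a \<Rightarrow> nat) \<Rightarrow> ('a \<Rightarrow> nat) \<Rightarrow> bool" where
  "polyb \<mu> h \<longleftrightarrow> (\<exists>d. \<forall>x. h x \<le> (\<mu> x + 2) ^ d)"

named_theorems polyb_intros

lemma polyb_mono: "polyb \<mu> h \<Longrightarrow> (\<And>x. h' x \<le> h x) \<Longrightarrow> polyb \<mu> h'"
  unfolding polyb_def by (meson le_trans)

lemma polyb_base [polyb_intros]: "polyb \<mu> \<mu>"
  unfolding polyb_def by (rule exI[of _ 1]) simp

lemma polyb_const [polyb_intros]: "polyb \<mu> (\<lambda>x. c)"
proof -
  have "c \<le> (\<mu> x + 2) ^ c" for x
    using less_exp[of c] power_mono[of 2 "\<mu> x + 2" c] by simp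
  then show ?thesis unfolding polyb_def by blast
qed

lemma polyb_mult [polyb_intros]:
  assumes "polyb \<mu> f" "polyb \<mu> g" shows "polyb \<mu> (\<lambda>x. f x * g x)"
proof -
  obtain d e where "\<And>x. f x \<le> (\<mu> x + 2) ^ d" "\<And>x. g x \<le> (\<mu> x + 2) ^ e"
    using assms unfolding polyb_def by blast
  then have "f x * g x \<le> (\<mu> x + 2) ^ (d + e)" for x
    by (simp add: mult_le_mono power_add)
  then show ?thesis unfolding polyb_def by blast
qed

lemma polyb_add [polyb_intros]:
  assumes "polyb \<mu> f" "polyb \<mu> g" shows "polyb \<mu> (\<lambda>x. f x + g x)"
proof -
  obtain d e where *: "\<And>x. f x \<le> (\<mu> x + 2) ^ d" "\<And>x. g x \<le> (\<mu> x + 2) ^ e"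
    using assms unfolding polyb_def by blast
  have "f x + g x \<le> (\<mu> x + 2) ^ Suc (d + e)" for x
  proof -
    have "(\<mu> x + 2) ^ d \<le> (\<mu> x + 2) ^ (d + e)" "(\<mu> x + 2) ^ e \<le> (\<mu> x + 2) ^ (d + e)"
      by (intro power_increasing; simp)+
    then have "f x + g x \<le> 2 * (\<mu> x + 2) ^ (d + e)" using *[of x] by linarith
    also have "\<dots> \<le> (\<mu> x + 2) * (\<mu> x + 2) ^ (d + e)" by (intro mult_right_mono) auto
    finally show ?thesis by simp
  qed
  then show ?thesis unfolding polyb_def by blast
qed

lemma polyb_Suc [polyb_intros]: "polyb \<mu> f \<Longrightarrow> polyb \<mu> (\<lambda>x. Suc (f x))"
  using polyb_add[OF _ polyb_const[of _ 1]] by simp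

lemma polyb_power [polyb_intros]: "polyb \<mu> f \<Longrightarrow> polyb \<mu> (\<lambda>x. f x ^ n)"
  by (induction n) (auto intro: polyb_mult polyb_const)

lemma polyb_comp: "polyb \<nu> h \<Longrightarrow> polyb \<mu> (\<lambda>x. \<nu> (f x)) \<Longrightarrow> polyb \<mu> (\<lambda>x. h (f x))"
proof -
  assume a: "polyb \<nu> h" "polyb \<mu> (\<lambda>x. \<nu> (f x))"
  then obtain d where d: "\<And>x. h x \<le> (\<nu> x + 2) ^ d" unfolding polyb_def by blast
  have "polyb \<mu> (\<lambda>x. (\<nu> (f x) + 2) ^ d)" by (intro polyb_intros a)
  then show ?thesis by (rule polyb_mono) (rule d)
qed

definition ptime :: "('a::enc \<Rightarrow> 'b::enc) \<Rightarrow> bool" where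
  "ptime f \<longleftrightarrow> (\<exists>\<tau>. runs f \<tau> \<and> polyb sz \<tau>)"

named_theorems ptime_intros

lemma ptimeI: "runs f \<tau> \<Longrightarrow> polyb sz \<tau> \<Longrightarrow> ptime f"
  unfolding ptime_def by blast

lemma ptime_size: "ptime f \<Longrightarrow> polyb sz (\<lambda>x. sz (f x))"
proof -
  assume "ptime f"
  then obtain \<tau> where \<tau>: "runs f \<tau>" "polyb sz \<tau>" unfolding ptime_def by blast
  have "polyb sz (\<lambda>x. sz x + \<tau> x)" by (intro polyb_intros \<tau>)
  then show ?thesis by (rule polyb_mono) (rule runs_size[OF \<tau>(1)])
qed

lemma ptime_comp: "ptime g \<Longrightarrow> ptime f \<Longrightarrow> ptime (\<lambda>x. g (f x))"
proof -
  assume g: "ptime g" and f: "ptime f"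
  obtain \<tau> \<sigma> where *: "runs f \<tau>" "polyb sz \<tau>" "runs g \<sigma>" "polyb sz \<sigma>"
    using f g unfolding ptime_def by blast
  show ?thesis
    by (rule ptimeI[OF runs_comp[OF *(1,3)]])
      (intro polyb_intros *(2) polyb_comp[OF *(4)] ptime_size f)
qed

lemma ptime_exp:
  assumes "\<And>b s x. s b = enc x \<Longrightarrow> eval_exp s (e b) = enc (f x)" "\<And>x. sz (f x) \<le> sz x"
  shows "ptime f"
proof (rule ptimeI[OF runs_exp[where e = e]])
  show "polyb sz (\<lambda>x. 1 + sz (f x))" by (intro polyb_intros polyb_mono[OF polyb_base assms(2)])
qed (rule assms(1))

text \<open>A change of type that keeps the tree is one copy. Successor and list construction are
  pairings followed by such a change.\<close>

lemma ptime_cast: "(\<And>x. enc (f x) = enc x) \<Longrightarrow> ptime f"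
  by (rule ptime_exp[of EVar]) auto

lemma ptime_id [ptime_intros]: "ptime (\<lambda>x. x)"
  by (rule ptime_cast) simp

lemma ptime_const [ptime_intros]: "ptime (\<lambda>x. c)"
  using runs_const[of c] polyb_const unfolding ptime_def by blast

lemma ptime_pair [ptime_intros]: "ptime f \<Longrightarrow> ptime g \<Longrightarrow> ptime (\<lambda>x. (f x, g x))"
proof -
  assume g: "ptime g" and f: "ptime f"
  obtain \<tau> \<sigma> where *: "runs f \<tau>" "polyb sz \<tau>" "runs g \<sigma>" "polyb sz \<sigma>"
    using f g unfolding ptime_def by blast
  show ?thesis
    by (rule ptimeI[OF runs_pair[OF *(1,3)]])
      (intro polyb_intros *(2,4) ptime_size f g)
qed

lemma ptime_fst_prim: "ptime fst"
  by (rule ptime_exp[of EFst]) (auto simp: enc_prod_inst)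

lemma ptime_snd_prim: "ptime snd"
  by (rule ptime_exp[of ESnd]) (auto simp: enc_prod_inst)

lemmas ptime_fst [ptime_intros] = ptime_comp[OF ptime_fst_prim]
lemmas ptime_snd [ptime_intros] = ptime_comp[OF ptime_snd_prim]

lemma ptime_case_prod [ptime_intros]:
  "ptime (\<lambda>x. f x (fst (g x)) (snd (g x))) \<Longrightarrow> ptime (\<lambda>x. case g x of (a, b) \<Rightarrow> f x a b)"
  by (simp add: case_prod_beta)

lemma ptime_Let [ptime_intros]:
  assumes "ptime f" "ptime (\<lambda>p. g (fst p) (snd p))" shows "ptime (\<lambda>x. let y = f x in g x y)"
  using ptime_comp[OF assms(2) ptime_pair[OF ptime_id assms(1)]] by simp

lemma ptime_branch:
  assumes l: "ptime l" and f: "ptime f" and g: "ptime g" and p: "polyb sz (\<lambda>x. sz (p x))"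
    and "\<And>x. enc (l x) = Leaf \<Longrightarrow> h x = f x"
    and "\<And>x. enc (l x) \<noteq> Leaf \<Longrightarrow> enc (p x) = Pair (enc x) (enc (l x)) \<and> h x = g (p x)"
  shows "ptime h"
proof -
  obtain \<rho> \<tau> \<sigma> where *: "runs l \<rho>" "polyb sz \<rho>" "runs f \<tau>" "polyb sz \<tau>" "runs g \<sigma>" "polyb sz \<sigma>"
    using l f g unfolding ptime_def by blast
  have "runs h (\<lambda>x. 5 + 2 * sz x + \<rho> x + sz (l x) + (if enc (l x) = Leaf then \<tau> x else \<sigma> (p x)))"
    by (rule runs_branch[OF *(1,3,5) assms(5,6)])
  then have "runs h (\<lambda>x. 5 + 2 * sz x + \<rho> x + sz (l x) + (\<tau> x + \<sigma> (p x)))"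
    by (rule runs_mono) simp
  then show ?thesis
    by (rule ptimeI) (intro polyb_intros * ptime_size l polyb_comp[OF *(6)] p)
qed

lemma polyb_pair_size: "ptime l \<Longrightarrow> polyb sz (\<lambda>x. sz (x, l x))"
  by (simp only: enc_simps dsize.simps) (intro polyb_intros ptime_size)

lemma ptime_if [ptime_intros]:
  assumes "ptime P" "ptime f" "ptime g" shows "ptime (\<lambda>x. if P x then f x else g x)"
  by (rule ptime_branch[OF assms(1,3) ptime_comp[OF assms(2) ptime_fst_prim] polyb_pair_size[OF assms(1)]])
    (auto simp: enc_bool_inst split: if_splits)

lemma ptime_case_list [ptime_intros]:
  assumes "ptime l" "ptime f" "ptime (\<lambda>p. g (fst p) (fst (snd p)) (snd (snd p)))"
  shows "ptime (\<lambda>x. case l x of [] \<Rightarrow> f x | y # ys \<Rightarrow> g x y ys)"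
proof (rule ptime_branch[OF assms, of "\<lambda>x. if l x = [] then (x, undefined) else (x, hd (l x), tl (l x))"])
  \<comment> \<open>The component \<open>undefined\<close> only makes the view total on the empty
    list, which is never handed to \<open>g\<close>; it adds a constant to the size.\<close>
  have "sz (if l x = [] then (x, undefined) else (x, hd (l x), tl (l x)))
      \<le> sz (x, l x) + sz (undefined :: 'b \<times> 'b list)" for x
    by (cases "l x") auto
  then show "polyb sz (\<lambda>x. sz (if l x = [] then (x, undefined) else (x, hd (l x), tl (l x))))"
    by (rule polyb_mono[rotated]) (intro polyb_intros polyb_pair_size assms)
next
  show "(case l x of [] \<Rightarrow> f x | y # ys \<Rightarrow> g x y ys) = f x" if "enc (l x) = Leaf" for x
    using that by (cases "l x") auto
qed (auto split: list.splits)

lemma ptime_case_nat [ptime_intros]: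
  assumes "ptime l" "ptime f" "ptime (\<lambda>p. g (fst p) (snd p))"
  shows "ptime (\<lambda>x. case l x of 0 \<Rightarrow> f x | Suc n \<Rightarrow> g x n)"
proof -
  \<comment> \<open>The tree of a successor is a pair with first component \<open>Leaf\<close>,
    hence the same as the tree of a unit paired with the predecessor.\<close>
  have "ptime (\<lambda>p :: 'a \<times> unit \<times> nat. g (fst p) (snd (snd p)))"
    using ptime_comp[OF assms(3), of "\<lambda>p. (fst p, snd (snd p))"] by (simp add: ptime_intros)
  then show ?thesis
  proof (rule ptime_branch[OF assms(1,2), of _ "\<lambda>x. (x, (), l x - 1)"])
    have "sz (x, (), l x - 1) \<le> sz (x, l x) + 2" for x by simp
    then show "polyb sz (\<lambda>x. sz (x, (), l x - 1))"
      by (rule polyb_mono[rotated]) (intro polyb_intros polyb_pair_size assms)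
  next
    show "(case l x of 0 \<Rightarrow> f x | Suc n \<Rightarrow> g x n) = f x" if "enc (l x) = Leaf" for x
      using that by (cases "l x") auto
  next
    show "enc (x, (), l x - 1) = Pair (enc x) (enc (l x)) \<and>
       (case l x of 0 \<Rightarrow> f x | Suc n \<Rightarrow> g x n) = g (fst (x, (), l x - 1)) (snd (snd (x, (), l x - 1)))"
      if "enc (l x) \<noteq> Leaf" for x
      using that by (cases "l x") auto
  qed
qed

lemma sz_append: "sz (xs @ ys) + 1 = sz xs + sz ys"
  by (induction xs) auto

lemma length_le_sz: "length xs < sz xs"
  by (induction xs) auto

text \<open>\<open>X\<close> has to bound the accumulator after every prefix of the list:
  polynomial-time steps alone might square the accumulator in each round.\<close>

lemma loop_time_bound:
  assumes "\<And>zs zs'. ys = zs @ zs' \<Longrightarrow> sz (fold (\<lambda>y a. f (e, y, a)) zs a) \<le> X"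
    and "\<And>x. \<tau> x \<le> (sz x + 2) ^ d" and "sz e \<le> N" "sz ys \<le> N"
  shows "loop_time f \<tau> e ys a \<le> 1 + length ys * (10 + 6 * N + 6 * X + (2 * N + X + 5) ^ d)"
  using assms(1,4)
proof (induction ys arbitrary: a)
  case Nil then show ?case by simp
next
  case (Cons y ys)
  let ?K = "10 + 6 * N + 6 * X + (2 * N + X + 5) ^ d"
  have a: "sz a \<le> X" using Cons.prems(1)[of "[]" "y # ys"] by simp
  have fa: "sz (f (e, y, a)) \<le> X" using Cons.prems(1)[of "[y]" ys] by simp
  have "sz (fold (\<lambda>y a. f (e, y, a)) zs (f (e, y, a))) \<le> X" if "ys = zs @ zs'" for zs zs'
    using Cons.prems(1)[of "y # zs" zs'] that by simp
  then have IH: "loop_time f \<tau> e ys (f (e, y, a)) \<le> 1 + length ys * ?K"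
    using Cons.prems(2) by (intro Cons.IH) auto
  have "sz (e, y, a) + 2 \<le> 2 * N + X + 5" using assms(3) Cons.prems(2) a by simp
  then have "\<tau> (e, y, a) \<le> (2 * N + X + 5) ^ d"
    using assms(2)[of "(e, y, a)"] power_mono[of "sz (e, y, a) + 2" "2 * N + X + 5" d] by linarith
  then have "loop_time f \<tau> e (y # ys) a \<le> ?K + loop_time f \<tau> e ys (f (e, y, a))"
    using a fa assms(3) Cons.prems(2) by simp
  with IH show ?case by simp
qed

text \<open>The size condition ranges over all lists and start values and thereby covers the
  prefixes that occur in the loop time.\<close>

lemma ptime_fold:
  assumes f: "ptime (\<lambda>p. f (fst p) (fst (snd p)) (snd (snd p)))" and l: "ptime l" and i: "ptime i"
    and b: "polyb (\<lambda>(x, ys, a). sz x + sz ys + sz a) (\<lambda>(x, ys, a). sz (fold (f x) ys a))"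
  shows "ptime (\<lambda>x. fold (f x) (l x) (i x))"
proof -
  let ?f = "\<lambda>p. f (fst p) (fst (snd p)) (snd (snd p))"
  obtain \<tau> where \<tau>: "runs ?f \<tau>" "polyb sz \<tau>" using f unfolding ptime_def by blast
  then obtain d where d: "\<And>x. \<tau> x \<le> (sz x + 2) ^ d" unfolding polyb_def by blast
  obtain c where c: "\<And>z. (case z of (x, ys, a) \<Rightarrow> sz (fold (f x) ys a))
      \<le> ((case z of (x, ys, a) \<Rightarrow> sz x + sz ys + sz a) + 2) ^ c"
    using b unfolding polyb_def by blast
  let ?X = "\<lambda>z. (sz z + 2) ^ c"
  let ?T = "\<lambda>z. 10 + 4 * sz z + ?X z + (1 + sz z * (10 + 6 * sz z + 6 * ?X z + (2 * sz z + ?X z + 5) ^ d))"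
  have "runs (\<lambda>(e, l, a). fold (\<lambda>y a. ?f (e, y, a)) l a) ?T"
  proof (rule runs_mono[OF runs_fold[OF \<tau>(1)]])
    fix z :: "'a \<times> 'b list \<times> 'c"
    obtain e ys a where z: "z = (e, ys, a)" by (cases z) auto
    have X: "sz (fold (f e) zs a) \<le> ?X z" if "ys = zs @ zs'" for zs zs'
    proof -
      have "sz zs \<le> sz ys" using sz_append[of zs zs'] that by (cases "enc zs'") auto
      then have "(sz e + sz zs + sz a + 2) ^ c \<le> ?X z" by (intro power_mono) (auto simp: z)
      with c[of "(e, zs, a)"] show ?thesis by (simp only: prod.case)
    qed
    have "loop_time ?f \<tau> e ys a \<le> 1 + length ys * (10 + 6 * sz z + 6 * ?X z + (2 * sz z + ?X z + 5) ^ d)"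
      by (rule loop_time_bound) (use X d in \<open>auto simp: z\<close>)
    also have "\<dots> \<le> 1 + sz z * (10 + 6 * sz z + 6 * ?X z + (2 * sz z + ?X z + 5) ^ d)"
      using length_le_sz[of ys] by (intro add_left_mono mult_right_mono) (auto simp: z)
    finally show "(case z of (e, l, a) \<Rightarrow> 10 + sz e + 2 * sz l + 2 * sz a + loop_time ?f \<tau> e l a
       + sz (fold (\<lambda>y a. ?f (e, y, a)) l a)) \<le> ?T z"
      using X[of ys "[]"] by (simp add: z)
  qed
  moreover have "polyb sz ?T" by (intro polyb_intros)
  ultimately have "ptime (\<lambda>(e, l, a). fold (\<lambda>y a. ?f (e, y, a)) l a)" by (rule ptimeI)
  from ptime_comp[OF this, of "\<lambda>x. (x, l x, i x)"] show ?thesis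
    using l i by (simp add: ptime_intros)
qed

text \<open>If the growth per step does not depend on the accumulator, the total growth is at most
  the length of the list times a polynomial. Most list functions are of this kind.\<close>

lemma ptime_fold_additive:
  assumes f: "ptime (\<lambda>p. f (fst p) (fst (snd p)) (snd (snd p)))" and l: "ptime l" and i: "ptime i"
    and q: "polyb sz q" and step: "\<And>x y a. sz (f x y a) \<le> sz a + q (x, y)"
  shows "ptime (\<lambda>x. fold (f x) (l x) (i x))"
proof (rule ptime_fold[OF f l i])
  obtain d where d: "\<And>x. q x \<le> (sz x + 2) ^ d" using q unfolding polyb_def by blast
  have "sz (fold (f x) ys a) \<le> sz a + length ys * (sz x + N + 3) ^ d" if "sz ys \<le> N" for x ys a N
    using that
  proof (induction ys arbitrary: a)
    case (Cons y ys)
    have "q (x, y) \<le> (sz x + N + 3) ^ d"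
      using d[of "(x, y)"] power_mono[of "sz (x, y) + 2" "sz x + N + 3" d] Cons.prems by auto
    with step[of x y a] Cons.IH[of "f x y a"] Cons.prems show ?case by auto
  qed simp
  then have "sz (fold (f x) ys a) \<le> sz a + length ys * (sz x + sz ys + 3) ^ d" for x ys a by blast
  also have "sz a + length ys * (sz x + sz ys + 3) ^ d
     \<le> (sz x + sz ys + sz a) + (sz x + sz ys + sz a) * (sz x + sz ys + sz a + 3) ^ d" for x ys a
    using length_le_sz[of ys]
    by (intro add_mono[of "sz a" "sz x + sz ys + sz a"] mult_le_mono power_mono) simp_all
  finally have "(case z of (x, ys, a) \<Rightarrow> sz (fold (f x) ys a)) \<le>
     (case z of (x, ys, a) \<Rightarrow> sz x + sz ys + sz a) +
     (case z of (x, ys, a) \<Rightarrow> sz x + sz ys + sz a) * ((case z of (x, ys, a) \<Rightarrow> sz x + sz ys + sz a) + 3) ^ d" for z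
    by (cases z) simp
  then show "polyb (\<lambda>(x, ys, a). sz x + sz ys + sz a) (\<lambda>(x, ys, a). sz (fold (f x) ys a))"
    by (rule polyb_mono[rotated]) (intro polyb_intros)
qed

lemma ptime_Suc [ptime_intros]: "ptime f \<Longrightarrow> ptime (\<lambda>x. Suc (f x))"
proof -
  assume f: "ptime f"
  have "ptime (\<lambda>p :: unit \<times> nat. Suc (snd p))" by (rule ptime_cast) (simp add: enc_prod_inst)
  from ptime_comp[OF this ptime_pair[OF ptime_const[of "()"] f]] show ?thesis by simp
qed

lemma ptime_Cons [ptime_intros]: "ptime f \<Longrightarrow> ptime g \<Longrightarrow> ptime (\<lambda>x. f x # g x)"
proof -
  assume fg: "ptime f" "ptime g"
  have "ptime (\<lambda>p :: 'b \<times> 'b list. fst p # snd p)" by (rule ptime_cast) (simp add: enc_prod_inst)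
  from ptime_comp[OF this ptime_pair[OF fg]] show ?thesis by simp
qed

lemma polyb_fst: "polyb sz h \<Longrightarrow> polyb sz (\<lambda>p. h (fst p))"
  by (erule polyb_comp[where \<nu> = sz and h = h]) (intro ptime_size ptime_intros)

lemma polyb_snd: "polyb sz h \<Longrightarrow> polyb sz (\<lambda>p. h (snd p))"
  by (erule polyb_comp[where \<nu> = sz and h = h]) (intro ptime_size ptime_intros)

lemma ptime_rev [ptime_intros]: "ptime f \<Longrightarrow> ptime (\<lambda>x. rev (f x))"
proof (rule ptime_comp[of rev])
  have "ptime (\<lambda>xs :: 'b list. fold (\<lambda>y ys. y # ys) xs [])"
    by (rule ptime_fold_additive[of "\<lambda>_ y ys. y # ys", where q = "\<lambda>p. 1 + sz (snd p)"])
      (auto intro!: ptime_intros polyb_intros polyb_snd)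
  then show "ptime (rev :: 'b list \<Rightarrow> _)" by (simp add: fold_Cons_rev fun_eq_iff)
qed

lemma ptime_append [ptime_intros]: "ptime f \<Longrightarrow> ptime g \<Longrightarrow> ptime (\<lambda>x. f x @ g x)"
proof -
  assume fg: "ptime f" "ptime g"
  have "ptime (\<lambda>x. fold (\<lambda>y ys. y # ys) (rev (f x)) (g x))"
    by (rule ptime_fold_additive[of "\<lambda>_ y ys. y # ys", where q = "\<lambda>p. 1 + sz (snd p)"])
      (auto intro!: ptime_intros polyb_intros polyb_snd fg)
  then show ?thesis by (simp add: fold_Cons_rev)
qed

lemma ptime_map [ptime_intros]:
  assumes "ptime (\<lambda>p. f (fst p) (snd p))" "ptime l" shows "ptime (\<lambda>x. map (f x) (l x))"
proof -
  have "ptime (\<lambda>x. rev (fold (\<lambda>y ys. f x y # ys) (l x) []))"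
  proof (rule ptime_rev, rule ptime_fold_additive[where q = "\<lambda>p. 1 + sz (f (fst p) (snd p))"])
    show "ptime (\<lambda>p. f (fst p) (fst (snd p)) # snd (snd p))"
      by (rule ptime_Cons) (use ptime_comp[OF assms(1), of "\<lambda>p. (fst p, fst (snd p))"] in \<open>simp_all add: ptime_intros\<close>)
  qed (auto intro!: ptime_intros polyb_intros ptime_size assms)
  moreover have "rev (fold (\<lambda>y ys. f x y # ys) l zs) = rev zs @ map (f x) l" for x l zs
    by (induction l arbitrary: zs) auto
  ultimately show ?thesis by simp
qed

lemma ptime_concat [ptime_intros]: "ptime l \<Longrightarrow> ptime (\<lambda>x. concat (l x))"
proof -
  assume l: "ptime l"
  have "sz (a @ y) \<le> sz a + sz y" for a y :: "'b list" using sz_append[of a y] by linarith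
  then have "ptime (\<lambda>x. fold (\<lambda>y ys. ys @ y) (l x) [])"
    by (intro ptime_fold_additive[of "\<lambda>_ y ys. ys @ y", where q = "\<lambda>p. sz (snd p)"])
      (auto intro!: ptime_intros polyb_intros polyb_snd l)
  moreover have "fold (\<lambda>y ys. ys @ y) xss zs = zs @ concat xss" for xss and zs :: "'b list"
    by (induction xss arbitrary: zs) auto
  ultimately show ?thesis by simp
qed

lemma ptime_filter [ptime_intros]:
  assumes "ptime (\<lambda>p. P (fst p) (snd p))" "ptime l" shows "ptime (\<lambda>x. filter (P x) (l x))"
proof -
  have "filter Q l = concat (map (\<lambda>y. if Q y then [y] else []) l)" for Q and l :: "'b list"
    by (induction l) auto
  then show ?thesis by (simp only:) (intro ptime_intros assms)
qed

lemma ptime_not [ptime_intros]: "ptime P \<Longrightarrow> ptime (\<lambda>x. \<not> P x)"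
proof -
  have "(\<lambda>x. \<not> P x) = (\<lambda>x. if P x then False else True)" by auto
  then show "ptime P \<Longrightarrow> ?thesis" by (simp only:) (intro ptime_intros)
qed

lemma ptime_conj [ptime_intros]: "ptime P \<Longrightarrow> ptime Q \<Longrightarrow> ptime (\<lambda>x. P x \<and> Q x)"
proof -
  have "(\<lambda>x. P x \<and> Q x) = (\<lambda>x. if P x then Q x else False)" by auto
  then show "ptime P \<Longrightarrow> ptime Q \<Longrightarrow> ?thesis" by (simp only:) (intro ptime_intros)
qed

lemma ptime_disj [ptime_intros]: "ptime P \<Longrightarrow> ptime Q \<Longrightarrow> ptime (\<lambda>x. P x \<or> Q x)"
  using ptime_not[OF ptime_conj[OF ptime_not ptime_not, of P Q]] by simp

lemma ptime_imp [ptime_intros]: "ptime P \<Longrightarrow> ptime Q \<Longrightarrow> ptime (\<lambda>x. P x \<longrightarrow> Q x)"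
  unfolding imp_conv_disj by (intro ptime_intros)

lemma ptime_eq_bool [ptime_intros]: "ptime P \<Longrightarrow> ptime Q \<Longrightarrow> ptime (\<lambda>x. (P x :: bool) = Q x)"
  unfolding iff_conv_conj_imp by (intro ptime_intros)

lemma ptime_ball [ptime_intros]:
  assumes "ptime (\<lambda>p. P (fst p) (snd p))" "ptime l" shows "ptime (\<lambda>x. \<forall>y\<in>set (l x). P x y)"
proof -
  have "(\<forall>y\<in>set l. Q y) = (case filter (\<lambda>y. \<not> Q y) l of [] \<Rightarrow> True | _ # _ \<Rightarrow> False)" for Q and l :: "'b list"
    by (induction l) auto
  then show ?thesis by (simp only:) (intro ptime_intros assms)
qed

lemma ptime_bex [ptime_intros]:
  assumes "ptime (\<lambda>p. P (fst p) (snd p))" "ptime l" shows "ptime (\<lambda>x. \<exists>y\<in>set (l x). P x y)"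
proof -
  have "(\<exists>y\<in>set l. Q y) = (\<not> (\<forall>y\<in>set l. \<not> Q y))" for Q and l :: "'b list" by blast
  then show ?thesis by (simp only:) (intro ptime_intros assms)
qed

text \<open>A number and a list of units are the same tree, so iteration up to a number is a
  fold.\<close>

lemma ptime_units: "ptime (\<lambda>n. replicate n ())"
proof (rule ptime_cast)
  show "enc (replicate n ()) = enc n" for n by (induction n) auto
qed

lemma ptime_funpow_additive:
  fixes f :: "'a::enc \<Rightarrow> 'b::enc \<Rightarrow> 'b"
  assumes f: "ptime (\<lambda>p. f (fst p) (snd p))" and l: "ptime n" and i: "ptime i"
    and q: "polyb sz q" and step: "\<And>x a. sz (f x a) \<le> sz a + q x"
  shows "ptime (\<lambda>x. (f x ^^ n x) (i x))"
proof -
  have "ptime (\<lambda>x. fold (\<lambda>_ a. f x a) (replicate (n x) ()) (i x))"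
  proof (rule ptime_fold_additive[where q = "\<lambda>p. q (fst p)"])
    show "ptime (\<lambda>p :: 'a \<times> unit \<times> 'b. f (fst p) (snd (snd p)))"
      using ptime_comp[OF f, of "\<lambda>p :: 'a \<times> unit \<times> 'b. (fst p, snd (snd p))"] by (simp add: ptime_intros)
  qed (auto intro!: ptime_intros l i step polyb_fst q ptime_comp[OF ptime_units])
  moreover have "fold (\<lambda>_ a. g a) (replicate m ()) b = (g ^^ m) b" for g m and b :: 'b
    by (induction m arbitrary: b) (auto simp: funpow_swap1)
  ultimately show ?thesis by simp
qed

lemma ptime_add [ptime_intros]:
  fixes f g :: "'a::enc \<Rightarrow> nat" shows "ptime f \<Longrightarrow> ptime g \<Longrightarrow> ptime (\<lambda>x. f x + g x)"
proof -
  assume "ptime f" "ptime g"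
  then have "ptime (\<lambda>x. ((\<lambda>a. Suc a) ^^ f x) (g x))"
    by (intro ptime_funpow_additive[of "\<lambda>_. Suc", where q = "\<lambda>_. 2"]) (auto intro!: ptime_intros polyb_intros)
  then show ?thesis by simp
qed

lemma ptime_diff [ptime_intros]:
  fixes f g :: "'a::enc \<Rightarrow> nat" shows "ptime f \<Longrightarrow> ptime g \<Longrightarrow> ptime (\<lambda>x. f x - g x)"
proof -
  let ?p = "\<lambda>n. case n of 0 \<Rightarrow> 0 | Suc m \<Rightarrow> m"
  assume "ptime f" "ptime g"
  then have "ptime (\<lambda>x. (?p ^^ g x) (f x))"
    by (intro ptime_funpow_additive[of "\<lambda>_. ?p", where q = "\<lambda>_. 0"])
      (auto intro!: ptime_intros polyb_intros split: nat.splits)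
  moreover have "(?p ^^ m) n = n - m" for m n by (induction m) (auto split: nat.splits)
  ultimately show ?thesis by simp
qed

lemma ptime_mult [ptime_intros]:
  fixes f g :: "'a::enc \<Rightarrow> nat" shows "ptime f \<Longrightarrow> ptime g \<Longrightarrow> ptime (\<lambda>x. f x * g x)"
proof -
  assume fg: "ptime f" "ptime g"
  then have "ptime (\<lambda>x. ((\<lambda>a. g x + a) ^^ f x) 0)"
    by (intro ptime_funpow_additive[of "\<lambda>x a. g x + a", where q = "\<lambda>x. sz (g x)"])
      (auto intro!: ptime_intros polyb_intros ptime_comp[of g] simp del: sz_nat intro: ptime_size, simp)
  moreover have "((\<lambda>a. b + a) ^^ m) 0 = m * b" for m b :: nat by (induction m) auto
  ultimately show ?thesis by simp
qed

lemma ptime_power [ptime_intros]: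
  fixes f :: "'a::enc \<Rightarrow> nat" shows "ptime f \<Longrightarrow> ptime (\<lambda>x. f x ^ n)"
  by (induction n) (auto intro!: ptime_intros)

lemma ptime_le [ptime_intros]:
  fixes f g :: "'a::enc \<Rightarrow> nat" assumes "ptime f" "ptime g" shows "ptime (\<lambda>x. f x \<le> g x)"
proof -
  have "(m \<le> n) = (case m - n of 0 \<Rightarrow> True | Suc _ \<Rightarrow> False)" for m n :: nat
    by (auto split: nat.splits)
  then show ?thesis by (simp only:) (intro ptime_intros assms)
qed

lemma ptime_less [ptime_intros]:
  fixes f g :: "'a::enc \<Rightarrow> nat" shows "ptime f \<Longrightarrow> ptime g \<Longrightarrow> ptime (\<lambda>x. f x < g x)"
  unfolding not_le[symmetric] by (intro ptime_intros)

lemma ptime_eq_nat [ptime_intros]: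
  fixes f g :: "'a::enc \<Rightarrow> nat" shows "ptime f \<Longrightarrow> ptime g \<Longrightarrow> ptime (\<lambda>x. f x = g x)"
  unfolding eq_iff[of "f _"] by (intro ptime_intros)

lemma ptime_length [ptime_intros]: "ptime l \<Longrightarrow> ptime (\<lambda>x. length (l x))"
proof -
  assume l: "ptime l"
  have "ptime (\<lambda>x. fold (\<lambda>_ n. Suc n) (l x) 0)"
    by (rule ptime_fold_additive[of "\<lambda>_ _ n. Suc n", where q = "\<lambda>_. 2"])
      (auto intro!: ptime_intros polyb_intros l)
  moreover have "fold (\<lambda>_ n. Suc n) xs m = m + length xs" for xs :: "'b list" and m
    by (induction xs arbitrary: m) auto
  ultimately show ?thesis by simp
qed

lemma ptime_replicate [ptime_intros]: "ptime n \<Longrightarrow> ptime f \<Longrightarrow> ptime (\<lambda>x. replicate (n x) (f x))"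
proof -
  assume nf: "ptime n" "ptime f"
  have "ptime (\<lambda>x. map (\<lambda>_. f x) (replicate (n x) ()))"
    by (intro ptime_intros ptime_comp[OF ptime_units] ptime_comp[OF nf(2)] nf(1))
  then show ?thesis by simp
qed

lemma ptime_drop [ptime_intros]: "ptime n \<Longrightarrow> ptime l \<Longrightarrow> ptime (\<lambda>x. drop (n x) (l x))"
proof -
  let ?p = "\<lambda>n. case n of [] \<Rightarrow> [] | _ # m \<Rightarrow> m"
  assume "ptime n" "ptime l"
  then have "ptime (\<lambda>x. (?p ^^ n x) (l x))"
    by (intro ptime_funpow_additive[of "\<lambda>_. ?p", where q = "\<lambda>_. 0"])
      (auto intro!: ptime_intros polyb_intros split: list.splits)
  moreover have "?p = (tl :: 'b list \<Rightarrow> _)" by (auto simp: fun_eq_iff split: list.splits)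
  moreover have "(tl ^^ m) xs = drop m xs" for m and xs :: "'b list"
    by (induction m) (auto simp: drop_Suc tl_drop)
  ultimately show ?thesis by (simp only:)
qed

text \<open>The counter is part of the accumulator and is stored in every round, so the growth per
  round depends on the accumulator. The additive rule does not apply, and the size is bounded
  explicitly.\<close>

lemma ptime_upt [ptime_intros]: "ptime m \<Longrightarrow> ptime n \<Longrightarrow> ptime (\<lambda>x. [m x..<n x])"
proof -
  assume mn: "ptime m" "ptime n"
  have *: "map (\<lambda>k. a + k) (rev (snd (((\<lambda>(i, l). (Suc i, i # l)) ^^ (b - a)) (0, [])))) = [a..<b]" for a b
  proof -
    have "((\<lambda>(i, l). (Suc i, i # l)) ^^ k) (0, []) = (k, rev [0..<k])" for k
      by (induction k) auto
    then show ?thesis by (cases "a \<le> b") (auto simp: map_add_upt add.commute)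
  qed
  have "ptime (\<lambda>x. ((\<lambda>(i, l). (Suc i, i # l)) ^^ (n x - m x)) (0, []))"
  proof -
    have "ptime (\<lambda>x. fold (\<lambda>_ (i, l). (Suc i, i # l)) (replicate (n x - m x) ()) (0 :: nat, []))"
    proof (rule ptime_fold)
      have *: "fold (\<lambda>_ (i, l). (Suc i, i # l)) ys (i, l) = (i + length ys, rev [i..<i + length ys] @ l)"
        for ys :: "unit list" and i l
      proof (induction ys arbitrary: i l)
        case (Cons y ys)
        then show ?case by (simp add: upt_conv_Cons del: upt_Suc)
      qed simp
      have u: "sz (rev [i..<i + n] @ l) \<le> sz l + n * (2 * (i + n) + 2)" for i n and l :: "nat list"
      proof (induction n arbitrary: l)
        case (Suc n)
        have "sz (rev [i..<i + n] @ l) \<le> sz l + n * (2 * (i + Suc n) + 2)"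
          by (rule order_trans[OF Suc]) (intro add_left_mono mult_le_mono2, simp)
        then show ?case by (simp add: algebra_simps)
      qed simp
      have "(case z of (x, ys, a) \<Rightarrow> sz (fold (\<lambda>_ (i, l). (Suc i, i # l)) ys a)) \<le>
         (\<lambda>N. 10 + 5 * N + N * (4 * N + 4)) (case z of (x, ys, a) \<Rightarrow> sz x + sz ys + sz a)"
        for z :: "'a \<times> unit list \<times> nat \<times> nat list"
      proof -
        obtain x ys i l where z: "z = (x, ys, i, l)" by (cases z) auto
        have len: "length ys < sz ys" by (rule length_le_sz)
        have aux: "s \<le> 10 + 5 * N + Q" if "q \<le> Q" "s = 2 + 2 * (i + n) + r" "r \<le> l' + q" "i \<le> N" "n \<le> N" "l' \<le> N"
          for q Q s r i n l' N :: nat using that by simp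
        define N where "N = sz x + sz ys + sz (i, l)"
        have N: "i \<le> N" "length ys \<le> N" "sz l \<le> N" using len by (auto simp: N_def)
        have "length ys * (2 * (i + length ys) + 2) \<le> N * (4 * N + 4)"
          using N by (intro mult_le_mono) auto
        moreover have "sz (fold (\<lambda>_ (i, l). (Suc i, i # l)) ys (i, l)) =
          2 + 2 * (i + length ys) + sz (rev [i..<i + length ys] @ l)" by (simp add: *)
        ultimately have "sz (fold (\<lambda>_ (i, l). (Suc i, i # l)) ys (i, l)) \<le> 10 + 5 * N + N * (4 * N + 4)"
          using u[of i "length ys" l] N aux by blast
        then show ?thesis by (simp add: z N_def)
      qed
      then show "polyb (\<lambda>(x, ys, a). sz x + sz ys + sz a)
        (\<lambda>(x :: 'a, ys :: unit list, a). sz (fold (\<lambda>_ (i, l). (Suc i, i # l)) ys (a :: nat \<times> nat list)))"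
        by (rule polyb_mono[rotated]) (intro polyb_intros)
    qed (intro ptime_intros mn)+
    moreover have "fold (\<lambda>_ a. g a) (replicate m ()) b = (g ^^ m) b" for g m and b :: "nat \<times> nat list"
      by (induction m arbitrary: b) (auto simp: funpow_swap1)
    ultimately show ?thesis by simp
  qed
  then have "ptime (\<lambda>x. map (\<lambda>k. m x + k) (rev (snd (((\<lambda>(i, l). (Suc i, i # l)) ^^ (n x - m x)) (0, [])))))"
    by (intro ptime_intros mn(2) ptime_comp[OF mn(1)])
  then show ?thesis by (simp only: *)
qed

section \<open>Computable functions and fpt-reductions\<close>

text \<open>Renaming all registers by an offset allows an arbitrary program to run above the
  registers that are in use.\<close>

fun shift_exp :: "nat \<Rightarrow> exp \<Rightarrow> exp" where
  "shift_exp b ELeaf = ELeaf"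
| "shift_exp b (EVar x) = EVar (x + b)"
| "shift_exp b (EPair x y) = EPair (x + b) (y + b)"
| "shift_exp b (EFst x) = EFst (x + b)"
| "shift_exp b (ESnd x) = ESnd (x + b)"

primrec shift_com :: "nat \<Rightarrow> com \<Rightarrow> com" where
  "shift_com b (Assign x e) = Assign (x + b) (shift_exp b e)"
| "shift_com b (Seq p q) = Seq (shift_com b p) (shift_com b q)"
| "shift_com b (IfPair x p q) = IfPair (x + b) (shift_com b p) (shift_com b q)"
| "shift_com b (WhilePair x p) = WhilePair (x + b) (shift_com b p)"

fun exp_fits :: "nat \<Rightarrow> exp \<Rightarrow> bool" where
  "exp_fits m ELeaf = True"
| "exp_fits m (EVar x) = (x < m)"
| "exp_fits m (EPair x y) = (x < m \<and> y < m)"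
| "exp_fits m (EFst x) = (x < m)"
| "exp_fits m (ESnd x) = (x < m)"

primrec com_fits :: "nat \<Rightarrow> com \<Rightarrow> bool" where
  "com_fits m (Assign x e) = (x < m \<and> exp_fits m e)"
| "com_fits m (Seq p q) = (com_fits m p \<and> com_fits m q)"
| "com_fits m (IfPair x p q) = (x < m \<and> com_fits m p \<and> com_fits m q)"
| "com_fits m (WhilePair x p) = (x < m \<and> com_fits m p)"

lemma exp_fits_mono: "exp_fits m e \<Longrightarrow> m \<le> n \<Longrightarrow> exp_fits n e"
  by (cases e) auto

lemma com_fits_mono: "com_fits m p \<Longrightarrow> m \<le> n \<Longrightarrow> com_fits n p"
  by (induction p) (auto intro: exp_fits_mono)

lemma com_fits_ex: "\<exists>m. com_fits m p"
proof (induction p)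
  case (Assign x e)
  have "\<exists>m. exp_fits m e"
  proof (cases e)
    case (EPair y z) then show ?thesis by (intro exI[of _ "Suc (max y z)"]) auto
  qed (auto intro: exI[of _ "Suc _"])
  then obtain m where "exp_fits m e" ..
  then show ?case by (intro exI[of _ "max m (Suc x)"]) (auto intro: exp_fits_mono)
next
  case (Seq p q)
  then obtain m n where "com_fits m p" "com_fits n q" by blast
  then show ?case by (intro exI[of _ "max m n"]) (auto intro: com_fits_mono)
next
  case (IfPair x p q)
  then obtain m n where "com_fits m p" "com_fits n q" by blast
  then show ?case by (intro exI[of _ "max (Suc x) (max m n)"]) (auto intro: com_fits_mono)
next
  case (WhilePair x p)
  then obtain m where "com_fits m p" by blast
  then show ?case by (intro exI[of _ "max (Suc x) m"]) (auto intro: com_fits_mono)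
qed

lemma eval_shift_exp:
  "exp_fits m e \<Longrightarrow> (\<forall>i<m. t (i + b) = s i) \<Longrightarrow> eval_exp t (shift_exp b e) = eval_exp s e"
  by (cases e) auto

text \<open>A program that fits into \<open>m\<close> registers sees nothing else, so the two stores
  have to agree only there; registers below the offset are never addressed.\<close>

lemma exec_shift:
  assumes "exec p s T s'" "com_fits m p" "\<forall>i<m. t (i + b) = s i"
  shows "\<exists>t'. exec (shift_com b p) t T t' \<and> (\<forall>i<m. t' (i + b) = s' i) \<and> (\<forall>i<b. t' i = t i)"
  using assms
proof (induction arbitrary: t rule: exec.induct)
  case (1 x e s)
  then have e: "eval_exp t (shift_exp b e) = eval_exp s e" by (auto intro: eval_shift_exp)
  have "exec (shift_com b (Assign x e)) t (1 + dsize (eval_exp s e)) (t(x + b := eval_exp s e))"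
    using exec.intros(1)[of "x + b" "shift_exp b e" t] by (simp only: e shift_com.simps)
  moreover have "\<forall>i<m. (t(x + b := eval_exp s e)) (i + b) = (s(x := eval_exp s e)) i" using 1 by auto
  ultimately show ?case by (intro exI[of _ "t(x + b := eval_exp s e)"] conjI) (assumption, assumption, simp)
next
  case (2 p s T1 s1 q T2 s2)
  from "2.IH"(1)[of t] "2.prems" obtain t1 where
    t1: "exec (shift_com b p) t T1 t1" "\<forall>i<m. t1 (i + b) = s1 i" "\<forall>i<b. t1 i = t i" by auto
  from "2.IH"(2)[of t1] "2.prems"(1) t1(2) obtain t2 where
    t2: "exec (shift_com b q) t1 T2 t2" "\<forall>i<m. t2 (i + b) = s2 i" "\<forall>i<b. t2 i = t1 i" by auto
  from exec.intros(2)[OF t1(1) t2(1)] t1(3) t2(2,3) show ?case by (intro exI[of _ t2]) simp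
next
  case (3 s x p T s' q)
  from "3.IH"[of t] "3.prems" obtain t' where
    t': "exec (shift_com b p) t T t'" "\<forall>i<m. t' (i + b) = s' i" "\<forall>i<b. t' i = t i" by auto
  have "t (x + b) \<noteq> Leaf" using 3 by simp
  from exec.intros(3)[of t "x + b", OF this t'(1), of "shift_com b q"] t'(2,3)
  show ?case by (intro exI[of _ t']) simp
next
  case (4 s x q T s' p)
  from "4.IH"[of t] "4.prems" obtain t' where
    t': "exec (shift_com b q) t T t'" "\<forall>i<m. t' (i + b) = s' i" "\<forall>i<b. t' i = t i" by auto
  have "t (x + b) = Leaf" using 4 by simp
  from exec.intros(4)[of t "x + b", OF this t'(1), of "shift_com b p"] t'(2,3)
  show ?case by (intro exI[of _ t']) simp
next
  case (5 s x p)
  then have "t (x + b) = Leaf" by simp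
  from exec.intros(5)[of t "x + b", OF this] 5 show ?case by (intro exI[of _ t]) simp
next
  case (6 s x p T1 s1 T2 s2)
  from "6.IH"(1)[of t] "6.prems" obtain t1 where
    t1: "exec (shift_com b p) t T1 t1" "\<forall>i<m. t1 (i + b) = s1 i" "\<forall>i<b. t1 i = t i" by auto
  from "6.IH"(2)[OF "6.prems"(1) t1(2)] obtain t2 where
    t2: "exec (shift_com b (WhilePair x p)) t1 T2 t2" "\<forall>i<m. t2 (i + b) = s2 i" "\<forall>i<b. t2 i = t1 i" by blast
  have "t (x + b) \<noteq> Leaf" using 6 by simp
  from exec.intros(6)[of t "x + b", OF this t1(1) t2(1)[unfolded shift_com.simps]] t1(3) t2(2,3)
  show ?case by (intro exI[of _ t2]) simp
qed

text \<open>\<open>computes_in\<close> starts with all registers but the input equal to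
  \<open>Leaf\<close>, so the working registers of a subroutine must be reset before each
  call.\<close>

primrec clear_regs :: "nat \<Rightarrow> nat \<Rightarrow> com" where
  "clear_regs b 0 = Assign (b + 1) ELeaf"
| "clear_regs b (Suc m) = Seq (clear_regs b m) (Assign (b + Suc (Suc m)) ELeaf)"

lemma hoare_clear:
  "hoare (clear_regs b m) s (2 * m + 2) (\<lambda>s'. (\<forall>i\<le>m. s' (b + Suc i) = Leaf) \<and> (\<forall>i\<le>b. s' i = s i))"
proof (induction m)
  case 0
  show ?case unfolding clear_regs.simps by (rule hoare_assign) auto
next
  case (Suc m)
  have "hoare (Assign (b + Suc (Suc m)) ELeaf) t 2
     (\<lambda>s'. (\<forall>i\<le>Suc m. s' (b + Suc i) = Leaf) \<and> (\<forall>i\<le>b. s' i = s i))"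
    if "(\<forall>i\<le>m. t (b + Suc i) = Leaf) \<and> (\<forall>i\<le>b. t i = s i)" for t
    by (rule hoare_assign) (use that in \<open>auto simp: le_Suc_eq\<close>)
  then show ?case unfolding clear_regs.simps by (rule hoare_seq[OF Suc]) auto
qed

text \<open>Programs that come from an existential statement, such as computability or an
  fpt-reduction, become usable at any base register. The surcharge \<open>c\<close> is the time for
  clearing and is the same for all bases.\<close>

lemma subroutine:
  "\<exists>c. \<forall>b. \<exists>q. \<forall>s y T. computes_in p (s b) y T \<longrightarrow>
     hoare q s (T + c) (\<lambda>s'. s' b = y \<and> (\<forall>i<b. s' i = s i))"
proof -
  obtain m0 where "com_fits m0 p" using com_fits_ex by blast
  \<comment> \<open>With \<open>Suc m0\<close>, register 0, which carries input and output, is among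
    the simulated ones.\<close>
  then have m: "com_fits (Suc m0) p" by (rule com_fits_mono) simp
  have "hoare (Seq (clear_regs b m0) (shift_com b p)) s (T + (2 * m0 + 2))
      (\<lambda>s'. s' b = y \<and> (\<forall>i<b. s' i = s i))" if c: "computes_in p (s b) y T" for b s y T
  proof -
    obtain s' where s': "exec p ((\<lambda>_. Leaf)(0 := s b)) T s'" "s' 0 = y"
      using c unfolding computes_in_def by blast
    have "hoare (shift_com b p) t T (\<lambda>s'. s' b = y \<and> (\<forall>i<b. s' i = s i))"
      if t: "(\<forall>i\<le>m0. t (b + Suc i) = Leaf) \<and> (\<forall>i\<le>b. t i = s i)" for t
    proof -
      have "\<forall>i<Suc m0. t (i + b) = ((\<lambda>_. Leaf)(0 := s b)) i"
      proof (intro allI impI)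
        fix i assume "i < Suc m0"
        then show "t (i + b) = ((\<lambda>_. Leaf)(0 := s b)) i"
          using t by (cases i) (auto simp: add.commute)
      qed
      from exec_shift[OF s'(1) m this] obtain t' where
        t': "exec (shift_com b p) t T t'" "\<forall>i<Suc m0. t' (i + b) = s' i" "\<forall>i<b. t' i = t i" by blast
      from t'(2) s'(2) have "t' b = y" by force
      with t' t show ?thesis unfolding hoare_def by (intro exI[of _ T] exI[of _ t']) simp
    qed
    then show ?thesis by (rule hoare_seq[OF hoare_clear]) auto
  qed
  then show ?thesis by (intro exI[of _ "2 * m0 + 2"]) blast
qed

definition comput :: "('a::enc \<Rightarrow> 'b::enc) \<Rightarrow> bool" where
  "comput f \<longleftrightarrow> (\<exists>\<tau>. runs f \<tau>)"

named_theorems comput_intros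

lemma computable_iff_comput: "computable f \<longleftrightarrow> comput f"
proof
  assume "computable f"
  then obtain p where "\<forall>n. \<exists>T. computes_in p (enc n) (enc (f n)) T"
    unfolding computable_def enc_nat_inst by blast
  then obtain T where T: "\<And>n. computes_in p (enc n) (enc (f n)) (T n)" using choice[of "\<lambda>n T. computes_in p (enc n) (enc (f n)) T"] by blast
  obtain c where c: "\<And>b. \<exists>q. \<forall>s y T. computes_in p (s b) y T \<longrightarrow>
     hoare q s (T + c) (\<lambda>s'. s' b = y \<and> (\<forall>i<b. s' i = s i))" using subroutine[of p] by blast
  have "runs f (\<lambda>n. T n + c)"
  proof (rule runsI)
    fix b
    obtain q where q: "\<And>s y T. computes_in p (s b) y T \<Longrightarrow>
     hoare q s (T + c) (\<lambda>s'. s' b = y \<and> (\<forall>i<b. s' i = s i))" using c[of b] by blast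
    have "hoare q s (T n + c) (\<lambda>s'. s' b = enc (f n) \<and> (\<forall>i<b. s' i = s i))" if "s b = enc n" for s n
      by (rule q) (simp add: that T)
    then show "\<exists>q. \<forall>s n. s b = enc n \<longrightarrow> hoare q s (T n + c) (\<lambda>s'. s' b = enc (f n) \<and> (\<forall>i<b. s' i = s i))"
      by blast
  qed
  then show "comput f" unfolding comput_def by blast
next
  assume "comput f"
  then obtain \<tau> where "runs f \<tau>" unfolding comput_def by blast
  from runsD[OF this, of 0] obtain q where
    q: "\<And>s x. s 0 = enc x \<Longrightarrow> hoare q s (\<tau> x) (\<lambda>s'. s' 0 = enc (f x) \<and> (\<forall>i<0. s' i = s i))" by blast
  have "\<exists>T. computes_in q (enc n) (enc (f n)) T" for n
    using q[of "(\<lambda>_. Leaf)(0 := enc n)" n] unfolding computes_in_def hoare_def by auto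
  then show "computable f" unfolding computable_def enc_nat_inst by blast
qed

lemma ptime_comput: "ptime f \<Longrightarrow> comput f"
  unfolding ptime_def comput_def by blast

lemma comput_comp: "comput g \<Longrightarrow> comput f \<Longrightarrow> comput (\<lambda>x. g (f x))"
  unfolding comput_def using runs_comp by blast

lemma comput_pair [comput_intros]: "comput f \<Longrightarrow> comput g \<Longrightarrow> comput (\<lambda>x. (f x, g x))"
  unfolding comput_def using runs_pair by blast

lemma comput_fold:
  assumes "comput (\<lambda>p. f (fst p) (fst (snd p)) (snd (snd p)))" "comput l" "comput i"
  shows "comput (\<lambda>x. fold (f x) (l x) (i x))"
proof -
  obtain \<tau> where "runs (\<lambda>p. f (fst p) (fst (snd p)) (snd (snd p))) \<tau>" using assms(1) unfolding comput_def by blast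
  from runs_fold[OF this] have "comput (\<lambda>(e, l, a). fold (f e) l a)" unfolding comput_def by (auto cong: if_cong)
  from comput_comp[OF this, of "\<lambda>x. (x, l x, i x)"] show ?thesis
    using assms(2,3) by (simp add: comput_intros ptime_comput ptime_id)
qed

lemma comput_id [comput_intros]: "comput (\<lambda>x. x)" and comput_const [comput_intros]: "comput (\<lambda>x. c)"
  by (intro ptime_comput ptime_intros)+

lemma comput_binop:
  assumes "ptime (\<lambda>p. h (fst p) (snd p))" "comput f" "comput g" shows "comput (\<lambda>x. h (f x) (g x))"
  using comput_comp[OF ptime_comput[OF assms(1)] comput_pair[OF assms(2,3)]] by simp

lemma comput_arith [comput_intros]:
  fixes f g :: "'a::enc \<Rightarrow> nat"
  assumes "comput f" "comput g"
  shows "comput (\<lambda>x. f x + g x)" "comput (\<lambda>x. f x * g x)"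
  by (rule comput_binop[OF _ assms], intro ptime_intros)+

lemma comput_power [comput_intros]:
  fixes f :: "'a::enc \<Rightarrow> nat" shows "comput f \<Longrightarrow> comput (\<lambda>x. f x ^ n)"
  by (induction n) (auto intro: comput_intros)

text \<open>Bounds need not be monotone, and of an intermediate parameter only an upper bound
  \<open>h k\<close> is known. Summing over all values up to it gives a computable majorant.\<close>

lemma comput_sum:
  fixes f h :: "nat \<Rightarrow> nat"
  assumes "comput f" "comput h" shows "comput (\<lambda>k. \<Sum>j\<le>h k. f j)"
proof -
  have "comput (\<lambda>k. fold (\<lambda>j a. a + f j) [0..<Suc (h k)] 0)"
    by (rule comput_fold)
      (intro comput_intros comput_comp[OF assms(1)] comput_comp[OF ptime_comput[of "\<lambda>n. [0..<Suc n]"]]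
         assms(2) ptime_intros ptime_comput)+
  moreover have "fold (\<lambda>j a. a + f j) [0..<n] 0 = (\<Sum>j<n. f j)" for n
    by (induction n) auto
  ultimately show ?thesis by (simp only: lessThan_Suc_atMost)
qed

lemma fpt_reducible_trans:
  assumes "P \<le>\<^sub>f\<^sub>p\<^sub>t Q" "Q \<le>\<^sub>f\<^sub>p\<^sub>t R" shows "P \<le>\<^sub>f\<^sub>p\<^sub>t R"
proof -
  obtain p1 f1 h1 d1 where c1: "computable f1" "computable h1"
    and r1': "\<forall>(x, k)\<in>instances P. \<exists>x' k' T.
         computes_in p1 (Pair x (enc_nat k)) (Pair x' (enc_nat k')) T \<and>
         T \<le> f1 k * dsize x ^ d1 \<and> k' \<le> h1 k \<and> (x', k') \<in> instances Q \<and>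
         ((x, k) \<in> yes_instances P \<longleftrightarrow> (x', k') \<in> yes_instances Q)"
    using assms(1) unfolding fpt_reducible_def by blast
  have r1: "\<exists>x' k' T.
         computes_in p1 (Pair x (enc_nat k)) (Pair x' (enc_nat k')) T \<and>
         T \<le> f1 k * dsize x ^ d1 \<and> k' \<le> h1 k \<and> (x', k') \<in> instances Q \<and>
         ((x, k) \<in> yes_instances P \<longleftrightarrow> (x', k') \<in> yes_instances Q)"
    if "(x, k) \<in> instances P" for x k using bspec[OF r1' that] by simp
  obtain p2 f2 h2 d2 where c2: "computable f2" "computable h2"
    and r2': "\<forall>(x, k)\<in>instances Q. \<exists>x' k' T.
         computes_in p2 (Pair x (enc_nat k)) (Pair x' (enc_nat k')) T \<and>
         T \<le> f2 k * dsize x ^ d2 \<and> k' \<le> h2 k \<and> (x', k') \<in> instances R \<and>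
         ((x, k) \<in> yes_instances Q \<longleftrightarrow> (x', k') \<in> yes_instances R)"
    using assms(2) unfolding fpt_reducible_def by blast
  have r2: "\<exists>x' k' T.
         computes_in p2 (Pair x (enc_nat k)) (Pair x' (enc_nat k')) T \<and>
         T \<le> f2 k * dsize x ^ d2 \<and> k' \<le> h2 k \<and> (x', k') \<in> instances R \<and>
         ((x, k) \<in> yes_instances Q \<longleftrightarrow> (x', k') \<in> yes_instances R)"
    if "(x, k) \<in> instances Q" for x k using bspec[OF r2' that] by simp
  obtain c where "\<exists>q. \<forall>s y T. computes_in p2 (s 0) y T \<longrightarrow>
     hoare q s (T + c) (\<lambda>s'. s' 0 = y \<and> (\<forall>i<0. s' i = s i))" using subroutine[of p2] by blast
  then obtain q where q: "\<And>s y T. computes_in p2 (s 0) y T \<Longrightarrow>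
     hoare q s (T + c) (\<lambda>s'. s' 0 = y \<and> (\<forall>i<0. s' i = s i))" by blast
  let ?F2 = "\<lambda>k. \<Sum>j\<le>h1 k. f2 j" and ?H = "\<lambda>k. \<Sum>j\<le>h1 k. h2 j"
  \<comment> \<open>The first program contributes the exponent \<open>d1\<close>. Its output has
    size at most a function of \<open>k\<close> times \<open>dsize x ^ (d1 + 1)\<close>, and the
    second program raises this to the power \<open>d2\<close>.\<close>
  let ?F = "\<lambda>k. f1 k + c + ?F2 k * (2 * k + 3 + f1 k) ^ d2" and ?d = "d1 + (d1 + 1) * d2"
  note c = c1[unfolded computable_iff_comput] c2[unfolded computable_iff_comput]
  have "computable ?F" "computable ?H" unfolding computable_iff_comput
    by (intro comput_intros comput_sum c)+
  moreover have "\<exists>x' k' T. computes_in (Seq p1 q) (Pair x (enc_nat k)) (Pair x' (enc_nat k')) T \<and>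
         T \<le> ?F k * dsize x ^ ?d \<and> k' \<le> ?H k \<and> (x', k') \<in> instances R \<and>
         ((x, k) \<in> yes_instances P \<longleftrightarrow> (x', k') \<in> yes_instances R)"
    if inst: "(x, k) \<in> instances P" for x k
  proof -
    obtain x1 k1 T1 where 1: "computes_in p1 (Pair x (enc_nat k)) (Pair x1 (enc_nat k1)) T1"
         "T1 \<le> f1 k * dsize x ^ d1" "k1 \<le> h1 k" "(x1, k1) \<in> instances Q"
         "(x, k) \<in> yes_instances P \<longleftrightarrow> (x1, k1) \<in> yes_instances Q" using r1[OF inst] by blast
    obtain x2 k2 T2 where 2: "computes_in p2 (Pair x1 (enc_nat k1)) (Pair x2 (enc_nat k2)) T2"
         "T2 \<le> f2 k1 * dsize x1 ^ d2" "k2 \<le> h2 k1" "(x2, k2) \<in> instances R"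
         "(x1, k1) \<in> yes_instances Q \<longleftrightarrow> (x2, k2) \<in> yes_instances R" using r2[OF 1(4)] by blast
    obtain s1 where s1: "exec p1 ((\<lambda>_. Leaf)(0 := Pair x (enc_nat k))) T1 s1" "s1 0 = Pair x1 (enc_nat k1)"
      using 1(1) unfolding computes_in_def by blast
    from q[of s1 "Pair x2 (enc_nat k2)" T2] 2(1) s1(2) obtain T' s2 where
      s2: "exec q s1 T' s2" "T' \<le> T2 + c" "s2 0 = Pair x2 (enc_nat k2)" by (auto simp: hoare_def)
    have comp: "computes_in (Seq p1 q) (Pair x (enc_nat k)) (Pair x2 (enc_nat k2)) (T1 + T')"
      unfolding computes_in_def using exec.intros(2)[OF s1(1) s2(1)] s2(3) by blast
    have x: "dsize x ^ i \<ge> 1" for i using dsize_pos[of x] by (simp add: Suc_leI)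
    have xm: "dsize x ^ i \<le> dsize x ^ j" if "i \<le> j" for i j
      using that dsize_pos[of x] by (intro power_increasing) (auto simp: Suc_leI)
    \<comment> \<open>The output of the first program was either there from the start or has been
      paid for by its running time.\<close>
    have "dsize x1 \<le> dsize x + 2 * k + 2 + T1"
      using exec_reg_size[OF s1(1), of 0] s1(2) sz_nat[of k] by (auto simp: enc_nat_inst)
    also have "\<dots> \<le> (2 * k + 3 + f1 k) * dsize x ^ (d1 + 1)"
    proof -
      have "dsize x + 2 * k + 2 \<le> (2 * k + 3) * dsize x ^ (d1 + 1)"
        using xm[of 1 "d1 + 1"] mult_le_mono2[OF x[of "d1 + 1"], of "2 * k + 2"]
        by (simp add: add_mult_distrib del: power_Suc)
      moreover have "T1 \<le> f1 k * dsize x ^ (d1 + 1)"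
        by (rule order_trans[OF 1(2) mult_le_mono2[OF xm]]) simp
      ultimately show ?thesis by (simp only: add_mult_distrib)
    qed
    finally have "dsize x1 ^ d2 \<le> ((2 * k + 3 + f1 k) * dsize x ^ (d1 + 1)) ^ d2" by (rule power_mono) simp
    also have "\<dots> = (2 * k + 3 + f1 k) ^ d2 * dsize x ^ ((d1 + 1) * d2)"
      by (simp only: power_mult_distrib power_mult)
    also have "\<dots> \<le> (2 * k + 3 + f1 k) ^ d2 * dsize x ^ ?d" by (intro mult_le_mono2 xm) simp
    finally have "dsize x1 ^ d2 \<le> (2 * k + 3 + f1 k) ^ d2 * dsize x ^ ?d" .
    moreover have "f2 k1 \<le> ?F2 k" "h2 k1 \<le> ?H k"
      using 1(3) by (auto intro: member_le_sum[of k1 "{..h1 k}" f2] member_le_sum[of k1 "{..h1 k}" h2])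
    ultimately have "T2 \<le> ?F2 k * ((2 * k + 3 + f1 k) ^ d2 * dsize x ^ ?d)" "k2 \<le> ?H k"
      using order_trans[OF 2(2) mult_le_mono] 2(3) by auto
    moreover have "T1 \<le> f1 k * dsize x ^ ?d" "c \<le> c * dsize x ^ ?d"
      using order_trans[OF 1(2) mult_le_mono2[OF xm[of d1 ?d]]] x[of ?d] by auto
    ultimately have "T1 + T' \<le> f1 k * dsize x ^ ?d + c * dsize x ^ ?d
        + ?F2 k * ((2 * k + 3 + f1 k) ^ d2 * dsize x ^ ?d)" "k2 \<le> ?H k" using s2(2) by linarith+
    then have "T1 + T' \<le> ?F k * dsize x ^ ?d" "k2 \<le> ?H k" by (simp_all only: add_mult_distrib mult.assoc)
    then show ?thesis using comp 1(5) 2(4,5) by blast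
  qed
  ultimately show ?thesis unfolding fpt_reducible_def by blast
qed

lemma fpt_reducible_WSAT_on:
  fixes R :: "circuit \<times> nat \<Rightarrow> circuit \<times> nat"
  assumes R: "runs R \<tau>" and \<tau>: "\<And>C k. \<tau> (C, k) \<le> F k * sz C ^ d"
    and F: "comput F" and h: "comput h"
    and corr: "\<And>C k C' k'. Q C \<Longrightarrow> R (C, k) = (C', k') \<Longrightarrow>
      Q' C' \<and> k' \<le> h k \<and> (weighted_satisfiable C k \<longleftrightarrow> weighted_satisfiable C' k')"
  shows "WSAT_on Q \<le>\<^sub>f\<^sub>p\<^sub>t WSAT_on Q'"
proof -
  obtain q where q: "\<And>s x. s 0 = enc x \<Longrightarrow> hoare q s (\<tau> x) (\<lambda>s'. s' 0 = enc (R x) \<and> (\<forall>i<0. s' i = s i))"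
    using runsD[OF R, of 0] by blast
  have "\<exists>x' k' T. computes_in q (Pair x (enc_nat k)) (Pair x' (enc_nat k')) T \<and>
         T \<le> F k * dsize x ^ d \<and> k' \<le> h k \<and> (x', k') \<in> instances (WSAT_on Q') \<and>
         ((x, k) \<in> yes_instances (WSAT_on Q) \<longleftrightarrow> (x', k') \<in> yes_instances (WSAT_on Q'))"
    if inst: "(x, k) \<in> instances (WSAT_on Q)" for x k
  proof -
    obtain C where C: "x = enc_circuit C" "Q C" using inst by (auto simp: WSAT_on_def)
    obtain C' k' where R': "R (C, k) = (C', k')" by fastforce
    note corr = corr[OF C(2) R']
    have eq: "Pair x (enc_nat k) = enc (C, k)" "Pair (enc_circuit C') (enc_nat k') = enc (R (C, k))"
      by (simp_all add: C R' enc_circuit_conv enc_nat_inst)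
    from q[of "(\<lambda>_. Leaf)(0 := enc (C, k))" "(C, k)"] obtain T where
      "computes_in q (enc (C, k)) (enc (R (C, k))) T" "T \<le> \<tau> (C, k)"
      unfolding computes_in_def hoare_def by auto
    moreover from this \<tau>[of C k] have "T \<le> F k * dsize x ^ d" by (simp add: C enc_circuit_conv)
    moreover have "(enc_circuit C', k') \<in> instances (WSAT_on Q')" using corr by (auto simp: WSAT_on_def)
    ultimately have "computes_in q (Pair x (enc_nat k)) (Pair (enc_circuit C') (enc_nat k')) T \<and>
         T \<le> F k * dsize x ^ d \<and> k' \<le> h k \<and> (enc_circuit C', k') \<in> instances (WSAT_on Q') \<and>
         ((x, k) \<in> yes_instances (WSAT_on Q) \<longleftrightarrow> (enc_circuit C', k') \<in> yes_instances (WSAT_on Q'))"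
      using corr C by (simp only: eq yes_instance_WSAT_on_iff) (simp add: enc_circuit_conv enc_nat_inst)
    then show ?thesis by blast
  qed
  then show ?thesis unfolding fpt_reducible_def
    using F h computable_iff_comput by blast
qed

text \<open>Separates size and parameter: since sizes are positive, a power of the sum is at most a
  product of the form that fpt-reductions ask for.\<close>

lemma fpt_bound:
  fixes h :: "nat \<Rightarrow> nat"
  shows "(sz C + h k + 2) ^ d \<le> (h k + 3) ^ d * sz (C :: circuit) ^ d"
proof -
  have "sz C + h k + 2 \<le> (h k + 3) * sz C"
    using dsize_pos[of "enc C"] by (cases "sz C") auto
  then have "(sz C + h k + 2) ^ d \<le> ((h k + 3) * sz C) ^ d" by (rule power_mono) simp
  then show ?thesis by (simp add: power_mult_distrib)
qed

lemma ptime_reduction_WSAT_on: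
  fixes R :: "circuit \<times> nat \<Rightarrow> circuit \<times> nat"
  assumes "ptime R" and h: "comput h"
    and "\<And>C k C' k'. Q C \<Longrightarrow> R (C, k) = (C', k') \<Longrightarrow>
      Q' C' \<and> k' \<le> h k \<and> (weighted_satisfiable C k \<longleftrightarrow> weighted_satisfiable C' k')"
  shows "WSAT_on Q \<le>\<^sub>f\<^sub>p\<^sub>t WSAT_on Q'"
proof -
  obtain \<tau> d where \<tau>: "runs R \<tau>" "\<And>x. \<tau> x \<le> (sz x + 2) ^ d"
    using assms(1) unfolding ptime_def polyb_def by blast
  show ?thesis
  proof (rule fpt_reducible_WSAT_on[OF \<tau>(1) _ _ h assms(3)])
    show "\<tau> (C, k) \<le> ((2 * k + 2) + 3) ^ d * sz C ^ d" for C k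
      using \<tau>(2)[of "(C, k)"] fpt_bound[of C "\<lambda>k. 2 * k + 2" k d]
      by (simp add: add.commute add.left_commute)
    show "comput (\<lambda>k :: nat. ((2 * k + 2) + 3) ^ d)" by (intro comput_intros)
  qed auto
qed

section \<open>Access to vertices through their raw trees\<close>

instantiation data :: enc begin
definition enc_data_inst: "enc (d :: data) = d"
instance ..
end

text \<open>Destructors of types other than products and lists are realised by surgery on the tree,
  which at type \<open>data\<close> is its own encoding.\<close>

lemma ptime_via_data:
  assumes "ptime F" "\<And>x. enc (f x) = F (enc x)" shows "ptime f"
proof -
  obtain \<tau> d where \<tau>: "runs F \<tau>" "\<And>x. \<tau> x \<le> (sz x + 2) ^ d" using assms(1) unfolding ptime_def polyb_def by blast
  have "runs f (\<lambda>x. \<tau> (enc x))"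
  proof (rule runsI)
    fix b
    obtain q where q: "\<And>s x. s b = enc x \<Longrightarrow> hoare q s (\<tau> x) (\<lambda>s'. s' b = enc (F x) \<and> (\<forall>i<b. s' i = s i))"
      using runsD[OF \<tau>(1), of b] by blast
    have "hoare q s (\<tau> (enc x)) (\<lambda>s'. s' b = enc (f x) \<and> (\<forall>i<b. s' i = s i))" if "s b = enc x" for s x
      using q[of s "enc x"] that assms(2)[of x] by (simp add: enc_data_inst)
    then show "\<exists>q. \<forall>s x. s b = enc x \<longrightarrow> hoare q s (\<tau> (enc x)) (\<lambda>s'. s' b = enc (f x) \<and> (\<forall>i<b. s' i = s i))"
      by blast
  qed
  moreover have "polyb sz (\<lambda>x. \<tau> (enc x))" unfolding polyb_def
    using \<tau>(2)[of "enc _"] by (auto simp: enc_data_inst)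
  ultimately show ?thesis by (rule ptimeI)
qed

lemma dsize_dfst: "dsize (dfst d) \<le> dsize d" and dsize_dsnd: "dsize (dsnd d) \<le> dsize d"
  by (cases d; simp)+

lemma ptime_dfst: "ptime f \<Longrightarrow> ptime (\<lambda>x. dfst (f x))"
  by (rule ptime_comp[of dfst], rule ptime_exp[of EFst]) (auto simp: enc_data_inst dsize_dfst)

lemma ptime_dsnd: "ptime f \<Longrightarrow> ptime (\<lambda>x. dsnd (f x))"
  by (rule ptime_comp[of dsnd], rule ptime_exp[of ESnd]) (auto simp: enc_data_inst dsize_dsnd)

lemma ptime_if_Leaf:
  assumes "ptime l" "ptime f" "ptime g" shows "ptime (\<lambda>x. if l x = Leaf then f x else g x)"
  by (rule ptime_branch[OF assms(1,2) ptime_comp[OF assms(3) ptime_fst_prim] polyb_pair_size[OF assms(1)]])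
    (auto simp: enc_data_inst)

lemmas ptime_data = ptime_dfst ptime_dsnd ptime_if_Leaf

definition vtag :: "vertex \<Rightarrow> nat" where
  "vtag v = (case v of Literal b x \<Rightarrow> if b then 0 else 1 | NotGate i \<Rightarrow> 2 | AndGate is \<Rightarrow> 3 | OrGate is \<Rightarrow> 4)"

definition vnum :: "vertex \<Rightarrow> nat" where
  "vnum v = (case v of Literal b x \<Rightarrow> x | NotGate i \<Rightarrow> i | _ \<Rightarrow> 0)"

definition vargs :: "vertex \<Rightarrow> nat list" where
  "vargs v = (case v of AndGate is \<Rightarrow> is | OrGate is \<Rightarrow> is | _ \<Rightarrow> [])"

lemma enc_vertex_simps:
  "enc (Literal b x) = Pair (enc (if b then 0 else 1 :: nat)) (enc x)"
  "enc (NotGate i) = Pair (enc (2 :: nat)) (enc i)"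
  "enc (AndGate is) = Pair (enc (3 :: nat)) (enc is)"
  "enc (OrGate is) = Pair (enc (4 :: nat)) (enc is)"
  by (simp_all add: enc_vertex_inst enc_nat_inst enc_list_inst)

lemma ptime_vtag [ptime_intros]: "ptime f \<Longrightarrow> ptime (\<lambda>x. vtag (f x))"
proof (rule ptime_comp[of vtag], rule ptime_via_data[of dfst])
  show "enc (vtag v) = dfst (enc v)" for v by (cases v) (auto simp: vtag_def enc_vertex_simps)
qed (intro ptime_data ptime_intros)

text \<open>Tags are unary, so two steps down the tag give \<open>Leaf\<close> exactly for tags up
  to 2, that is, for literals and NOT-gates. The same test recognises the gates with argument
  lists.\<close>

lemma ptime_vnum [ptime_intros]: "ptime f \<Longrightarrow> ptime (\<lambda>x. vnum (f x))"
proof (rule ptime_comp[of vnum], rule ptime_via_data[of "\<lambda>d. if dsnd (dsnd (dfst d)) = Leaf then dsnd d else Leaf"])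
  show "enc (vnum v) = (if dsnd (dsnd (dfst (enc v))) = Leaf then dsnd (enc v) else Leaf)" for v
    by (cases v) (auto simp: vnum_def enc_vertex_simps numeral_eq_Suc)
qed (intro ptime_data ptime_intros)

lemma ptime_vargs [ptime_intros]: "ptime f \<Longrightarrow> ptime (\<lambda>x. vargs (f x))"
proof (rule ptime_comp[of vargs], rule ptime_via_data[of "\<lambda>d. if dsnd (dsnd (dfst d)) = Leaf then Leaf else dsnd d"])
  show "enc (vargs v) = (if dsnd (dsnd (dfst (enc v))) = Leaf then Leaf else dsnd (enc v))" for v
    by (cases v) (auto simp: vargs_def enc_vertex_simps numeral_eq_Suc)
qed (intro ptime_data ptime_intros)

lemma ptime_Pair_enc: "ptime u \<Longrightarrow> ptime (\<lambda>x. Pair c (enc (u x)))"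
proof -
  assume u: "ptime u"
  have "ptime (\<lambda>p :: data \<times> data. Pair (fst p) (snd p))" by (rule ptime_cast) (simp add: enc_data_inst enc_prod_inst)
  moreover have "ptime (\<lambda>x. enc (u x))"
    by (rule ptime_comp[OF _ u]) (rule ptime_cast, simp add: enc_data_inst)
  ultimately show ?thesis
    using ptime_comp[of "\<lambda>p :: data \<times> data. Pair (fst p) (snd p)" "\<lambda>x. (c, enc (u x))"] by (simp add: ptime_intros)
qed

lemma ptime_data_result: "ptime w \<Longrightarrow> (\<And>x. enc (v x) = w x) \<Longrightarrow> ptime v"
  unfolding ptime_def runs_def by (simp add: enc_data_inst)

lemma ptime_vertex_constructors [ptime_intros]:
  "ptime f \<Longrightarrow> ptime (\<lambda>x. Literal b (f x))"
  "ptime f \<Longrightarrow> ptime (\<lambda>x. NotGate (f x))"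
  "ptime h \<Longrightarrow> ptime (\<lambda>x. AndGate (h x))"
  "ptime h \<Longrightarrow> ptime (\<lambda>x. OrGate (h x))"
  by (rule ptime_data_result[OF ptime_Pair_enc], assumption, rule enc_vertex_simps)+

text \<open>\<open>!\<close> is underspecified beyond the end of a list; with a default value the
  access is a function that a program can compute on all inputs.\<close>

definition nthd :: "'a \<Rightarrow> 'a list \<Rightarrow> nat \<Rightarrow> 'a" where
  "nthd d l i = (case drop i l of [] \<Rightarrow> d | y # ys \<Rightarrow> y)"

lemma nthd_eq [simp]: "i < length l \<Longrightarrow> nthd d l i = l ! i"
  by (simp add: nthd_def Cons_nth_drop_Suc[symmetric])

lemma ptime_nthd [ptime_intros]:
  "ptime d \<Longrightarrow> ptime l \<Longrightarrow> ptime i \<Longrightarrow> ptime (\<lambda>x. nthd (d x) (l x) (i x))"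
  unfolding nthd_def by (intro ptime_intros)

lemma ptime_eq_nat_list [ptime_intros]:
  fixes f g :: "'a::enc \<Rightarrow> nat list"
  assumes "ptime f" "ptime g" shows "ptime (\<lambda>x. f x = g x)"
proof -
  have eq: "(\<lambda>x. f x = g x) = (\<lambda>x. length (f x) = length (g x) \<and>
      (\<forall>i\<in>set [0..<length (f x)]. nthd 0 (f x) i = nthd 0 (g x) i))"
  proof
    fix x
    have "(\<forall>i\<in>set [0..<length (f x)]. nthd 0 (f x) i = nthd 0 (g x) i) \<longleftrightarrow> (\<forall>i<length (f x). f x ! i = g x ! i)"
      if "length (f x) = length (g x)" using that by auto
    then show "f x = g x \<longleftrightarrow> length (f x) = length (g x) \<and>
      (\<forall>i\<in>set [0..<length (f x)]. nthd 0 (f x) i = nthd 0 (g x) i)"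
      using list_eq_iff_nth_eq[of "f x" "g x"] by blast
  qed
  note fst = ptime_comp[OF assms(1) ptime_fst_prim] ptime_comp[OF assms(2) ptime_fst_prim]
  show ?thesis unfolding eq by (intro ptime_intros assms fst)
qed

section \<open>Alternating trees and their serialisation\<close>

text \<open>Connectives are not stored: they alternate from level to level, so the one at the root
  determines all others.\<close>

datatype 'a ntree = NLf 'a | Nd "'a ntree list"

primrec enc_ntree :: "('a \<Rightarrow> data) \<Rightarrow> 'a ntree \<Rightarrow> data" where
  "enc_ntree f (NLf a) = Pair Leaf (f a)"
| "enc_ntree f (Nd ts) = Pair (Pair Leaf Leaf) (enc_list id (map (enc_ntree f) ts))"

instantiation ntree :: (enc) enc begin
definition enc_ntree_inst: "enc = enc_ntree enc"
instance ..
end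

lemma enc_ntree_simps [simp]:
  "enc (NLf a) = Pair Leaf (enc a)"
  "enc (Nd ts) = Pair (Pair Leaf Leaf) (enc ts)"
proof -
  have "enc_list id (map f ts) = enc_list f ts" for f :: "'c \<Rightarrow> data" and ts
    by (induction ts) auto
  then show "enc (Nd ts) = Pair (Pair Leaf Leaf) (enc ts)"
    by (simp add: enc_ntree_inst enc_list_inst)
qed (simp add: enc_ntree_inst)

definition kids :: "'a ntree \<Rightarrow> 'a ntree list" where
  "kids t = (case t of NLf a \<Rightarrow> [] | Nd ts \<Rightarrow> ts)"

definition leafv :: "'a \<Rightarrow> 'a ntree \<Rightarrow> 'a" where
  "leafv d t = (case t of NLf a \<Rightarrow> a | Nd ts \<Rightarrow> d)"

definition is_leaf :: "'a ntree \<Rightarrow> bool" where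
  "is_leaf t = (case t of NLf a \<Rightarrow> True | Nd ts \<Rightarrow> False)"

lemma ntree_sel_simps [simp]:
  "kids (Nd ts) = ts" "leafv d (NLf a) = a" "is_leaf (NLf a)" "\<not> is_leaf (Nd ts)"
  by (simp_all add: kids_def leafv_def is_leaf_def)

lemma ptime_NLf [ptime_intros]: "ptime f \<Longrightarrow> ptime (\<lambda>x. NLf (f x))"
  using ptime_comp[OF ptime_cast[of "\<lambda>p :: unit \<times> 'b. NLf (snd p)"] ptime_pair[OF ptime_const[of "()"]], of f]
  by (simp add: enc_prod_inst)

lemma ptime_Nd [ptime_intros]: "ptime f \<Longrightarrow> ptime (\<lambda>x. Nd (f x))"
proof -
  assume f: "ptime f"
  have "ptime (\<lambda>p :: (unit \<times> unit) \<times> 'b ntree list. Nd (snd p))"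
    by (rule ptime_cast) (simp add: enc_prod_inst)
  from ptime_comp[OF this ptime_pair[OF ptime_const[of "((), ())"] f]] show ?thesis by simp
qed

lemma ptime_kids [ptime_intros]: "ptime f \<Longrightarrow> ptime (\<lambda>x. kids (f x))"
proof (rule ptime_comp[of kids], rule ptime_via_data[of "\<lambda>d. if dfst d = Leaf then Leaf else dsnd d"])
  show "enc (kids t) = (if dfst (enc t) = Leaf then Leaf else dsnd (enc t))" for t :: "'b ntree"
    by (cases t) (auto simp: kids_def)
qed (intro ptime_data ptime_intros)

lemma ptime_is_leaf [ptime_intros]: "ptime f \<Longrightarrow> ptime (\<lambda>x. is_leaf (f x))"
proof (rule ptime_comp[of is_leaf], rule ptime_via_data[of "\<lambda>d. if dfst d = Leaf then Pair Leaf Leaf else Leaf"])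
  show "enc (is_leaf t) = (if dfst (enc t) = Leaf then Pair Leaf Leaf else Leaf)" for t :: "'b ntree"
    by (cases t) (auto simp: is_leaf_def)
qed (intro ptime_data ptime_intros)

lemma ptime_leafv [ptime_intros]: "ptime d \<Longrightarrow> ptime f \<Longrightarrow> ptime (\<lambda>x. leafv (d x) (f x))"
proof -
  assume df: "ptime d" "ptime f"
  have "ptime (\<lambda>p :: 'b \<times> 'b ntree. leafv (fst p) (snd p))"
  proof (rule ptime_via_data[of "\<lambda>d. if dfst (dsnd d) = Leaf then dsnd (dsnd d) else dfst d"])
    show "enc (leafv (fst p) (snd p)) = (if dfst (dsnd (enc p)) = Leaf then dsnd (dsnd (enc p)) else dfst (enc p))"
      for p :: "'b \<times> 'b ntree" by (cases p; cases "snd p") (auto simp: leafv_def)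
  qed (intro ptime_data ptime_intros)
  from ptime_comp[OF this ptime_pair[OF df]] show ?thesis by simp
qed

fun ev :: "('a \<Rightarrow> bool) \<Rightarrow> bool \<Rightarrow> 'a ntree \<Rightarrow> bool" where
  "ev I pol (NLf a) = I a"
| "ev I pol (Nd ts) = (if pol then (\<forall>t\<in>set ts. ev I False t) else (\<exists>t\<in>set ts. ev I True t))"

section \<open>Values, depth and weft at single vertices\<close>

lemma length_sweep [simp]: "length (sweep f C) = length C"
  unfolding sweep_def by (induction C rule: rev_induct) auto

lemma sweep_Nil [simp]: "sweep f [] = []"
  by (simp add: sweep_def)

lemma sweep_snoc: "sweep f (C @ [v]) = sweep f C @ [f (sweep f C) v]"
  by (simp add: sweep_def)

lemma sweep_append_nth: "j < length C \<Longrightarrow> sweep f (C @ D) ! j = sweep f C ! j"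
proof (induction D rule: rev_induct)
  case (snoc v D)
  then show ?case using sweep_snoc[of f "C @ D" v] by (simp add: nth_append)
qed simp

lemma last_sweep: "C \<noteq> [] \<Longrightarrow> last (sweep f C) = sweep f C ! (length C - 1)"
proof -
  assume "C \<noteq> []"
  then have "length (sweep f C) \<noteq> 0" by simp
  then have "sweep f C \<noteq> []" by (intro notI) simp
  then show ?thesis by (simp add: last_conv_nth)
qed

text \<open>While a vertex is processed only the results of earlier vertices exist. An
  \<open>f\<close> that depends on in-neighbours alone cannot tell them from the complete list,
  which yields a recursive equation.\<close>

lemma sweep_nth:
  assumes "j < length C" "in_nbrs (C ! j) \<subseteq> {..<j}"
    and "\<And>rs rs'. (\<And>i. i \<in> in_nbrs (C ! j) \<Longrightarrow> rs ! i = rs' ! i) \<Longrightarrow> f rs (C ! j) = f rs' (C ! j)"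
  shows "sweep f C ! j = f (sweep f C) (C ! j)"
proof -
  let ?B = "take j C"
  have C: "C = (?B @ [C ! j]) @ drop (Suc j) C" using assms(1) by (simp add: id_take_nth_drop)
  have "sweep f C ! j = sweep f (?B @ [C ! j]) ! j"
    using sweep_append_nth[of j "?B @ [C ! j]" f "drop (Suc j) C"] C assms(1) by simp
  also have "\<dots> = f (sweep f ?B) (C ! j)" using assms(1) by (simp add: sweep_snoc nth_append)
  also have "\<dots> = f (sweep f C) (C ! j)"
  proof (rule assms(3))
    fix i assume "i \<in> in_nbrs (C ! j)"
    then have "i < j" using assms(2) by auto
    then show "sweep f ?B ! i = sweep f C ! i"
      using sweep_append_nth[of i ?B f "drop j C"] assms(1) by simp
  qed
  finally show ?thesis .
qed

definition value_at :: "nat set \<Rightarrow> circuit \<Rightarrow> nat \<Rightarrow> bool" where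
  "value_at A C j = sweep (vertex_value A) C ! j"

definition depth_at :: "circuit \<Rightarrow> nat \<Rightarrow> nat" where
  "depth_at C j = sweep (\<lambda>rs v. if is_literal v then 0 else 1 + Max ((!) rs ` in_nbrs v)) C ! j"

definition weft_at :: "circuit \<Rightarrow> nat \<Rightarrow> nat" where
  "weft_at C j = sweep (\<lambda>rs v. if is_literal v then 0
     else (if card (in_nbrs v) > 2 then 1 else 0) + Max ((!) rs ` in_nbrs v)) C ! j"

lemma satisfies_conv: "C \<noteq> [] \<Longrightarrow> satisfies A C = value_at A C (length C - 1)"
  and depth_conv: "C \<noteq> [] \<Longrightarrow> depth C = depth_at C (length C - 1)"
  and weft_conv: "C \<noteq> [] \<Longrightarrow> weft C = weft_at C (length C - 1)"
  by (simp_all add: satisfies_def depth_def weft_def value_at_def depth_at_def weft_at_def last_sweep)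

lemmas at_defs = value_at_def depth_at_def weft_at_def

lemma at_append:
  "j < length C \<Longrightarrow> value_at A (C @ D) j = value_at A C j"
  "j < length C \<Longrightarrow> depth_at (C @ D) j = depth_at C j"
  "j < length C \<Longrightarrow> weft_at (C @ D) j = weft_at C j"
  by (simp_all add: at_defs sweep_append_nth)

lemma value_at_nth:
  assumes "is_circuit C" "j < length C"
  shows "value_at A C j = vertex_value A (sweep (vertex_value A) C) (C ! j)"
  unfolding value_at_def
proof (rule sweep_nth)
  show "vertex_value A rs (C ! j) = vertex_value A rs' (C ! j)" if "\<And>i. i \<in> in_nbrs (C ! j) \<Longrightarrow> rs ! i = rs' ! i" for rs rs'
    using that by (cases "C ! j") auto
qed (use assms in \<open>auto simp: is_circuit_def\<close>)

lemma depth_at_nth: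
  assumes "is_circuit C" "j < length C"
  shows "depth_at C j = (if is_literal (C ! j) then 0 else 1 + Max (depth_at C ` in_nbrs (C ! j)))"
proof -
  let ?f = "\<lambda>(rs :: nat list) v. if is_literal v then 0 else 1 + Max ((!) rs ` in_nbrs v)"
  have "sweep ?f C ! j = ?f (sweep ?f C) (C ! j)"
  proof (rule sweep_nth)
    show "?f rs (C ! j) = ?f rs' (C ! j)" if "\<And>i. i \<in> in_nbrs (C ! j) \<Longrightarrow> rs ! i = rs' ! i" for rs rs' :: "nat list"
      using image_cong[OF refl that, of "in_nbrs (C ! j)"] by simp
  qed (use assms in \<open>auto simp: is_circuit_def\<close>)
  then show ?thesis unfolding depth_at_def by simp
qed

lemma weft_at_nth:
  assumes "is_circuit C" "j < length C"
  shows "weft_at C j = (if is_literal (C ! j) then 0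
    else (if card (in_nbrs (C ! j)) > 2 then 1 else 0) + Max (weft_at C ` in_nbrs (C ! j)))"
proof -
  let ?f = "\<lambda>(rs :: nat list) v. if is_literal v then 0
    else (if card (in_nbrs v) > 2 then 1 else 0) + Max ((!) rs ` in_nbrs v)"
  have "sweep ?f C ! j = ?f (sweep ?f C) (C ! j)"
  proof (rule sweep_nth)
    show "?f rs (C ! j) = ?f rs' (C ! j)" if "\<And>i. i \<in> in_nbrs (C ! j) \<Longrightarrow> rs ! i = rs' ! i" for rs rs' :: "nat list"
      using image_cong[OF refl that, of "in_nbrs (C ! j)"] by simp
  qed (use assms in \<open>auto simp: is_circuit_def\<close>)
  then show ?thesis unfolding weft_at_def by simp
qed

lemma finite_in_nbrs [simp]: "finite (in_nbrs v)" by (cases v) auto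

section \<open>Turning alternating trees into gates\<close>

definition gate :: "bool \<Rightarrow> nat list \<Rightarrow> vertex" where
  "gate pol is = (if pol then AndGate is else OrGate is)"

lemma gate_simps [simp]:
  "in_nbrs (gate pol is) = set is" "is_and (gate pol is) = pol" "\<not> is_literal (gate pol is)"
  "\<not> is_not (gate pol is)"
  by (simp_all add: gate_def)

text \<open>The recursion is on a depth bound and not on the tree. This bound is a constant of the
  reduction, so polynomial time follows by induction on it. Leaves are positions in the given
  circuit, and the second component of the result is the position of the root.\<close>

primrec ser :: "nat \<Rightarrow> bool \<Rightarrow> nat ntree \<Rightarrow> circuit \<Rightarrow> circuit \<times> nat" where
  "ser 0 = (\<lambda>pol t C. (C, leafv 0 t))"
| "ser (Suc n) = (\<lambda>pol t C. if is_leaf t then (C, leafv 0 t) else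
     (\<lambda>r. (fst r @ [gate pol (snd r)], length (fst r)))
       (fold (\<lambda>t r. (fst (ser n (\<not> pol) t (fst r)), snd r @ [snd (ser n (\<not> pol) t (fst r))])) (kids t) (C, [])))"

definition sers :: "nat \<Rightarrow> bool \<Rightarrow> nat ntree list \<Rightarrow> circuit \<times> nat list \<Rightarrow> circuit \<times> nat list" where
  "sers n pol ts r = fold (\<lambda>t r. (fst (ser n pol t (fst r)), snd r @ [snd (ser n pol t (fst r))])) ts r"

lemma sers_simps:
  "sers n pol [] r = r"
  "sers n pol (t # ts) r = sers n pol ts (fst (ser n pol t (fst r)), snd r @ [snd (ser n pol t (fst r))])"
  by (simp_all add: sers_def)

lemma ser_Suc: "ser (Suc n) pol t C = (if is_leaf t then (C, leafv 0 t) else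
   (fst (sers n (\<not> pol) (kids t) (C, [])) @ [gate pol (snd (sers n (\<not> pol) (kids t) (C, [])))],
    length (fst (sers n (\<not> pol) (kids t) (C, [])))))"
  by (simp add: sers_def)

declare ser.simps(2) [simp del]

text \<open>Empty nodes are excluded because every gate of a circuit needs an in-neighbour.\<close>

fun tok :: "nat \<Rightarrow> nat \<Rightarrow> nat ntree \<Rightarrow> bool" where
  "tok nl n (NLf a) = (a < nl)"
| "tok nl 0 (Nd ts) = False"
| "tok nl (Suc n) (Nd ts) = (ts \<noteq> [] \<and> (\<forall>t\<in>set ts. tok nl n t))"

lemma tok_mono: "tok nl n t \<Longrightarrow> n \<le> n' \<Longrightarrow> nl \<le> nl' \<Longrightarrow> tok nl' n' t"
proof (induction nl n t arbitrary: n' rule: tok.induct)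
  case (3 nl n ts)
  obtain m where m: "n' = Suc m" "n \<le> m" using "3.prems"(2) by (cases n') auto
  have "tok nl' m t" if "t \<in> set ts" for t
    by (rule "3.IH"[OF that _ m(2) "3.prems"(3)]) (use "3.prems"(1) that in simp)
  then show ?case using "3.prems"(1) m(1) by simp
qed simp_all

text \<open>\<open>ext_trees nl pol C C' is\<close>: \<open>C'\<close> extends \<open>C\<close> by disjoint alternating trees of gates over the first
  \<open>nl\<close> vertices, whose roots are \<open>is\<close>.\<close>

definition ext_trees :: "nat \<Rightarrow> bool \<Rightarrow> circuit \<Rightarrow> circuit \<Rightarrow> nat list \<Rightarrow> bool" where
  "ext_trees nl pol C C' is \<longleftrightarrow> (\<exists>gs. C' = C @ gs \<and> (\<forall>v\<in>set gs. \<not> is_literal v \<and> \<not> is_not v \<and> in_nbrs v \<noteq> {})) \<and>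
     (\<forall>j. length C \<le> j \<longrightarrow> j < length C' \<longrightarrow> in_nbrs (C' ! j) \<subseteq> {..<nl} \<union> {length C..<j}) \<and>
     (\<forall>j j' i. length C \<le> j \<longrightarrow> j < length C' \<longrightarrow> length C \<le> j' \<longrightarrow> j' < length C' \<longrightarrow> length C \<le> i \<longrightarrow>
        i \<in> in_nbrs (C' ! j) \<longrightarrow> i \<in> in_nbrs (C' ! j') \<longrightarrow> j = j') \<and>
     (\<forall>i\<in>set is. i < nl \<or> length C \<le> i \<and> i < length C' \<and> is_and (C' ! i) = pol \<and>
        (\<forall>j. length C \<le> j \<longrightarrow> j < length C' \<longrightarrow> i \<notin> in_nbrs (C' ! j))) \<and>
     (\<forall>j i. length C \<le> j \<longrightarrow> j < length C' \<longrightarrow> length C \<le> i \<longrightarrow> i \<in> in_nbrs (C' ! j) \<longrightarrow>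
        is_and (C' ! i) \<noteq> is_and (C' ! j))"

lemma ext_treesI:
  assumes "C' = C @ gs" "\<And>v. v \<in> set gs \<Longrightarrow> \<not> is_literal v \<and> \<not> is_not v \<and> in_nbrs v \<noteq> {}"
    and "\<And>j. length C \<le> j \<Longrightarrow> j < length C' \<Longrightarrow> in_nbrs (C' ! j) \<subseteq> {..<nl} \<union> {length C..<j}"
    and "\<And>j j' i. length C \<le> j \<Longrightarrow> j < length C' \<Longrightarrow> length C \<le> j' \<Longrightarrow> j' < length C' \<Longrightarrow> length C \<le> i \<Longrightarrow>
        i \<in> in_nbrs (C' ! j) \<Longrightarrow> i \<in> in_nbrs (C' ! j') \<Longrightarrow> j = j'"
    and "\<And>i. i \<in> set is \<Longrightarrow> i < nl \<or> length C \<le> i \<and> i < length C' \<and> is_and (C' ! i) = pol \<and>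
        (\<forall>j. length C \<le> j \<longrightarrow> j < length C' \<longrightarrow> i \<notin> in_nbrs (C' ! j))"
    and "\<And>i j. length C \<le> j \<Longrightarrow> j < length C' \<Longrightarrow> length C \<le> i \<Longrightarrow> i \<in> in_nbrs (C' ! j) \<Longrightarrow>
        is_and (C' ! i) \<noteq> is_and (C' ! j)"
  shows "ext_trees nl pol C C' is"
  unfolding ext_trees_def
  apply (rule conjI, use assms(1,2) in blast)
  apply (rule conjI, use assms(3) in blast)
  apply (rule conjI, use assms(4) in blast)
  apply (rule conjI, use assms(5) in blast)
  by (use assms(6) in blast)

lemma ext_refl: "ext_trees nl pol C C []"
  unfolding ext_trees_def by auto

lemma ext_leaf: "a < nl \<Longrightarrow> ext_trees nl pol C C [a]"
  unfolding ext_trees_def by auto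

lemma extD:
  assumes "ext_trees nl pol C C' is"
  shows "\<exists>gs. C' = C @ gs \<and> (\<forall>v\<in>set gs. \<not> is_literal v \<and> \<not> is_not v \<and> in_nbrs v \<noteq> {})"
    and "length C \<le> j \<Longrightarrow> j < length C' \<Longrightarrow> in_nbrs (C' ! j) \<subseteq> {..<nl} \<union> {length C..<j}"
    and "length C \<le> j \<Longrightarrow> j < length C' \<Longrightarrow> length C \<le> j' \<Longrightarrow> j' < length C' \<Longrightarrow> length C \<le> i \<Longrightarrow>
        i \<in> in_nbrs (C' ! j) \<Longrightarrow> i \<in> in_nbrs (C' ! j') \<Longrightarrow> j = j'"
    and "i \<in> set is \<Longrightarrow> i < nl \<or> length C \<le> i \<and> i < length C' \<and> is_and (C' ! i) = pol \<and>
        (\<forall>j. length C \<le> j \<longrightarrow> j < length C' \<longrightarrow> i \<notin> in_nbrs (C' ! j))"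
    and "length C \<le> j \<Longrightarrow> j < length C' \<Longrightarrow> length C \<le> i \<Longrightarrow> i \<in> in_nbrs (C' ! j) \<Longrightarrow>
        is_and (C' ! i) \<noteq> is_and (C' ! j)"
proof -
  note a = assms[unfolded ext_trees_def]
  note a2 = conjunct2[OF a] note a3 = conjunct2[OF a2] note a4 = conjunct2[OF a3]
  show "\<exists>gs. C' = C @ gs \<and> (\<forall>v\<in>set gs. \<not> is_literal v \<and> \<not> is_not v \<and> in_nbrs v \<noteq> {})"
    by (rule conjunct1[OF a])
  show "length C \<le> j \<Longrightarrow> j < length C' \<Longrightarrow> in_nbrs (C' ! j) \<subseteq> {..<nl} \<union> {length C..<j}"
    using conjunct1[OF a2] by blast
  show "length C \<le> j \<Longrightarrow> j < length C' \<Longrightarrow> length C \<le> j' \<Longrightarrow> j' < length C' \<Longrightarrow> length C \<le> i \<Longrightarrow>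
        i \<in> in_nbrs (C' ! j) \<Longrightarrow> i \<in> in_nbrs (C' ! j') \<Longrightarrow> j = j'"
    using conjunct1[OF a3] by blast
  show "i \<in> set is \<Longrightarrow> i < nl \<or> length C \<le> i \<and> i < length C' \<and> is_and (C' ! i) = pol \<and>
        (\<forall>j. length C \<le> j \<longrightarrow> j < length C' \<longrightarrow> i \<notin> in_nbrs (C' ! j))"
    using conjunct1[OF a4] by (rule bspec)
  show "length C \<le> j \<Longrightarrow> j < length C' \<Longrightarrow> length C \<le> i \<Longrightarrow> i \<in> in_nbrs (C' ! j) \<Longrightarrow>
        is_and (C' ! i) \<noteq> is_and (C' ! j)"
    using conjunct2[OF a4] by blast
qed

text \<open>In-neighbours of a new gate lie among the first \<open>nl\<close> vertices or in its own
  extension. The two extensions therefore never refer to each other, and every condition reduces to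
  one of the two assumptions.\<close>

lemma ext_trans:
  assumes 1: "ext_trees nl pol C C1 is1" and 2: "ext_trees nl pol C1 C2 is2" and nl: "nl \<le> length C"
  shows "ext_trees nl pol C C2 (is1 @ is2)"
proof -
  obtain g1 where g1: "C1 = C @ g1" "\<forall>v\<in>set g1. \<not> is_literal v \<and> \<not> is_not v \<and> in_nbrs v \<noteq> {}"
    using extD(1)[OF 1] by blast
  obtain g2 where g2: "C2 = C1 @ g2" "\<forall>v\<in>set g2. \<not> is_literal v \<and> \<not> is_not v \<and> in_nbrs v \<noteq> {}"
    using extD(1)[OF 2] by blast
  have old: "C2 ! j = C1 ! j" if "j < length C1" for j using that g2(1) by (simp add: nth_append)
  have len: "length C \<le> length C1" "length C1 \<le> length C2" using g1 g2 by auto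
  have n1: "in_nbrs (C2 ! j) \<subseteq> {..<nl} \<union> {length C..<j}" if "length C \<le> j" "j < length C1" for j
    using extD(2)[OF 1 that] that old by simp
  have n2: "in_nbrs (C2 ! j) \<subseteq> {..<nl} \<union> {length C1..<j}" if "length C1 \<le> j" "j < length C2" for j
    using extD(2)[OF 2 that] .
  have a1: "in_nbrs (C2 ! j) \<subseteq> {..<nl} \<union> {length C..<j}" if "length C \<le> j" "j < length C2" for j
    using n1[of j] n2[of j] that len by (cases "j < length C1") auto
  have a2: "j = j'" if "length C \<le> j" "j < length C2" "length C \<le> j'" "j' < length C2" "length C \<le> i"
    "i \<in> in_nbrs (C2 ! j)" "i \<in> in_nbrs (C2 ! j')" for i j j'
  proof (cases "i < length C1")
    case True
    have j: "l < length C1" if "l < length C2" "i \<in> in_nbrs (C2 ! l)" for l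
      using n2[of l] that True \<open>length C \<le> i\<close> nl by (cases "l < length C1") auto
    from j[of j] j[of j'] extD(3)[OF 1, of j j' i] that old show ?thesis by simp
  next
    case False
    have j: "length C1 \<le> l" if "length C \<le> l" "i \<in> in_nbrs (C2 ! l)" for l
      using n1[of l] that False nl len by (cases "l < length C1") auto
    from j[of j] j[of j'] extD(3)[OF 2, of j j' i] that False show ?thesis by simp
  qed
  have a3: "i < nl \<or> length C \<le> i \<and> i < length C2 \<and> is_and (C2 ! i) = pol \<and>
        (\<forall>j. length C \<le> j \<longrightarrow> j < length C2 \<longrightarrow> i \<notin> in_nbrs (C2 ! j))" if "i \<in> set (is1 @ is2)" for i
  proof (cases "i < nl")
    case False
    show ?thesis
    proof (cases "i \<in> set is1")
      case True
      then have i: "length C \<le> i" "i < length C1" "is_and (C1 ! i) = pol"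
        "\<And>j. length C \<le> j \<Longrightarrow> j < length C1 \<Longrightarrow> i \<notin> in_nbrs (C1 ! j)"
        using extD(4)[OF 1 True] False by auto
      have "i \<notin> in_nbrs (C2 ! j)" if "length C \<le> j" "j < length C2" for j
        using i(4)[of j] old[of j] n2[of j] that i(2) False by (cases "j < length C1") auto
      with i len old show ?thesis by auto
    next
      case i2: False
      then have i: "length C1 \<le> i" "i < length C2" "is_and (C2 ! i) = pol"
        "\<And>j. length C1 \<le> j \<Longrightarrow> j < length C2 \<Longrightarrow> i \<notin> in_nbrs (C2 ! j)"
        using extD(4)[OF 2, of i] False i2 that by auto
      have "i \<notin> in_nbrs (C2 ! j)" if "length C \<le> j" "j < length C2" for j
        using i(4)[of j] n1[of j] that i(1) False by (cases "j < length C1") auto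
      with i len show ?thesis by auto
    qed
  qed simp
  have a4: "is_and (C2 ! i) \<noteq> is_and (C2 ! j)" if "length C \<le> j" "j < length C2" "length C \<le> i" "i \<in> in_nbrs (C2 ! j)" for i j
  proof (cases "j < length C1")
    case True
    with n1[of j] that nl have "i < length C1" by auto
    with True extD(5)[OF 1, of j i] that old show ?thesis by simp
  next
    case False
    with n2[of j] that nl have "length C1 \<le> i" by auto
    with False extD(5)[OF 2, of j i] that show ?thesis by simp
  qed
  have eq: "C2 = C @ (g1 @ g2)" using g1 g2 by simp
  show ?thesis
  proof (rule ext_treesI[OF eq])
    show "\<not> is_literal v \<and> \<not> is_not v \<and> in_nbrs v \<noteq> {}" if "v \<in> set (g1 @ g2)" for v
      using that g1(2) g2(2) by auto
  qed (fact a1 a2 a3 a4)+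
qed

text \<open>The roots that are new gates have no parent so far, so collecting them under one further
  gate keeps parents unique. They have the polarity opposite to that of the new gate, which gives
  the alternation.\<close>

lemma ext_gate:
  assumes 1: "ext_trees nl (\<not> pol) C C' is" and nl: "nl \<le> length C" and "is \<noteq> []"
  shows "ext_trees nl pol C (C' @ [gate pol is]) [length C']"
proof -
  obtain gs where gs: "C' = C @ gs" "\<forall>v\<in>set gs. \<not> is_literal v \<and> \<not> is_not v \<and> in_nbrs v \<noteq> {}"
    using extD(1)[OF 1] by blast
  let ?D = "C' @ [gate pol is]"
  have old: "?D ! j = C' ! j" if "j < length C'" for j using that by (simp add: nth_append)
  have new: "?D ! length C' = gate pol is" by simp
  have len: "length C \<le> length C'" using gs by simp
  have root: "i < nl \<or> length C \<le> i \<and> i < length C' \<and> is_and (C' ! i) = (\<not> pol) \<and>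
        (\<forall>j. length C \<le> j \<longrightarrow> j < length C' \<longrightarrow> i \<notin> in_nbrs (C' ! j))" if "i \<in> set is" for i
    using extD(4)[OF 1 that] .
  have n: "in_nbrs (C' ! j) \<subseteq> {..<nl} \<union> {length C..<j}" if "length C \<le> j" "j < length C'" for j
    using extD(2)[OF 1 that] .
  have u: "j = j'" if "length C \<le> j" "j < length C'" "length C \<le> j'" "j' < length C'" "length C \<le> i"
    "i \<in> in_nbrs (C' ! j)" "i \<in> in_nbrs (C' ! j')" for i j j'
    using extD(3)[OF 1 that] .
  have alt: "is_and (C' ! i) \<noteq> is_and (C' ! j)" if "length C \<le> j" "j < length C'" "length C \<le> i" "i \<in> in_nbrs (C' ! j)" for i j
    using extD(5)[OF 1 that] .
  have nD: "in_nbrs (?D ! j) \<subseteq> {..<nl} \<union> {length C..<j}" if "length C \<le> j" "j < length ?D" for j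
  proof (cases "j = length C'")
    case True
    then have "in_nbrs (?D ! j) = set is" using new by simp
    with root True show ?thesis by force
  next
    case False with n[of j] that old[of j] show ?thesis by simp
  qed
  have a2: "j = j'" if "length C \<le> j" "j < length ?D" "length C \<le> j'" "j' < length ?D" "length C \<le> i"
    "i \<in> in_nbrs (?D ! j)" "i \<in> in_nbrs (?D ! j')" for i j j'
  proof -
    have "\<not> (i \<in> set is \<and> i \<in> in_nbrs (C' ! l) \<and> length C \<le> l \<and> l < length C')" for l
      using root[of i] that(5) nl by auto
    with that u[of j j' i] old[of j] old[of j'] new show ?thesis
      by (cases "j < length C'"; cases "j' < length C'") (auto simp: less_Suc_eq)
  qed
  have a4: "is_and (?D ! i) \<noteq> is_and (?D ! j)" if "length C \<le> j" "j < length ?D" "length C \<le> i" "i \<in> in_nbrs (?D ! j)" for i j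
  proof (cases "j = length C'")
    case True
    with that new root[of i] nl old[of i] show ?thesis by auto
  next
    case False
    with that have j: "j < length C'" by simp
    with nD[of j] that nl have "i < length C'" by auto
    with j that alt[of j i] old show ?thesis by auto
  qed
  have a3: "length C' \<notin> in_nbrs (?D ! j)" if "length C \<le> j" "j < length ?D" for j
    using nD[OF that] that nl len by auto
  have eq: "?D = C @ (gs @ [gate pol is])" using gs by simp
  show ?thesis
  proof (rule ext_treesI[OF eq])
    show "\<not> is_literal v \<and> \<not> is_not v \<and> in_nbrs v \<noteq> {}" if "v \<in> set (gs @ [gate pol is])" for v
      using that gs(2) assms(3) by auto
    show "i < nl \<or> length C \<le> i \<and> i < length ?D \<and> is_and (?D ! i) = pol \<and>
        (\<forall>j. length C \<le> j \<longrightarrow> j < length ?D \<longrightarrow> i \<notin> in_nbrs (?D ! j))" if "i \<in> set [length C']" for i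
    proof -
      have i: "i = length C'" using that by simp
      have "\<forall>j. length C \<le> j \<longrightarrow> j < length ?D \<longrightarrow> i \<notin> in_nbrs (?D ! j)" using a3 unfolding i by blast
      moreover have "is_and (?D ! i) = pol" unfolding i new by simp
      ultimately show ?thesis using len i by simp
    qed
  qed (fact nD a2 a4)+
qed

lemma ext_sers:
  assumes "\<And>t C. t \<in> set ts \<Longrightarrow> nl \<le> length C \<Longrightarrow> ext_trees nl pol C (fst (ser n pol t C)) [snd (ser n pol t C)]"
    and "ext_trees nl pol C0 (fst r) (snd r)" "nl \<le> length C0"
  shows "ext_trees nl pol C0 (fst (sers n pol ts r)) (snd (sers n pol ts r)) \<and>
     length (snd (sers n pol ts r)) = length (snd r) + length ts"
  using assms(1,2)
proof (induction ts arbitrary: r)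
  case (Cons t ts)
  let ?r = "(fst (ser n pol t (fst r)), snd r @ [snd (ser n pol t (fst r))])"
  obtain gs where "fst r = C0 @ gs" using extD(1)[OF Cons.prems(2)] by blast
  then have "nl \<le> length (fst r)" using assms(3) by simp
  then have "ext_trees nl pol (fst r) (fst (ser n pol t (fst r))) [snd (ser n pol t (fst r))]"
    by (intro Cons.prems(1)) simp_all
  from ext_trans[OF Cons.prems(2) this assms(3)] have "ext_trees nl pol C0 (fst ?r) (snd ?r)" by simp
  from Cons.IH[OF Cons.prems(1) this] show ?case by (simp add: sers_simps)
qed (simp add: sers_simps)

lemma ext_ser: "tok nl n t \<Longrightarrow> nl \<le> length C \<Longrightarrow> ext_trees nl pol C (fst (ser n pol t C)) [snd (ser n pol t C)]"
proof (induction n arbitrary: t pol C)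
  case 0
  then show ?case by (cases t) (simp_all add: ext_leaf)
next
  case (Suc n)
  show ?case
  proof (cases t)
    case (NLf a) then show ?thesis using Suc.prems by (simp add: ser_Suc ext_leaf)
  next
    case (Nd us)
    have "ext_trees nl (\<not> pol) C (fst (sers n (\<not> pol) us (C, []))) (snd (sers n (\<not> pol) us (C, []))) \<and>
      length (snd (sers n (\<not> pol) us (C, []))) = length (snd (C, [] :: nat list)) + length us"
      by (rule ext_sers[OF Suc.IH]) (use Suc.prems Nd in \<open>auto simp: ext_refl\<close>)
    moreover from this have "snd (sers n (\<not> pol) us (C, [])) \<noteq> []" using Suc.prems Nd by auto
    ultimately have "ext_trees nl pol C (fst (sers n (\<not> pol) us (C, [])) @ [gate pol (snd (sers n (\<not> pol) us (C, [])))])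
       [length (fst (sers n (\<not> pol) us (C, [])))]"
      using Suc.prems(2) by (intro ext_gate) auto
    then show ?thesis using Nd by (simp add: ser_Suc)
  qed
qed

lemma ext_trees_bounds:
  assumes "ext_trees nl pol C C' js" "nl \<le> length C"
  shows "\<exists>gs. C' = C @ gs" "length C \<le> length C'" "i \<in> set js \<Longrightarrow> i < length C'"
proof -
  show *: "\<exists>gs. C' = C @ gs" using extD(1)[OF assms(1)] by blast
  then show len: "length C \<le> length C'" by auto
  show "i \<in> set js \<Longrightarrow> i < length C'" using extD(4)[OF assms(1), of i] assms(2) len by auto
qed

lemma ev_cong:
  "tok nl n t \<Longrightarrow> (\<And>a. a < nl \<Longrightarrow> I a = J a) \<Longrightarrow> ev I pol t = ev J pol t"
proof (induction nl n t arbitrary: pol rule: tok.induct)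
  case (3 nl n ts)
  have "ev I p t = ev J p t" if "t \<in> set ts" for p t
    by (rule "3.IH"[OF that]) (use "3.prems" that in auto)
  then show ?case by simp
qed simp_all

lemma value_sers:
  assumes "\<And>t C. t \<in> set ts \<Longrightarrow> nl \<le> length C \<Longrightarrow>
      value_at A (fst (ser n pol t C)) (snd (ser n pol t C)) = ev (value_at A C) pol t"
    and "\<And>t. t \<in> set ts \<Longrightarrow> tok nl n t" "nl \<le> length (fst r)" "\<forall>i\<in>set (snd r). i < length (fst r)"
  shows "map (value_at A (fst (sers n pol ts r))) (snd (sers n pol ts r)) =
     map (value_at A (fst r)) (snd r) @ map (ev (value_at A (fst r)) pol) ts"
  using assms
proof (induction ts arbitrary: r)
  case (Cons t ts)
  obtain C js where r: "r = (C, js)" by (cases r)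
  obtain C1 i where 1: "ser n pol t C = (C1, i)" by fastforce
  have ext: "ext_trees nl pol C C1 [i]"
    using ext_ser[of nl n t C pol] Cons.prems(2,3) 1 r by auto
  obtain gs where C1: "C1 = C @ gs" "i < length C1"
    using ext_trees_bounds[OF ext] Cons.prems(3) r by auto
  have I: "map (value_at A (fst (sers n pol ts (C1, js @ [i])))) (snd (sers n pol ts (C1, js @ [i]))) =
     map (value_at A C1) (js @ [i]) @ map (ev (value_at A C1) pol) ts"
  proof -
    have "\<forall>i'\<in>set (snd (C1, js @ [i])). i' < length (fst (C1, js @ [i]))" using Cons.prems(4) C1 r by auto
    moreover have "nl \<le> length (fst (C1, js @ [i]))" using Cons.prems(3) C1 r by simp
    ultimately have "map (value_at A (fst (sers n pol ts (C1, js @ [i])))) (snd (sers n pol ts (C1, js @ [i]))) =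
      map (value_at A (fst (C1, js @ [i]))) (snd (C1, js @ [i])) @ map (ev (value_at A (fst (C1, js @ [i]))) pol) ts"
      by (intro Cons.IH Cons.prems(1,2)) simp_all
    then show ?thesis by simp
  qed
  have "value_at A C1 j = value_at A C j" if "j < length C" for j
    using that by (simp add: C1 at_append)
  then have "map (value_at A C1) js = map (value_at A C) js"
    "map (ev (value_at A C1) pol) ts = map (ev (value_at A C) pol) ts"
    using Cons.prems(2-4) r by (auto intro!: ev_cong[of nl n])
  moreover have "value_at A C1 i = ev (value_at A C) pol t"
    using Cons.prems(1)[of t C] Cons.prems(3) r 1 by simp
  ultimately show ?case using I by (simp add: r sers_simps 1)
qed (simp add: sers_simps)

lemma value_ser:
  "tok nl n t \<Longrightarrow> nl \<le> length C \<Longrightarrow>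
    value_at A (fst (ser n pol t C)) (snd (ser n pol t C)) = ev (value_at A C) pol t"
proof (induction n arbitrary: t pol C)
  case 0
  then show ?case by (cases t) simp_all
next
  case (Suc n)
  show ?case
  proof (cases t)
    case (NLf a) then show ?thesis by (simp add: ser_Suc)
  next
    case (Nd us)
    obtain C' js where r: "sers n (\<not> pol) us (C, []) = (C', js)" by fastforce
    have "map (value_at A C') js = map (ev (value_at A C) (\<not> pol)) us"
      using value_sers[of us nl A n "\<not> pol" "(C, [])", OF Suc.IH] Suc.prems Nd r by auto
    then have "set (map (value_at A C') js) = set (map (ev (value_at A C) (\<not> pol)) us)" by simp
    then have *: "value_at A C' ` set js = ev (value_at A C) (\<not> pol) ` set us" by simp
    have "value_at A (C' @ [gate pol js]) (length C') = vertex_value A (sweep (vertex_value A) C') (gate pol js)"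
      by (simp add: value_at_def sweep_snoc nth_append)
    also have "\<dots> = (if pol then (\<forall>b\<in>value_at A C' ` set js. b) else (\<exists>b\<in>value_at A C' ` set js. b))"
      by (simp add: gate_def value_at_def)
    also have "\<dots> = ev (value_at A C) pol t" unfolding * Nd by simp
    finally show ?thesis using Nd r by (simp add: ser_Suc)
  qed
qed

lemma height_sers:
  assumes "\<And>t C. t \<in> set ts \<Longrightarrow> nl \<le> length C \<Longrightarrow> \<forall>a<nl. sweep f C ! a \<le> c \<Longrightarrow>
      sweep f (fst (ser n pol t C)) ! snd (ser n pol t C) \<le> m"
    and "\<And>t. t \<in> set ts \<Longrightarrow> tok nl n t" "nl \<le> length (fst r)" "\<forall>a<nl. sweep f (fst r) ! a \<le> c"
      "\<forall>i\<in>set (snd r). i < length (fst r) \<and> sweep f (fst r) ! i \<le> m"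
  shows "\<forall>i\<in>set (snd (sers n pol ts r)). sweep f (fst (sers n pol ts r)) ! i \<le> m"
  using assms
proof (induction ts arbitrary: r)
  case (Cons t ts)
  obtain C js where r: "r = (C, js)" by (cases r)
  obtain C1 i where 1: "ser n pol t C = (C1, i)" by fastforce
  have ext: "ext_trees nl pol C C1 [i]"
    using ext_ser[of nl n t C pol] Cons.prems(2,3) 1 r by auto
  obtain gs where C1: "C1 = C @ gs" "i < length C1"
    using ext_trees_bounds[OF ext] Cons.prems(3) r by auto
  have eq: "sweep f C1 ! j = sweep f C ! j" if "j < length C" for j
    using that by (simp add: C1 sweep_append_nth)
  have "sweep f C1 ! i \<le> m" using Cons.prems(1)[of t C] Cons.prems(3,4) r 1 by auto
  then have "\<forall>i'\<in>set (snd (C1, js @ [i])). i' < length (fst (C1, js @ [i])) \<and> sweep f (fst (C1, js @ [i])) ! i' \<le> m"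
    using Cons.prems(5) C1 eq r by auto
  then have "\<forall>i'\<in>set (snd (sers n pol ts (C1, js @ [i]))). sweep f (fst (sers n pol ts (C1, js @ [i]))) ! i' \<le> m"
    using Cons.prems(1-4) C1 eq r by (intro Cons.IH) auto
  then show ?case by (simp add: r sers_simps 1)
qed (simp add: sers_simps)

text \<open>Depth and weft are both computed by a sweep in which a gate exceeds the maximum over its
  in-neighbours by at most 1; the abstract \<open>f\<close> treats them together.\<close>

lemma height_ser:
  fixes f :: "nat list \<Rightarrow> vertex \<Rightarrow> nat"
  assumes f: "\<And>rs pol js m. js \<noteq> [] \<Longrightarrow> \<forall>i\<in>set js. rs ! i \<le> m \<Longrightarrow> f rs (gate pol js) \<le> Suc m"
  shows "tok nl n t \<Longrightarrow> nl \<le> length C \<Longrightarrow> \<forall>a<nl. sweep f C ! a \<le> c \<Longrightarrow>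
    sweep f (fst (ser n pol t C)) ! snd (ser n pol t C) \<le> n + c"
proof (induction n arbitrary: t pol C)
  case 0
  then show ?case by (cases t) simp_all
next
  case (Suc n)
  show ?case
  proof (cases t)
    case (NLf a)
    with Suc.prems have "sweep f C ! a \<le> c" by simp
    then show ?thesis using NLf by (simp add: ser_Suc)
  next
    case (Nd us)
    obtain C' js where r: "sers n (\<not> pol) us (C, []) = (C', js)" by fastforce
    have 1: "\<forall>i\<in>set js. sweep f C' ! i \<le> n + c"
    proof -
      have "\<forall>i\<in>set (snd (sers n (\<not> pol) us (C, []))). sweep f (fst (sers n (\<not> pol) us (C, []))) ! i \<le> n + c"
        by (rule height_sers[of us nl f c, OF Suc.IH]) (use Suc.prems Nd in simp_all)
      then show ?thesis using r by simp
    qed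
    have "length (snd (sers n (\<not> pol) us (C, []))) = length (snd (C, [] :: nat list)) + length us"
      using ext_sers[of us nl "\<not> pol" n C "(C, [])", OF ext_ser] Suc.prems Nd by (simp add: ext_refl)
    then have "js \<noteq> []" using r Suc.prems Nd by auto
    from f[OF this 1] have "sweep f (C' @ [gate pol js]) ! length C' \<le> Suc (n + c)"
      by (simp add: sweep_snoc nth_append)
    then show ?thesis using Nd r by (simp add: ser_Suc)
  qed
qed

text \<open>The number of new gates does not depend on the start circuit. It can thus be computed
  from the empty circuit, before the padded base, whose size depends on it, is built.\<close>

lemma length_sers: "\<exists>m. \<forall>r. length (fst (sers n pol ts r)) = length (fst r) + m"
proof -
  have list: "\<exists>m. \<forall>r. length (fst (sers n pol ts r)) = length (fst r) + m"
    if a: "\<And>t. \<exists>m. \<forall>C. length (fst (ser n pol t C)) = length C + m" for n pol ts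
  proof (induction ts)
    case Nil
    show ?case by (rule exI[of _ 0]) (simp add: sers_simps)
  next
    case (Cons t ts)
    obtain m1 where m1: "\<And>C. length (fst (ser n pol t C)) = length C + m1" using a by blast
    obtain m2 where m2: "\<And>r. length (fst (sers n pol ts r)) = length (fst r) + m2" using Cons by blast
    show ?case by (rule exI[of _ "m1 + m2"]) (simp add: sers_simps m1 m2)
  qed
  have "\<exists>m. \<forall>C. length (fst (ser n pol t C)) = length C + m" for n pol t
  proof (induction n arbitrary: pol t)
    case 0
    show ?case by (rule exI[of _ 0]) simp
  next
    case (Suc n)
    obtain m where m: "\<And>r. length (fst (sers n (\<not> pol) (kids t) r)) = length (fst r) + m"
      using list[OF Suc] by blast
    show ?case
      by (rule exI[of _ "if is_leaf t then 0 else Suc m"]) (simp add: ser_Suc m)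
  qed
  then show ?thesis by (rule list)
qed

lemma sz_snoc: "sz (xs @ [x]) = sz xs + sz x + 1"
  using sz_append[of xs "[x]"] by simp

text \<open>\<open>L\<close> bounds all positions, so an entry of an argument list costs at most
  \<open>2 * L + 2\<close>. The multiple of \<open>1 + length ts\<close> on the left is slack that
  pays for the gate to be put on top of these trees.\<close>

lemma sz_sers:
  assumes "\<And>t C. length C + sz t \<le> L \<Longrightarrow> length (fst (ser n pol t C)) \<le> length C + sz t \<and>
      snd (ser n pol t C) \<le> L \<and> sz (fst (ser n pol t C)) \<le> sz C + sz t * (2 * L + 20)"
    and "length (fst r) + sz ts \<le> L"
  shows "length (fst (sers n pol ts r)) \<le> length (fst r) + sz ts \<and>
    sz (fst (sers n pol ts r)) + (1 + length ts) * (2 * L + 20) \<le> sz (fst r) + sz ts * (2 * L + 20) \<and>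
    sz (snd (sers n pol ts r)) \<le> sz (snd r) + length ts * (2 * L + 2)"
  using assms(2)
proof (induction ts arbitrary: r)
  case (Cons t ts)
  obtain C js where r: "r = (C, js)" by (cases r)
  obtain C1 i where 1: "ser n pol t C = (C1, i)" by fastforce
  have b: "length C1 \<le> length C + sz t" "i \<le> L" "sz C1 \<le> sz C + sz t * (2 * L + 20)"
    using assms(1)[of C t] Cons.prems 1 r by auto
  define R where "R = sers n pol ts (C1, js @ [i])"
  have "length (fst R) \<le> length C1 + sz ts"
    "sz (fst R) + (1 + length ts) * (2 * L + 20) \<le> sz C1 + sz ts * (2 * L + 20)"
    "sz (snd R) \<le> sz (js @ [i]) + length ts * (2 * L + 2)"
    using Cons.IH[of "(C1, js @ [i])"] Cons.prems b(1) r unfolding R_def by auto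
  moreover have "sz (js @ [i]) \<le> sz js + (2 * L + 2)" using b(2) by (simp add: sz_snoc)
  moreover have "sers n pol (t # ts) r = R" by (simp add: r sers_simps 1 R_def)
  moreover have "sz (fst R) + (1 + length (t # ts)) * K \<le> sz C + sz (t # ts) * K"
    if "sz (fst R) + (1 + length ts) * K \<le> sz C1 + sz ts * K" "sz C1 \<le> sz C + sz t * K" for K
    using that by (simp add: add_mult_distrib)
  moreover have "sz (snd R) \<le> sz js + length (t # ts) * M"
    if "sz (snd R) \<le> sz (js @ [i]) + length ts * M" "sz (js @ [i]) \<le> sz js + M" for M
    using that by simp
  ultimately show ?case using b(1,3) by (simp only: r fst_conv snd_conv) simp
qed (simp add: sers_simps)

lemma sz_ser:
  "length C + sz t \<le> L \<Longrightarrow> length (fst (ser n pol t C)) \<le> length C + sz t \<and>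
      snd (ser n pol t C) \<le> L \<and> sz (fst (ser n pol t C)) \<le> sz C + sz t * (2 * L + 20)"
proof (induction n arbitrary: pol t C)
  case 0
  then show ?case by (cases t) (auto simp: leafv_def)
next
  case (Suc n)
  show ?case
  proof (cases t)
    case (NLf a) with Suc.prems show ?thesis by (simp add: ser_Suc)
  next
    case (Nd us)
    define R where "R = sers n (\<not> pol) us (C, [])"
    have R: "length (fst R) \<le> length C + sz us"
      "sz (fst R) + (1 + length us) * (2 * L + 20) \<le> sz C + sz us * (2 * L + 20)"
      "sz (snd R) \<le> 1 + length us * (2 * L + 2)"
      using sz_sers[of L n "\<not> pol" "(C, [])" us, OF Suc.IH] Suc.prems Nd unfolding R_def by auto
    have "sz (gate pol (snd R)) \<le> 10 + sz (snd R)" by (simp add: gate_def enc_vertex_simps)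
    then have "sz (fst R @ [gate pol (snd R)]) \<le> sz (fst R) + 12 + length us * (2 * L + 2)"
      using R(3) by (simp add: sz_snoc)
    also have "\<dots> \<le> sz (fst R) + (1 + length us) * (2 * L + 20)"
    proof -
      have "length us * (2 * L + 2) \<le> length us * (2 * L + 20)" by (rule mult_le_mono2) simp
      then show ?thesis by simp
    qed
    also have "\<dots> \<le> sz C + sz us * (2 * L + 20)" by (rule R(2))
    also have "\<dots> \<le> sz C + sz t * (2 * L + 20)" using Nd by simp
    finally show ?thesis using R(1) Nd Suc.prems by (simp add: ser_Suc R_def)
  qed
qed

lemma ptime_gate [ptime_intros]: "ptime pol \<Longrightarrow> ptime f \<Longrightarrow> ptime (\<lambda>x. gate (pol x) (f x))"
  unfolding gate_def by (intro ptime_intros)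

text \<open>Positions grow with the circuit built so far, so the growth per step depends on the
  accumulator and the general rule for folds is needed, with the bound from
  \<open>sz_sers\<close>.\<close>

lemma ptime_sers_step:
  assumes "ptime (\<lambda>p. ser n (fst p) (fst (snd p)) (snd (snd p)))" "ptime pol" "ptime ts" "ptime i"
  shows "ptime (\<lambda>x. sers n (pol x) (ts x) (i x))"
  unfolding sers_def
proof (rule ptime_fold)
  have "ptime (\<lambda>p :: 'a \<times> nat ntree \<times> circuit \<times> nat list. ser n (pol (fst p)) (fst (snd p)) (fst (snd (snd p))))"
    using ptime_comp[OF assms(1), of "\<lambda>p :: 'a \<times> nat ntree \<times> circuit \<times> nat list. (pol (fst p), fst (snd p), fst (snd (snd p)))"]
    by (simp add: ptime_intros ptime_comp[OF assms(2)])
  then show "ptime (\<lambda>p. (fst (ser n (pol (fst p)) (fst (snd p)) (fst (snd (snd p)))),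
      snd (snd (snd p)) @ [snd (ser n (pol (fst p)) (fst (snd p)) (fst (snd (snd p))))]))"
    by (intro ptime_intros)
next
  have "(case z of (x, ys, a) \<Rightarrow> sz (sers n (pol x) ys a)) \<le>
     (\<lambda>N. 1 + 2 * N + N * (4 * N + 20) + N * (4 * N + 2)) (case z of (x, ys, a) \<Rightarrow> sz x + sz ys + sz a)"
    for z :: "'a \<times> nat ntree list \<times> circuit \<times> nat list"
  proof -
    obtain x ys C js where z: "z = (x, ys, C, js)" by (cases z) auto
    define N where "N = sz x + sz ys + sz (C, js)"
    define R where "R = sers n (pol x) ys (C, js)"
    have N: "sz C \<le> N" "sz js \<le> N" "sz ys \<le> N" "length ys \<le> N" "length C + sz ys \<le> 2 * N"
      using length_le_sz[of ys] length_le_sz[of C] by (auto simp: N_def)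
    have R: "sz (fst R) + (1 + length ys) * (2 * (2 * N) + 20) \<le> sz C + sz ys * (2 * (2 * N) + 20)"
      "sz (snd R) \<le> sz js + length ys * (2 * (2 * N) + 2)"
      using sz_sers[of "2 * N" n "pol x" "(C, js)" ys, OF sz_ser] N unfolding R_def by auto
    have "sz ys * (2 * (2 * N) + 20) \<le> N * (4 * N + 20)" "length ys * (2 * (2 * N) + 2) \<le> N * (4 * N + 2)"
      using N by (intro mult_le_mono; simp)+
    moreover have "sz R = 1 + sz (fst R) + sz (snd R)" by (cases R) simp
    ultimately have "sz R \<le> 1 + 2 * N + N * (4 * N + 20) + N * (4 * N + 2)" using R N by linarith
    then show ?thesis by (simp add: z N_def R_def)
  qed
  then show "polyb (\<lambda>(x, ys, a). sz x + sz ys + sz a)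
     (\<lambda>(x, ys, a). sz (fold (\<lambda>t r. (fst (ser n (pol x) t (fst r)), snd r @ [snd (ser n (pol x) t (fst r))])) ys a))"
    unfolding sers_def by (rule polyb_mono[rotated]) (intro polyb_intros)
qed (rule assms)+

lemma ptime_ser_prim: "ptime (\<lambda>p. ser n (fst p) (fst (snd p)) (snd (snd p)))"
proof (induction n)
  case 0
  show ?case unfolding ser.simps(1) by (intro ptime_intros)
next
  case (Suc n)
  show ?case unfolding ser_Suc by (intro ptime_intros ptime_sers_step Suc)
qed

lemma ptime_sers [ptime_intros]:
  "ptime pol \<Longrightarrow> ptime ts \<Longrightarrow> ptime i \<Longrightarrow> ptime (\<lambda>x. sers n (pol x) (ts x) (i x))"
  by (rule ptime_sers_step[OF ptime_ser_prim])

section \<open>Circuits made of a base, trees over it and one output conjunction\<close>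

definition assemble :: "nat \<Rightarrow> circuit \<Rightarrow> nat ntree list \<Rightarrow> nat list \<Rightarrow> circuit" where
  "assemble n B ts xs = fst (sers n False ts (B, [])) @ [AndGate (snd (sers n False ts (B, [])) @ xs)]"

lemma ptime_assemble [ptime_intros]:
  "ptime B \<Longrightarrow> ptime ts \<Longrightarrow> ptime xs \<Longrightarrow> ptime (\<lambda>x. assemble n (B x) (ts x) (xs x))"
  unfolding assemble_def by (intro ptime_intros)

locale assembly =
  fixes lb n :: nat and B :: circuit and ts :: "nat ntree list" and xs :: "nat list"
  assumes B: "is_circuit B" and lb: "lb \<le> length B" and ts: "\<And>t. t \<in> set ts \<Longrightarrow> tok lb n t"
    and xs: "set xs \<subseteq> {..<length B}" "xs \<noteq> []"
begin

definition C' where "C' = fst (sers n False ts (B, []))"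
definition js where "js = snd (sers n False ts (B, []))"

lemma assemble_eq: "assemble n B ts xs = C' @ [AndGate (js @ xs)]"
  by (simp add: assemble_def C'_def js_def)

lemma ext: "ext_trees lb False B C' js"
  using ext_sers[of ts lb False n B "(B, [])", OF ext_ser] ts lb by (simp add: ext_refl C'_def js_def)

lemma C'_ext: "\<exists>gs. C' = B @ gs \<and> (\<forall>v\<in>set gs. \<not> is_literal v \<and> \<not> is_not v \<and> in_nbrs v \<noteq> {})"
  by (rule extD(1)[OF ext])

lemma length_C': "length B \<le> length C'" using C'_ext by auto

lemma js_less: "i \<in> set js \<Longrightarrow> i < length C'"
  using ext_trees_bounds(3)[OF ext lb] .

lemma xs_less: "i \<in> set xs \<Longrightarrow> i < length B" using xs(1) by auto

lemma C'_nth: "j < length B \<Longrightarrow> C' ! j = B ! j"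
  using C'_ext by (auto simp: nth_append)

lemma in_nbrs_C': "j < length C' \<Longrightarrow> in_nbrs (C' ! j) \<subseteq> {..<j}"
proof (cases "j < length B")
  case True
  then show ?thesis using B C'_nth by (simp add: is_circuit_def)
next
  case False
  then show "j < length C' \<Longrightarrow> ?thesis" using extD(2)[OF ext, of j] lb by auto
qed

lemma is_circuit_assemble: "is_circuit (assemble n B ts xs)"
proof -
  obtain gs where gs: "C' = B @ gs" "\<forall>v\<in>set gs. \<not> is_literal v \<and> \<not> is_not v \<and> in_nbrs v \<noteq> {}"
    using C'_ext by blast
  have "filter is_literal gs = []" using gs(2) by (simp add: filter_empty_conv)
  then have lits: "filter is_literal (assemble n B ts xs) = filter is_literal B"
    by (simp add: assemble_eq gs(1))
  have "in_nbrs ((C' @ [AndGate (js @ xs)]) ! j) \<subseteq> {..<j}" if "j < length (C' @ [AndGate (js @ xs)])" for j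
    using that in_nbrs_C'[of j] js_less xs_less length_C' by (fastforce simp: nth_append less_Suc_eq)
  moreover have "in_nbrs v \<noteq> {}" if "v \<in> set (C' @ [AndGate (js @ xs)])" "\<not> is_literal v" for v
    using that gs B xs(2) by (auto simp: is_circuit_def)
  ultimately show ?thesis
    unfolding is_circuit_def lits using B unfolding assemble_eq by (simp add: is_circuit_def)
qed

lemma vars_assemble: "vars (assemble n B ts xs) = vars B"
proof -
  obtain gs where gs: "C' = B @ gs" "\<forall>v\<in>set gs. \<not> is_literal v" using C'_ext by blast
  have "Literal b x \<notin> set gs" for b x using gs(2) by (metis is_literal.simps(1))
  then show ?thesis by (auto simp: vars_def assemble_eq gs(1))
qed

lemma satisfies_assemble:
  "satisfies A (assemble n B ts xs) \<longleftrightarrow>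
    (\<forall>t\<in>set ts. ev (value_at A B) False t) \<and> (\<forall>i\<in>set xs. value_at A B i)"
proof -
  have "map (value_at A C') js = map (ev (value_at A B) False) ts"
    using value_sers[of ts lb A n False "(B, [])", OF value_ser[where nl = lb]] ts lb by (simp add: C'_def js_def)
  then have "set (map (value_at A C') js) = set (map (ev (value_at A B) False) ts)" by simp
  then have *: "value_at A C' ` set js = ev (value_at A B) False ` set ts" by simp
  have xsv: "value_at A C' i = value_at A B i" if "i \<in> set xs" for i
  proof -
    obtain gs where "C' = B @ gs" using C'_ext by blast
    then show ?thesis using that xs(1) by (auto simp: at_append)
  qed
  have "satisfies A (assemble n B ts xs) = (\<forall>i\<in>set (js @ xs). value_at A C' i)"
    by (simp add: satisfies_conv assemble_eq value_at_def sweep_snoc nth_append)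
  also have "\<dots> = ((\<forall>b\<in>value_at A C' ` set js. b) \<and> (\<forall>i\<in>set xs. value_at A B i))"
    using xsv by auto
  finally show ?thesis unfolding * by simp
qed

lemma height_assemble:
  fixes f :: "nat list \<Rightarrow> vertex \<Rightarrow> nat"
  assumes f: "\<And>rs pol js m. js \<noteq> [] \<Longrightarrow> \<forall>i\<in>set js. rs ! i \<le> m \<Longrightarrow> f rs (gate pol js) \<le> Suc m"
    and c: "\<And>a. a < lb \<Longrightarrow> sweep f B ! a \<le> c" and m: "n + c \<le> m" "\<And>i. i \<in> set xs \<Longrightarrow> sweep f B ! i \<le> m"
  shows "sweep f (assemble n B ts xs) ! (length (assemble n B ts xs) - 1) \<le> Suc m"
proof -
  have "\<forall>i\<in>set js. sweep f C' ! i \<le> n + c"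
    unfolding C'_def js_def
    by (rule height_sers[of ts lb f c n False "n + c" "(B, [])", OF height_ser[where f = f and nl = lb]])
      (use ts lb c f in auto)
  moreover have "sweep f C' ! i = sweep f B ! i" if "i \<in> set xs" for i
  proof -
    obtain gs where "C' = B @ gs" using C'_ext by blast
    then show ?thesis using that xs(1) by (auto simp: sweep_append_nth)
  qed
  ultimately have "\<forall>i\<in>set (js @ xs). sweep f C' ! i \<le> m" using m by fastforce
  from f[OF _ this, of True] xs(2) show ?thesis
    by (simp add: assemble_eq sweep_snoc nth_append gate_def)
qed

lemma depth_assemble:
  assumes "\<And>a. a < lb \<Longrightarrow> depth_at B a \<le> c" "n + c \<le> m" "\<And>i. i \<in> set xs \<Longrightarrow> depth_at B i \<le> m"
  shows "depth (assemble n B ts xs) \<le> Suc m"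
proof -
  have ne: "assemble n B ts xs \<noteq> []" by (simp add: assemble_eq)
  let ?f = "\<lambda>rs v. if is_literal v then 0 else 1 + Max ((!) rs ` in_nbrs v)"
  have *: "?f rs (gate pol js) \<le> Suc m" if "js \<noteq> []" "\<forall>i\<in>set js. rs ! i \<le> m" for rs :: "nat list" and pol js m
  proof -
    have "Max ((!) rs ` set js) \<le> m" using that by (subst Max_le_iff) auto
    then show ?thesis by simp
  qed
  show ?thesis unfolding depth_conv[OF ne] depth_at_def
    by (rule height_assemble[where f = ?f and c = c, OF *]) (use assms in \<open>simp_all add: depth_at_def\<close>)
qed

lemma weft_assemble:
  assumes "\<And>a. a < lb \<Longrightarrow> weft_at B a \<le> c" "n + c \<le> m" "\<And>i. i \<in> set xs \<Longrightarrow> weft_at B i \<le> m"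
  shows "weft (assemble n B ts xs) \<le> Suc m"
proof -
  have ne: "assemble n B ts xs \<noteq> []" by (simp add: assemble_eq)
  let ?f = "\<lambda>rs v. if is_literal v then 0
     else (if card (in_nbrs v) > 2 then 1 else 0) + Max ((!) rs ` in_nbrs v)"
  have *: "?f rs (gate pol js) \<le> Suc m" if "js \<noteq> []" "\<forall>i\<in>set js. rs ! i \<le> m" for rs :: "nat list" and pol js m
  proof -
    have "Max ((!) rs ` set js) \<le> m" using that by (subst Max_le_iff) auto
    then show ?thesis by simp
  qed
  show ?thesis unfolding weft_conv[OF ne] weft_at_def
    by (rule height_assemble[where f = ?f and c = c, OF *]) (use assms in \<open>simp_all add: weft_at_def\<close>)
qed

end

section \<open>Normalisation of circuits of bounded weft\<close>

text \<open>Unary gates push a literal down to the common leaf level of a tree.\<close>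

primrec nest :: "nat \<Rightarrow> 'a \<Rightarrow> 'a ntree" where
  "nest 0 a = NLf a"
| "nest (Suc n) a = Nd [nest n a]"

text \<open>The first entry and the first one different from it, if any. Weft counts in-neighbours
  without multiplicity, so even a long list may belong to a gate with at most two of them.\<close>

definition two :: "nat list \<Rightarrow> nat \<times> nat" where
  "two js = (case js of [] \<Rightarrow> (0, 0) | a # r \<Rightarrow> (a, case filter (\<lambda>i. i \<noteq> a) r of [] \<Rightarrow> a | b # _ \<Rightarrow> b))"

definition small :: "nat list \<Rightarrow> bool" where
  "small js \<longleftrightarrow> (\<forall>i\<in>set js. i = fst (two js) \<or> i = snd (two js))"

text \<open>Distributivity: the disjunction of two conjunctions of disjunctions, or dually, becomes
  one tree of the same depth whose second-level nodes are merged in pairs.\<close>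

definition prodT :: "'a ntree list \<Rightarrow> 'a ntree list \<Rightarrow> 'a ntree list" where
  "prodT ps qs = concat (map (\<lambda>p. map (\<lambda>q. Nd (kids p @ kids q)) qs) ps)"

text \<open>\<open>norm_form d L C s pol v\<close> is a tree of depth \<open>L\<close>, with outermost connective \<open>\<and>\<close> if \<open>pol\<close> and \<open>\<or>\<close>
  otherwise, for the statement that vertex \<open>v\<close> has value \<open>s\<close>. It exists whenever \<open>v\<close> has depth at most
  \<open>d\<close> and weft at most \<open>L - 2\<close>; its lowest level has fan-in at most \<open>2 ^ d\<close>. A literal \<open>(0, x)\<close>,
  \<open>(1, x)\<close> or \<open>(2, i)\<close> means \<open>x \<in> A\<close>, \<open>x \<notin> A\<close> or \<open>u \<noteq> i\<close>, where \<open>u\<close> is an additional choice.\<close>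

primrec norm_form :: "nat \<Rightarrow> nat \<Rightarrow> circuit \<Rightarrow> bool \<Rightarrow> bool \<Rightarrow> nat \<Rightarrow> (nat \<times> nat) ntree" where
  "norm_form 0 = (\<lambda>L C s pol v. nest L (if s then 0 else 1, vnum (nthd (AndGate []) C v)))"
| "norm_form (Suc d) = (\<lambda>L C s pol v. let w = nthd (AndGate []) C v in
     if vtag w \<le> 1 then nest L (if s then 0 else 1, vnum w)
     else if vtag w = 2 then norm_form d L C (\<not> s) pol (vnum w)
     else if ((vtag w = 3) = s) = pol
       then Nd (concat (map (\<lambda>i. kids (norm_form d L C s pol i)) (vargs w)))
     else if small (vargs w)
       then Nd (prodT (kids (norm_form d L C s pol (fst (two (vargs w)))))
                      (kids (norm_form d L C s pol (snd (two (vargs w))))))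
     else Nd [Nd (concat (map (\<lambda>i. kids (norm_form d (L - 1) C s (\<not> pol) i)) (vargs w)))])"

definition lval :: "nat set \<Rightarrow> nat \<Rightarrow> nat \<times> nat \<Rightarrow> bool" where
  "lval A u l = (if fst l = 0 then snd l \<in> A else if fst l = 1 then snd l \<notin> A else u \<noteq> snd l)"

fun full :: "nat \<Rightarrow> nat \<Rightarrow> 'a ntree \<Rightarrow> bool" where
  "full r n (NLf a) = (n = 0)"
| "full r n (Nd ts) = (case n of 0 \<Rightarrow> False
     | Suc m \<Rightarrow> ts \<noteq> [] \<and> (m = 0 \<longrightarrow> length ts \<le> r) \<and> (\<forall>t\<in>set ts. full r m t))"

lemma full_mono: "full r n t \<Longrightarrow> r \<le> r' \<Longrightarrow> full r' n t"
proof (induction r n t rule: full.induct)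
  case (2 r n ts)
  show ?case
  proof (cases n)
    case 0 then show ?thesis using "2.prems"(1) by simp
  next
    case (Suc m)
    have "full r' m t" if "t \<in> set ts" for t
      using "2.IH"[OF Suc that] "2.prems" Suc that by simp
    then show ?thesis using "2.prems" Suc by auto
  qed
qed simp

lemma full_nest: "1 \<le> r \<Longrightarrow> full r n (nest n a)"
  by (induction n) auto

lemma ev_nest: "ev I pol (nest n a) = I a"
  by (induction n arbitrary: pol) auto

lemma set_nest [simp]: "set_ntree (nest n a) = {a}"
  by (induction n) auto

lemma ev_cong_leaves: "(\<And>l. l \<in> set_ntree t \<Longrightarrow> I l = J l) \<Longrightarrow> ev I pol t = ev J pol t"
proof (induction t arbitrary: pol)
  case (Nd ts)
  have "ev I p t = ev J p t" if "t \<in> set ts" for p t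
    by (rule Nd.IH[OF that]) (use Nd.prems that in auto)
  then show ?case by simp
qed simp

lemma ev_concat_kids:
  assumes "\<And>i. i \<in> set js \<Longrightarrow> \<exists>us. t i = Nd us"
  shows "ev I pol (Nd (concat (map (\<lambda>i. kids (t i)) js))) =
    (if pol then \<forall>i\<in>set js. ev I pol (t i) else \<exists>i\<in>set js. ev I pol (t i))"
proof -
  have *: "ev I True (t i) = (\<forall>u\<in>set (kids (t i)). ev I False u)" "ev I False (t i) = (\<exists>u\<in>set (kids (t i)). ev I True u)"
    if "i \<in> set js" for i using assms[OF that] by auto
  have mem: "set (concat (map (\<lambda>i. kids (t i)) js)) = (\<Union>i\<in>set js. set (kids (t i)))" by auto
  show ?thesis unfolding ev.simps mem by (cases pol) (simp_all add: * cong: ball_cong_simp bex_cong_simp)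
qed

lemma concat_kids:
  assumes "js \<noteq> []" "\<And>i. i \<in> set js \<Longrightarrow> \<exists>us. t i = Nd us \<and> us \<noteq> [] \<and> (\<forall>u\<in>set us. P u)"
  shows "concat (map (\<lambda>i. kids (t i)) js) \<noteq> []" "u \<in> set (concat (map (\<lambda>i. kids (t i)) js)) \<Longrightarrow> P u"
proof -
  have "hd js \<in> set js" using assms(1) by simp
  then obtain us where us: "t (hd js) = Nd us" "us \<noteq> []" using assms(2) by blast
  then have "hd us \<in> set (kids (t (hd js)))" by simp
  with \<open>hd js \<in> set js\<close> have "hd us \<in> set (concat (map (\<lambda>i. kids (t i)) js))" by auto
  then show "concat (map (\<lambda>i. kids (t i)) js) \<noteq> []" by (intro notI) simp
  show "u \<in> set (concat (map (\<lambda>i. kids (t i)) js)) \<Longrightarrow> P u" using assms(2) by fastforce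
qed

lemma ev_prodT:
  assumes "\<And>p. p \<in> set ps \<Longrightarrow> \<exists>us. p = Nd us" "\<And>q. q \<in> set qs \<Longrightarrow> \<exists>us. q = Nd us"
  shows "ev I pol (Nd (prodT ps qs)) =
    (if pol then ev I pol (Nd ps) \<or> ev I pol (Nd qs) else ev I pol (Nd ps) \<and> ev I pol (Nd qs))"
proof -
  have 1: "ev I True (Nd (kids p @ kids q)) = (ev I True p \<and> ev I True q)"
      "ev I False (Nd (kids p @ kids q)) = (ev I False p \<or> ev I False q)"
    if pq: "p \<in> set ps" "q \<in> set qs" for p q
  proof -
    obtain us vs where "p = Nd us" "q = Nd vs" using assms pq by blast
    then show "ev I True (Nd (kids p @ kids q)) = (ev I True p \<and> ev I True q)"
      "ev I False (Nd (kids p @ kids q)) = (ev I False p \<or> ev I False q)" by auto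
  qed
  have mem: "set (prodT ps qs) = (\<Union>p\<in>set ps. \<Union>q\<in>set qs. {Nd (kids p @ kids q)})"
    unfolding prodT_def by auto
  have T: "(\<forall>t\<in>set (prodT ps qs). ev I False t) = ((\<forall>p\<in>set ps. ev I False p) \<or> (\<forall>q\<in>set qs. ev I False q))"
    unfolding mem using 1(2) by blast
  have F: "(\<exists>t\<in>set (prodT ps qs). ev I True t) = ((\<exists>p\<in>set ps. ev I True p) \<and> (\<exists>q\<in>set qs. ev I True q))"
    unfolding mem using 1(1) by blast
  show ?thesis using T F by simp
qed

lemma two_props:
  assumes "js \<noteq> []"
  shows "fst (two js) \<in> set js" "snd (two js) \<in> set js" "small js \<Longrightarrow> set js = {fst (two js), snd (two js)}"
    "\<not> small js \<Longrightarrow> card (set js) > 2"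
proof -
  obtain a r where js: "js = a # r" using assms by (cases js) auto
  define b where "b = snd (two js)"
  have a: "fst (two js) = a" by (simp add: two_def js)
  have b: "b = (case filter (\<lambda>i. i \<noteq> a) r of [] \<Rightarrow> a | b # _ \<Rightarrow> b)" by (simp add: two_def js b_def)
  have b2: "b \<in> set js \<and> (b = a \<longrightarrow> set js = {a})"
  proof (cases "filter (\<lambda>i. i \<noteq> a) r")
    case Nil
    then show ?thesis using b js by (auto simp: filter_empty_conv)
  next
    case (Cons y ys)
    then have "y \<in> set (filter (\<lambda>i. i \<noteq> a) r)" by simp
    then have "y \<in> set r \<and> y \<noteq> a" by simp
    moreover have "b = y" using b Cons by simp
    ultimately show ?thesis using js by auto
  qed
  show "fst (two js) \<in> set js" "snd (two js) \<in> set js" using a b2 js b_def by auto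
  show "small js \<Longrightarrow> set js = {fst (two js), snd (two js)}"
    using a b2 js unfolding small_def b_def[symmetric] by auto
  show "card (set js) > 2" if ns: "\<not> small js"
  proof -
    obtain c where c: "c \<in> set js" "c \<noteq> a" "c \<noteq> b" using ns a unfolding small_def b_def[symmetric] by blast
    have "b \<noteq> a" using b2 c by auto
    then have "card {a, b, c} = 3" using c by simp
    moreover have "card {a, b, c} \<le> card (set js)" using c b2 js by (intro card_mono) auto
    ultimately show ?thesis by linarith
  qed
qed

lemma vertex_by_tag:
  "vtag w \<le> 1 \<longleftrightarrow> is_literal w"
  "vtag w = 2 \<Longrightarrow> w = NotGate (vnum w)"
  "vtag w = 3 \<Longrightarrow> w = AndGate (vargs w)"
  "\<not> vtag w \<le> 1 \<Longrightarrow> vtag w \<noteq> 2 \<Longrightarrow> vtag w \<noteq> 3 \<Longrightarrow> w = OrGate (vargs w)"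
proof -
  show "vtag w \<le> 1 \<longleftrightarrow> is_literal w" by (cases w) (auto simp: vtag_def)
  show "vtag w = 2 \<Longrightarrow> w = NotGate (vnum w)" by (cases w) (auto simp: vtag_def vnum_def split: if_splits)
  show "vtag w = 3 \<Longrightarrow> w = AndGate (vargs w)" by (cases w) (auto simp: vtag_def vargs_def split: if_splits)
  show "\<not> vtag w \<le> 1 \<Longrightarrow> vtag w \<noteq> 2 \<Longrightarrow> vtag w \<noteq> 3 \<Longrightarrow> w = OrGate (vargs w)"
    by (cases w) (auto simp: vtag_def vargs_def split: if_splits)
qed

lemma depth_at_nbr:
  assumes "is_circuit C" "v < length C" "i \<in> in_nbrs (C ! v)"
  shows "depth_at C i < depth_at C v"
proof -
  have "\<not> is_literal (C ! v)" using assms(3) by (cases "C ! v") auto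
  moreover have "depth_at C i \<le> Max (depth_at C ` in_nbrs (C ! v))" using assms(3) by (intro Max_ge) auto
  ultimately show ?thesis using depth_at_nth[OF assms(1,2)] by simp
qed

lemma weft_at_nbr:
  assumes "is_circuit C" "v < length C" "i \<in> in_nbrs (C ! v)"
  shows "weft_at C i + (if card (in_nbrs (C ! v)) > 2 then 1 else 0) \<le> weft_at C v"
proof -
  have "\<not> is_literal (C ! v)" using assms(3) by (cases "C ! v") auto
  moreover have "weft_at C i \<le> Max (weft_at C ` in_nbrs (C ! v))" using assms(3) by (intro Max_ge) auto
  ultimately show ?thesis using weft_at_nth[OF assms(1,2)] by simp
qed

definition nf_ok :: "('a \<Rightarrow> bool) \<Rightarrow> 'a set \<Rightarrow> nat \<Rightarrow> nat \<Rightarrow> bool \<Rightarrow> 'a ntree \<Rightarrow> bool \<Rightarrow> bool" where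
  "nf_ok I S r L pol t b \<longleftrightarrow> full r L t \<and> ev I pol t = b \<and> set_ntree t \<subseteq> S"

lemma nf_ok_mono: "nf_ok I S r L pol t b \<Longrightarrow> r \<le> r' \<Longrightarrow> nf_ok I S r' L pol t b"
  unfolding nf_ok_def using full_mono by blast

lemma nf_ok_nest: "1 \<le> r \<Longrightarrow> a \<in> S \<Longrightarrow> nf_ok I S r L pol (nest L a) (I a)"
  unfolding nf_ok_def by (simp add: full_nest ev_nest)

text \<open>A gate is merged with subtrees of the same outermost connective. As
  \<open>n \<noteq> 0\<close>, the level that grows is not the lowest one, whose fan-in has to stay
  bounded.\<close>

lemma nf_ok_concat:
  assumes "js \<noteq> []" "\<And>i. i \<in> set js \<Longrightarrow> nf_ok I S r (Suc n) pol (t i) (b i)" "n \<noteq> 0"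
  shows "nf_ok I S r (Suc n) pol (Nd (concat (map (\<lambda>i. kids (t i)) js)))
    (if pol then \<forall>i\<in>set js. b i else \<exists>i\<in>set js. b i)"
proof -
  have nd: "\<exists>us. t i = Nd us \<and> us \<noteq> [] \<and> (\<forall>u\<in>set us. full r n u \<and> set_ntree u \<subseteq> S)" if "i \<in> set js" for i
    using assms(2)[OF that] unfolding nf_ok_def by (cases "t i") auto
  note c = concat_kids[OF assms(1), of t "\<lambda>u. full r n u \<and> set_ntree u \<subseteq> S", OF nd]
  have "full r (Suc n) (Nd (concat (map (\<lambda>i. kids (t i)) js)))"
    using c assms(3) by (simp only: full.simps nat.case) blast
  moreover have "set_ntree (Nd (concat (map (\<lambda>i. kids (t i)) js))) \<subseteq> S" using c(2) by (auto simp del: set_concat)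
  moreover have "ev I pol (t i) = b i" if "i \<in> set js" for i using assms(2)[OF that] unfolding nf_ok_def by blast
  then have "ev I pol (Nd (concat (map (\<lambda>i. kids (t i)) js))) = (if pol then \<forall>i\<in>set js. b i else \<exists>i\<in>set js. b i)"
    using ev_concat_kids[of js t I pol] nd by metis
  ultimately show ?thesis unfolding nf_ok_def by blast
qed

text \<open>Merging two nodes at most doubles the lowest fan-in. This happens at most once per unit
  of depth, which is the origin of the bound \<open>2 ^ d\<close>.\<close>

lemma nf_ok_prod:
  assumes p: "nf_ok I S r (Suc (Suc n)) pol p b" and q: "nf_ok I S r (Suc (Suc n)) pol q c"
  shows "nf_ok I S (2 * r) (Suc (Suc n)) pol (Nd (prodT (kids p) (kids q))) (if pol then b \<or> c else b \<and> c)"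
proof -
  obtain ps where ps: "p = Nd ps" "ps \<noteq> []" "\<forall>u\<in>set ps. full r (Suc n) u \<and> set_ntree u \<subseteq> S"
    using p unfolding nf_ok_def by (cases p) auto
  obtain qs where qs: "q = Nd qs" "qs \<noteq> []" "\<forall>u\<in>set qs. full r (Suc n) u \<and> set_ntree u \<subseteq> S"
    using q unfolding nf_ok_def by (cases q) auto
  have nds: "\<exists>us. u = Nd us" if "full r (Suc n) u" for u :: "'a ntree"
    using that by (cases u) auto
  have mem: "set (prodT ps qs) = (\<Union>x\<in>set ps. \<Union>y\<in>set qs. {Nd (kids x @ kids y)})"
    unfolding prodT_def by auto
  have el: "full (2 * r) (Suc n) (Nd (kids x @ kids y)) \<and> set_ntree (Nd (kids x @ kids y)) \<subseteq> S"
    if xy: "x \<in> set ps" "y \<in> set qs" for x y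
  proof -
    have xy': "full r (Suc n) x" "full r (Suc n) y" "set_ntree x \<subseteq> S" "set_ntree y \<subseteq> S" using ps(3) qs(3) xy by auto
    then obtain us vs where us: "x = Nd us" "us \<noteq> []" "n = 0 \<longrightarrow> length us \<le> r" "\<forall>t\<in>set us. full r n t"
      and vs: "y = Nd vs" "n = 0 \<longrightarrow> length vs \<le> r" "\<forall>t\<in>set vs. full r n t"
      by (cases x; cases y) auto
    have "full (2 * r) n t" if "t \<in> set (us @ vs)" for t
      by (rule full_mono[of r]) (use that us(4) vs(3) in auto)
    moreover have "n = 0 \<longrightarrow> length (us @ vs) \<le> 2 * r" using us(3) vs(2) by auto
    ultimately have "full (2 * r) (Suc n) (Nd (kids x @ kids y))" using us(1,2) vs(1) by simp
    moreover have "set_ntree (Nd (kids x @ kids y)) \<subseteq> S" using xy'(3,4) us(1) vs(1) by simp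
    ultimately show ?thesis ..
  qed
  have "prodT ps qs \<noteq> []" using ps(2) qs(2) by (cases ps; cases qs) (auto simp: prodT_def)
  moreover have "\<forall>u\<in>set (prodT ps qs). full (2 * r) (Suc n) u \<and> set_ntree u \<subseteq> S" unfolding mem using el by blast
  ultimately have "full (2 * r) (Suc (Suc n)) (Nd (prodT ps qs))" "set_ntree (Nd (prodT ps qs)) \<subseteq> S" by auto
  moreover have "ev I pol (Nd (prodT ps qs)) = (if pol then b \<or> c else b \<and> c)"
  proof -
    have "ev I pol (Nd ps) = b" "ev I pol (Nd qs) = c" using p q ps(1) qs(1) unfolding nf_ok_def by blast+
    then show ?thesis using ev_prodT[of ps qs I pol] nds ps(3) qs(3) by metis
  qed
  ultimately show ?thesis unfolding nf_ok_def ps(1) qs(1) by simp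
qed

lemma nf_ok_wrap:
  assumes "nf_ok I S r (Suc n) (\<not> pol) t b" shows "nf_ok I S r (Suc (Suc n)) pol (Nd [t]) b"
  using assms unfolding nf_ok_def by (cases pol) auto

text \<open>Negations are absorbed into the wanted value \<open>s\<close>. A gate whose connective,
  read with respect to \<open>s\<close>, is that of the root is merged with its subtrees. One with
  the other connective is distributed if it has at most two in-neighbours; otherwise it costs one
  level, which the weft pays for. The two extra levels leave room for distribution even at weft
  0.\<close>

lemma norm_form_correct:
  assumes C: "is_circuit C" and pos: "\<And>b x. Literal b x \<in> set C \<Longrightarrow> b"
  shows "v < length C \<Longrightarrow> depth_at C v \<le> d \<Longrightarrow> weft_at C v + 2 \<le> L \<Longrightarrow>
    nf_ok (lval A u) {l. fst l < 2 \<and> snd l \<in> vars C} (2 ^ d) L pol (norm_form d L C s pol v) (value_at A C v = s)"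
proof (induction d arbitrary: L s pol v)
  case 0
  have lit: "is_literal (C ! v)" using depth_at_nth[OF C 0(1)] 0(2) by (cases "is_literal (C ! v)") auto
  then obtain b x where w: "C ! v = Literal b x" by (cases "C ! v") auto
  then have b: "b" "x \<in> vars C" using pos[of b x] nth_mem[OF 0(1)] by (auto simp: vars_def)
  have "lval A u (if s then 0 else 1, x) = (value_at A C v = s)"
    using w b value_at_nth[OF C 0(1), of A] by (simp add: lval_def)
  moreover have "norm_form 0 L C s pol v = nest L (if s then 0 else 1, x)" using 0(1) w by (simp add: vnum_def)
  ultimately show ?case using nf_ok_nest[of "2 ^ 0" "(if s then 0 else 1, x)" _ "lval A u" L pol] b(2) by simp
next
  case (Suc d)
  let ?S = "{l. fst l < (2 :: nat) \<and> snd l \<in> vars C}"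
  let ?w = "C ! v"
  note v = Suc.prems(1)
  have nthd: "nthd (AndGate []) C v = ?w" using v by simp
  define n where "n = L - 2"
  have L: "L = Suc (Suc n)" using Suc.prems(3) unfolding n_def by simp
  have p2: "(1::nat) \<le> 2 ^ Suc d" "(2::nat) ^ d \<le> 2 ^ Suc d" by simp_all
  have nbr: "i < length C \<and> depth_at C i \<le> d \<and>
      weft_at C i + (if card (in_nbrs ?w) > 2 then 1 else 0) + 2 \<le> L" if "i \<in> in_nbrs ?w" for i
  proof -
    have "i < v" using C v that by (auto simp: is_circuit_def)
    then show ?thesis using v depth_at_nbr[OF C v that] weft_at_nbr[OF C v that] Suc.prems(2,3) by simp
  qed
  consider (lit) "is_literal ?w" | (neg) "vtag ?w = 2" "?w = NotGate (vnum ?w)"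
    | (gate) "\<not> vtag ?w \<le> 1" "vtag ?w \<noteq> 2" "?w = gate (vtag ?w = 3) (vargs ?w)"
    using vertex_by_tag[of ?w] unfolding gate_def by (cases "vtag ?w = 3") auto
  then show ?case
  proof cases
    case lit
    then obtain b x where w: "?w = Literal b x" by (cases ?w) auto
    then have b: "b" "x \<in> vars C" using pos[of b x] nth_mem[OF v] by (auto simp: vars_def)
    have eq: "norm_form (Suc d) L C s pol v = nest L (if s then 0 else 1, x)"
      using nthd w by (simp add: vtag_def vnum_def)
    have "lval A u (if s then 0 else 1, x) = (value_at A C v = s)"
      using w b value_at_nth[OF C v, of A] by (simp add: lval_def)
    then show ?thesis unfolding eq
      using nf_ok_nest[OF p2(1), of "(if s then 0 else 1, x)" ?S "lval A u" L pol] b(2) by simp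
  next
    case neg
    have i: "vnum ?w \<in> in_nbrs ?w" by (subst (2) neg(2)) simp
    have eq: "norm_form (Suc d) L C s pol v = norm_form d L C (\<not> s) pol (vnum ?w)"
      using nthd neg by simp
    have "value_at A C v = (\<not> value_at A C (vnum ?w))"
      using value_at_nth[OF C v, of A] by (subst (asm) neg(2)) (simp add: value_at_def)
    moreover have "nf_ok (lval A u) ?S (2 ^ d) L pol (norm_form d L C (\<not> s) pol (vnum ?w)) (value_at A C (vnum ?w) = (\<not> s))"
      using nbr[OF i] by (intro Suc.IH) simp_all
    ultimately have "nf_ok (lval A u) ?S (2 ^ d) L pol (norm_form d L C (\<not> s) pol (vnum ?w)) (value_at A C v = s)"
      unfolding nf_ok_def by auto
    then show ?thesis unfolding eq by (rule nf_ok_mono[OF _ p2(2)])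
  next
    case gate
    let ?js = "vargs ?w"
    define conj where "conj = ((vtag ?w = 3) = s)"
    have set_js: "in_nbrs ?w = set ?js" by (subst gate(3)) simp
    have ne: "?js \<noteq> []"
    proof -
      have "\<not> is_literal ?w" using gate(1) vertex_by_tag(1) by blast
      then have "in_nbrs ?w \<noteq> {}" using C v by (auto simp: is_circuit_def)
      then show ?thesis using set_js by auto
    qed
    have "value_at A C v = (if vtag ?w = 3 then \<forall>i\<in>set ?js. value_at A C i else \<exists>i\<in>set ?js. value_at A C i)"
      using value_at_nth[OF C v, of A] by (subst (asm) gate(3)) (simp add: gate_def value_at_def)
    then have val: "(value_at A C v = s) =
       (if conj then \<forall>i\<in>set ?js. value_at A C i = s else \<exists>i\<in>set ?js. value_at A C i = s)"
      unfolding conj_def by (cases s) auto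
    have IH: "nf_ok (lval A u) ?S (2 ^ d) L pol (norm_form d L C s pol i) (value_at A C i = s)" if i: "i \<in> set ?js" for i
      using nbr[of i] i set_js by (intro Suc.IH) simp_all
    have unf: "norm_form (Suc d) L C s pol v =
      (if conj = pol then Nd (concat (map (\<lambda>i. kids (norm_form d L C s pol i)) ?js))
       else if small ?js then Nd (prodT (kids (norm_form d L C s pol (fst (two ?js)))) (kids (norm_form d L C s pol (snd (two ?js)))))
       else Nd [Nd (concat (map (\<lambda>i. kids (norm_form d (L - 1) C s (\<not> pol) i)) ?js))])"
      unfolding norm_form.simps(2) Let_def nthd conj_def using gate(1,2) by (simp only: if_False simp_thms)
    consider (same) "conj = pol" | (sm) "conj \<noteq> pol" "small ?js" | (big) "conj \<noteq> pol" "\<not> small ?js" by blast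
    then show ?thesis
    proof cases
      case same
      have eq: "norm_form (Suc d) L C s pol v = Nd (concat (map (\<lambda>i. kids (norm_form d L C s pol i)) ?js))"
        unfolding unf using same by (simp only: if_True simp_thms)
      have "nf_ok (lval A u) ?S (2 ^ d) L pol (Nd (concat (map (\<lambda>i. kids (norm_form d L C s pol i)) ?js)))
         (if pol then \<forall>i\<in>set ?js. value_at A C i = s else \<exists>i\<in>set ?js. value_at A C i = s)"
        unfolding L by (rule nf_ok_concat[OF ne]) (use IH L in auto)
      then show ?thesis unfolding eq val same by (rule nf_ok_mono) (rule p2)
    next
      case sm
      note tw = two_props[OF ne]
      have eq: "norm_form (Suc d) L C s pol v =
        Nd (prodT (kids (norm_form d L C s pol (fst (two ?js)))) (kids (norm_form d L C s pol (snd (two ?js)))))"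
        unfolding unf using sm by (simp only: if_True if_False simp_thms)
      have val': "(value_at A C v = s) = (if pol then (value_at A C (fst (two ?js)) = s) \<or> (value_at A C (snd (two ?js)) = s)
        else (value_at A C (fst (two ?js)) = s) \<and> (value_at A C (snd (two ?js)) = s))"
        unfolding val tw(3)[OF sm(2)] using sm(1) by auto
      show ?thesis unfolding eq val'
        using nf_ok_prod[OF IH[OF tw(1), unfolded L] IH[OF tw(2), unfolded L]] by (simp only: L power_Suc)
    next
      case big
      have crd: "card (in_nbrs ?w) > 2" using two_props(4)[OF ne big(2)] set_js by simp
      have J: "nf_ok (lval A u) ?S (2 ^ d) (Suc n) (\<not> pol) (norm_form d (Suc n) C s (\<not> pol) i) (value_at A C i = s)"
        if i: "i \<in> set ?js" for i
      proof -
        have "i \<in> in_nbrs ?w" using i set_js by simp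
        then have "i < length C" "depth_at C i \<le> d" "weft_at C i + 2 \<le> Suc n" using nbr[of i] crd L by simp_all
        then show ?thesis by (rule Suc.IH)
      qed
      \<comment> \<open>The gate is large, so its weft is at least 1 and \<open>L\<close> exceeds 2:
        the level merged below it is not the lowest.\<close>
      have n1: "n \<noteq> 0"
      proof -
        have "hd ?js \<in> in_nbrs ?w" using ne set_js by simp
        then have "weft_at C (hd ?js) + 1 + 2 \<le> L" using nbr[of "hd ?js"] crd by simp
        then show ?thesis using L by simp
      qed
      have eq: "norm_form (Suc d) L C s pol v = Nd [Nd (concat (map (\<lambda>i. kids (norm_form d (Suc n) C s (\<not> pol) i)) ?js))]"
        unfolding unf using big by (simp add: L)
      have "nf_ok (lval A u) ?S (2 ^ d) L pol (Nd [Nd (concat (map (\<lambda>i. kids (norm_form d (Suc n) C s (\<not> pol) i)) ?js))])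
         (if \<not> pol then \<forall>i\<in>set ?js. value_at A C i = s else \<exists>i\<in>set ?js. value_at A C i = s)"
        unfolding L by (rule nf_ok_wrap, rule nf_ok_concat[OF ne J n1])
      moreover have "conj = (\<not> pol)" using big(1) by blast
      ultimately show ?thesis unfolding eq val by (intro nf_ok_mono[OF _ p2(2)]) simp
    qed
  qed
qed

text \<open>Each clause of the disjunct with index \<open>i\<close> receives the additional literal
  saying that \<open>u \<noteq> i\<close>. Choosing \<open>u\<close> thus makes the clauses of all
  other disjuncts true and turns the disjunction into a conjunction. The guard sits under
  \<open>T - 1\<close> unary gates to keep all leaves on one level; for \<open>T = 1\<close> it
  raises the fan-in of the clause by 1.\<close>

definition phi :: "nat \<Rightarrow> nat \<Rightarrow> circuit \<Rightarrow> (nat \<times> nat) ntree list \<times> nat" where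
  "phi T d C = (let Ps = kids (norm_form d (T + 2) C True False (length C - 1)) in
     (concat (map (\<lambda>i. map (\<lambda>Q. Nd (nest (T - 1) (2, i) # kids Q)) (kids (nthd (Nd []) Ps i))) [0..<length Ps]),
      length Ps))"

text \<open>The outermost disjunction of the normal form is absorbed by the choice \<open>u\<close> of a disjunct.\<close>

lemma phi_correct:
  assumes C: "weft_circuit T d C" and T: "T \<ge> 1" and phi: "phi T d C = (\<Phi>, N)"
  shows "satisfies A C \<longleftrightarrow> (\<exists>u<N. \<forall>Q\<in>set \<Phi>. ev (lval A u) False Q)"
    and "\<And>Q. Q \<in> set \<Phi> \<Longrightarrow> full (2 ^ d + 1) T Q \<and> set_ntree Q \<subseteq> {l. fst l < 2 \<longrightarrow> snd l \<in> vars C}"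
    and "\<Phi> \<noteq> []" "N > 0"
proof -
  have ic: "is_circuit C" "\<And>b x. Literal b x \<in> set C \<Longrightarrow> b" "weft C \<le> T" "depth C \<le> d"
    using C unfolding weft_circuit_def by auto
  have ne: "C \<noteq> []" using ic(1) by (simp add: is_circuit_def)
  let ?F = "norm_form d (T + 2) C True False (length C - 1)"
  let ?S = "{l. fst l < (2 :: nat) \<and> snd l \<in> vars C}"
  have F: "nf_ok (lval A u) ?S (2 ^ d) (T + 2) False ?F (value_at A C (length C - 1) = True)" for A u
    by (rule norm_form_correct[OF ic(1,2)]) (use ne ic(3,4) in \<open>auto simp: depth_conv weft_conv\<close>)
  define Ps where "Ps = kids ?F"
  have Fe: "?F = Nd Ps" using F[of undefined undefined] unfolding nf_ok_def Ps_def by (cases ?F) auto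
  obtain t where t: "T = Suc t" using T by (cases T) auto
  have P: "Ps \<noteq> []" "\<And>P. P \<in> set Ps \<Longrightarrow> full (2 ^ d) (Suc T) P \<and> set_ntree P \<subseteq> ?S"
    using F[of undefined undefined] unfolding nf_ok_def Fe by auto
  have N: "N = length Ps" and \<Phi>: "\<Phi> = concat (map (\<lambda>i. map (\<lambda>Q. Nd (nest t (2, i) # kids Q)) (kids (nthd (Nd []) Ps i))) [0..<length Ps])"
    using phi unfolding phi_def Let_def Ps_def[symmetric] by (auto simp: t)
  show "N > 0" using N P(1) by simp
  have kid: "\<exists>Qs. Ps ! i = Nd Qs \<and> Qs \<noteq> [] \<and> (\<forall>Q\<in>set Qs. \<exists>us. Q = Nd us \<and> us \<noteq> [] \<and> full (2 ^ d) T Q \<and> set_ntree Q \<subseteq> ?S)" if "i < N" for i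
  proof -
    have "Ps ! i \<in> set Ps" using that N by simp
    from P(2)[OF this] obtain Qs where Qs: "Ps ! i = Nd Qs" "Qs \<noteq> []" "\<forall>Q\<in>set Qs. full (2 ^ d) T Q \<and> set_ntree Q \<subseteq> ?S"
      by (cases "Ps ! i") auto
    have "\<exists>us. Q = Nd us \<and> us \<noteq> []" if "Q \<in> set Qs" for Q using Qs(3) that unfolding t by (cases Q) auto
    then show ?thesis using Qs by blast
  qed
  have mem: "set \<Phi> = (\<Union>i\<in>{..<N}. (\<lambda>Q. Nd (nest t (2, i) # kids Q)) ` set (kids (Ps ! i)))"
    unfolding \<Phi> N by auto
  show "\<Phi> \<noteq> []"
  proof -
    obtain Qs where "Ps ! 0 = Nd Qs" "Qs \<noteq> []" using kid[of 0] \<open>N > 0\<close> by blast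
    then have "Nd (nest t (2, 0) # kids (hd Qs)) \<in> set \<Phi>"
      unfolding mem using \<open>N > 0\<close> by (intro UN_I[of 0] imageI) auto
    then show ?thesis by auto
  qed
  show "full (2 ^ d + 1) T Q' \<and> set_ntree Q' \<subseteq> {l. fst l < 2 \<longrightarrow> snd l \<in> vars C}" if Q': "Q' \<in> set \<Phi>" for Q'
  proof -
    obtain i Q where iQ: "i < N" "Q \<in> set (kids (Ps ! i))" "Q' = Nd (nest t (2, i) # kids Q)" using Q' unfolding mem by auto
    obtain us where us: "Q = Nd us" "us \<noteq> []" "full (2 ^ d) T Q" "set_ntree Q \<subseteq> ?S" 
    proof -
      obtain Qs where "Ps ! i = Nd Qs" "\<forall>Q\<in>set Qs. \<exists>us. Q = Nd us \<and> us \<noteq> [] \<and> full (2 ^ d) T Q \<and> set_ntree Q \<subseteq> ?S"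
        using kid[OF iQ(1)] by blast
      moreover from this iQ(2) have "Q \<in> set Qs" by simp
      ultimately show ?thesis using that by blast
    qed
    have "full (2 ^ d + 1) t u" if "u \<in> set us" for u
      by (rule full_mono[of "2 ^ d"]) (use us(1,3) that t in auto)
    moreover have "t = 0 \<longrightarrow> length us \<le> 2 ^ d" using us(1,3) t by simp
    ultimately have "full (2 ^ d + 1) T Q'" using iQ(3) us(1) t full_nest[of "2 ^ d + 1" t "(2, i)"] by simp
    moreover have "set_ntree Q' \<subseteq> {l. fst l < 2 \<longrightarrow> snd l \<in> vars C}" using iQ(3) us(1,4) by auto
    ultimately show ?thesis ..
  qed
  have evQ: "ev (lval A u) False (Nd (nest t (2, i) # kids Q)) = (u \<noteq> i \<or> ev (lval A u) False Q)"
    if iQ: "i < N" "Q \<in> set (kids (Ps ! i))" for i Q u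
  proof -
    obtain us where "Q = Nd us" using kid[OF iQ(1)] iQ(2) by fastforce
    then show ?thesis by (simp add: ev_nest lval_def)
  qed
  have evP: "(\<forall>Q\<in>set \<Phi>. ev (lval A u) False Q) = ev (lval A u) True (Ps ! u)" if u: "u < N" for u
  proof -
    obtain Qs where Qs: "Ps ! u = Nd Qs" using kid[OF u] by blast
    have "(\<forall>Q\<in>set \<Phi>. ev (lval A u) False Q) =
       (\<forall>i<N. \<forall>Q\<in>set (kids (Ps ! i)). ev (lval A u) False (Nd (nest t (2, i) # kids Q)))"
      unfolding mem by auto
    also have "\<dots> = (\<forall>i<N. \<forall>Q\<in>set (kids (Ps ! i)). u \<noteq> i \<or> ev (lval A u) False Q)" using evQ by blast
    also have "\<dots> = (\<forall>Q\<in>set (kids (Ps ! u)). ev (lval A u) False Q)" using u by blast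
    finally show ?thesis using Qs by simp
  qed
  have "satisfies A C = (\<exists>P\<in>set Ps. ev (lval A 0) True P)"
    using F[of A 0] unfolding nf_ok_def Fe satisfies_conv[OF ne] by simp
  also have "\<dots> = (\<exists>u<N. ev (lval A 0) True (Ps ! u))" unfolding N in_set_conv_nth by (metis in_set_conv_nth)
  \<comment> \<open>The disjuncts themselves contain no guards, so the choice may be set to the
    index of the disjunct considered.\<close>
  also have "\<dots> = (\<exists>u<N. ev (lval A u) True (Ps ! u))"
  proof -
    have "ev (lval A 0) True (Ps ! u) = ev (lval A u) True (Ps ! u)" if "u < N" for u
    proof (rule ev_cong_leaves)
      fix l assume "l \<in> set_ntree (Ps ! u)"
      then have "fst l < 2" using P(2)[of "Ps ! u"] that N by auto
      then show "lval A 0 l = lval A u l" by (auto simp: lval_def)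
    qed
    then show ?thesis by blast
  qed
  finally show "satisfies A C \<longleftrightarrow> (\<exists>u<N. \<forall>Q\<in>set \<Phi>. ev (lval A u) False Q)" using evP by blast
qed

section \<open>The normal form in polynomial time\<close>

lemma ptime_nest [ptime_intros]: "ptime f \<Longrightarrow> ptime (\<lambda>x. nest n (f x))"
  by (induction n) (auto intro!: ptime_intros)

lemma ptime_two [ptime_intros]: "ptime f \<Longrightarrow> ptime (\<lambda>x. two (f x))"
proof (rule ptime_comp[of two])
  show "ptime two" unfolding two_def by (intro ptime_intros)
qed

lemma ptime_small [ptime_intros]: "ptime f \<Longrightarrow> ptime (\<lambda>x. small (f x))"
proof (rule ptime_comp[of small])
  show "ptime small" unfolding small_def by (intro ptime_intros)
qed

lemma ptime_prodT [ptime_intros]: "ptime f \<Longrightarrow> ptime g \<Longrightarrow> ptime (\<lambda>x. prodT (f x) (g x))"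
proof -
  assume fg: "ptime f" "ptime g"
  have "ptime (\<lambda>p. prodT (fst p) (snd p))" unfolding prodT_def by (intro ptime_intros)
  from ptime_comp[OF this ptime_pair[OF fg]] show ?thesis by simp
qed

lemma ptime_norm_form_rule:
  assumes "ptime (\<lambda>p. norm_form d L (fst p) (fst (snd p)) (fst (snd (snd p))) (snd (snd (snd p))))"
    "ptime C" "ptime s" "ptime pol" "ptime v"
  shows "ptime (\<lambda>x. norm_form d L (C x) (s x) (pol x) (v x))"
  using ptime_comp[OF assms(1), of "\<lambda>x. (C x, s x, pol x, v x)"] assms(2-) by (simp add: ptime_pair)

text \<open>For constant \<open>d\<close> and \<open>L\<close> the recursion is a nesting of
  boundedly many polynomial-time steps, and a distribution at most multiplies two polynomial
  sizes.\<close>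

lemma ptime_norm_form_prim: "ptime (\<lambda>p. norm_form d L (fst p) (fst (snd p)) (fst (snd (snd p))) (snd (snd (snd p))))"
proof (induction d arbitrary: L)
  case 0
  show ?case unfolding norm_form.simps(1) by (intro ptime_intros)
next
  case (Suc d)
  show ?case unfolding norm_form.simps(2) by (intro ptime_intros ptime_norm_form_rule[OF Suc])
qed

lemmas ptime_norm_form [ptime_intros] = ptime_norm_form_rule[OF ptime_norm_form_prim]

lemma ptime_phi [ptime_intros]: "ptime C \<Longrightarrow> ptime (\<lambda>x. phi T d (C x))"
proof (rule ptime_comp[of "phi T d"])
  show "ptime (phi T d)" unfolding phi_def by (intro ptime_intros)
qed

section \<open>Encoding weighted assignments by cliques of gaps\<close>

text \<open>An assignment \<open>a\<^sub>1 < \<dots> < a\<^sub>k\<close> together with a choice \<open>u < N\<close> is represented by the \<open>k + 2\<close> atoms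
  \<open>(i, e\<^sub>i, e\<^sub>i\<^sub>+\<^sub>1)\<close> with \<open>e\<^sub>0 = 0\<close>, \<open>e\<^sub>i = a\<^sub>i + 1\<close>, \<open>e\<^sub>k\<^sub>+\<^sub>1 = M + 1\<close>, and \<open>(k + 1, u, 0)\<close>. Every literal is then
  false if and only if it is refuted by a single atom, positive literals being refuted by a gap.\<close>

definition atoms :: "nat \<Rightarrow> nat \<Rightarrow> nat list \<Rightarrow> nat \<Rightarrow> (nat \<times> nat \<times> nat) list" where
  "atoms k M vs N = filter (\<lambda>a. fst (snd a) < snd (snd a) \<and> (fst a = 0 \<longrightarrow> fst (snd a) = 0) \<and>
       (fst a = k \<longrightarrow> snd (snd a) = Suc M))
     (List.product [0..<Suc k] (List.product (0 # map Suc vs @ [Suc M]) (0 # map Suc vs @ [Suc M])))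
     @ map (\<lambda>u. (Suc k, u, 0)) [0..<N]"

text \<open>Atoms in the same slot must coincide, and consecutive gaps must share their common end.
  The condition \<open>\<le> k\<close> exempts slot \<open>Suc k\<close>, which holds the choice of
  a disjunct and has no left neighbour to match.\<close>

definition compat :: "nat \<Rightarrow> nat \<times> nat \<times> nat \<Rightarrow> nat \<times> nat \<times> nat \<Rightarrow> bool" where
  "compat k a b \<longleftrightarrow> (fst a = fst b \<longrightarrow> fst (snd a) = fst (snd b) \<and> snd (snd a) = snd (snd b)) \<and>
     (fst b = Suc (fst a) \<and> fst b \<le> k \<longrightarrow> snd (snd a) = fst (snd b)) \<and>
     (fst a = Suc (fst b) \<and> fst a \<le> k \<longrightarrow> snd (snd b) = fst (snd a))"

text \<open>Boundaries are variables shifted by one, so that 0 is free for the left end. The right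
  end \<open>Suc M\<close> of the last gap belongs to no variable, as these lie below
  \<open>M\<close>.\<close>

definition refutes :: "nat \<Rightarrow> nat \<times> nat \<Rightarrow> nat \<times> nat \<times> nat \<Rightarrow> bool" where
  "refutes k l a = (if fst l = 0 then fst a \<le> k \<and> fst (snd a) < Suc (snd l) \<and> Suc (snd l) < snd (snd a)
     else if fst l = 1 then fst a \<le> k \<and> snd (snd a) = Suc (snd l)
     else fst a = Suc k \<and> fst (snd a) = snd l)"

lemma set_atoms:
  "(i, lo, hi) \<in> set (atoms k M vs N) \<longleftrightarrow>
     i \<le> k \<and> lo \<in> {0, Suc M} \<union> Suc ` set vs \<and> hi \<in> {0, Suc M} \<union> Suc ` set vs \<and> lo < hi \<and>
       (i = 0 \<longrightarrow> lo = 0) \<and> (i = k \<longrightarrow> hi = Suc M)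
     \<or> i = Suc k \<and> lo < N \<and> hi = 0"
proof -
  let ?es = "0 # map Suc vs @ [Suc M]"
  have E: "set ?es = {0, Suc M} \<union> Suc ` set vs" by auto
  have 1: "(i, lo, hi) \<in> set (filter (\<lambda>a. fst (snd a) < snd (snd a) \<and> (fst a = 0 \<longrightarrow> fst (snd a) = 0) \<and>
       (fst a = k \<longrightarrow> snd (snd a) = Suc M)) (List.product [0..<Suc k] (List.product ?es ?es))) \<longleftrightarrow>
     (i < Suc k \<and> lo \<in> set ?es \<and> hi \<in> set ?es) \<and> lo < hi \<and> (i = 0 \<longrightarrow> lo = 0) \<and> (i = k \<longrightarrow> hi = Suc M)"
    by (simp only: set_filter mem_Collect_eq set_product mem_Times_iff fst_conv snd_conv set_upt atLeastLessThan_iff le0 simp_thms)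
  have 2: "(i, lo, hi) \<in> set (map (\<lambda>u. (Suc k, u, 0)) [0..<N]) \<longleftrightarrow> i = Suc k \<and> lo < N \<and> hi = 0" by auto
  show ?thesis unfolding atoms_def set_append Un_iff 1 2 E less_Suc_eq_le by blast
qed

lemma distinct_atoms:
  assumes "distinct vs" "\<And>x. x \<in> set vs \<Longrightarrow> x < M" shows "distinct (atoms k M vs N)"
proof -
  have "distinct (0 # map Suc vs @ [Suc M])" using assms by (auto simp: distinct_map)
  then have "distinct (List.product [0..<Suc k] (List.product (0 # map Suc vs @ [Suc M]) (0 # map Suc vs @ [Suc M])))"
    by (intro distinct_product) auto
  moreover have "distinct (map (\<lambda>u. (Suc k, u, 0 :: nat)) [0..<N])" by (auto simp: distinct_map inj_on_def)
  moreover have "fst a \<noteq> Suc k" if "a \<in> set (List.product [0..<Suc k] (List.product (0 # map Suc vs @ [Suc M]) (0 # map Suc vs @ [Suc M])))" for a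
    using that by (simp only: set_product mem_Times_iff set_upt atLeastLessThan_iff) simp
  ultimately show ?thesis unfolding atoms_def distinct_append by fastforce
qed

definition chain :: "nat \<Rightarrow> nat \<Rightarrow> (nat \<Rightarrow> nat) \<Rightarrow> bool" where
  "chain k M e \<longleftrightarrow> e 0 = 0 \<and> e (Suc k) = Suc M \<and> (\<forall>i\<le>k. e i < e (Suc i))"

definition chain_atoms :: "nat \<Rightarrow> (nat \<Rightarrow> nat) \<Rightarrow> nat \<Rightarrow> (nat \<times> nat \<times> nat) set" where
  "chain_atoms k e u = insert (Suc k, u, 0) ((\<lambda>i. (i, e i, e (Suc i))) ` {..k})"

definition chain_set :: "nat \<Rightarrow> (nat \<Rightarrow> nat) \<Rightarrow> nat set" where
  "chain_set k e = {x. \<exists>i<k. e (Suc i) = Suc x}"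

lemma chain_mono:
  assumes "chain k M e" "i < j" "j \<le> Suc k" shows "e i < e j"
  using assms(2,3)
proof (induction j)
  case (Suc j)
  have "e j < e (Suc j)" using assms(1) Suc.prems unfolding chain_def by simp
  then show ?case using Suc by (cases "i = j") auto
qed simp

text \<open>A shifted variable is either an inner boundary, which makes the variable true and is
  seen at the gap ending there, or lies strictly inside one gap, which makes it false. Either fact
  is witnessed by one atom.\<close>

lemma chain_refutes:
  assumes e: "chain k M e" and l: "fst l < 2 \<Longrightarrow> snd l < M"
  shows "lval (chain_set k e) u l \<longleftrightarrow> \<not> (\<exists>a\<in>chain_atoms k e u. refutes k l a)"
proof -
  have e': "e 0 = 0" "e (Suc k) = Suc M" using e unfolding chain_def by auto
  obtain kd x where lx: "l = (kd, x)" by (cases l)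
  consider "kd = 0" | "kd = 1" | "kd \<ge> 2" by linarith
  then show ?thesis
  proof cases
    case 1
    have x: "x < M" using l lx 1 by simp
    have ref: "(\<exists>a\<in>chain_atoms k e u. refutes k l a) \<longleftrightarrow> (\<exists>i\<le>k. e i < Suc x \<and> Suc x < e (Suc i))"
      unfolding chain_atoms_def refutes_def lx using 1 by auto
    show ?thesis
    proof (cases "x \<in> chain_set k e")
      case True
      then obtain j where j: "j < k" "e (Suc j) = Suc x" unfolding chain_set_def by blast
      have "\<not> (e i < Suc x \<and> Suc x < e (Suc i))" if "i \<le> k" for i
      proof (cases "i \<le> j")
        case True
        then have "e (Suc i) \<le> e (Suc j)" using chain_mono[OF e, of "Suc i" "Suc j"] j(1) by (cases "i = j") auto
        then show ?thesis using j(2) by simp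
      next
        case False
        then have "e (Suc j) \<le> e i" using chain_mono[OF e, of "Suc j" i] that by (cases "i = Suc j") auto
        then show ?thesis using j(2) by simp
      qed
      then show ?thesis using True ref lx 1 by (auto simp: lval_def)
    next
      case False
      \<comment> \<open>The first boundary that reaches \<open>Suc x\<close>; the gap ending there
        contains \<open>Suc x\<close>, strictly because \<open>x\<close> is false.\<close>
      define j where "j = (LEAST j. Suc x \<le> e j)"
      have P: "Suc x \<le> e (Suc k)" using e'(2) x by simp
      have j: "Suc x \<le> e j" "j \<le> Suc k" unfolding j_def by (rule LeastI[of _ "Suc k"], rule P) (rule Least_le, rule P)
      obtain i where i: "j = Suc i" using j(1) e'(1) by (cases j) auto
      have "e i < Suc x" using not_less_Least[of i "\<lambda>j. Suc x \<le> e j"] i unfolding j_def by simp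
      moreover have "e j \<noteq> Suc x"
      proof
        assume *: "e j = Suc x"
        then have "i \<noteq> k" using i e'(2) x by auto
        then have "i < k" using j(2) i by simp
        then show False using False * i unfolding chain_set_def by blast
      qed
      ultimately have "\<exists>i\<le>k. e i < Suc x \<and> Suc x < e (Suc i)" using j i by (intro exI[of _ i]) auto
      then show ?thesis using False ref lx 1 by (auto simp: lval_def)
    qed
  next
    case 2
    have x: "x < M" using l lx 2 by simp
    have "(\<exists>a\<in>chain_atoms k e u. refutes k l a) \<longleftrightarrow> (\<exists>i\<le>k. e (Suc i) = Suc x)"
      unfolding chain_atoms_def refutes_def lx using 2 by auto
    also have "\<dots> \<longleftrightarrow> x \<in> chain_set k e"
    proof
      assume "\<exists>i\<le>k. e (Suc i) = Suc x"
      then obtain i where i: "i \<le> k" "e (Suc i) = Suc x" by blast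
      then have "i \<noteq> k" using e'(2) x by auto
      then show "x \<in> chain_set k e" using i unfolding chain_set_def by (intro CollectI exI[of _ i]) auto
    qed (auto simp: chain_set_def intro: less_imp_le)
    finally show ?thesis using lx 2 by (simp add: lval_def)
  next
    case 3
    then have "(\<exists>a\<in>chain_atoms k e u. refutes k l a) \<longleftrightarrow> u = x"
      unfolding chain_atoms_def refutes_def lx by auto
    then show ?thesis using lx 3 by (simp add: lval_def)
  qed
qed

lemma chain_atoms_clique:
  assumes "a \<in> chain_atoms k e u" "b \<in> chain_atoms k e u" shows "compat k a b"
  using assms unfolding chain_atoms_def compat_def by auto

lemma card_chain_atoms: "card (chain_atoms k e u) = k + 2"
proof -
  have "card ((\<lambda>i. (i, e i, e (Suc i))) ` {..k}) = Suc k" by (subst card_image) (auto simp: inj_on_def)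
  moreover have "(Suc k, u, 0) \<notin> (\<lambda>i. (i, e i, e (Suc i))) ` {..k}" by auto
  ultimately show ?thesis unfolding chain_atoms_def by simp
qed

lemma card_chain_set:
  assumes e: "chain k M e" shows "card (chain_set k e) = k"
proof -
  have pos: "e (Suc i) > 0" if "i < k" for i using chain_mono[OF e, of 0 "Suc i"] that by simp
  have "chain_set k e = (\<lambda>i. e (Suc i) - 1) ` {..<k}"
  proof (intro set_eqI iffI)
    fix x assume "x \<in> chain_set k e"
    then obtain i where "i < k" "e (Suc i) = Suc x" unfolding chain_set_def by blast
    then show "x \<in> (\<lambda>i. e (Suc i) - 1) ` {..<k}" by (intro image_eqI[of _ _ i]) auto
  next
    fix x assume "x \<in> (\<lambda>i. e (Suc i) - 1) ` {..<k}"
    then obtain i where "i < k" "x = e (Suc i) - 1" by auto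
    then show "x \<in> chain_set k e" unfolding chain_set_def using pos[of i] by (intro CollectI exI[of _ i]) simp
  qed
  moreover have "inj_on (\<lambda>i. e (Suc i) - 1) {..<k}"
  proof (rule linorder_inj_onI)
    fix i j :: nat assume ij: "i < j" "i \<in> {..<k}" "j \<in> {..<k}"
    then show "e (Suc i) - 1 \<noteq> e (Suc j) - 1"
      using chain_mono[OF e, of "Suc i" "Suc j"] pos[of i] pos[of j] by simp
  qed auto
  ultimately show ?thesis by (simp add: card_image)
qed

lemma chain_of_assignment:
  assumes "A \<subseteq> set vs" "card A = k" "u < N" and M: "\<And>x. x \<in> set vs \<Longrightarrow> x < M"
  obtains e where "chain k M e" "chain_set k e = A" "chain_atoms k e u \<subseteq> set (atoms k M vs N)"
proof -
  define as where "as = sorted_list_of_set A"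
  have fin: "finite A" using assms(1) finite_subset by blast
  have as: "set as = A" "length as = k" "sorted_wrt (<) as"
    using fin assms(2) by (auto simp: as_def)
  define e where "e i = (if i = 0 then 0 else if i \<le> k then Suc (as ! (i - 1)) else Suc M)" for i
  have asM: "as ! i \<in> set vs" "as ! i < M" if "i < k" for i
  proof -
    show "as ! i \<in> set vs" using nth_mem[of i as] that as(1,2) assms(1) by auto
    then show "as ! i < M" by (rule M)
  qed
  have "e i < e (Suc i)" if "i \<le> k" for i
  proof -
    consider "i = 0" | "0 < i" "i < k" | "0 < i" "i = k" using \<open>i \<le> k\<close> by linarith
    then show ?thesis
    proof cases
      case 1 then show ?thesis by (simp add: e_def)
    next
      case 2
      then have "as ! (i - 1) < as ! i" using sorted_wrt_nth_less[OF as(3), of "i - 1" i] as(2) by simp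
      then show ?thesis using 2 by (simp add: e_def)
    next
      case 3 then show ?thesis using asM(2)[of "i - 1"] by (simp add: e_def)
    qed
  qed
  then have ch: "chain k M e" unfolding chain_def by (simp add: e_def)
  moreover have "chain_set k e = A"
  proof -
    have e1: "e (Suc i) = Suc (as ! i)" if "i < k" for i using that by (simp add: e_def)
    then have "chain_set k e = {x. \<exists>i<k. as ! i = x}" unfolding chain_set_def by (auto cong: conj_cong)
    also have "\<dots> = set as" by (auto simp: in_set_conv_nth as(2))
    finally show ?thesis using as(1) by simp
  qed
  moreover have "chain_atoms k e u \<subseteq> set (atoms k M vs N)"
  proof -
    have E: "e i \<in> {0, Suc M} \<union> Suc ` set vs" for i using asM(1)[of "i - 1"] by (auto simp: e_def)
    show ?thesis
    proof
      fix a assume "a \<in> chain_atoms k e u"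
      then consider "a = (Suc k, u, 0)" | i where "i \<le> k" "a = (i, e i, e (Suc i))" unfolding chain_atoms_def by auto
      then show "a \<in> set (atoms k M vs N)"
      proof cases
        case 1 then show ?thesis using assms(3) set_atoms by simp
      next
        case 2
        then show ?thesis using E[of i] E[of "Suc i"] ch unfolding chain_def by (simp only: set_atoms) auto
      qed
    qed
  qed
  ultimately show ?thesis by (rule that)
qed

text \<open>Compatible atoms in the same slot are equal, so \<open>k + 2\<close> pairwise compatible
  atoms occupy each of the \<open>k + 2\<close> slots exactly once; matching ends then make the gaps
  into a chain.\<close>

lemma assignment_of_clique:
  assumes S: "S \<subseteq> set (atoms k M vs N)" and cl: "\<And>a b. a \<in> S \<Longrightarrow> b \<in> S \<Longrightarrow> compat k a b" and card: "card S = k + 2"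
  obtains e u where "u < N" "chain k M e" "S = chain_atoms k e u" "chain_set k e \<subseteq> set vs"
proof -
  have fin: "finite S" using S finite_subset by blast
  have inj: "inj_on fst S"
  proof (rule inj_onI)
    fix a b assume "a \<in> S" "b \<in> S" "fst a = fst b"
    then show "a = b" using cl[of a b] unfolding compat_def by (simp add: prod_eq_iff)
  qed
  have "fst ` S \<subseteq> {..Suc k}"
  proof
    fix i assume "i \<in> fst ` S"
    then obtain lo hi where "(i, lo, hi) \<in> S" by force
    then show "i \<in> {..Suc k}" using S set_atoms[of i lo hi k M vs N] by auto
  qed
  moreover have "card (fst ` S) = card {..Suc k}" using card_image[OF inj] card by simp
  ultimately have im: "fst ` S = {..Suc k}" by (intro card_subset_eq) auto
  have ex: "\<exists>p. (i, p) \<in> S" if "i \<le> Suc k" for i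
  proof -
    have "i \<in> fst ` S" using im that by simp
    then show ?thesis by force
  qed
  define g where "g i = (SOME p. (i, p) \<in> S)" for i
  have g: "(i, g i) \<in> S" if "i \<le> Suc k" for i using someI_ex[OF ex[OF that]] unfolding g_def .
  define u where "u = fst (g (Suc k))"
  define e where "e i = (if i \<le> k then fst (g i) else Suc M)" for i
  have gk: "g (Suc k) = (u, 0)" "u < N"
  proof -
    have "(Suc k, fst (g (Suc k)), snd (g (Suc k))) \<in> set (atoms k M vs N)" using g[of "Suc k"] S by auto
    then show "g (Suc k) = (u, 0)" "u < N" unfolding set_atoms u_def by (auto simp: prod_eq_iff)
  qed
  have gi: "g i = (e i, e (Suc i))" and at: "e i \<in> {0, Suc M} \<union> Suc ` set vs" "e i < e (Suc i)" "i = 0 \<longrightarrow> e i = 0" if i: "i \<le> k" for i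
  proof -
    have a: "(i, fst (g i), snd (g i)) \<in> set (atoms k M vs N)" using g[of i] i S by auto
    have "snd (g i) = e (Suc i)"
    proof (cases "i = k")
      case True then show ?thesis using a unfolding set_atoms e_def by auto
    next
      case False
      then have "compat k (i, g i) (Suc i, g (Suc i))" using i g by (intro cl) auto
      then show ?thesis using False i unfolding compat_def e_def by auto
    qed
    then show "g i = (e i, e (Suc i))" using i by (simp add: e_def prod_eq_iff)
    then show "e i \<in> {0, Suc M} \<union> Suc ` set vs" "e i < e (Suc i)" "i = 0 \<longrightarrow> e i = 0"
      using a i unfolding set_atoms by auto
  qed
  have ch: "chain k M e" unfolding chain_def using at(2,3) by (auto simp: e_def)
  have "S = chain_atoms k e u"
  proof -
    have "chain_atoms k e u \<subseteq> S"
    proof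
      fix a assume "a \<in> chain_atoms k e u"
      then consider "a = (Suc k, u, 0)" | i where "i \<le> k" "a = (i, e i, e (Suc i))" unfolding chain_atoms_def by auto
      then show "a \<in> S"
      proof cases
        case 1 then show ?thesis using g[of "Suc k"] gk(1) by simp
      next
        case 2 then show ?thesis using g[of i] gi[of i] by simp
      qed
    qed
    moreover have "card (chain_atoms k e u) = card S" using card card_chain_atoms by simp
    ultimately show ?thesis by (intro card_subset_eq[OF fin, symmetric])
  qed
  moreover have "chain_set k e \<subseteq> set vs"
  proof
    fix x assume "x \<in> chain_set k e"
    then obtain i where i: "i < k" "e (Suc i) = Suc x" unfolding chain_set_def by blast
    have "e (Suc i) \<noteq> Suc M" using chain_mono[OF ch, of "Suc i" "Suc k"] i(1) ch unfolding chain_def by auto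
    then show "x \<in> set vs" using at(1)[of "Suc i"] i by auto
  qed
  ultimately show ?thesis using that gk(2) ch by blast
qed

subsection \<open>Tuples of atoms\<close>

text \<open>Also meant for \<open>p = q\<close>: a tuple whose own atoms clash is in conflict with
  itself and can never be selected.\<close>

definition conflict :: "nat \<Rightarrow> (nat \<times> nat \<times> nat) list \<Rightarrow> (nat \<times> nat \<times> nat) list \<Rightarrow> bool" where
  "conflict k p q \<longleftrightarrow> (\<exists>a\<in>set p. \<exists>b\<in>set q. \<not> compat k a b)"

definition bad :: "nat \<Rightarrow> (nat \<times> nat) ntree \<Rightarrow> (nat \<times> nat \<times> nat) list \<Rightarrow> bool" where
  "bad k Q p \<longleftrightarrow> (\<forall>l\<in>set (kids Q). \<exists>a\<in>set p. refutes k (leafv (0, 0) l) a)"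

definition bad_indices :: "nat \<Rightarrow> (nat \<times> nat \<times> nat) list list \<Rightarrow> (nat \<times> nat) ntree \<Rightarrow> nat list" where
  "bad_indices k tu Q = filter (\<lambda>i. bad k Q (nthd [] tu i)) [0..<length tu]"

text \<open>The atoms occurring in conflict-free tuples form a set \<open>S\<close> of pairwise
  compatible atoms, hence at most \<open>k + 2\<close>. There are only \<open>card S ^ r\<close>
  tuples over \<open>S\<close>, so selecting \<open>(k + 2) ^ r\<close> of them leaves no freedom:
  \<open>S\<close> has full size and all tuples over it are selected.\<close>

lemma tuples_clique:
  assumes r: "r \<ge> 1" and at: "distinct as" and tu: "tu = List.n_lists r as"
    and cls: "\<And>a. a \<in> set as \<Longrightarrow> fst a \<le> Suc k"
    and B: "B \<subseteq> {..<length tu}" "card B = (k + 2) ^ r" "\<And>i j. i \<in> B \<Longrightarrow> j \<in> B \<Longrightarrow> \<not> conflict k (tu ! i) (tu ! j)"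
  obtains S where "S \<subseteq> set as" "\<And>a b. a \<in> S \<Longrightarrow> b \<in> S \<Longrightarrow> compat k a b" "card S = k + 2"
    "B = {i. i < length tu \<and> set (tu ! i) \<subseteq> S}"
proof -
  have dtu: "distinct tu" unfolding tu by (rule distinct_n_lists[OF at])
  have stu: "set tu = {ys. length ys = r \<and> set ys \<subseteq> set as}" unfolding tu by (rule set_n_lists)
  define S where "S = (\<Union>i\<in>B. set (tu ! i))"
  have Sa: "S \<subseteq> set as"
  proof
    fix a assume "a \<in> S"
    then obtain i where "i \<in> B" "a \<in> set (tu ! i)" unfolding S_def by blast
    moreover from this B(1) have "tu ! i \<in> set tu" by auto
    ultimately show "a \<in> set as" using stu by auto
  qed
  have cl: "compat k a b" if "a \<in> S" "b \<in> S" for a b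
    using that B(3) unfolding S_def conflict_def by blast
  have fin: "finite S" using Sa finite_subset by blast
  have "inj_on fst S"
  proof (rule inj_onI)
    fix a b assume "a \<in> S" "b \<in> S" "fst a = fst b"
    then show "a = b" using cl[of a b] unfolding compat_def by (simp add: prod_eq_iff)
  qed
  then have "card S = card (fst ` S)" by (simp add: card_image)
  also have "\<dots> \<le> card {..Suc k}" using cls Sa by (intro card_mono) auto
  finally have cS: "card S \<le> k + 2" by simp
  define X where "X = {ys. length ys = r \<and> set ys \<subseteq> S}"
  have X: "card X = card S ^ r" "finite X"
    using card_lists_length_eq[OF fin, of r] finite_lists_length_eq[OF fin, of r] unfolding X_def by (simp_all add: conj_commute)
  have inj: "inj_on ((!) tu) {..<length tu}" using dtu by (auto simp: inj_on_def nth_eq_iff_index_eq)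
  have sub: "(!) tu ` B \<subseteq> X"
  proof
    fix y assume "y \<in> (!) tu ` B"
    then obtain i where i: "i \<in> B" "y = tu ! i" by blast
    then have "y \<in> set tu" using B(1) by auto
    then show "y \<in> X" using stu i unfolding X_def S_def by auto
  qed
  have cB: "card ((!) tu ` B) = (k + 2) ^ r" using card_image[OF inj_on_subset[OF inj B(1)]] B(2) by simp
  have "(k + 2) ^ r \<le> card S ^ r" using card_mono[OF X(2) sub] cB X(1) by simp
  then have "k + 2 \<le> card S" using r by (simp add: power_mono_iff)
  with cS have cS: "card S = k + 2" by simp
  have eq: "(!) tu ` B = X" by (rule card_subset_eq[OF X(2) sub]) (simp add: cB X(1) cS)
  have "B = {i. i < length tu \<and> set (tu ! i) \<subseteq> S}"
  proof (intro set_eqI iffI)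
    fix i assume "i \<in> B" then show "i \<in> {i. i < length tu \<and> set (tu ! i) \<subseteq> S}" using B(1) unfolding S_def by auto
  next
    fix i assume i: "i \<in> {i. i < length tu \<and> set (tu ! i) \<subseteq> S}"
    then have "tu ! i \<in> X" using stu nth_mem[of i tu] unfolding X_def by auto
    then obtain j where "j \<in> B" "tu ! j = tu ! i" using eq by (metis imageE)
    then show "i \<in> B" using inj_onD[OF inj, of j i] i B(1) by auto
  qed
  with that Sa cl cS show ?thesis by blast
qed

lemma clique_tuples:
  assumes at: "distinct as" and tu: "tu = List.n_lists r as" and S: "S \<subseteq> set as" "card S = K"
  shows "card {i. i < length tu \<and> set (tu ! i) \<subseteq> S} = K ^ r"
proof -
  have dtu: "distinct tu" unfolding tu by (rule distinct_n_lists[OF at])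
  have stu: "set tu = {ys. length ys = r \<and> set ys \<subseteq> set as}" unfolding tu by (rule set_n_lists)
  have fin: "finite S" using S finite_subset by blast
  have inj: "inj_on ((!) tu) {..<length tu}" using dtu by (auto simp: inj_on_def nth_eq_iff_index_eq)
  let ?B = "{i. i < length tu \<and> set (tu ! i) \<subseteq> S}" and ?X = "{ys. set ys \<subseteq> S \<and> length ys = r}"
  have "(!) tu ` ?B = ?X"
  proof (intro set_eqI iffI)
    fix y assume "y \<in> (!) tu ` ?B"
    then obtain i where i: "i < length tu" "set (tu ! i) \<subseteq> S" "y = tu ! i" by blast
    then show "y \<in> ?X" using stu nth_mem[of i tu] by auto
  next
    fix y assume "y \<in> ?X"
    then have "y \<in> set tu" using stu S(1) by auto
    then obtain i where "i < length tu" "tu ! i = y" by (auto simp: in_set_conv_nth)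
    with \<open>y \<in> ?X\<close> show "y \<in> (!) tu ` ?B" by auto
  qed
  moreover have "card ((!) tu ` ?B) = card ?B" by (rule card_image[OF inj_on_subset[OF inj]]) auto
  ultimately show ?thesis using card_lists_length_eq[OF fin, of r] S(2) by simp
qed

text \<open>A clause fails iff each of its at most \<open>r\<close> literals is refuted by an atom
  of \<open>S\<close>. These atoms fit into one tuple, and as every tuple over \<open>S\<close> is
  selected, so is this one.\<close>

lemma clause_bad_indices:
  assumes tu: "tu = List.n_lists r as" and S: "S \<subseteq> set as" "S \<noteq> {}"
    and B: "B = {i. i < length tu \<and> set (tu ! i) \<subseteq> S}"
    and I: "\<And>l. l \<in> set_ntree Q \<Longrightarrow> I l \<longleftrightarrow> \<not> (\<exists>a\<in>S. refutes k l a)" and Q: "full r 1 Q"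
  shows "ev I False Q \<longleftrightarrow> (\<forall>i\<in>set (bad_indices k tu Q). i \<notin> B)"
proof -
  have stu: "set tu = {ys. length ys = r \<and> set ys \<subseteq> set as}" unfolding tu by (rule set_n_lists)
  obtain ts where ts: "Q = Nd ts" "ts \<noteq> []" "length ts \<le> r" "\<forall>t\<in>set ts. full r 0 t"
    using Q by (cases Q) auto
  have lf: "t = NLf (leafv (0, 0) t) \<and> leafv (0, 0) t \<in> set_ntree Q" if "t \<in> set ts" for t
  proof (cases t)
    case (NLf l) then show ?thesis using that ts(1) by (auto intro!: bexI[of _ t])
  next
    case (Nd us) then show ?thesis using that ts(4) by auto
  qed
  have evt: "ev I True t = (\<not> (\<exists>a\<in>S. refutes k (leafv (0, 0) t) a))" if "t \<in> set ts" for t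
  proof -
    have "ev I True t = I (leafv (0, 0) t)" using lf[OF that] by (metis ev.simps(1))
    then show ?thesis using I lf[OF that] by blast
  qed
  have "(\<not> ev I False Q) \<longleftrightarrow> (\<forall>t\<in>set ts. \<exists>a\<in>S. refutes k (leafv (0, 0) t) a)"
    unfolding ts(1) using evt by auto
  also have "\<dots> \<longleftrightarrow> (\<exists>i\<in>set (bad_indices k tu Q). i \<in> B)"
  proof
    assume "\<forall>t\<in>set ts. \<exists>a\<in>S. refutes k (leafv (0, 0) t) a"
    then obtain h where h: "\<And>t. t \<in> set ts \<Longrightarrow> h t \<in> S \<and> refutes k (leafv (0, 0) t) (h t)" by metis
    obtain a0 where a0: "a0 \<in> S" using S(2) by blast
    \<comment> \<open>Clauses may be shorter than \<open>r\<close>; an arbitrary atom of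
      \<open>S\<close> fills the tuple up.\<close>
    define p where "p = map h ts @ replicate (r - length ts) a0"
    have p: "length p = r" "set p \<subseteq> S" using ts(3) h a0 by (auto simp: p_def)
    then have "p \<in> set tu" using stu S(1) by auto
    then obtain i where i: "i < length tu" "tu ! i = p" by (auto simp: in_set_conv_nth)
    have "bad k Q p" unfolding bad_def ts(1) p_def using h by fastforce
    then have "i \<in> set (bad_indices k tu Q)" using i unfolding bad_indices_def by simp
    moreover have "i \<in> B" using i p B by simp
    ultimately show "\<exists>i\<in>set (bad_indices k tu Q). i \<in> B" by blast
  next
    assume "\<exists>i\<in>set (bad_indices k tu Q). i \<in> B"
    then obtain i where "i < length tu" "bad k Q (tu ! i)" "set (tu ! i) \<subseteq> S" unfolding bad_indices_def B by auto
    then show "\<forall>t\<in>set ts. \<exists>a\<in>S. refutes k (leafv (0, 0) t) a" unfolding bad_def ts(1) by fastforce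
  qed
  finally show ?thesis by blast
qed

text \<open>A clause turns into the conjunction of the negated variables of its bad tuples and
  merges with the conjunction above it, so one level disappears. The leaf \<open>length tu\<close>
  denotes the negation of a dummy variable that is forced to be false; it keeps the conjunction
  nonempty.\<close>

primrec conv :: "nat \<Rightarrow> nat \<Rightarrow> (nat \<times> nat \<times> nat) list list \<Rightarrow> (nat \<times> nat) ntree list \<Rightarrow> nat ntree list" where
  "conv 0 = (\<lambda>k tu Qs. NLf (length tu) # map NLf (concat (map (bad_indices k tu) Qs)))"
| "conv (Suc m) = (\<lambda>k tu Qs. map (\<lambda>Q. Nd (map (\<lambda>R. Nd (conv m k tu (kids R))) (kids Q))) Qs)"

lemma full_kids:
  assumes "full r (Suc n) Q" "set_ntree Q \<subseteq> S"
  shows "\<exists>Rs. Q = Nd Rs \<and> (\<forall>R\<in>set Rs. full r n R \<and> set_ntree R \<subseteq> S)"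
  using assms by (cases Q) auto

lemma conv_correct:
  assumes "\<And>Q. full r 1 Q \<Longrightarrow> set_ntree Q \<subseteq> S \<Longrightarrow> ev I False Q \<longleftrightarrow> (\<forall>i\<in>set (bad_indices k tu Q). i \<notin> B)"
    and "length tu \<notin> B"
  shows "\<forall>Q\<in>set Qs. full r (2 * m + 1) Q \<and> set_ntree Q \<subseteq> S \<Longrightarrow>
    (\<forall>t\<in>set (conv m k tu Qs). ev (\<lambda>i. i \<notin> B) False t) = (\<forall>Q\<in>set Qs. ev I False Q)"
proof (induction m arbitrary: Qs)
  case 0
  then have "\<forall>Q\<in>set Qs. ev I False Q = (\<forall>i\<in>set (bad_indices k tu Q). i \<notin> B)" using assms(1) by simp
  then show ?case using assms(2) by auto
next
  case (Suc m)
  have "ev (\<lambda>i. i \<notin> B) False (Nd (map (\<lambda>R. Nd (conv m k tu (kids R))) (kids Q))) = ev I False Q" if Q: "Q \<in> set Qs" for Q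
  proof -
    obtain Rs where Rs: "Q = Nd Rs" "\<forall>R\<in>set Rs. full r (Suc (2 * m + 1)) R \<and> set_ntree R \<subseteq> S"
      using full_kids[of r "Suc (2 * m + 1)" Q S] Suc.prems Q by auto
    have "(\<forall>t\<in>set (conv m k tu (kids R)). ev (\<lambda>i. i \<notin> B) False t) = ev I True R" if R: "R \<in> set Rs" for R
    proof -
      obtain Us where Us: "R = Nd Us" "\<forall>U\<in>set Us. full r (2 * m + 1) U \<and> set_ntree U \<subseteq> S"
        using full_kids[of r "2 * m + 1" R S] Rs(2) R by auto
      show ?thesis using Suc.IH[OF Us(2)] Us(1) by simp
    qed
    then show ?thesis using Rs(1) by auto
  qed
  then show ?case by auto
qed

lemma conv_nonempty: "Qs \<noteq> [] \<Longrightarrow> conv m k tu Qs \<noteq> []"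
  by (cases m) auto

lemma conv_tok:
  "\<forall>Q\<in>set Qs. full r (2 * m + 1) Q \<Longrightarrow> t \<in> set (conv m k tu Qs) \<Longrightarrow> tok (Suc (length tu)) (2 * m) t"
proof (induction m arbitrary: Qs t)
  case 0
  then show ?case by (auto simp: bad_indices_def)
next
  case (Suc m)
  obtain Q where Q: "Q \<in> set Qs" "t = Nd (map (\<lambda>R. Nd (conv m k tu (kids R))) (kids Q))" using Suc.prems(2) by auto
  obtain Rs where Rs: "Q = Nd Rs" "Rs \<noteq> []" "\<forall>R\<in>set Rs. full r (Suc (2 * m + 1)) R"
    using Suc.prems(1) Q(1) by (cases Q) auto
  have "tok (Suc (length tu)) (Suc (2 * m)) (Nd (conv m k tu (kids R)))" if R: "R \<in> set Rs" for R
  proof -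
    obtain Us where Us: "R = Nd Us" "Us \<noteq> []" "\<forall>U\<in>set Us. full r (2 * m + 1) U"
      using Rs(3) R by (cases R) auto
    show ?thesis using Suc.IH[OF Us(3)] conv_nonempty[OF Us(2)] Us(1) by simp
  qed
  then show ?case using Q(2) Rs(1,2) by simp
qed

section \<open>The genus of graphs with many edges\<close>

lemma orbit_cycle_of_list:
  assumes "distinct cs" "x \<in> set cs" shows "orbit (cycle_of_list cs) x = set cs"
proof -
  let ?n = "length cs"
  obtain i where i: "i < ?n" "x = cs ! i" using assms(2) by (auto simp: in_set_conv_nth)
  have pow: "(cycle_of_list cs ^^ m) x = cs ! ((i + m) mod ?n)" for m
  proof -
    have "map (cycle_of_list cs ^^ m) cs ! i = rotate m cs ! i" using cyclic_rotation[OF assms(1), of m] by simp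
    then show ?thesis using i by (simp add: nth_rotate add.commute)
  qed
  have "cs ! j \<in> orbit (cycle_of_list cs) x" if "j < ?n" for j
  proof -
    have "(i + (?n + j - i)) mod ?n = j" using i(1) that by simp
    then have "(cycle_of_list cs ^^ (?n + j - i)) x = cs ! j" using pow[of "?n + j - i"] by simp
    moreover have "0 < ?n + j - i" using i(1) by simp
    ultimately have "cs ! j = (cycle_of_list cs ^^ (?n + j - i)) x \<and> 0 < ?n + j - i" by simp
    then show ?thesis unfolding orbit_altdef by blast
  qed
  moreover have "orbit (cycle_of_list cs) x \<subseteq> set cs"
  proof
    fix y assume "y \<in> orbit (cycle_of_list cs) x"
    then obtain m where "y = (cycle_of_list cs ^^ m) x" unfolding orbit_altdef by blast
    then have "y = cs ! ((i + m) mod ?n)" by (simp only: pow)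
    moreover have "(i + m) mod ?n < ?n" using i(1) by (intro mod_less_divisor) linarith
    ultimately show "y \<in> set cs" using nth_mem by blast
  qed
  moreover have "set cs \<subseteq> orbit (cycle_of_list cs) x"
  proof
    fix y assume "y \<in> set cs"
    then obtain j where "j < ?n" "y = cs ! j" by (auto simp: in_set_conv_nth)
    with calculation(1) show "y \<in> orbit (cycle_of_list cs) x" by simp
  qed
  ultimately show ?thesis by blast
qed

lemma evenperm_cycle_of_list:
  "distinct cs \<Longrightarrow> cs \<noteq> [] \<Longrightarrow> evenperm (cycle_of_list cs) \<longleftrightarrow> odd (length cs)"
proof (induction cs rule: cycle_of_list.induct)
  case (1 i j cs)
  have "i \<noteq> j" using 1(2) by simp
  moreover have "evenperm (cycle_of_list (j # cs)) \<longleftrightarrow> odd (length (j # cs))" using 1 by auto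
  ultimately show ?case
    unfolding cycle_of_list.simps(1) evenperm_comp[OF permutation_swap_id permutation_of_cycle] evenperm_swap by simp
qed simp_all

text \<open>A further disjoint cycle of length n adds n points and one orbit and has the sign of n -
  1. Applied to darts, this controls the parity in Euler's equation.\<close>

lemma evenperm_orbits_decomp:
  "cycle_decomp S p \<Longrightarrow> finite S \<and> p permutes S \<and> (evenperm p \<longleftrightarrow> even (card S + card (orbit p ` S)))"
proof (induction rule: cycle_decomp.induct)
  case empty
  show ?case by (intro conjI) (simp, rule permutes_id, simp only: evenperm_id, simp)
next
  case (comp I p cs)
  let ?c = "cycle_of_list cs" and ?S = "set cs \<union> I"
  have fin: "finite I" and p: "p permutes I" and ev: "evenperm p \<longleftrightarrow> even (card I + card (orbit p ` I))"
    using comp.IH by auto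
  have c: "?c permutes set cs" by (rule cycle_permutes)
  have dj: "set cs \<inter> I = {}" by (rule comp.hyps(3))
  have cI: "?c y = y" if "y \<in> I" for y using permutes_not_in[OF c] that dj by blast
  have pc: "p y = y" if "y \<in> set cs" for y using permutes_not_in[OF p] that dj by blast
  have per: "?c \<circ> p permutes ?S"
    by (intro permutes_compose permutes_subset[OF p] permutes_subset[OF c]) auto
  have o1: "orbit (?c \<circ> p) y = orbit p y" if y: "y \<in> I" for y
    by (rule orbit_cong0[OF y]) (use cI permutes_in_image[OF p] in auto)
  have o2: "orbit (?c \<circ> p) y = set cs" if y: "y \<in> set cs" for y
  proof -
    have "orbit (?c \<circ> p) y = orbit ?c y"
      by (rule orbit_cong0[OF y]) (use pc permutes_in_image[OF c] in auto)
    then show ?thesis using orbit_cycle_of_list[OF comp.hyps(2) y] by simp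
  qed
  have card: "card ?S = length cs + card I"
    using card_Un_disjoint[of "set cs" I] fin dj comp.hyps(2) by (simp add: distinct_card)
  have pp: "permutation ?c" "permutation p" using permutation_of_cycle p fin by (auto simp: permutation_permutes)
  show ?case
  proof (cases "cs = []")
    case True
    then have "?c \<circ> p = p" "?S = I" by (simp_all add: fun_eq_iff)
    then show ?thesis using fin p ev by (simp only: simp_thms)
  next
    case False
    have "orbit (?c \<circ> p) ` ?S = insert (set cs) (orbit p ` I)"
    proof -
      have "orbit (?c \<circ> p) ` set cs = (\<lambda>_. set cs) ` set cs" by (rule image_cong[OF refl o2])
      then have "orbit (?c \<circ> p) ` set cs = {set cs}" using False by (simp add: image_constant_conv)
      moreover have "orbit (?c \<circ> p) ` I = orbit p ` I" by (rule image_cong[OF refl o1])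
      ultimately show ?thesis unfolding image_Un by (simp only: insert_is_Un[symmetric])
    qed
    moreover have "set cs \<notin> orbit p ` I"
    proof
      assume "set cs \<in> orbit p ` I"
      then obtain y where "y \<in> I" "set cs = orbit p y" by blast
      then have "set cs \<subseteq> I" using permutes_orbit_subset[OF p] by blast
      then show False using dj False by (cases cs) auto
    qed
    ultimately have crd: "card (orbit (?c \<circ> p) ` ?S) = Suc (card (orbit p ` I))"
      using card_insert_disjoint[OF finite_imageI[OF fin], of "set cs" "orbit p"] by simp
    have eve: "evenperm (?c \<circ> p) \<longleftrightarrow> (odd (length cs) = evenperm p)"
      using evenperm_comp[OF pp] evenperm_cycle_of_list[of cs] comp.hyps(2) False by simp
    have "even (length cs + card I + Suc m) \<longleftrightarrow> (odd (length cs) = even (card I + m))" for m by auto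
    then have "evenperm (?c \<circ> p) \<longleftrightarrow> even (card ?S + card (orbit (?c \<circ> p) ` ?S))"
      by (simp only: eve ev card crd)
    moreover have "finite ?S" using fin by simp
    ultimately show ?thesis using per by blast
  qed
qed

lemma evenperm_orbits:
  assumes "finite S" "p permutes S" shows "evenperm p \<longleftrightarrow> even (card S + card (orbit p ` S))"
  using evenperm_orbits_decomp[OF cycle_decomposition[OF assms(2,1)]] by blast

lemma orbit_partition:
  assumes "finite S" "p permutes S"
  shows "\<Union> (orbit p ` S) = S" "x \<in> S \<Longrightarrow> y \<in> S \<Longrightarrow> orbit p x = orbit p y \<or> orbit p x \<inter> orbit p y = {}"
proof -
  have perm: "permutation p" using assms by (auto simp: permutation_permutes)
  have self: "x \<in> orbit p x" for x by (rule permutation_self_in_orbit[OF perm])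
  show "\<Union> (orbit p ` S) = S" using self permutes_orbit_subset[OF assms(2)] by blast
  have eq: "orbit p x = orbit p z" if "z \<in> orbit p x" for x z
    using orbit_cyclic_eq3[OF cyclic_on_orbit'[OF perm] that] by simp
  show "orbit p x = orbit p y \<or> orbit p x \<inter> orbit p y = {}" using eq by blast
qed

lemma sum_card_orbits:
  assumes "finite S" "p permutes S" "A \<subseteq> S" shows "(\<Sum>X\<in>orbit p ` S. card (X \<inter> A)) = card A"
proof -
  note part = orbit_partition[OF assms(1,2)]
  have "card (\<Union>X\<in>orbit p ` S. X \<inter> A) = (\<Sum>X\<in>orbit p ` S. card (X \<inter> A))"
  proof (rule card_UN_disjoint)
    show "\<forall>X\<in>orbit p ` S. finite (X \<inter> A)" using assms(1,3) finite_subset by blast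
    show "\<forall>X\<in>orbit p ` S. \<forall>Y\<in>orbit p ` S. X \<noteq> Y \<longrightarrow> X \<inter> A \<inter> (Y \<inter> A) = {}" using part(2) by blast
  qed (use assms(1) in simp)
  moreover have "(\<Union>X\<in>orbit p ` S. X \<inter> A) = A" using part(1) assms(3) by blast
  ultimately show ?thesis by simp
qed

section \<open>Rotation systems and an upper bound for the genus\<close>

lemma rotation_system_exists:
  assumes fin: "finite D" shows "\<exists>r. rotation_system D r"
proof -
  define F where "F v = {e \<in> D. fst e = v}" for v
  have "\<forall>v. \<exists>f. f permutes F v \<and> (\<forall>x\<in>F v. orbit f x = F v)"
  proof
    fix v
    obtain cs where cs: "distinct cs" "set cs = F v"
      using finite_distinct_list[of "F v"] fin unfolding F_def by auto
    then show "\<exists>f. f permutes F v \<and> (\<forall>x\<in>F v. orbit f x = F v)"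
      using cycle_permutes[of cs] orbit_cycle_of_list[of cs] by (intro exI[of _ "cycle_of_list cs"]) simp
  qed
  then obtain f where "\<forall>v. f v permutes F v \<and> (\<forall>x\<in>F v. orbit (f v) x = F v)" by (rule choice[THEN exE])
  then have f: "\<And>v. f v permutes F v" "\<And>v x. x \<in> F v \<Longrightarrow> orbit (f v) x = F v" by blast+
  define r where "r d = (if d \<in> D then f (fst d) d else d)" for d
  have rF: "r d \<in> F (fst d)" if "d \<in> D" for d
    using that permutes_in_image[OF f(1)[of "fst d"], of d] unfolding r_def F_def by simp
  have "inj_on r D"
  proof (rule inj_onI)
    fix x y assume xy: "x \<in> D" "y \<in> D" "r x = r y"
    then have "fst x = fst y" using rF[of x] rF[of y] unfolding F_def by auto
    then show "x = y" using xy permutes_inj[OF f(1)[of "fst x"]] unfolding r_def by (auto dest: injD)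
  qed
  moreover have "r ` D \<subseteq> D" using rF unfolding F_def by auto
  ultimately have "bij_betw r D D" unfolding bij_betw_def using endo_inj_surj[OF fin] by blast
  then have per: "r permutes D" by (rule bij_imp_permutes) (simp add: r_def)
  have "orbit r d = F (fst d)" if d: "d \<in> D" for d
  proof -
    have dF: "d \<in> F (fst d)" using d unfolding F_def by simp
    have "orbit r d = orbit (f (fst d)) d"
    proof (rule orbit_cong0[OF dF])
      show "r \<in> F (fst d) \<rightarrow> F (fst d)" using rF unfolding F_def by auto
      show "r y = f (fst d) y" if "y \<in> F (fst d)" for y using that unfolding r_def F_def by auto
    qed
    then show ?thesis using f(2)[OF dF] by simp
  qed
  then show ?thesis unfolding rotation_system_def F_def using per by blast
qed

locale graph =
  fixes V :: "'v set" and D :: "('v \<times> 'v) set"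
  assumes finV: "finite V" and DV: "D \<subseteq> V \<times> V"
    and sym: "\<And>x y. (x, y) \<in> D \<Longrightarrow> (y, x) \<in> D" and irr: "\<And>x. (x, x) \<notin> D"
begin

lemma finD: "finite D" using DV finV finite_subset by blast

definition W where "W = fst ` D"

text \<open>\<open>permutes\<close> demands fixed points outside \<open>D\<close>, so the reversal
  of darts is cut off there; on \<open>D\<close> it agrees with \<open>prod.swap\<close> and yields
  the same faces.\<close>

definition \<alpha> where "\<alpha> d = (if d \<in> D then prod.swap d else d)"

lemma swapD: "d \<in> D \<longleftrightarrow> prod.swap d \<in> D" using sym by (cases d) auto

lemma \<alpha>_permutes: "\<alpha> permutes D"
proof (rule bij_imp_permutes)
  have "inj_on \<alpha> D" unfolding inj_on_def \<alpha>_def by auto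
  moreover have "\<alpha> ` D \<subseteq> D" using swapD unfolding \<alpha>_def by auto
  ultimately show "bij_betw \<alpha> D D" unfolding bij_betw_def using endo_inj_surj[OF finD] by blast
qed (simp add: \<alpha>_def)

lemma card_orbits_\<alpha>: "card D = 2 * card (orbit \<alpha> ` D)"
proof -
  have o: "card (X \<inter> D) = 2" if X: "X \<in> orbit \<alpha> ` D" for X
  proof -
    obtain d where d: "d \<in> D" "X = orbit \<alpha> d" using X by blast
    have "orbit \<alpha> d = {d, prod.swap d}"
    proof
      show "orbit \<alpha> d \<subseteq> {d, prod.swap d}"
      proof
        fix x assume "x \<in> orbit \<alpha> d" then show "x \<in> {d, prod.swap d}"
          by (induction rule: orbit.induct) (use d(1) swapD in \<open>auto simp: \<alpha>_def\<close>)
      qed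
      have "\<alpha> d \<in> orbit \<alpha> d" "\<alpha> (\<alpha> d) \<in> orbit \<alpha> d" by (auto intro: orbit.intros)
      then show "{d, prod.swap d} \<subseteq> orbit \<alpha> d" using d(1) swapD[of d] unfolding \<alpha>_def by auto
    qed
    moreover have "d \<noteq> prod.swap d" using d(1) irr by (cases d) auto
    moreover have "{d, prod.swap d} \<inter> D = {d, prod.swap d}" using d(1) swapD by auto
    ultimately show ?thesis using d(2) by simp
  qed
  have "card D = (\<Sum>X\<in>orbit \<alpha> ` D. card (X \<inter> D))" using sum_card_orbits[OF finD \<alpha>_permutes, of D] by simp
  also have "\<dots> = (\<Sum>X\<in>orbit \<alpha> ` D. 2)" by (rule sum.cong) (use o in auto)
  finally show ?thesis by simp
qed

lemma card_D_le: "card D \<le> card W ^ 2"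
proof -
  have "D \<subseteq> W \<times> W"
  proof
    fix d assume "d \<in> D"
    then show "d \<in> W \<times> W" using sym[of "fst d" "snd d"] unfolding W_def by (cases d) force
  qed
  then have "card D \<le> card (W \<times> W)" using finD by (intro card_mono) (auto simp: W_def)
  then show ?thesis by (simp add: power2_eq_square card_cartesian_product)
qed

text \<open>Any rotation system will do. Let E, N and W count the edges, the faces with darts and
  the non-isolated vertices. If E - W - N is even and nonnegative, half of it together with the
  number of components solves Euler's equation, and the least solution is no larger. Faces have at
  least three darts apart from those of isolated edges, so 3 N is at most 2 E + W, and with E at
  least 4 W this gives W + N \<le> E. The final estimate uses that E is at most the square of
  W.\<close>

lemma genus_le:
  assumes dense: "8 * card W \<le> card D"
  shows "2 * genus V D \<le> card W + card W ^ 2"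
proof -
  obtain r where r: "rotation_system D r" using rotation_system_exists[OF finD] by blast
  then have rp: "r permutes D" and ro: "\<And>d. d \<in> D \<Longrightarrow> orbit r d = {e \<in> D. fst e = fst d}"
    unfolding rotation_system_def by auto
  define \<phi> where "\<phi> = r \<circ> \<alpha>"
  have \<phi>p: "\<phi> permutes D" unfolding \<phi>_def by (rule permutes_compose[OF \<alpha>_permutes rp])
  have orb: "orbit (r \<circ> prod.swap) d = orbit \<phi> d" if d: "d \<in> D" for d
    by (rule orbit_cong0[OF d]) (use swapD permutes_in_image[OF rp] in \<open>auto simp: \<phi>_def \<alpha>_def\<close>)
  define N where "N = card (orbit \<phi> ` D)"
  define iso where "iso = card (V - W)"
  define c where "c = num_components V D"
  define E where "E = card (orbit \<alpha> ` D)"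
  have D2E: "card D = 2 * E" unfolding E_def by (rule card_orbits_\<alpha>)
  have faces: "num_faces V D r = N + iso"
    unfolding num_faces_def N_def iso_def W_def using orb by (simp cong: image_cong)
  have WV: "W \<subseteq> V" using DV unfolding W_def by auto
  have finW: "finite W" using WV finV finite_subset by blast
  have cardV: "card V = card W + iso"
    unfolding iso_def using card_Diff_subset[OF finW WV] card_mono[OF finV WV] by simp
  have rW: "card (orbit r ` D) = card W"
  proof -
    have "orbit r ` D = (\<lambda>v. {e \<in> D. fst e = v}) ` W" using ro unfolding W_def image_image by (intro image_cong) auto
    moreover have "inj_on (\<lambda>v. {e \<in> D. fst e = v}) W" unfolding W_def by (rule inj_onI) force
    ultimately show ?thesis by (simp add: card_image)
  qed
  \<comment> \<open>The number of darts is even, so each sign is the parity of the number of orbits.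
    The orbits of \<open>\<phi>\<close>, \<open>r\<close> and \<open>\<alpha>\<close> are the faces,
    the vertices and the edges, and \<open>\<phi>\<close> is the product of the other two.\<close>
  have parity: "even N \<longleftrightarrow> (even (card W) \<longleftrightarrow> even E)"
  proof -
    have "permutation r" "permutation \<alpha>" using rp \<alpha>_permutes finD by (auto simp: permutation_permutes)
    then have "evenperm \<phi> \<longleftrightarrow> (evenperm r \<longleftrightarrow> evenperm \<alpha>)" unfolding \<phi>_def by (rule evenperm_comp)
    moreover have "evenperm \<phi> \<longleftrightarrow> even N" "evenperm r \<longleftrightarrow> even (card W)" "evenperm \<alpha> \<longleftrightarrow> even E"
      using evenperm_orbits[OF finD \<phi>p] evenperm_orbits[OF finD rp] evenperm_orbits[OF finD \<alpha>_permutes]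
      unfolding N_def[symmetric] rW E_def[symmetric] D2E by auto
    ultimately show ?thesis by simp
  qed
  text \<open>Only an isolated edge has a face of length less than three.\<close>
  define D2 where "D2 = {d \<in> D. \<phi> (\<phi> d) = d}"
  have face_fst: "fst (\<phi> d) = snd d" if d: "d \<in> D" for d
  proof -
    have "prod.swap d \<in> D" using d swapD by blast
    moreover have "r (prod.swap d) \<in> orbit r (prod.swap d)" by (rule orbit.base)
    ultimately show ?thesis using ro[of "prod.swap d"] d unfolding \<phi>_def \<alpha>_def by auto
  qed
  have \<phi>D: "\<phi> d \<in> D" if "d \<in> D" for d using permutes_in_image[OF \<phi>p] that by blast
  have D2: "{e \<in> D. fst e = fst d} = {d}" if d: "d \<in> D2" for d
  proof -
    have dD: "d \<in> D" and dd: "\<phi> (\<phi> d) = d" using d unfolding D2_def by auto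
    have "snd (\<phi> d) = fst d" using face_fst[OF \<phi>D[OF dD]] dd by simp
    then have "\<phi> d = prod.swap d" using face_fst[OF dD] by (simp add: prod_eq_iff)
    then have "r d = d" using dd dD swapD unfolding \<phi>_def \<alpha>_def by auto
    then have "orbit r d = {d}" by (simp add: orbit_eq_singleton_iff)
    then show ?thesis using ro[OF dD] by simp
  qed
  have cD2: "card D2 \<le> card W"
  proof (rule card_inj_on_le[of fst])
    show "inj_on fst D2"
    proof (rule inj_onI)
      fix x y assume xy: "x \<in> D2" "y \<in> D2" "fst x = fst y"
      then have "y \<in> {e \<in> D. fst e = fst x}" unfolding D2_def by auto
      then show "x = y" using D2[OF xy(1)] by simp
    qed
    show "fst ` D2 \<subseteq> W" unfolding D2_def W_def by auto
  qed (rule finW)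
  \<comment> \<open>Darts in \<open>D2\<close> count twice, which lifts a face with two darts above
    3.\<close>
  have big: "3 \<le> card (X \<inter> D) + card (X \<inter> D2)" if X: "X \<in> orbit \<phi> ` D" for X
  proof -
    obtain d where d: "d \<in> D" "X = orbit \<phi> d" using X by blast
    have XD: "X \<subseteq> D" using permutes_orbit_subset[OF \<phi>p d(1)] d(2) by simp
    have finX: "finite X" using XD finD finite_subset by blast
    have perm: "permutation \<phi>" using \<phi>p finD by (auto simp: permutation_permutes)
    have in1: "d \<in> X" "\<phi> d \<in> X" "\<phi> (\<phi> d) \<in> X"
      using permutation_self_in_orbit[OF perm, of d] d(2) by (auto intro: orbit.intros)
    have ne: "\<phi> e \<noteq> e" if "e \<in> D" for e using face_fst[OF that] that irr by (cases e) auto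
    show ?thesis
    proof (cases "\<phi> (\<phi> d) = d")
      case True
      then have "{d, \<phi> d} \<subseteq> X \<inter> D" "{d, \<phi> d} \<subseteq> X \<inter> D2" using in1 d(1) \<phi>D unfolding D2_def by auto
      then have "card {d, \<phi> d} \<le> card (X \<inter> D)" "card {d, \<phi> d} \<le> card (X \<inter> D2)" using finX by (auto intro!: card_mono)
      moreover have "card {d, \<phi> d} = 2" using ne[OF d(1)] by auto
      ultimately show ?thesis by linarith
    next
      case False
      have "{d, \<phi> d, \<phi> (\<phi> d)} \<subseteq> X \<inter> D" using in1 XD by auto
      then have "card {d, \<phi> d, \<phi> (\<phi> d)} \<le> card (X \<inter> D)" using finX by (auto intro!: card_mono)
      moreover have "card {d, \<phi> d, \<phi> (\<phi> d)} = 3" using False ne[OF d(1)] ne[OF \<phi>D[OF d(1)]] by auto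
      ultimately show ?thesis by linarith
    qed
  qed
  have "3 * N \<le> (\<Sum>X\<in>orbit \<phi> ` D. card (X \<inter> D) + card (X \<inter> D2))"
  proof -
    have "(\<Sum>X\<in>orbit \<phi> ` D. 3) \<le> (\<Sum>X\<in>orbit \<phi> ` D. card (X \<inter> D) + card (X \<inter> D2))"
      by (rule sum_mono) (rule big)
    then show ?thesis unfolding N_def by (simp add: mult.commute)
  qed
  also have "\<dots> = card D + card D2"
    using sum_card_orbits[OF finD \<phi>p, of D] sum_card_orbits[OF finD \<phi>p, of D2]
    by (simp add: sum.distrib D2_def)
  finally have N3: "3 * N \<le> 2 * E + card W" using cD2 D2E by simp
  have quot: "V // (D\<^sup>* \<inter> V \<times> V) = (\<lambda>v. (D\<^sup>* \<inter> V \<times> V) `` {v}) ` V" unfolding quotient_def by auto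
  have c_le: "c \<le> card W + iso" unfolding c_def num_components_def quot cardV[symmetric] by (rule card_image_le[OF finV])
  have c_ge: "iso \<le> c"
  proof -
    have cls: "(D\<^sup>* \<inter> V \<times> V) `` {v} = {v}" if v: "v \<in> V - W" for v
    proof -
      have "w = v" if vw: "(v, w) \<in> D\<^sup>*" for w
        using vw
      proof (cases rule: converse_rtranclE)
        case (step z)
        then have "v \<in> W" unfolding W_def by (intro image_eqI[of _ _ "(v, z)"]) simp_all
        then show ?thesis using v by simp
      qed simp
      then show ?thesis using v by blast
    qed
    have "(\<lambda>v. {v}) ` (V - W) \<subseteq> V // (D\<^sup>* \<inter> V \<times> V)" 
    proof
      fix X assume "X \<in> (\<lambda>v. {v}) ` (V - W)"
      then obtain v where v: "v \<in> V - W" "X = {v}" by blast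
      then show "X \<in> V // (D\<^sup>* \<inter> V \<times> V)" unfolding quot using cls[OF v(1)] by (intro image_eqI[of _ _ v]) simp_all
    qed
    moreover have "finite (V // (D\<^sup>* \<inter> V \<times> V))" unfolding quot using finV by simp
    ultimately have "card ((\<lambda>v. {v}) ` (V - W)) \<le> card (V // (D\<^sup>* \<inter> V \<times> V))" by (intro card_mono)
    then show ?thesis unfolding iso_def c_def num_components_def by (simp add: card_image)
  qed
  have E4: "4 * card W \<le> E" using dense D2E by simp
  have le: "card W + N \<le> E" using N3 E4 by linarith
  have "even (E - (card W + N))" using parity le by auto
  then obtain m where "E - (card W + N) = 2 * m" by (rule evenE)
  then have m: "E = card W + N + 2 * m" using le by simp
  \<comment> \<open>An isolated vertex adds one vertex, one face and one component, which cancels in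
    the equation. The other components and the surplus \<open>m\<close> remain.\<close>
  define g where "g = (c - iso) + m"
  have eq: "int (card V) - int (card D div 2) + int (num_faces V D r) = 2 * int (num_components V D) - 2 * int g"
    unfolding cardV faces c_def[symmetric] g_def using D2E m c_ge by (simp add: of_nat_diff)
  then have "genus V D \<le> g" unfolding genus_def using r by (intro Least_le exI[of _ r] conjI)
  moreover have "2 * g \<le> card W + E" unfolding g_def using c_le c_ge m by simp
  moreover have "E \<le> card W ^ 2" using card_D_le D2E by simp
  ultimately show ?thesis by linarith
qed

end

section \<open>Hardness\<close>

context assembly begin

lemma assemble_nth:
  "j < length C' \<Longrightarrow> assemble n B ts xs ! j = C' ! j"
  "assemble n B ts xs ! length C' = AndGate (js @ xs)"
  "length (assemble n B ts xs) = Suc (length C')"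
  by (simp_all add: assemble_eq nth_append)

end

text \<open>Literals occupy the first \<open>nl\<close> positions and are followed by clauses over
  the first \<open>lb\<close> of them. Literals from \<open>lb\<close> on feed at most the output
  gate, so they are isolated in the graph that determines the genus.\<close>

locale pi_assembly = assembly +
  fixes nl :: nat
  assumes lb_nl: "lb \<le> nl" and nl_B: "nl \<le> length B"
    and lits: "\<And>j. j < nl \<Longrightarrow> is_literal (B ! j)"
    and ors: "\<And>j. nl \<le> j \<Longrightarrow> j < length B \<Longrightarrow> \<exists>us. B ! j = OrGate us \<and> set us \<subseteq> {..<lb}"
begin

lemma nbrs_base: "j < length B \<Longrightarrow> in_nbrs (C' ! j) \<subseteq> {..<lb}"
proof (cases "j < nl")
  case True
  then show "j < length B \<Longrightarrow> ?thesis" using lits[of j] C'_nth[of j] by (cases "B ! j") auto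
next
  case False
  then show "j < length B \<Longrightarrow> ?thesis" using ors[of j] C'_nth[of j] by auto
qed

lemma nbrs_new: "length B \<le> j \<Longrightarrow> j < length C' \<Longrightarrow> in_nbrs (C' ! j) \<subseteq> {..<lb} \<union> {length B..<j}"
  by (rule extD(2)[OF ext])

lemma nbrs_baseD: "j < length B \<Longrightarrow> i \<in> in_nbrs (C' ! j) \<Longrightarrow> i < lb"
  using nbrs_base by blast

lemma nbrs_newD: "length B \<le> j \<Longrightarrow> j < length C' \<Longrightarrow> i \<in> in_nbrs (C' ! j) \<Longrightarrow> i < lb \<or> length B \<le> i"
  using nbrs_new by fastforce

lemma gate_ge_nl: "j < length C' \<Longrightarrow> \<not> is_literal (C' ! j) \<Longrightarrow> nl \<le> j"
  using lits[of j] C'_nth[of j] nl_B by (cases "j < nl") auto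

lemma root_child:
  assumes "i \<in> set (js @ xs)" "\<not> is_literal (C' ! i)" shows "\<not> is_and (C' ! i)"
proof (cases "i < length B")
  case True
  then have "nl \<le> i" using assms(2) gate_ge_nl[of i] length_C' by simp
  then show ?thesis using ors[of i] True C'_nth[of i] by auto
next
  case False
  then have "i \<in> set js" using assms(1) xs_less by auto
  then show ?thesis using extD(4)[OF ext, of i] False lb by auto
qed

text \<open>Clauses of the base are used by the output gate only; a gate of a tree is used by its
  parent there or, if it is a root, by the output gate.\<close>

lemma unique_parent:
  assumes i: "\<not> is_literal (C' ! i)" "i < length C'"
    and j: "j \<le> length C'" "i \<in> in_nbrs (assemble n B ts xs ! j)"
    and j': "j' \<le> length C'" "i \<in> in_nbrs (assemble n B ts xs ! j')"
  shows "j = j'"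
proof -
  have inl: "nl \<le> i" by (rule gate_ge_nl[OF i(2,1)])
  have new: "length B \<le> l \<and> length B \<le> i" if "l < length C'" "i \<in> in_nbrs (C' ! l)" for l
  proof -
    have "\<not> l < length B" using nbrs_baseD[of l i] that(2) inl lb_nl by linarith
    then show ?thesis using nbrs_newD[of l i] that inl lb_nl by linarith
  qed
  have root: "i \<notin> set (js @ xs)" if l: "l < length C'" "i \<in> in_nbrs (C' ! l)" for l
  proof
    assume "i \<in> set (js @ xs)"
    moreover have "i \<notin> set xs" using new[OF l] xs_less by fastforce
    ultimately have "i \<in> set js" by simp
    then show False using extD(4)[OF ext, of i] new[OF l] l lb_nl inl lb by auto
  qed
  have nb: "i \<in> in_nbrs (assemble n B ts xs ! l) \<longleftrightarrow> (if l = length C' then i \<in> set (js @ xs) else i \<in> in_nbrs (C' ! l))"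
    if "l \<le> length C'" for l using that assemble_nth by (cases "l = length C'") auto
  show ?thesis
  proof (cases "j = length C' \<or> j' = length C'")
    case True
    then show ?thesis using root[of j] root[of j'] nb[OF j(1)] nb[OF j'(1)] j j' by (auto split: if_splits)
  next
    case False
    then have l: "j < length C'" "j' < length C'" "i \<in> in_nbrs (C' ! j)" "i \<in> in_nbrs (C' ! j')"
      using j j' nb[OF j(1)] nb[OF j'(1)] by auto
    then show ?thesis using extD(3)[OF ext, of j j' i] new by blast
  qed
qed

lemma Pi_circuit_assemble:
  assumes "depth (assemble n B ts xs) \<le> t"
  shows "Pi_circuit t (assemble n B ts xs)"
proof -
  let ?C = "assemble n B ts xs"
  obtain gs where gs: "C' = B @ gs" "\<forall>v\<in>set gs. \<not> is_literal v \<and> \<not> is_not v \<and> in_nbrs v \<noteq> {}"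
    using C'_ext by blast
  have B_not: "\<not> is_not v" if v: "v \<in> set B" for v
  proof -
    obtain j where j: "j < length B" "v = B ! j" using v by (auto simp: in_set_conv_nth)
    show ?thesis
    proof (cases "j < nl")
      case True
      then have "is_literal v" using lits[OF True] j(2) by simp
      then show ?thesis by (cases v) auto
    next
      case False
      then show ?thesis using ors[of j] j by auto
    qed
  qed
  have not: "\<not> is_not v" if "v \<in> set ?C" for v
    using that gs B_not unfolding assemble_eq by auto
  have out: "outdegree ?C i \<le> 1" if i: "i < length ?C" "\<not> is_literal (?C ! i)" for i
  proof (cases "i = length C'")
    case True
    have "i \<notin> in_nbrs (?C ! j)" if "j < length ?C" for j
      using is_circuit_assemble that True assemble_nth(3) unfolding is_circuit_def by fastforce
    then have "{j. j < length ?C \<and> i \<in> in_nbrs (?C ! j)} = {}" by blast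
    then show ?thesis unfolding outdegree_def by (simp only: card.empty le0)
  next
    case False
    then have i': "i < length C'" using i(1) assemble_nth(3) by simp
    then have il: "\<not> is_literal (C' ! i)" using i(2) assemble_nth(1) by simp
    have "\<forall>a\<in>{j. j < length ?C \<and> i \<in> in_nbrs (?C ! j)}. \<forall>b\<in>{j. j < length ?C \<and> i \<in> in_nbrs (?C ! j)}. a = b"
      using unique_parent[OF il i'] assemble_nth(3) by (auto simp: less_Suc_eq_le)
    then show ?thesis unfolding outdegree_def by (subst One_nat_def, subst card_le_Suc0_iff_eq) auto
  qed
  have alt: "is_and (?C ! i) \<noteq> is_and (?C ! j)" if j: "j < length ?C" "i \<in> in_nbrs (?C ! j)" "\<not> is_literal (?C ! i)" for i j
  proof -
    have ij: "i < j" using is_circuit_assemble j(1,2) unfolding is_circuit_def by blast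
    then have i: "i < length C'" "?C ! i = C' ! i" using j(1) assemble_nth by auto
    show ?thesis
    proof (cases "j = length C'")
      case True
      then show ?thesis using root_child[of i] j(2,3) i assemble_nth(2) by auto
    next
      case False
      then have jj: "j < length C'" "?C ! j = C' ! j" using j(1) assemble_nth by auto
      have inl: "nl \<le> i" using gate_ge_nl[of i] i j(3) by simp
      have nb: "i \<in> in_nbrs (C' ! j)" using j(2) jj by simp
      have "\<not> j < length B" using nbrs_baseD[OF _ nb] inl lb_nl by linarith
      moreover from this have "length B \<le> i" using nbrs_newD[OF _ jj(1) nb] inl lb_nl by linarith
      ultimately show ?thesis using extD(5)[OF ext, of j i] j(2) jj i by simp
    qed
  qed
  have "last ?C = AndGate (js @ xs)" by (simp add: assemble_eq)
  then show ?thesis unfolding Pi_circuit_def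
    using is_circuit_assemble assms not out alt by auto
qed

text \<open>The \<open>m\<close> equal clauses over the same \<open>m\<close> literals form a
  complete bipartite graph with \<open>2 * (m * m)\<close> darts. At most \<open>3 * m\<close>
  vertices are not isolated, so \<open>12 \<le> m\<close> yields the eight darts per vertex that
  \<open>genus_le\<close> asks for.\<close>

lemma genus_assemble:
  fixes m p :: nat
  assumes pads: "\<And>b. b < m \<Longrightarrow> B ! (nl + b) = OrGate [p..<p + m]" "nl + m \<le> length B" "p + m \<le> lb"
    and W3: "lb + (length C' - nl) \<le> 3 * m" "12 \<le> m"
  shows "2 * circuit_genus (assemble n B ts xs) \<le> 3 * m + (3 * m) ^ 2"
proof -
  let ?C = "assemble n B ts xs"
  define V where "V = {..<length C'}"
  define D where "D = {(i, j) \<in> V \<times> V. i \<in> in_nbrs (C' ! j) \<or> j \<in> in_nbrs (C' ! i)}"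
  have D_eq: "{(i, j) \<in> V \<times> V. i \<in> in_nbrs (?C ! j) \<or> j \<in> in_nbrs (?C ! i)} = D"
    unfolding D_def V_def using assemble_nth(1) by auto
  have g: "circuit_genus ?C = genus V D"
    unfolding circuit_genus_def Let_def assemble_nth(3) diff_Suc_1 V_def[symmetric] D_eq ..
  interpret graph V D
  proof
    show "finite V" "D \<subseteq> V \<times> V" unfolding V_def D_def by auto
    show "(y, x) \<in> D" if "(x, y) \<in> D" for x y using that unfolding D_def by auto
    show "(x, x) \<notin> D" for x using in_nbrs_C'[of x] unfolding D_def V_def by auto
  qed
  have "W \<subseteq> {..<lb} \<union> {nl..<length C'}"
  proof
    fix i assume "i \<in> W"
    then obtain j where "(i, j) \<in> D" unfolding W_def by auto
    then have ij: "i < length C'" "j < length C'" "i \<in> in_nbrs (C' ! j) \<or> j \<in> in_nbrs (C' ! i)"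
      unfolding D_def V_def by auto
    show "i \<in> {..<lb} \<union> {nl..<length C'}"
    proof (cases "i \<in> in_nbrs (C' ! j)")
      case True
      then have "i < lb \<or> length B \<le> i" using nbrs_baseD[OF _ True] nbrs_newD[OF _ ij(2) True] by linarith
      then show ?thesis using ij(1) nl_B by auto
    next
      case False
      then have "\<not> is_literal (C' ! i)" using ij(3) by (cases "C' ! i") auto
      then show ?thesis using gate_ge_nl[OF ij(1)] ij(1) by simp
    qed
  qed
  then have "card W \<le> card ({..<lb} \<union> {nl..<length C'})" by (intro card_mono) auto
  also have "\<dots> \<le> lb + (length C' - nl)" using card_Un_le[of "{..<lb}" "{nl..<length C'}"] by simp
  finally have cW: "card W \<le> 3 * m" using W3 by linarith
  \<comment> \<open>The darts from the padding literals to the padding clauses; \<open>D2\<close>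
    holds their reversals.\<close>
  define D1 where "D1 = (\<lambda>x. (p + fst x, nl + snd x)) ` ({..<m} \<times> {..<m})"
  define D2 where "D2 = prod.swap ` D1"
  have "inj_on (\<lambda>x. (p + fst x, nl + snd x)) ({..<m} \<times> {..<m})"
    by (rule inj_onI) (simp add: prod_eq_iff)
  then have c1: "card D1 = m * m" unfolding D1_def by (simp add: card_image card_cartesian_product)
  have c2: "card D2 = m * m" unfolding D2_def by (simp add: card_image c1)
  have lt: "fst d < nl \<and> nl \<le> snd d" if "d \<in> D1" for d
    using that pads(3) lb_nl unfolding D1_def by auto
  have disj: "D1 \<inter> D2 = {}"
  proof -
    have False if d: "d \<in> D1" "d \<in> D2" for d
    proof -
      obtain d' where "d' \<in> D1" "d = prod.swap d'" using d(2) unfolding D2_def by blast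
      then show False using lt[of d'] lt[OF d(1)] by simp
    qed
    then show ?thesis by blast
  qed
  have "D1 \<subseteq> D"
  proof
    fix d assume "d \<in> D1"
    then obtain x where x: "fst x < m" "snd x < m" "d = (p + fst x, nl + snd x)" unfolding D1_def by auto
    have nb: "nl + snd x < length B" using pads(2) x(2) by simp
    then have "in_nbrs (C' ! (nl + snd x)) = {p..<p + m}" using C'_nth[of "nl + snd x"] pads(1)[OF x(2)] by simp
    then have "p + fst x \<in> in_nbrs (C' ! (nl + snd x))" using x(1) by simp
    moreover have "nl + snd x < length C'" "p + fst x < length C'" using nb length_C' pads(3) lb x(1) by auto
    ultimately show "d \<in> D" using x(3) unfolding D_def V_def by simp
  qed
  moreover from this have "D2 \<subseteq> D" unfolding D2_def using swapD by blast
  ultimately have "card (D1 \<union> D2) \<le> card D" by (intro card_mono[OF finD]) blast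
  moreover have "finite D1" "finite D2" unfolding D2_def D1_def by auto
  ultimately have cD: "2 * (m * m) \<le> card D" using card_Un_disjoint[of D1 D2] disj c1 c2 by simp
  have "24 * m \<le> 2 * (m * m)" using mult_le_mono1[OF W3(2), of m] by simp
  then have "8 * card W \<le> card D" using cD cW by linarith
  from genus_le[OF this] have "2 * genus V D \<le> card W + card W ^ 2" .
  also have "\<dots> \<le> 3 * m + (3 * m) ^ 2" using cW by (intro add_mono power_mono) auto
  finally show ?thesis unfolding g .
qed

end

section \<open>The circuit of the hardness reduction\<close>

definition vlist :: "circuit \<Rightarrow> nat list" where
  "vlist C = map vnum (filter (\<lambda>w. vtag w \<le> 1) C)"

text \<open>A sum in place of a maximum: it exceeds all variables and, numbers being encoded in
  unary, stays below the size of the circuit.\<close>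

definition vbound :: "circuit \<Rightarrow> nat" where
  "vbound C = fold (\<lambda>w b. b + (vnum w + 1)) C 0"

lemma vlist_vars: "set (vlist C) = vars C"
proof -
  have "x \<in> set (vlist C) \<longleftrightarrow> x \<in> vars C" for x
  proof
    assume "x \<in> set (vlist C)"
    then obtain w where "w \<in> set C" "is_literal w" "x = vnum w" unfolding vlist_def vertex_by_tag(1) by auto
    moreover from this(2) obtain b y where "w = Literal b y" by (cases w) auto
    ultimately show "x \<in> vars C" unfolding vars_def by (auto simp: vnum_def)
  next
    assume "x \<in> vars C"
    then obtain b where "Literal b x \<in> set C" unfolding vars_def by blast
    then show "x \<in> set (vlist C)" unfolding vlist_def vertex_by_tag(1)
      by (auto simp: vnum_def intro!: image_eqI[of _ _ "Literal b x"])
  qed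
  then show ?thesis by blast
qed

lemma distinct_vlist:
  assumes "is_circuit C" "\<And>b x. Literal b x \<in> set C \<Longrightarrow> b = s" shows "distinct (vlist C)"
proof -
  have "distinct (filter is_literal C)" using assms(1) by (simp add: is_circuit_def)
  moreover have "inj_on vnum (set (filter is_literal C))"
  proof (rule inj_onI)
    fix v w assume a: "v \<in> set (filter is_literal C)" "w \<in> set (filter is_literal C)" "vnum v = vnum w"
    then have "is_literal v" "is_literal w" by auto
    then obtain b x b' x' where "v = Literal b x" "w = Literal b' x'" by (metis is_literal.elims(2))
    then show "v = w" using a assms(2)[of b x] assms(2)[of b' x'] by (simp add: vnum_def)
  qed
  ultimately show ?thesis unfolding vlist_def vertex_by_tag(1) by (simp add: distinct_map)
qed

lemma vbound_less: "x \<in> vars C \<Longrightarrow> x < vbound C"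
proof -
  have mono: "b \<le> fold (\<lambda>w b. b + (vnum w + 1)) C b" for b
  proof (induction C arbitrary: b)
    case (Cons w C) from Cons[of "b + (vnum w + 1)"] show ?case by simp
  qed simp
  have "w \<in> set C \<Longrightarrow> vnum w < fold (\<lambda>w b. b + (vnum w + 1)) C b" for w b
  proof (induction C arbitrary: b)
    case (Cons v C)
    have m: "b' \<le> fold (\<lambda>w b. b + (vnum w + 1)) C b'" for b'
    proof (induction C arbitrary: b')
      case (Cons w C) from Cons[of "b' + (vnum w + 1)"] show ?case by simp
    qed simp
    show ?case
    proof (cases "w = v")
      case True then show ?thesis using m[of "b + (vnum v + 1)"] by simp
    next
      case False then show ?thesis using Cons.IH[of "b + (vnum v + 1)"] Cons.prems by simp
    qed
  qed simp
  moreover assume "x \<in> vars C"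
  then obtain w where "w \<in> set C" "vnum w = x" unfolding vars_def by (auto simp: vnum_def intro!: that[of "Literal _ x"])
  ultimately show ?thesis unfolding vbound_def by blast
qed

definition conflicts :: "nat \<Rightarrow> (nat \<times> nat \<times> nat) list list \<Rightarrow> (nat \<times> nat) list" where
  "conflicts k tu = filter (\<lambda>p. conflict k (nthd [] tu (fst p)) (nthd [] tu (snd p)))
     (List.product [0..<length tu] [0..<length tu])"

text \<open>Layout: \<open>M0\<close> variables for tuples, \<open>P\<close> dummies,
  \<open>mm\<close> equal clauses over the first \<open>mm\<close> dummies, and one binary clause
  per conflict. The equal clauses are there for their edges; they hold as soon as the dummies are
  false.\<close>

definition pad_base :: "nat \<Rightarrow> nat \<Rightarrow> nat \<Rightarrow> (nat \<times> nat) list \<Rightarrow> circuit" where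
  "pad_base M0 P mm cf = map (Literal False) [0..<M0 + P] @ replicate mm (OrGate [M0..<M0 + mm])
     @ map (\<lambda>p. OrGate [fst p, snd p]) cf"

lemma pad_base_nth:
  "j < M0 + P \<Longrightarrow> pad_base M0 P mm cf ! j = Literal False j"
  "b < mm \<Longrightarrow> pad_base M0 P mm cf ! (M0 + P + b) = OrGate [M0..<M0 + mm]"
  "i < length cf \<Longrightarrow> pad_base M0 P mm cf ! (M0 + P + mm + i) = OrGate [fst (cf ! i), snd (cf ! i)]"
  "length (pad_base M0 P mm cf) = M0 + P + mm + length cf"
  by (simp_all add: pad_base_def nth_append)

lemma pad_base_nth_ge:
  assumes "M0 + P \<le> j" "j < length (pad_base M0 P mm cf)"
  obtains "pad_base M0 P mm cf ! j = OrGate [M0..<M0 + mm]" "mm > 0"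
    | a b where "(a, b) \<in> set cf" "pad_base M0 P mm cf ! j = OrGate [a, b]"
proof (cases "j < M0 + P + mm")
  case True
  then show ?thesis using that(1) pad_base_nth(2)[of "j - (M0 + P)" mm M0 P cf] assms(1) by auto
next
  case False
  then have i: "j - (M0 + P + mm) < length cf" using assms(2) pad_base_nth(4) by simp
  then have "pad_base M0 P mm cf ! j = OrGate [fst (cf ! (j - (M0 + P + mm))), snd (cf ! (j - (M0 + P + mm)))]"
    using pad_base_nth(3)[OF i, of M0 P mm] False by simp
  then show ?thesis using that(2) nth_mem[OF i] by (metis prod.collapse)
qed

lemma is_circuit_pad_base:
  assumes "set cf \<subseteq> {..<M0} \<times> {..<M0}" "0 < P" "mm \<le> P" shows "is_circuit (pad_base M0 P mm cf)"
proof -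
  let ?B = "pad_base M0 P mm cf"
  have "in_nbrs (?B ! j) \<subseteq> {..<j} \<and> (\<not> is_literal (?B ! j) \<longrightarrow> in_nbrs (?B ! j) \<noteq> {})" if j: "j < length ?B" for j
  proof (cases "j < M0 + P")
    case True then show ?thesis by (simp add: pad_base_nth(1))
  next
    case False
    then have ge: "M0 + P \<le> j" by simp
    show ?thesis
    proof (rule pad_base_nth_ge[OF ge j])
      assume "?B ! j = OrGate [M0..<M0 + mm]" "mm > 0"
      then show ?thesis using ge \<open>mm \<le> P\<close> by auto
    next
      fix a b assume "(a, b) \<in> set cf" "?B ! j = OrGate [a, b]"
      then show ?thesis using assms(1) ge by auto
    qed
  qed
  moreover have "distinct (filter is_literal ?B)"
  proof -
    have "filter is_literal ?B = map (Literal False) [0..<M0 + P]"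
      unfolding pad_base_def by (auto simp: filter_map o_def filter_empty_conv)
    then show ?thesis by (simp add: distinct_map inj_on_def)
  qed
  moreover have "?B \<noteq> []" using assms(2) by (simp add: pad_base_def)
  ultimately show ?thesis unfolding is_circuit_def by (auto simp: in_set_conv_nth)
qed

text \<open>Tuple variables, conflict clauses and tree gates together number at most this many. With
  the two sides of the bipartite part there are at most three times as many non-isolated vertices;
  the 16 ensures the minimal width in \<open>genus_assemble\<close>.\<close>

definition pad_width :: "nat \<Rightarrow> nat \<Rightarrow> (nat \<times> nat \<times> nat) list list \<Rightarrow> nat ntree list \<Rightarrow> nat" where
  "pad_width m k tu ts = length tu + length (conflicts k tu) + length (fst (sers (2 * m) False ts ([], []))) + 16"

text \<open>The first summand provides the dummies of the bipartite part. The second makes the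
  number of variables so large that \<open>g\<close> exceeds the square of
  \<open>3 * mm\<close>.\<close>

definition pad_count :: "nat \<Rightarrow> nat \<Rightarrow> nat \<Rightarrow> nat" where
  "pad_count e q mm = mm + (3 * mm + q) ^ e"

definition hard_circuit :: "nat \<Rightarrow> nat \<Rightarrow> nat \<Rightarrow> nat \<Rightarrow> (nat \<times> nat \<times> nat) list list \<Rightarrow> nat ntree list \<Rightarrow> circuit" where
  "hard_circuit m e q k tu ts = assemble (2 * m)
     (pad_base (length tu) (pad_count e q (pad_width m k tu ts)) (pad_width m k tu ts) (conflicts k tu)) ts
     ([length tu..<length tu + pad_count e q (pad_width m k tu ts)] @
      [length tu + pad_count e q (pad_width m k tu ts)..<
        length tu + pad_count e q (pad_width m k tu ts) + pad_width m k tu ts + length (conflicts k tu)])"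

text \<open>Trees of depth \<open>2 * m\<close> below the output give depth
  \<open>2 * m + 1\<close>, while the binary clauses need depth 2; the maximum matters for
  \<open>m = 0\<close> only. The output gate takes the negated dummies directly, which forces the
  dummies to be false and thereby satisfies the padding clauses.\<close>

lemma hard_circuit:
  fixes m e q k :: nat and tu :: "(nat \<times> nat \<times> nat) list list" and ts :: "nat ntree list"
  assumes ts: "\<And>t. t \<in> set ts \<Longrightarrow> tok (Suc (length tu)) (2 * m) t"
  defines "mm \<equiv> pad_width m k tu ts" and "P \<equiv> pad_count e q (pad_width m k tu ts)"
  defines "C \<equiv> hard_circuit m e q k tu ts"
  shows "Pi_circuit (max (2 * m + 1) 2) C" "antimonotone C" "vars C = {..<length tu + P}"
    "2 * circuit_genus C \<le> 3 * mm + (3 * mm) ^ 2"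
    "satisfies A C \<longleftrightarrow> (\<forall>t\<in>set ts. ev (\<lambda>i. i \<notin> A) False t) \<and> (\<forall>i\<in>{length tu..<length tu + P}. i \<notin> A) \<and>
       (\<forall>p\<in>set (conflicts k tu). fst p \<notin> A \<or> snd p \<notin> A)"
proof -
  let ?M = "length tu"
  define cf where "cf = conflicts k tu"
  define B where "B = pad_base ?M P mm cf"
  define xs where "xs = [?M..<?M + P] @ [?M + P..<?M + P + mm + length cf]"
  have C: "C = assemble (2 * m) B ts xs"
    unfolding C_def hard_circuit_def B_def xs_def mm_def P_def cf_def ..
  have mm: "16 \<le> mm" "mm \<le> P" unfolding mm_def P_def pad_width_def pad_count_def by simp_all
  have cf: "set cf \<subseteq> {..<?M} \<times> {..<?M}" unfolding cf_def conflicts_def by auto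
  have icB: "is_circuit B" unfolding B_def by (rule is_circuit_pad_base[OF cf]) (use mm in simp_all)
  have lenB: "length B = ?M + P + mm + length cf" unfolding B_def by (rule pad_base_nth(4))
  have lit: "B ! j = Literal False j" if "j < ?M + P" for j unfolding B_def by (rule pad_base_nth(1)[OF that])
  have org: "\<exists>us. B ! j = OrGate us \<and> set us \<subseteq> {..<?M + mm}" if j: "?M + P \<le> j" "j < length B" for j
    by (rule pad_base_nth_ge[of ?M P j mm cf]) (use j cf in \<open>auto simp: B_def\<close>)
  interpret pi_assembly "?M + mm" "2 * m" B ts xs "?M + P"
  proof
    show "is_circuit B" by (rule icB)
    show "?M + mm \<le> length B" using lenB by simp
    show "tok (?M + mm) (2 * m) t" if "t \<in> set ts" for t
      by (rule tok_mono[OF ts[OF that]]) (use mm in simp_all)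
    show "set xs \<subseteq> {..<length B}" unfolding xs_def lenB by auto
    show "xs \<noteq> []" unfolding xs_def using mm by simp
    show "?M + mm \<le> ?M + P" using mm by simp
    show "?M + P \<le> length B" using lenB by simp
    show "is_literal (B ! j)" if "j < ?M + P" for j using lit[OF that] by simp
    show "\<exists>us. B ! j = OrGate us \<and> set us \<subseteq> {..<?M + mm}" if "?M + P \<le> j" "j < length B" for j
      by (rule org[OF that])
  qed
  have d0: "depth_at B j = 0" if "j < ?M + P" for j
    using depth_at_nth[OF icB, of j] lit[OF that] that lenB by simp
  have d1: "depth_at B j \<le> 1" if j: "j < length B" for j
  proof (cases "j < ?M + P")
    case True then show ?thesis using d0 by simp
  next
    case False
    then obtain us where us: "B ! j = OrGate us" "set us \<subseteq> {..<?M + mm}" using org[of j] j by auto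
    have "\<not> is_literal (B ! j) \<longrightarrow> in_nbrs (B ! j) \<noteq> {}" using icB nth_mem[OF j] unfolding is_circuit_def by blast
    then have ne: "in_nbrs (B ! j) \<noteq> {}" using us(1) by simp
    have "depth_at B i = 0" if "i \<in> set us" for i using that us(2) mm(2) by (intro d0) auto
    then have "Max (depth_at B ` in_nbrs (B ! j)) \<le> 0" using ne us(1) by (subst Max_le_iff) auto
    then show ?thesis using depth_at_nth[OF icB j] us(1) by simp
  qed
  have "depth C \<le> Suc (max (2 * m) 1)" unfolding C
  proof (rule depth_assemble)
    show "depth_at B a \<le> 0" if "a < ?M + mm" for a using d0[of a] that mm(2) by simp
    show "depth_at B i \<le> max (2 * m) 1" if "i \<in> set xs" for i using d1[OF xs_less[OF that]] by simp
  qed simp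
  then show "Pi_circuit (max (2 * m + 1) 2) C" unfolding C by (intro Pi_circuit_assemble) simp
  have varsB: "Literal b x \<in> set B \<longleftrightarrow> \<not> b \<and> x < ?M + P" for b x
    unfolding B_def pad_base_def by auto
  show vars: "vars C = {..<?M + P}" unfolding C vars_assemble unfolding vars_def varsB by auto
  show "antimonotone C" unfolding antimonotone_def
  proof (intro allI impI)
    fix b x assume l: "Literal b x \<in> set C"
    obtain gs where gs: "C' = B @ gs" "\<forall>v\<in>set gs. \<not> is_literal v" using C'_ext by blast
    have "Literal b x \<in> set B" using l gs unfolding C assemble_eq by (auto dest!: bspec)
    then show "\<not> b" using varsB by simp
  qed
  have cnt: "length C' = length B + length (fst (sers (2 * m) False ts ([], [])))"
  proof -
    obtain c where c: "\<And>r. length (fst (sers (2 * m) False ts r)) = length (fst r) + c" using length_sers by blast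
    show ?thesis unfolding C'_def c by simp
  qed
  show "2 * circuit_genus C \<le> 3 * mm + (3 * mm) ^ 2" unfolding C
  proof (rule genus_assemble[where p = ?M])
    show "B ! (?M + P + b) = OrGate [?M..<?M + mm]" if "b < mm" for b unfolding B_def by (rule pad_base_nth(2)[OF that])
    show "?M + P + mm \<le> length B" using lenB by simp
    show "?M + mm + (length C' - (?M + P)) \<le> 3 * mm"
      unfolding cnt lenB using mm_def unfolding pad_width_def cf_def by simp
  qed (use mm in simp_all)
  have v0: "value_at A B i = (i \<notin> A)" if "i < ?M + P" for i
    using value_at_nth[OF icB, of i A] lit[OF that] that lenB by simp
  have vor: "value_at A B j = (\<exists>i\<in>set us. i \<notin> A)" if j: "j < length B" "B ! j = OrGate us" "set us \<subseteq> {..<?M + P}" for j us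
  proof -
    have "value_at A B j = (\<exists>i\<in>set us. value_at A B i)"
      using value_at_nth[OF icB j(1), of A] j(2) by (simp add: value_at_def)
    also have "\<dots> = (\<exists>i\<in>set us. i \<notin> A)" using v0 j(3) by (intro bex_cong refl) auto
    finally show ?thesis .
  qed
  have vpad: "value_at A B (?M + P + b) = (\<exists>i\<in>{?M..<?M + mm}. i \<notin> A)" if "b < mm" for b
  proof -
    have b: "B ! (?M + P + b) = OrGate [?M..<?M + mm]" unfolding B_def by (rule pad_base_nth(2)[OF that])
    have "value_at A B (?M + P + b) = (\<exists>i\<in>set [?M..<?M + mm]. i \<notin> A)"
      by (rule vor[OF _ b]) (use that lenB mm(2) in auto)
    then show ?thesis by simp
  qed
  have vcf: "value_at A B (?M + P + mm + i) = (fst (cf ! i) \<notin> A \<or> snd (cf ! i) \<notin> A)" if i: "i < length cf" for i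
  proof -
    have "cf ! i \<in> {..<?M} \<times> {..<?M}" using cf nth_mem[OF i] by blast
    then show ?thesis using vor[of "?M + P + mm + i" "[fst (cf ! i), snd (cf ! i)]"] pad_base_nth(3)[OF i, of ?M P mm] i lenB
      by (auto simp: B_def)
  qed
  have "ev (value_at A B) False t = ev (\<lambda>i. i \<notin> A) False t" if "t \<in> set ts" for t
    by (rule ev_cong[OF ts[OF that]]) (use v0 mm in auto)
  then have sat: "satisfies A C \<longleftrightarrow> (\<forall>t\<in>set ts. ev (\<lambda>i. i \<notin> A) False t) \<and> (\<forall>i\<in>set xs. value_at A B i)"
    unfolding C satisfies_assemble by simp
  have "(\<forall>i\<in>set xs. value_at A B i) \<longleftrightarrow> (\<forall>i\<in>{?M..<?M + P}. i \<notin> A) \<and> (\<forall>p\<in>set cf. fst p \<notin> A \<or> snd p \<notin> A)" (is "?L \<longleftrightarrow> ?R1 \<and> ?R2")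
  proof
    assume L: ?L
    have ?R1
    proof
      fix i assume i: "i \<in> {?M..<?M + P}"
      then have "i \<in> set xs" unfolding xs_def by simp
      then have "value_at A B i" using L by blast
      then show "i \<notin> A" using v0[of i] i by simp
    qed
    moreover have ?R2
    proof
      fix p assume "p \<in> set cf"
      then obtain i where i: "i < length cf" "p = cf ! i" by (auto simp: in_set_conv_nth)
      have "?M + P + mm + i \<in> set xs" unfolding xs_def using i(1) by simp
      then show "fst p \<notin> A \<or> snd p \<notin> A" using L vcf[OF i(1)] i(2) by blast
    qed
    ultimately show "?R1 \<and> ?R2" ..
  next
    assume R: "?R1 \<and> ?R2"
    show ?L
    proof
      fix j assume "j \<in> set xs"
      then have j: "?M \<le> j" "j < ?M + P + mm + length cf" unfolding xs_def by auto
      consider "j < ?M + P" | "?M + P \<le> j" "j < ?M + P + mm" | "?M + P + mm \<le> j" by linarith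
      then show "value_at A B j"
      proof cases
        case 1 then show ?thesis using R v0[of j] j by simp
      next
        case 2
        have "?M \<notin> A" using R mm by auto
        then show ?thesis using vpad[of "j - (?M + P)"] 2 mm by (auto intro!: bexI[of _ ?M])
      next
        case 3
        then have i: "j - (?M + P + mm) < length cf" using j by simp
        have "cf ! (j - (?M + P + mm)) \<in> set cf" by (rule nth_mem[OF i])
        then show ?thesis using vcf[OF i] R 3 by auto
      qed
    qed
  qed
  then show "satisfies A C \<longleftrightarrow> (\<forall>t\<in>set ts. ev (\<lambda>i. i \<notin> A) False t) \<and> (\<forall>i\<in>{?M..<?M + P}. i \<notin> A) \<and>
       (\<forall>p\<in>set (conflicts k tu). fst p \<notin> A \<or> snd p \<notin> A)"
    using sat unfolding cf_def by blast
qed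

definition hard_tuples :: "nat \<Rightarrow> nat \<Rightarrow> circuit \<Rightarrow> nat \<Rightarrow> (nat \<times> nat \<times> nat) list list" where
  "hard_tuples m d C k = List.n_lists (2 ^ d + 1) (atoms k (vbound C) (vlist C) (snd (phi (2 * m + 1) d C)))"

text \<open>An assignment of weight \<open>k\<close> corresponds to \<open>k + 2\<close> compatible
  atoms and these to all their tuples of length \<open>2 ^ d + 1\<close>, whose number is the new
  weight.\<close>

lemma weighted_satisfiable_hard_circuit:
  fixes m d k e q :: nat and C :: circuit
  assumes C: "weft_circuit (2 * m + 1) d C"
  defines "tu \<equiv> hard_tuples m d C k" and "ts \<equiv> conv m k (hard_tuples m d C k) (fst (phi (2 * m + 1) d C))"
  shows "weighted_satisfiable C k \<longleftrightarrow> weighted_satisfiable (hard_circuit m e q k tu ts) ((k + 2) ^ (2 ^ d + 1))"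
    and "\<And>t. t \<in> set ts \<Longrightarrow> tok (Suc (length tu)) (2 * m) t"
proof -
  let ?r = "2 ^ d + 1" and ?M = "length tu"
  obtain \<Phi> N where phi: "phi (2 * m + 1) d C = (\<Phi>, N)" by fastforce
  note ph = phi_correct[OF C _ phi, simplified]
  have full: "full ?r (2 * m + 1) Q" "set_ntree Q \<subseteq> {l. fst l < 2 \<longrightarrow> snd l < vbound C}" if "Q \<in> set \<Phi>" for Q
    using ph(2)[OF that] vbound_less[of _ C] by auto
  have ts: "ts = conv m k tu \<Phi>" unfolding ts_def tu_def phi by simp
  show tok: "\<And>t. t \<in> set ts \<Longrightarrow> tok (Suc ?M) (2 * m) t"
    unfolding ts by (rule conv_tok[of \<Phi> ?r]) (use full(1) in auto)
  define as where "as = atoms k (vbound C) (vlist C) N"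
  have tu: "tu = List.n_lists ?r as" unfolding tu_def hard_tuples_def as_def phi by simp
  have ic: "is_circuit C" "\<And>b x. Literal b x \<in> set C \<Longrightarrow> b = True" using C unfolding weft_circuit_def by auto
  have das: "distinct as" unfolding as_def
    by (rule distinct_atoms[OF distinct_vlist[OF ic]]) (use vbound_less vlist_vars in auto)
  have cls: "fst a \<le> Suc k" if "a \<in> set as" for a
    using that set_atoms[of "fst a" "fst (snd a)" "snd (snd a)" k "vbound C" "vlist C" N] unfolding as_def by auto
  let ?ok = "\<lambda>B. card B = (k + 2) ^ ?r \<and> (\<forall>i\<in>B. \<forall>j\<in>B. \<not> conflict k (tu ! i) (tu ! j)) \<and>
    (\<forall>t\<in>set ts. ev (\<lambda>i. i \<notin> B) False t)"
  define S0 where "S0 = {l :: nat \<times> nat. fst l < 2 \<longrightarrow> snd l < vbound C}"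
  have key: "(\<forall>t\<in>set ts. ev (\<lambda>i. i \<notin> B) False t) = (\<forall>Q\<in>set \<Phi>. ev (lval (chain_set k ch) u) False Q)"
    if ch: "chain k (vbound C) ch" and Sas: "chain_atoms k ch u \<subseteq> set as"
      and B: "B = {i. i < ?M \<and> set (tu ! i) \<subseteq> chain_atoms k ch u}" for B ch u
    unfolding ts
  proof (rule conv_correct[where r = ?r and S = S0])
    show "ev (lval (chain_set k ch) u) False Q \<longleftrightarrow> (\<forall>i\<in>set (bad_indices k tu Q). i \<notin> B)"
      if Q: "full ?r 1 Q" "set_ntree Q \<subseteq> S0" for Q
    proof (rule clause_bad_indices[OF tu Sas _ B _ Q(1)])
      show "chain_atoms k ch u \<noteq> {}" unfolding chain_atoms_def by blast
      show "lval (chain_set k ch) u l \<longleftrightarrow> \<not> (\<exists>a\<in>chain_atoms k ch u. refutes k l a)" if "l \<in> set_ntree Q" for l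
        by (rule chain_refutes[OF ch]) (use Q(2) that in \<open>auto simp: S0_def\<close>)
    qed
    show "?M \<notin> B" unfolding B by simp
    show "\<forall>Q\<in>set \<Phi>. full ?r (2 * m + 1) Q \<and> set_ntree Q \<subseteq> S0" using full unfolding S0_def by blast
  qed
  \<comment> \<open>An intermediate form that speaks about sets of tuples only, before dummies and
    gates come in.\<close>
  have "weighted_satisfiable C k \<longleftrightarrow> (\<exists>B\<subseteq>{..<?M}. ?ok B)"
  proof
    assume "weighted_satisfiable C k"
    then obtain A where A: "A \<subseteq> vars C" "card A = k" "satisfies A C" unfolding weighted_satisfiable_def by blast
    then obtain u where u: "u < N" "\<forall>Q\<in>set \<Phi>. ev (lval A u) False Q" using ph(1) by blast
    obtain ch where ch: "chain k (vbound C) ch" "chain_set k ch = A" "chain_atoms k ch u \<subseteq> set as"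
      unfolding as_def by (rule chain_of_assignment[of A "vlist C" k u N "vbound C"]) (use A u vlist_vars vbound_less in auto)
    define B where "B = {i. i < ?M \<and> set (tu ! i) \<subseteq> chain_atoms k ch u}"
    have "card B = (k + 2) ^ ?r" unfolding B_def by (rule clique_tuples[OF das tu ch(3) card_chain_atoms])
    moreover have "\<not> conflict k (tu ! i) (tu ! j)" if "i \<in> B" "j \<in> B" for i j
      using that chain_atoms_clique unfolding B_def conflict_def by blast
    moreover have "\<forall>t\<in>set ts. ev (\<lambda>i. i \<notin> B) False t" using key[OF ch(1,3) B_def] ch(2) u(2) by simp
    moreover have "B \<subseteq> {..<?M}" unfolding B_def by auto
    ultimately show "\<exists>B\<subseteq>{..<?M}. ?ok B" by blast
  next
    assume "\<exists>B\<subseteq>{..<?M}. ?ok B"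
    then obtain B where B: "B \<subseteq> {..<?M}" "card B = (k + 2) ^ ?r" "\<And>i j. i \<in> B \<Longrightarrow> j \<in> B \<Longrightarrow> \<not> conflict k (tu ! i) (tu ! j)"
      "\<forall>t\<in>set ts. ev (\<lambda>i. i \<notin> B) False t" by blast
    obtain S where S: "S \<subseteq> set as" "\<And>a b. a \<in> S \<Longrightarrow> b \<in> S \<Longrightarrow> compat k a b" "card S = k + 2"
      "B = {i. i < ?M \<and> set (tu ! i) \<subseteq> S}"
      by (rule tuples_clique[OF _ das tu cls B(1-3)]) auto
    obtain ch u where ch: "u < N" "chain k (vbound C) ch" "S = chain_atoms k ch u" "chain_set k ch \<subseteq> set (vlist C)"
      by (rule assignment_of_clique[OF S(1)[unfolded as_def] S(2,3)])
    have "\<forall>Q\<in>set \<Phi>. ev (lval (chain_set k ch) u) False Q"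
      using key[OF ch(2) S(1)[unfolded ch(3)] S(4)[unfolded ch(3)]] B(4) by simp
    then have "satisfies (chain_set k ch) C" using ph(1) ch(1) by blast
    then show "weighted_satisfiable C k" unfolding weighted_satisfiable_def
      using card_chain_set[OF ch(2)] ch(4) vlist_vars by blast
  qed
  also have "\<dots> \<longleftrightarrow> weighted_satisfiable (hard_circuit m e q k tu ts) ((k + 2) ^ ?r)"
  proof -
    define P where "P = pad_count e q (pad_width m k tu ts)"
    note hc = hard_circuit[of ts tu m, OF tok, where e = e and q = q and k = k, folded P_def]
    have cfl: "(\<forall>p\<in>set (conflicts k tu). fst p \<notin> B \<or> snd p \<notin> B) \<longleftrightarrow> (\<forall>i\<in>B. \<forall>j\<in>B. \<not> conflict k (tu ! i) (tu ! j))"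
      if B: "B \<subseteq> {..<?M}" for B
    proof -
      have 1: "p \<in> set (conflicts k tu) \<longleftrightarrow> fst p < ?M \<and> snd p < ?M \<and> conflict k (tu ! fst p) (tu ! snd p)" for p
        unfolding conflicts_def by (cases p) auto
      show ?thesis
      proof (intro iffI ballI notI)
        fix i j assume a: "\<forall>p\<in>set (conflicts k tu). fst p \<notin> B \<or> snd p \<notin> B" "i \<in> B" "j \<in> B" "conflict k (tu ! i) (tu ! j)"
        then have "(i, j) \<in> set (conflicts k tu)" unfolding 1 using B by auto
        then show False using a by fastforce
      next
        fix p assume "\<forall>i\<in>B. \<forall>j\<in>B. \<not> conflict k (tu ! i) (tu ! j)" "p \<in> set (conflicts k tu)"
        then show "fst p \<notin> B \<or> snd p \<notin> B" unfolding 1 by blast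
      qed
    qed
    have vs: "vars (hard_circuit m e q k tu ts) = {..<?M + P}" by (rule hc(3))
    show ?thesis
    proof
      assume "\<exists>B\<subseteq>{..<?M}. ?ok B"
      then obtain B where B: "B \<subseteq> {..<?M}" "?ok B" by blast
      have "\<forall>i\<in>{?M..<?M + P}. i \<notin> B" using B(1) by auto
      moreover have "\<forall>p\<in>set (conflicts k tu). fst p \<notin> B \<or> snd p \<notin> B" by (rule iffD2[OF cfl[OF B(1)]]) (use B(2) in blast)
      moreover have "\<forall>t\<in>set ts. ev (\<lambda>i. i \<notin> B) False t" using B(2) by (elim conjE)
      ultimately have "satisfies B (hard_circuit m e q k tu ts)" using hc(5)[of B] by (simp only: simp_thms)
      moreover have "B \<subseteq> vars (hard_circuit m e q k tu ts)" using B(1) vs by auto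
      ultimately show "weighted_satisfiable (hard_circuit m e q k tu ts) ((k + 2) ^ ?r)"
        unfolding weighted_satisfiable_def using B(2) by blast
    next
      assume "weighted_satisfiable (hard_circuit m e q k tu ts) ((k + 2) ^ ?r)"
      then obtain B where B: "B \<subseteq> {..<?M + P}" "card B = (k + 2) ^ ?r" "satisfies B (hard_circuit m e q k tu ts)"
        unfolding weighted_satisfiable_def vs by blast
      have s: "\<forall>t\<in>set ts. ev (\<lambda>i. i \<notin> B) False t" "\<forall>i\<in>{?M..<?M + P}. i \<notin> B"
        "\<forall>p\<in>set (conflicts k tu). fst p \<notin> B \<or> snd p \<notin> B" using iffD1[OF hc(5) B(3)] by simp_all
      have sub: "B \<subseteq> {..<?M}"
      proof
        fix i assume i: "i \<in> B"
        then have "i < ?M + P" "\<not> (?M \<le> i \<and> i < ?M + P)" using B(1) s(2) by auto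
        then show "i \<in> {..<?M}" by simp
      qed
      have "?ok B" using B(2) s(1) iffD1[OF cfl[OF sub] s(3)] by blast
      then show "\<exists>B\<subseteq>{..<?M}. ?ok B" using sub by blast
    qed
  qed
  finally show "weighted_satisfiable C k \<longleftrightarrow> weighted_satisfiable (hard_circuit m e q k tu ts) ((k + 2) ^ ?r)" .
qed

section \<open>The hardness reduction in polynomial time\<close>

lemma ptime_product [ptime_intros]:
  assumes "ptime f" "ptime g"
  shows "ptime (\<lambda>x. List.product (f x) (g x))"
  unfolding product_concat_map by (intro ptime_intros assms(1)[THEN ptime_comp] assms(2)[THEN ptime_comp])

lemma ptime_n_lists [ptime_intros]:
  assumes "ptime f" shows "ptime (\<lambda>x. List.n_lists r (f x))"
proof (induction r)
  case 0
  show ?case unfolding List.n_lists.simps by (intro ptime_intros)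
next
  case (Suc r)
  show ?case unfolding List.n_lists.simps by (intro ptime_intros Suc assms[THEN ptime_comp])
qed

lemma ptime_vlist [ptime_intros]: "ptime f \<Longrightarrow> ptime (\<lambda>x. vlist (f x))"
  unfolding vlist_def by (intro ptime_intros)

lemma ptime_vbound [ptime_intros]: "ptime f \<Longrightarrow> ptime (\<lambda>x. vbound (f x))"
proof (rule ptime_comp[of vbound])
  have v: "ptime (\<lambda>p :: circuit \<times> vertex. vnum (snd p) + 1)" by (intro ptime_intros)
  have "ptime (\<lambda>C. fold (\<lambda>w b. b + (vnum w + 1)) (C :: circuit) 0)"
    by (rule ptime_fold_additive[where f = "\<lambda>_ w b. b + (vnum w + 1)" and q = "\<lambda>p. sz (vnum (snd p) + 1)"])
      (rule ptime_size[OF v] | intro ptime_intros | simp)+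
  then show "ptime vbound" unfolding vbound_def .
qed

lemma ptime_atoms [ptime_intros]:
  assumes "ptime k" "ptime M" "ptime vs" "ptime N"
  shows "ptime (\<lambda>x. atoms (k x) (M x) (vs x) (N x))"
  unfolding atoms_def by (intro ptime_intros assms(1)[THEN ptime_comp] assms(2)[THEN ptime_comp] assms(3)[THEN ptime_comp] assms(4)[THEN ptime_comp])

lemma ptime_compat [ptime_intros]:
  "ptime k \<Longrightarrow> ptime a \<Longrightarrow> ptime b \<Longrightarrow> ptime (\<lambda>x. compat (k x) (a x) (b x))"
  unfolding compat_def by (intro ptime_intros)

lemma ptime_refutes [ptime_intros]:
  "ptime k \<Longrightarrow> ptime l \<Longrightarrow> ptime a \<Longrightarrow> ptime (\<lambda>x. refutes (k x) (l x) (a x))"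
  unfolding refutes_def by (intro ptime_intros)

lemma ptime_conflict [ptime_intros]:
  assumes "ptime k" "ptime p" "ptime q"
  shows "ptime (\<lambda>x. conflict (k x) (p x) (q x))"
  unfolding conflict_def by (intro ptime_intros assms(1)[THEN ptime_comp] assms(2)[THEN ptime_comp] assms(3)[THEN ptime_comp])

lemma ptime_bad_indices [ptime_intros]:
  assumes "ptime k" "ptime tu" "ptime Q"
  shows "ptime (\<lambda>x. bad_indices (k x) (tu x) (Q x))"
  unfolding bad_indices_def bad_def by (intro ptime_intros assms(1)[THEN ptime_comp] assms(2)[THEN ptime_comp] assms(3)[THEN ptime_comp])

lemma ptime_conv_rule:
  assumes "ptime (\<lambda>p. conv m (fst p) (fst (snd p)) (snd (snd p)))" "ptime k" "ptime tu" "ptime Qs"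
  shows "ptime (\<lambda>x. conv m (k x) (tu x) (Qs x))"
  using ptime_comp[OF assms(1), of "\<lambda>x. (k x, tu x, Qs x)"] assms(2-) by (simp add: ptime_pair)

lemma ptime_conv_prim: "ptime (\<lambda>p. conv m (fst p) (fst (snd p)) (snd (snd p)))"
proof (induction m)
  case 0
  show ?case unfolding conv.simps(1) by (intro ptime_intros)
next
  case (Suc m)
  show ?case unfolding conv.simps(2) by (intro ptime_intros ptime_conv_rule[OF Suc])
qed

lemmas ptime_conv [ptime_intros] = ptime_conv_rule[OF ptime_conv_prim]

lemma ptime_conflicts [ptime_intros]:
  assumes "ptime k" "ptime tu"
  shows "ptime (\<lambda>x. conflicts (k x) (tu x))"
  unfolding conflicts_def by (intro ptime_intros assms(1)[THEN ptime_comp] assms(2)[THEN ptime_comp])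

lemma ptime_pad_base [ptime_intros]:
  "ptime M \<Longrightarrow> ptime P \<Longrightarrow> ptime mm \<Longrightarrow> ptime cf \<Longrightarrow> ptime (\<lambda>x. pad_base (M x) (P x) (mm x) (cf x))"
  unfolding pad_base_def by (intro ptime_intros)

lemma ptime_pad_width [ptime_intros]:
  "ptime k \<Longrightarrow> ptime tu \<Longrightarrow> ptime ts \<Longrightarrow> ptime (\<lambda>x. pad_width m (k x) (tu x) (ts x))"
  unfolding pad_width_def by (intro ptime_intros)

lemma ptime_pad_count [ptime_intros]: "ptime mm \<Longrightarrow> ptime (\<lambda>x. pad_count e q (mm x))"
  unfolding pad_count_def by (intro ptime_intros)

lemma ptime_hard_circuit [ptime_intros]:
  "ptime k \<Longrightarrow> ptime tu \<Longrightarrow> ptime ts \<Longrightarrow> ptime (\<lambda>x. hard_circuit m e q (k x) (tu x) (ts x))"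
  unfolding hard_circuit_def by (intro ptime_intros)

lemma ptime_hard_tuples [ptime_intros]:
  "ptime C \<Longrightarrow> ptime k \<Longrightarrow> ptime (\<lambda>x. hard_tuples m d (C x) (k x))"
  unfolding hard_tuples_def by (intro ptime_intros)

section \<open>Growth of the genus bound and the hardness reduction\<close>

lemma Pi_circuit_mono: "Pi_circuit t C \<Longrightarrow> t \<le> t' \<Longrightarrow> Pi_circuit t' C"
  unfolding Pi_circuit_def by auto

text \<open>With \<open>X = s + q\<close> and \<open>e\<close> at least \<open>3 / c\<close>, the
  assumption on \<open>n\<close> makes \<open>real n powr c\<close> at least the cube of
  \<open>X\<close>. Two factors give the square, and the third, being at least \<open>1 / a\<close>,
  absorbs the hidden constant of the growth condition; \<open>q\<close> also exceeds the threshold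
  from which that condition holds.\<close>

lemma growth_absorbs_squares:
  fixes g :: "nat \<Rightarrow> real"
  assumes "c > 0" and nonneg: "\<And>n. g n \<ge> 0" and g: "g \<in> \<Omega>(\<lambda>n. real n powr c)"
  shows "\<exists>e q :: nat. \<forall>s n. (s + q) ^ e \<le> n \<longrightarrow> real (s ^ 2) \<le> g n"
proof -
  obtain a where a: "a > 0" "eventually (\<lambda>n. norm (g n) \<ge> a * norm (real n powr c)) at_top"
    using g by (rule landau_omega.bigE)
  then obtain n0 where n0: "\<And>n. n \<ge> n0 \<Longrightarrow> g n \<ge> a * real n powr c"
    using nonneg by (auto simp: eventually_at_top_linorder)
  define e where "e = nat \<lceil>3 / c\<rceil>"
  define q where "q = n0 + nat \<lceil>1 / a\<rceil> + 1"
  have "3 / c \<le> real e" unfolding e_def by linarith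
  then have ec: "3 \<le> real e * c" using assms(1) by (simp add: field_simps)
  then have "e \<noteq> 0" by (intro notI) simp
  have "real (s ^ 2) \<le> g n" if n: "(s + q) ^ e \<le> n" for s n
  proof -
    define X where "X = s + q"
    have X: "1 \<le> X" "n0 \<le> X" "1 / a \<le> real X" unfolding X_def q_def by simp_all linarith
    have "X \<le> X ^ e" using X(1) \<open>e \<noteq> 0\<close> by (simp add: self_le_power)
    then have nX: "X ^ e \<le> n" "n0 \<le> n" using n X(2) unfolding X_def by linarith+
    have "real X ^ 3 = real X powr 3" using X(1) by (simp add: powr_numeral)
    also have "\<dots> \<le> real X powr (real e * c)" using ec X(1) by (intro powr_mono) auto
    also have "\<dots> = real (X ^ e) powr c" using X(1) by (simp add: powr_powr[symmetric] powr_realpow)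
    also have "\<dots> \<le> real n powr c" using nX(1) assms(1) by (intro powr_mono2) auto
    finally have "a * real X ^ 3 \<le> a * real n powr c" using a(1) by simp
    moreover have "1 * real X ^ 2 \<le> (a * real X) * real X ^ 2"
      using X(3) a(1) by (intro mult_right_mono) (auto simp: field_simps)
    ultimately have "real X ^ 2 \<le> g n" using n0[OF nX(2)] by (simp add: power2_eq_square power3_eq_cube mult.assoc)
    moreover have "real (s ^ 2) \<le> real X ^ 2" unfolding X_def by (simp add: power_mono)
    ultimately show ?thesis by linarith
  qed
  then show ?thesis by blast
qed

text \<open>The growth of \<open>g\<close> enters only through the constants \<open>e\<close> and
  \<open>q\<close>, which are hard-wired; for constant \<open>m\<close> and \<open>d\<close> the
  reduction is even polynomial in size and parameter together.\<close>

theorem weft_circuit_reducible_anti_genus: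
  fixes g :: "nat \<Rightarrow> real"
  assumes "c > 0" "\<And>n. g n \<ge> 0" "g \<in> \<Omega>(\<lambda>n. real n powr c)" and t: "max (2 * m + 1) 2 \<le> t"
  shows "WSAT_on (weft_circuit (2 * m + 1) d) \<le>\<^sub>f\<^sub>p\<^sub>t WSAT_anti_genus t g"
proof -
  obtain e q where eq: "\<forall>s n. (s + q) ^ e \<le> n \<longrightarrow> real (s ^ 2) \<le> g n"
    using growth_absorbs_squares[OF assms(1-3)] by (elim exE)
  define R where "R = (\<lambda>p. (hard_circuit m e q (snd p) (hard_tuples m d (fst p) (snd p))
    (conv m (snd p) (hard_tuples m d (fst p) (snd p)) (fst (phi (2 * m + 1) d (fst p)))), (snd p + 2) ^ (2 ^ d + 1)))"
  have pow: "ptime (\<lambda>p :: circuit \<times> nat. (snd p + 2) ^ (2 ^ d + 1))"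
    by (rule ptime_power) (intro ptime_intros)
  have tup: "ptime (\<lambda>p. hard_tuples m d (fst p) (snd p))" by (intro ptime_hard_tuples ptime_fst ptime_snd ptime_id)
  show ?thesis unfolding WSAT_anti_genus_def
  proof (rule ptime_reduction_WSAT_on)
    show "ptime R" unfolding R_def
      by (intro ptime_pair ptime_hard_circuit ptime_conv tup pow) (intro ptime_intros)+
    show "comput (\<lambda>k :: nat. (k + 2) ^ (2 ^ d + 1))" by (intro comput_intros)
    fix C k C' k' assume C: "weft_circuit (2 * m + 1) d C" and R': "R (C, k) = (C', k')"
    let ?tu = "hard_tuples m d C k" and ?ts = "conv m k (hard_tuples m d C k) (fst (phi (2 * m + 1) d C))"
    have eqs: "C' = hard_circuit m e q k ?tu ?ts" "k' = (k + 2) ^ (2 ^ d + 1)"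
      using R' unfolding R_def by auto
    have hc: "Pi_circuit (max (2 * m + 1) 2) C'" "antimonotone C'"
      "vars C' = {..<length ?tu + pad_count e q (pad_width m k ?tu ?ts)}"
      "2 * circuit_genus C' \<le> 3 * pad_width m k ?tu ?ts + (3 * pad_width m k ?tu ?ts) ^ 2"
      unfolding eqs(1) by (rule hard_circuit[OF weighted_satisfiable_hard_circuit(2)[OF C]], assumption)+
    define mm where "mm = pad_width m k ?tu ?ts"
    note hc = hc[folded mm_def]
    have "2 * circuit_genus C' \<le> 3 * mm + (3 * mm) ^ 2" by (rule hc(4))
    also have "\<dots> \<le> 2 * (3 * mm) ^ 2" using le_square[of "3 * mm"] unfolding power2_eq_square by linarith
    finally have 1: "real (circuit_genus C') \<le> real ((3 * mm) ^ 2)" unfolding of_nat_le_iff by linarith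
    have "card (vars C') = length ?tu + pad_count e q mm" unfolding hc(3) by simp
    then have "(3 * mm + q) ^ e \<le> card (vars C')" unfolding pad_count_def by simp
    from eq[rule_format, OF this] 1 have "real (circuit_genus C') \<le> g (card (vars C'))" by linarith
    moreover have "Pi_circuit t C'" by (rule Pi_circuit_mono[OF hc(1) t])
    moreover have "antimonotone C'" by (rule hc(2))
    moreover have "weighted_satisfiable C k \<longleftrightarrow> weighted_satisfiable C' k'"
      unfolding eqs by (rule weighted_satisfiable_hard_circuit(1)[OF C])
    ultimately show "(Pi_circuit t C' \<and> antimonotone C' \<and> real (circuit_genus C') \<le> g (card (vars C'))) \<and>
        k' \<le> (k + 2) ^ (2 ^ d + 1) \<and> (weighted_satisfiable C k \<longleftrightarrow> weighted_satisfiable C' k')"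
      using eqs(2) by simp
  qed
qed

section \<open>Membership\<close>

text \<open>An index set is represented by a decreasing list, so that the walk of \<open>J\<close> through the trie extends the
  walk of \<open>tl J\<close>. The letters of the trie are the variables shifted by one; hence \<open>[0]\<close> can serve as the dead state.\<close>

primrec dlists :: "nat \<Rightarrow> nat list list" where
  "dlists 0 = [[]]"
| "dlists (Suc k) = dlists k @ map ((#) k) (dlists k)"

lemma set_dlists: "J \<in> set (dlists k) \<longleftrightarrow> sorted_wrt (>) J \<and> set J \<subseteq> {..<k}"
proof (induction k arbitrary: J)
  case 0 show ?case by auto
next
  case (Suc k)
  show ?case
  proof (cases J)
    case Nil then show ?thesis using Suc by simp
  next
    case (Cons j I)
    have "J \<in> set (dlists (Suc k)) \<longleftrightarrow> J \<in> set (dlists k) \<or> j = k \<and> I \<in> set (dlists k)" unfolding Cons by auto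
    also have "\<dots> \<longleftrightarrow> sorted_wrt (>) J \<and> set J \<subseteq> {..<Suc k}"
    proof -
      have 1: "sorted_wrt (>) J \<longleftrightarrow> set I \<subseteq> {..<j} \<and> sorted_wrt (>) I" unfolding Cons by auto
      have 2: "set J \<subseteq> {..<n} \<longleftrightarrow> j < n \<and> set I \<subseteq> {..<n}" for n unfolding Cons by auto
      have 3: "set I \<subseteq> {..<n}" if "set I \<subseteq> {..<j}" "j \<le> n" for n using that by fastforce
      show ?thesis unfolding Suc 1 2 by (cases j k rule: linorder_cases) (use 3[of k] 3[of "Suc k"] in \<open>simp; blast\<close>)+
    qed
    finally show ?thesis .
  qed
qed

lemma length_dlists: "length (dlists k) = 2 ^ k" by (induction k) auto

lemma distinct_dlists: "distinct (dlists k)"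
proof (induction k)
  case (Suc k)
  have "k # I \<notin> set (dlists k)" for I unfolding set_dlists by auto
  then show ?case using Suc by (auto simp: distinct_map)
qed simp

lemma card_dlists: "card (set (dlists k) - {[]}) = 2 ^ k - 1"
proof -
  have "[] \<in> set (dlists k)" unfolding set_dlists by simp
  then show ?thesis using distinct_card[OF distinct_dlists, of k] length_dlists[of k] by simp
qed

lemma dlists_Cons: "j # J \<in> set (dlists k) \<Longrightarrow> j < k \<and> J \<in> set (dlists k)"
  unfolding set_dlists by auto

section \<open>Clauses as sorted words and walks through their trie\<close>

definition canon :: "nat \<Rightarrow> nat list \<Rightarrow> nat list" where
  "canon M S = map Suc (filter (\<lambda>x. \<exists>z\<in>set S. z = x) [0..<M])"

text \<open>The trie as an automaton whose states are the prefixes read so far; leaving the trie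
  leads to the dead state \<open>[0]\<close>.\<close>

definition step :: "nat list list \<Rightarrow> nat list \<Rightarrow> nat \<Rightarrow> nat list" where
  "step Pre s y = (if \<exists>p\<in>set Pre. p = s @ [Suc y] then s @ [Suc y] else [0])"

primrec trace :: "nat list list \<Rightarrow> (nat \<Rightarrow> nat) \<Rightarrow> nat list \<Rightarrow> nat list" where
  "trace Pre x [] = []"
| "trace Pre x (j # J) = step Pre (trace Pre x J) (x j)"

text \<open>The second condition keeps the dead state dead: no word of the trie begins with the
  letter 0.\<close>

definition prefix_closed :: "nat list list \<Rightarrow> bool" where
  "prefix_closed Pre \<longleftrightarrow> (\<forall>s y. s @ [y] \<in> set Pre \<and> s \<noteq> [] \<longrightarrow> s \<in> set Pre) \<and> (\<forall>s\<in>set Pre. 0 \<notin> set s)"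

text \<open>A word outside a prefix-closed set has no extension in it, so a walk that has left the
  trie cannot return, and the state reached depends on the whole word alone.\<close>

lemma trace_eq:
  assumes "prefix_closed Pre"
  shows "trace Pre x J = (if J = [] \<or> map (\<lambda>j. Suc (x j)) (rev J) \<in> set Pre then map (\<lambda>j. Suc (x j)) (rev J) else [0])"
proof (induction J)
  case (Cons j J)
  let ?w = "map (\<lambda>j. Suc (x j)) (rev J)"
  show ?case
  proof (cases "J = [] \<or> ?w \<in> set Pre")
    case True
    then have "trace Pre x J = ?w" using Cons by simp
    then show ?thesis by (simp add: step_def)
  next
    case False
    then have 1: "trace Pre x J = [0]" using Cons by simp
    have "[0, Suc (x j)] \<notin> set Pre" using assms unfolding prefix_closed_def by fastforce
    then have "trace Pre x (j # J) = [0]" using 1 by (simp add: step_def)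
    moreover have "?w @ [Suc (x j)] \<notin> set Pre" using False assms unfolding prefix_closed_def by blast
    ultimately show ?thesis by simp
  qed
qed simp

lemma trace_mem: "trace Pre x J \<in> set ([0] # [] # Pre)"
  by (induction J) (auto simp: step_def)

text \<open>As \<open>x\<close> is increasing, reading the positions of the elements of
  \<open>S\<close> in increasing order spells precisely the sorted word of \<open>S\<close>.
  Conversely, a walk that ends in this word has read exactly the letters of
  \<open>S\<close>.\<close>

lemma trace_canon:
  assumes Pre: "prefix_closed Pre" and S: "canon M S \<in> set Pre" "S \<noteq> []" "set S \<subseteq> {..<M}"
    and x: "\<And>i j. i < j \<Longrightarrow> j < k \<Longrightarrow> x i < x j"
  shows "(\<exists>J\<in>set (dlists k) - {[]}. trace Pre x J = canon M S) \<longleftrightarrow> set S \<subseteq> x ` {..<k}"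
proof
  assume "\<exists>J\<in>set (dlists k) - {[]}. trace Pre x J = canon M S"
  then obtain J where J: "J \<in> set (dlists k)" "trace Pre x J = canon M S" by blast
  have "0 \<notin> set (canon M S)" unfolding canon_def by auto
  then have "trace Pre x J \<noteq> [0]" using J(2) by auto
  then have "map (\<lambda>j. Suc (x j)) (rev J) = canon M S" using J(2) unfolding trace_eq[OF Pre] by (auto split: if_splits)
  then have "set (map (\<lambda>j. Suc (x j)) (rev J)) = set (canon M S)" by simp
  also have "set (canon M S) = Suc ` set S" using S(3) unfolding canon_def by auto
  finally have "Suc ` (x ` set J) = Suc ` set S" by (simp add: image_image)
  then have "x ` set J = set S" by (simp add: inj_image_eq_iff)
  then show "set S \<subseteq> x ` {..<k}" using J(1) unfolding set_dlists by blast
next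
  assume sub: "set S \<subseteq> x ` {..<k}"
  define I where "I = filter (\<lambda>j. x j \<in> set S) [0..<k]"
  have I: "sorted_wrt (<) I" unfolding I_def by (rule sorted_wrt_filter) simp
  have Ik: "set I \<subseteq> {..<k}" unfolding I_def by auto
  have xI: "x ` set I = set S" using sub unfolding I_def by auto
  have "sorted_wrt (<) (map x I)" unfolding sorted_wrt_map
    by (rule sorted_wrt_mono_rel[OF _ I]) (use Ik x in auto)
  then have 1: "sorted (map x I)" "distinct (map x I)" unfolding strict_sorted_iff by auto
  have 2: "sorted (filter (\<lambda>x. \<exists>z\<in>set S. z = x) [0..<M])" "distinct (filter (\<lambda>x. \<exists>z\<in>set S. z = x) [0..<M])"
    by (rule sorted_wrt_filter, simp) (rule distinct_filter, simp)
  have "map x I = filter (\<lambda>x. \<exists>z\<in>set S. z = x) [0..<M]"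
    by (rule sorted_distinct_set_unique[OF 1 2]) (use xI S(3) in auto)
  then have "map (\<lambda>j. Suc (x j)) I = canon M S" unfolding canon_def by (simp add: comp_def map_map[symmetric, of Suc x, unfolded comp_def] del: map_map)
  then have "trace Pre x (rev I) = canon M S" unfolding trace_eq[OF Pre] using S(1) by simp
  moreover have "rev I \<in> set (dlists k)" unfolding set_dlists using I Ik by (simp add: sorted_wrt_rev)
  moreover have "rev I \<noteq> []" using xI S(2) by auto
  ultimately show "\<exists>J\<in>set (dlists k) - {[]}. trace Pre x J = canon M S" by blast
qed

section \<open>Atoms of walks and their cliques\<close>

type_synonym matom = "nat list \<times> nat list \<times> nat"

text \<open>An atom \<open>(J, s, y)\<close> records an index set, the state before its last letter,
  and that letter \<open>y\<close>, the variable at the largest index \<open>hd J\<close>. The state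
  afterwards is a function of \<open>s\<close> and \<open>y\<close>. Walks of singletons start at
  the root.\<close>

definition matoms :: "nat list list \<Rightarrow> nat list list \<Rightarrow> nat list \<Rightarrow> matom list" where
  "matoms Js Pre vs = filter (\<lambda>a. fst a \<noteq> [] \<and> (tl (fst a) = [] \<longrightarrow> fst (snd a) = []))
     (List.product Js (List.product ([0] # [] # Pre) vs))"

text \<open>Everything is a condition on two atoms, so that binary clauses suffice: one atom per
  index set, one variable per index, variables in increasing order, and agreement between the walk
  of \<open>J\<close> and that of \<open>tl J\<close>.\<close>

definition mcompat :: "nat list list \<Rightarrow> matom \<Rightarrow> matom \<Rightarrow> bool" where
  "mcompat Pre a b \<longleftrightarrow> fst a \<noteq> fst b \<and>
     (hd (fst a) = hd (fst b) \<longrightarrow> snd (snd a) = snd (snd b)) \<and>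
     (hd (fst a) < hd (fst b) \<longrightarrow> snd (snd a) < snd (snd b)) \<and>
     (hd (fst b) < hd (fst a) \<longrightarrow> snd (snd b) < snd (snd a)) \<and>
     (tl (fst b) = fst a \<longrightarrow> fst (snd b) = step Pre (fst (snd a)) (snd (snd a))) \<and>
     (tl (fst a) = fst b \<longrightarrow> fst (snd a) = step Pre (fst (snd b)) (snd (snd b)))"

definition matom_of :: "nat list list \<Rightarrow> (nat \<Rightarrow> nat) \<Rightarrow> nat list \<Rightarrow> matom" where
  "matom_of Pre x J = (J, trace Pre x (tl J), x (hd J))"

lemma step_matom_of: "J \<noteq> [] \<Longrightarrow> step Pre (fst (snd (matom_of Pre x J))) (snd (snd (matom_of Pre x J))) = trace Pre x J"
  by (cases J) (auto simp: matom_of_def)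

lemma mcompat_sym: "mcompat Pre a b \<Longrightarrow> mcompat Pre b a"
  unfolding mcompat_def by auto

lemma clique_of_assignment:
  assumes x: "\<And>i j. i < j \<Longrightarrow> j < k \<Longrightarrow> x i < x j" "\<And>j. j < k \<Longrightarrow> x j \<in> set vs"
    and ats: "ats = matoms (dlists k) Pre vs"
  shows "\<exists>B\<subseteq>{..<length ats}. card B = 2 ^ k - 1 \<and> (\<forall>i\<in>B. \<forall>j\<in>B. i \<noteq> j \<longrightarrow> mcompat Pre (ats ! i) (ats ! j)) \<and>
    (!) ats ` B = matom_of Pre x ` (set (dlists k) - {[]})"
proof -
  let ?D = "set (dlists k) - {[]}"
  have mem: "matom_of Pre x J \<in> set ats" if J: "J \<in> ?D" for J
  proof (cases J)
    case (Cons j I)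
    then have "x j \<in> set vs" using dlists_Cons[of j I k] J x(2) by simp
    then show ?thesis using J trace_mem[of Pre x I] Cons unfolding ats matoms_def matom_of_def by auto
  qed (use J in simp)
  have "\<forall>J. \<exists>i. J \<in> ?D \<longrightarrow> i < length ats \<and> ats ! i = matom_of Pre x J"
    using mem unfolding in_set_conv_nth by blast
  from choice[OF this] obtain f where f0: "\<forall>J. J \<in> ?D \<longrightarrow> f J < length ats \<and> ats ! f J = matom_of Pre x J" by (elim exE)
  have f: "f J < length ats" "ats ! f J = matom_of Pre x J" if "J \<in> ?D" for J using f0 that by blast+
  have inj: "inj_on f ?D"
  proof (rule inj_onI)
    fix J J' assume "J \<in> ?D" "J' \<in> ?D" "f J = f J'"
    then have "matom_of Pre x J = matom_of Pre x J'" using f(2)[of J] f(2)[of J'] by simp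
    then show "J = J'" by (simp add: matom_of_def)
  qed
  have comp: "mcompat Pre (matom_of Pre x J) (matom_of Pre x J')" if J: "J \<in> ?D" "J' \<in> ?D" "J \<noteq> J'" for J J'
  proof -
    obtain j I j' I' where eq: "J = j # I" "J' = j' # I'" using J by (cases J; cases J') auto
    then have "j < k" "j' < k" using J dlists_Cons by blast+
    then show ?thesis using x(1)[of j j'] x(1)[of j' j] J(3) unfolding eq mcompat_def matom_of_def by auto
  qed
  have "(!) ats ` f ` ?D = matom_of Pre x ` ?D" unfolding image_image using f(2) by (intro image_cong) auto
  moreover have "card (f ` ?D) = 2 ^ k - 1" using card_image[OF inj] card_dlists by simp
  moreover have "\<forall>i\<in>f ` ?D. \<forall>j\<in>f ` ?D. i \<noteq> j \<longrightarrow> mcompat Pre (ats ! i) (ats ! j)" using f(2) comp by auto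
  moreover have "f ` ?D \<subseteq> {..<length ats}" using f(1) by auto
  ultimately show ?thesis by blast
qed

text \<open>Pairwise compatible atoms have distinct index sets, so \<open>2 ^ k - 1\<close> of them
  contain exactly one for each nonempty set. Singletons determine \<open>x\<close>, and
  compatibility carries variables and states over to all other sets.\<close>

lemma assignment_of_matom_clique:
  assumes B: "B \<subseteq> {..<length ats}" "card B = 2 ^ k - 1"
    "\<And>i j. i \<in> B \<Longrightarrow> j \<in> B \<Longrightarrow> i \<noteq> j \<Longrightarrow> mcompat Pre (ats ! i) (ats ! j)"
    and ats: "ats = matoms (dlists k) Pre vs"
  shows "\<exists>x. (\<forall>i j. i < j \<and> j < k \<longrightarrow> x i < x j) \<and> (\<forall>j<k. x j \<in> set vs) \<and>
    (!) ats ` B = matom_of Pre x ` (set (dlists k) - {[]})"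
proof -
  let ?D = "set (dlists k) - {[]}"
  have at: "fst (ats ! i) \<in> ?D" "snd (snd (ats ! i)) \<in> set vs" "tl (fst (ats ! i)) = [] \<Longrightarrow> fst (snd (ats ! i)) = []"
    if "i \<in> B" for i
  proof -
    have "ats ! i \<in> set ats" using that B(1) by auto
    then show "fst (ats ! i) \<in> ?D" "snd (snd (ats ! i)) \<in> set vs" "tl (fst (ats ! i)) = [] \<Longrightarrow> fst (snd (ats ! i)) = []"
      unfolding ats matoms_def by auto
  qed
  have inj: "inj_on (\<lambda>i. fst (ats ! i)) B"
  proof (rule inj_onI, rule ccontr)
    fix i j assume "i \<in> B" "j \<in> B" "fst (ats ! i) = fst (ats ! j)" "i \<noteq> j"
    then show False using B(3)[of i j] unfolding mcompat_def by simp
  qed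
  have "(\<lambda>i. fst (ats ! i)) ` B \<subseteq> ?D" using at(1) by (intro image_subsetI)
  moreover have "card ((\<lambda>i. fst (ats ! i)) ` B) = card ?D" unfolding card_image[OF inj] B(2) card_dlists ..
  ultimately have img: "(\<lambda>i. fst (ats ! i)) ` B = ?D" by (intro card_subset_eq) simp_all
  have "\<forall>J. \<exists>i. J \<in> ?D \<longrightarrow> i \<in> B \<and> fst (ats ! i) = J"
  proof
    fix J show "\<exists>i. J \<in> ?D \<longrightarrow> i \<in> B \<and> fst (ats ! i) = J"
    proof (cases "J \<in> ?D")
      case True
      then have "J \<in> (\<lambda>i. fst (ats ! i)) ` B" unfolding img .
      then show ?thesis by (elim imageE) auto
    qed blast
  qed
  from choice[OF this] obtain f where f0: "\<forall>J. J \<in> ?D \<longrightarrow> f J \<in> B \<and> fst (ats ! f J) = J" by (elim exE)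
  have f: "f J \<in> B" "fst (ats ! f J) = J" if "J \<in> ?D" for J using f0 that by blast+
  define x where "x = (\<lambda>j. snd (snd (ats ! f [j])))"
  have sing: "[j] \<in> ?D" if "j < k" for j using that by (simp add: set_dlists)
  have y: "snd (snd (ats ! i)) = x (hd (fst (ats ! i)))" if i: "i \<in> B" for i
  proof -
    obtain j I where eq: "fst (ats ! i) = j # I" using at(1)[OF i] by (cases "fst (ats ! i)") auto
    then have j: "j < k" using at(1)[OF i] dlists_Cons[of j I k] by simp
    show ?thesis
    proof (cases "i = f [j]")
      case True then show ?thesis using eq unfolding x_def by simp
    next
      case False
      from B(3)[OF i f(1)[OF sing[OF j]] False] show ?thesis
        unfolding mcompat_def x_def using eq f(2)[OF sing[OF j]] by simp
    qed
  qed
  \<comment> \<open>The atom selected for the tail, which is again an index set, fixes the state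
    stored in the atom for the whole list; singletons start the induction.\<close>
  have s: "i \<in> B \<Longrightarrow> fst (ats ! i) = j # I \<Longrightarrow> fst (snd (ats ! i)) = trace Pre x I" for i j I
  proof (induction I arbitrary: i j)
    case Nil then show ?case using at(3)[of i] by simp
  next
    case (Cons j' I)
    have D: "j' # I \<in> ?D" using at(1)[OF Cons.prems(1)] Cons.prems(2) dlists_Cons[of j "j' # I" k] by simp
    let ?i = "f (j' # I)"
    have i: "?i \<in> B" "fst (ats ! ?i) = j' # I" using f D by blast+
    have "?i \<noteq> i" using i(2) Cons.prems(2) by auto
    from B(3)[OF i(1) Cons.prems(1) this] have "fst (snd (ats ! i)) = step Pre (fst (snd (ats ! ?i))) (snd (snd (ats ! ?i)))"
      unfolding mcompat_def using i(2) Cons.prems(2) by simp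
    then show ?case using Cons.IH[OF i] y[OF i(1)] i(2) by simp
  qed
  have eq: "ats ! i = matom_of Pre x (fst (ats ! i))" if i: "i \<in> B" for i
  proof -
    obtain j I where J: "fst (ats ! i) = j # I" using at(1)[OF i] by (cases "fst (ats ! i)") auto
    show ?thesis using y[OF i] s[OF i J] J unfolding matom_of_def by (simp add: prod_eq_iff)
  qed
  have "(!) ats ` B = matom_of Pre x ` ((\<lambda>i. fst (ats ! i)) ` B)"
    unfolding image_image using eq by (intro image_cong) auto
  then have "(!) ats ` B = matom_of Pre x ` ?D" unfolding img .
  moreover have "x i < x j" if ij: "i < j" "j < k" for i j
  proof -
    have D: "[i] \<in> ?D" "[j] \<in> ?D" using sing ij by auto
    have "f [i] \<noteq> f [j]" using f(2)[OF D(1)] f(2)[OF D(2)] ij(1) by auto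
    from B(3)[OF f(1)[OF D(1)] f(1)[OF D(2)] this] show ?thesis
      unfolding mcompat_def x_def using f(2)[OF D(1)] f(2)[OF D(2)] ij(1) by simp
  qed
  moreover have "x j \<in> set vs" if "j < k" for j unfolding x_def by (rule at(2)[OF f(1)[OF sing[OF that]]])
  ultimately show ?thesis by blast
qed

section \<open>Replacing the bottom clauses of an antimonotone circuit\<close>

abbreviation vx :: "circuit \<Rightarrow> nat \<Rightarrow> vertex" where "vx C i \<equiv> nthd (AndGate []) C i"

text \<open>Recognises bottom clauses, a literal counting as a clause of length one. The circuits
  are not levelled, so clauses may occur at any height.\<close>

definition pure :: "circuit \<Rightarrow> nat \<Rightarrow> bool" where
  "pure C i \<longleftrightarrow> vtag (vx C i) \<le> 1 \<or> (\<forall>j\<in>set (vargs (vx C i)). vtag (vx C j) \<le> 1)"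

definition cvars :: "circuit \<Rightarrow> nat \<Rightarrow> nat list" where
  "cvars C i = (if vtag (vx C i) \<le> 1 then [vnum (vx C i)] else map (\<lambda>j. vnum (vx C j)) (vargs (vx C i)))"

text \<open>A literal at a place where alternation would put a conjunction is read as a conjunction
  of itself alone.\<close>

definition conj_args :: "circuit \<Rightarrow> nat \<Rightarrow> nat list" where
  "conj_args C j = (if vtag (vx C j) \<le> 1 then [j] else vargs (vx C j))"

text \<open>Leaf \<open>Suc (length ats) + j\<close> is the negation of the variable of atom \<open>j\<close>, and \<open>2 * length ats + 1\<close> is the
  negation of an additional variable that is forced to be false.\<close>

definition clause_leaves :: "circuit \<Rightarrow> nat list list \<Rightarrow> matom list \<Rightarrow> nat \<Rightarrow> nat ntree list" where
  "clause_leaves C Pre ats i = map (\<lambda>j. NLf (Suc (length ats) + j))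
     (filter (\<lambda>j. step Pre (fst (snd (nthd ([], [], 0) ats j))) (snd (snd (nthd ([], [], 0) ats j))) =
        canon (vbound C) (cvars C i)) [0..<length ats])"

text \<open>A clause becomes a possibly empty list of negated variables that joins the conjunction
  above it. The always true leaf \<open>2 * length ats + 1\<close> keeps inner conjunctions
  nonempty.\<close>

primrec anti :: "nat \<Rightarrow> circuit \<Rightarrow> nat list list \<Rightarrow> matom list \<Rightarrow> nat list \<Rightarrow> nat ntree list" where
  "anti 0 = (\<lambda>C Pre ats us. concat (map (clause_leaves C Pre ats) us))"
| "anti (Suc m) = (\<lambda>C Pre ats us. concat (map (\<lambda>i. if pure C i then clause_leaves C Pre ats i
     else [Nd (map (\<lambda>j. Nd (NLf (2 * length ats + 1) # anti m C Pre ats (conj_args C j))) (vargs (vx C i)))]) us))"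

lemma vtag_literal [simp]: "vtag w \<le> Suc 0 \<longleftrightarrow> is_literal w"
  using vertex_by_tag(1)[of w] by simp

lemma anti_tok: "t \<in> set (anti m C Pre ats us) \<Longrightarrow> tok (2 * length ats + 2) (2 * m) t"
proof (induction m arbitrary: us t)
  case 0 then show ?case by (auto simp: clause_leaves_def)
next
  case (Suc m)
  then obtain i where i: "i \<in> set us" "t \<in> set (if pure C i then clause_leaves C Pre ats i
     else [Nd (map (\<lambda>j. Nd (NLf (2 * length ats + 1) # anti m C Pre ats (conj_args C j))) (vargs (vx C i)))])" by auto
  show ?case
  proof (cases "pure C i")
    case True then show ?thesis using i(2) by (auto simp: clause_leaves_def)
  next
    case False
    then have "vargs (vx C i) \<noteq> []" unfolding pure_def by auto
    then show ?thesis using i(2) False Suc.IH by auto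
  qed
qed

locale anti_pi =
  fixes C :: circuit and t :: nat
  assumes Pi: "Pi_circuit t C" and anti: "antimonotone C"
begin

lemma ic: "is_circuit C" using Pi unfolding Pi_circuit_def by blast

lemma literal: "j < length C \<Longrightarrow> is_literal (C ! j) \<Longrightarrow> C ! j = Literal False (vnum (C ! j))"
  using anti nth_mem[of j C] unfolding antimonotone_def vnum_def by (cases "C ! j") auto

lemma nbr_less: "j < length C \<Longrightarrow> i \<in> in_nbrs (C ! j) \<Longrightarrow> i < length C"
  using ic unfolding is_circuit_def by fastforce

lemma value_literal: "j < length C \<Longrightarrow> is_literal (C ! j) \<Longrightarrow> value_at A C j = (vnum (C ! j) \<notin> A)"
  using value_at_nth[OF ic, of j A] arg_cong[OF literal[of j], of "vertex_value A (sweep (vertex_value A) C)"] by simp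

lemma gate_cases:
  assumes j: "j < length C" "\<not> is_literal (C ! j)"
  shows "vargs (C ! j) \<noteq> []" "in_nbrs (C ! j) = set (vargs (C ! j))"
    "is_and (C ! j) \<Longrightarrow> value_at A C j = (\<forall>i\<in>set (vargs (C ! j)). value_at A C i)"
    "\<not> is_and (C ! j) \<Longrightarrow> value_at A C j = (\<exists>i\<in>set (vargs (C ! j)). value_at A C i)"
proof -
  have n: "\<not> is_not (C ! j)" using Pi nth_mem[OF j(1)] unfolding Pi_circuit_def by blast
  show nb: "in_nbrs (C ! j) = set (vargs (C ! j))" using n j(2) by (cases "C ! j") (auto simp: vargs_def)
  have "in_nbrs (C ! j) \<noteq> {}" using ic nth_mem[OF j(1)] j(2) unfolding is_circuit_def by blast
  then show "vargs (C ! j) \<noteq> []" unfolding nb by simp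
  note v = value_at_nth[OF ic j(1), of A]
  show "is_and (C ! j) \<Longrightarrow> value_at A C j = (\<forall>i\<in>set (vargs (C ! j)). value_at A C i)"
    using v by (cases "C ! j") (auto simp: vargs_def value_at_def)
  show "\<not> is_and (C ! j) \<Longrightarrow> value_at A C j = (\<exists>i\<in>set (vargs (C ! j)). value_at A C i)"
    using v n j(2) by (cases "C ! j") (auto simp: vargs_def value_at_def)
qed

lemma alternates:
  assumes "j < length C" "i \<in> in_nbrs (C ! j)" "\<not> is_literal (C ! i)"
  shows "is_and (C ! i) \<longleftrightarrow> \<not> is_and (C ! j)"
  using Pi assms unfolding Pi_circuit_def by blast

text \<open>All literals are negative, so a clause over a set of variables fails iff the whole set
  is contained in \<open>A\<close>.\<close>

lemma pure_value:
  assumes i: "i < length C" "\<not> is_and (C ! i)" "pure C i"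
  shows "value_at A C i = (\<not> set (cvars C i) \<subseteq> A)" "cvars C i \<noteq> []" "set (cvars C i) \<subseteq> vars C"
proof -
  have lv: "vnum (C ! j) \<in> vars C" if "j < length C" "is_literal (C ! j)" for j
  proof -
    have "Literal False (vnum (C ! j)) \<in> set C" using nth_mem[OF that(1)] unfolding literal[OF that, symmetric] .
    then show ?thesis unfolding vars_def by blast
  qed
  have "value_at A C i = (\<not> set (cvars C i) \<subseteq> A) \<and> cvars C i \<noteq> [] \<and> set (cvars C i) \<subseteq> vars C"
  proof (cases "is_literal (C ! i)")
    case True
    then have "cvars C i = [vnum (C ! i)]" unfolding cvars_def using i(1) by simp
    then show ?thesis using value_literal[OF i(1) True] lv[OF i(1) True] by simp
  next
    case False
    note g = gate_cases[OF i(1) False]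
    have l: "j < length C" if "j \<in> set (vargs (C ! i))" for j using nbr_less[OF i(1)] that g(2) by blast
    have lit: "is_literal (C ! j)" if "j \<in> set (vargs (C ! i))" for j
      using i(1,3) False that l[OF that] unfolding pure_def by (auto)
    have "cvars C i = map (\<lambda>j. vnum (C ! j)) (vargs (C ! i))"
      unfolding cvars_def using i(1) False l by simp
    then show ?thesis using g(1) g(4)[OF i(2), of A] value_literal[OF l lit, of _ A] lv[OF l lit] by auto
  qed
  then show "value_at A C i = (\<not> set (cvars C i) \<subseteq> A)" "cvars C i \<noteq> []" "set (cvars C i) \<subseteq> vars C" by blast+
qed

lemma depth_literal: "j < length C \<Longrightarrow> depth_at C j = 0 \<Longrightarrow> is_literal (C ! j)"
  using depth_at_nth[OF ic, of j] by (cases "is_literal (C ! j)") auto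

lemma pure_of_depth:
  assumes i: "i < length C" "depth_at C i \<le> 1" shows "pure C i"
proof (cases "is_literal (C ! i)")
  case True then show ?thesis unfolding pure_def using i(1) by simp
next
  case False
  have "vtag (vx C j) \<le> 1" if j: "j \<in> set (vargs (C ! i))" for j
  proof -
    have nb: "j \<in> in_nbrs (C ! i)" using gate_cases(2)[OF i(1) False] j by blast
    have "depth_at C j = 0" using depth_at_nbr[OF ic i(1) nb] i(2) by simp
    then show ?thesis using depth_literal nbr_less[OF i(1) nb] by simp
  qed
  then show ?thesis unfolding pure_def using i(1) by simp
qed

lemma conj_args:
  assumes j: "j < length C" "is_literal (C ! j) \<or> is_and (C ! j)" "depth_at C j \<le> Suc d"
  shows "value_at A C j = (\<forall>i\<in>set (conj_args C j). value_at A C i)"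
    "\<forall>i\<in>set (conj_args C j). i < length C \<and> \<not> is_and (C ! i) \<and> depth_at C i \<le> d"
proof -
  have "value_at A C j = (\<forall>i\<in>set (conj_args C j). value_at A C i) \<and>
    (\<forall>i\<in>set (conj_args C j). i < length C \<and> \<not> is_and (C ! i) \<and> depth_at C i \<le> d)"
  proof (cases "is_literal (C ! j)")
    case True
    then have "conj_args C j = [j]" unfolding conj_args_def using j(1) by simp
    moreover have "\<not> is_and (C ! j)" using True by (cases "C ! j") auto
    moreover have "depth_at C j = 0" using depth_at_nth[OF ic j(1)] True by simp
    ultimately show ?thesis using j(1) by simp
  next
    case False
    then have a: "is_and (C ! j)" using j(2) by simp
    note g = gate_cases[OF j(1) False]
    have eq: "conj_args C j = vargs (C ! j)" unfolding conj_args_def using j(1) False by simp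
    have "i < length C \<and> \<not> is_and (C ! i) \<and> depth_at C i \<le> d" if "i \<in> set (vargs (C ! j))" for i
    proof -
      have nb: "i \<in> in_nbrs (C ! j)" using that g(2) by blast
      have "\<not> is_and (C ! i)" using alternates[OF j(1) nb] a by (cases "C ! i") auto
      then show ?thesis using nbr_less[OF j(1) nb] depth_at_nbr[OF ic j(1) nb] j(3) by simp
    qed
    then show ?thesis unfolding eq using g(3)[OF a, of A] by blast
  qed
  then show "value_at A C j = (\<forall>i\<in>set (conj_args C j). value_at A C i)"
    "\<forall>i\<in>set (conj_args C j). i < length C \<and> \<not> is_and (C ! i) \<and> depth_at C i \<le> d" by blast+
qed

text \<open>Each round of the induction unfolds a disjunction and the conjunctions below it; at
  \<open>m = 0\<close> the remaining depth is at most 1, and every vertex is a clause.\<close>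

lemma anti_correct:
  assumes cl: "\<And>i. i < length C \<Longrightarrow> \<not> is_and (C ! i) \<Longrightarrow> pure C i \<Longrightarrow>
      (\<forall>t\<in>set (clause_leaves C Pre ats i). ev I False t) \<longleftrightarrow> \<not> set (cvars C i) \<subseteq> A"
    and dummy: "I (2 * length ats + 1)"
  shows "\<forall>i\<in>set us. i < length C \<and> \<not> is_and (C ! i) \<and> depth_at C i \<le> 2 * m + 1 \<Longrightarrow>
    (\<forall>t\<in>set (anti m C Pre ats us). ev I False t) = (\<forall>i\<in>set us. value_at A C i)"
proof (induction m arbitrary: us)
  case 0
  have "(\<forall>t\<in>set (clause_leaves C Pre ats i). ev I False t) = value_at A C i" if "i \<in> set us" for i
    using 0 that cl[of i] pure_of_depth[of i] pure_value(1)[of i A] by simp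
  then show ?case by auto
next
  case (Suc m)
  define F where "F = (\<lambda>i. if pure C i then clause_leaves C Pre ats i
     else [Nd (map (\<lambda>j. Nd (NLf (2 * length ats + 1) # anti m C Pre ats (conj_args C j))) (vargs (vx C i)))])"
  have *: "anti (Suc m) C Pre ats us = concat (map F us)" unfolding F_def by (simp only: anti.simps)
  have "(\<forall>t\<in>set (F i). ev I False t) = value_at A C i" if iu: "i \<in> set us" for i
  proof -
    have i: "i < length C" "\<not> is_and (C ! i)" "depth_at C i \<le> Suc (Suc (2 * m + 1))" using Suc.prems iu by auto
    show ?thesis
    proof (cases "pure C i")
      case True then show ?thesis using cl[OF i(1,2)] pure_value(1)[OF i(1,2)] unfolding F_def by simp
    next
      case False
      then have nl: "\<not> is_literal (C ! i)" unfolding pure_def using i(1) by (auto)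
      note g = gate_cases[OF i(1) nl]
      have "(\<forall>t\<in>set (anti m C Pre ats (conj_args C j)). ev I False t) = value_at A C j" if j: "j \<in> set (vargs (C ! i))" for j
      proof -
        have nb: "j \<in> in_nbrs (C ! i)" using j g(2) by blast
        have "is_literal (C ! j) \<or> is_and (C ! j)" using alternates[OF i(1) nb] i(2) by blast
        moreover have "depth_at C j \<le> Suc (2 * m + 1)" using depth_at_nbr[OF ic i(1) nb] i(3) by simp
        ultimately show ?thesis using Suc.IH conj_args[OF nbr_less[OF i(1) nb]] by blast
      qed
      then show ?thesis using False g(4)[OF i(2), of A] i(1) dummy unfolding F_def by auto
    qed
  qed
  then have "(\<forall>i\<in>set us. \<forall>t\<in>set (F i). ev I False t) = (\<forall>i\<in>set us. value_at A C i)" by (intro ball_cong refl)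
  then show ?case unfolding * by simp
qed

end

text \<open>Words are taken for every vertex, clause or not. The additional ones only enlarge the
  trie, as correctness rests on closure under prefixes and on the presence of the words of actual
  clauses.\<close>

definition prefs :: "circuit \<Rightarrow> nat list list" where
  "prefs C = concat (map (\<lambda>i. map (\<lambda>n. take (Suc n) (canon (vbound C) (cvars C i)))
     [0..<length (canon (vbound C) (cvars C i))]) [0..<length C])"

lemma set_prefs: "s \<in> set (prefs C) \<longleftrightarrow> s \<noteq> [] \<and> (\<exists>i<length C. \<exists>r. canon (vbound C) (cvars C i) = s @ r)"
proof -
  have "(\<exists>n<length c. s = take (Suc n) c) \<longleftrightarrow> s \<noteq> [] \<and> (\<exists>r. c = s @ r)" for c :: "nat list"
  proof
    assume "\<exists>n<length c. s = take (Suc n) c"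
    then obtain n where n: "n < length c" "s = take (Suc n) c" by blast
    then have "c = s @ drop (Suc n) c" by simp
    moreover have "s \<noteq> []" using n by auto
    ultimately show "s \<noteq> [] \<and> (\<exists>r. c = s @ r)" by blast
  next
    assume "s \<noteq> [] \<and> (\<exists>r. c = s @ r)"
    then obtain r where r: "s \<noteq> []" "c = s @ r" by blast
    then have "length s - 1 < length c \<and> s = take (Suc (length s - 1)) c" by (cases s) auto
    then show "\<exists>n<length c. s = take (Suc n) c" by blast
  qed
  moreover have "s \<in> set (prefs C) \<longleftrightarrow> (\<exists>i<length C. \<exists>n<length (canon (vbound C) (cvars C i)). s = take (Suc n) (canon (vbound C) (cvars C i)))"
  proof -
    define c where "c = (\<lambda>i. canon (vbound C) (cvars C i))"
    have "set (prefs C) = (\<Union>i\<in>{..<length C}. (\<lambda>n. take (Suc n) (c i)) ` {..<length (c i)})"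
      unfolding prefs_def c_def by (simp add: atLeast0LessThan)
    then have "s \<in> set (prefs C) \<longleftrightarrow> (\<exists>i<length C. \<exists>n<length (c i). s = take (Suc n) (c i))" by auto
    then show ?thesis unfolding c_def .
  qed
  ultimately show ?thesis by auto
qed

lemma prefix_closed_prefs: "prefix_closed (prefs C)"
  unfolding prefix_closed_def
proof (intro conjI allI impI ballI)
  fix s y assume "s @ [y] \<in> set (prefs C) \<and> s \<noteq> []"
  then show "s \<in> set (prefs C)" unfolding set_prefs by auto
next
  fix s assume "s \<in> set (prefs C)"
  then obtain i r where "canon (vbound C) (cvars C i) = s @ r" unfolding set_prefs by blast
  moreover have "0 \<notin> set (canon (vbound C) (cvars C i))" unfolding canon_def by auto
  ultimately show "0 \<notin> set s" by simp
qed

text \<open>\<open>mcompat\<close> is symmetric, so ordered pairs of positions suffice, and it fails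
  on the diagonal, which has to be left out.\<close>

definition mconflicts :: "nat list list \<Rightarrow> matom list \<Rightarrow> (nat \<times> nat) list" where
  "mconflicts Pre ats = filter (\<lambda>p. fst p < snd p \<and>
       \<not> mcompat Pre (nthd ([], [], 0) ats (fst p)) (nthd ([], [], 0) ats (snd p)))
     (List.product [0..<length ats] [0..<length ats])"

text \<open>Inputs must be positive here, so each variable is followed by its NOT-gate. The variable
  \<open>length ats\<close> is an additional one whose negation serves as a true leaf.\<close>

definition mbase :: "nat list list \<Rightarrow> matom list \<Rightarrow> circuit" where
  "mbase Pre ats = map (Literal True) [0..<Suc (length ats)] @ map NotGate [0..<Suc (length ats)] @
     map (\<lambda>p. OrGate [Suc (length ats) + fst p, Suc (length ats) + snd p]) (mconflicts Pre ats)"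

text \<open>The direct in-neighbours of the output are the negation of the additional variable,
  which forces it to be false, and all binary clauses.\<close>

definition member_circuit :: "nat \<Rightarrow> circuit \<Rightarrow> nat list list \<Rightarrow> matom list \<Rightarrow> circuit" where
  "member_circuit m C Pre ats = assemble (2 * m) (mbase Pre ats)
     (anti m C Pre ats (conj_args C (length C - 1)))
     [Suc (2 * length ats)..<2 * length ats + 2 + length (mconflicts Pre ats)]"

lemma set_mconflicts:
  "p \<in> set (mconflicts Pre ats) \<longleftrightarrow> fst p < snd p \<and> snd p < length ats \<and> \<not> mcompat Pre (ats ! fst p) (ats ! snd p)"
  unfolding mconflicts_def by (cases p) auto

lemma mbase_nth:
  fixes Pre :: "nat list list" and ats :: "matom list"
  defines "M \<equiv> Suc (length ats)" and "cf \<equiv> mconflicts Pre ats"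
  shows "i < M \<Longrightarrow> mbase Pre ats ! i = Literal True i"
    "i < M \<Longrightarrow> mbase Pre ats ! (M + i) = NotGate i"
    "i < length cf \<Longrightarrow> mbase Pre ats ! (2 * M + i) = OrGate [M + fst (cf ! i), M + snd (cf ! i)]"
    "length (mbase Pre ats) = 2 * M + length cf"
  unfolding mbase_def M_def[symmetric] cf_def[symmetric] by (simp_all add: nth_append del: upt_Suc)

lemma mbase_cases:
  assumes "j < length (mbase Pre ats)"
  obtains (lit) "j < Suc (length ats)" "mbase Pre ats ! j = Literal True j"
  | (neg) i where "i < Suc (length ats)" "j = Suc (length ats) + i" "mbase Pre ats ! j = NotGate i"
  | (disj) p i where "i < length (mconflicts Pre ats)" "p = mconflicts Pre ats ! i" "j = 2 * Suc (length ats) + i"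
      "p \<in> set (mconflicts Pre ats)" "mbase Pre ats ! j = OrGate [Suc (length ats) + fst p, Suc (length ats) + snd p]"
proof -
  let ?M = "Suc (length ats)"
  consider "j < ?M" | "?M \<le> j" "j < 2 * ?M" | "2 * ?M \<le> j" by linarith
  then show thesis
  proof cases
    case 1 then show ?thesis by (intro lit mbase_nth(1))
  next
    case 2
    then have "j - ?M < ?M" "j = ?M + (j - ?M)" by simp_all
    then show ?thesis using neg[of "j - ?M"] mbase_nth(2)[of "j - ?M" ats Pre] by simp
  next
    case 3
    then obtain i where j: "j = 2 * ?M + i" using le_Suc_ex by blast
    have i: "i < length (mconflicts Pre ats)" using assms unfolding mbase_nth(4) j by simp
    show ?thesis by (rule disj[OF i refl j nth_mem[OF i]]) (unfold j, rule mbase_nth(3)[OF i])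
  qed
qed

lemma is_circuit_mbase: "is_circuit (mbase Pre ats)"
proof -
  let ?B = "mbase Pre ats"
  have nb: "in_nbrs (?B ! j) \<subseteq> {..<j} \<and> (\<not> is_literal (?B ! j) \<longrightarrow> in_nbrs (?B ! j) \<noteq> {})" if j: "j < length ?B" for j
    using j
  proof (cases rule: mbase_cases)
    case (disj p i)
    then show ?thesis unfolding set_mconflicts by simp
  qed simp_all
  have "filter is_literal ?B = map (Literal True) [0..<Suc (length ats)]"
    unfolding mbase_def by (simp add: filter_empty_conv del: upt_Suc)
  moreover have "?B \<noteq> []" unfolding mbase_def by simp
  moreover have "distinct (map (Literal True) [0..<Suc (length ats)])" unfolding distinct_map by (simp add: inj_on_def)
  moreover have "in_nbrs v \<noteq> {}" if v: "v \<in> set ?B" "\<not> is_literal v" for v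
  proof -
    obtain j where "j < length ?B" "v = ?B ! j" using v(1) unfolding in_set_conv_nth by blast
    then show ?thesis using nb v(2) by blast
  qed
  ultimately show ?thesis unfolding is_circuit_def using nb by (simp del: upt_Suc)
qed

lemma value_mbase:
  "i < Suc (length ats) \<Longrightarrow> value_at D (mbase Pre ats) i = (i \<in> D)"
  "i < Suc (length ats) \<Longrightarrow> value_at D (mbase Pre ats) (Suc (length ats) + i) = (i \<notin> D)"
  "i < length (mconflicts Pre ats) \<Longrightarrow> value_at D (mbase Pre ats) (2 * Suc (length ats) + i) =
     (fst (mconflicts Pre ats ! i) \<notin> D \<or> snd (mconflicts Pre ats ! i) \<notin> D)"
proof -
  let ?B = "mbase Pre ats" and ?M = "Suc (length ats)"
  note v = value_at_nth[OF is_circuit_mbase, where A = D]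
  show 1: "value_at D ?B i = (i \<in> D)" if "i < ?M" for i
    using v[of i Pre ats] mbase_nth(1)[OF that, of Pre] mbase_nth(4)[of Pre ats] that by simp
  show 2: "value_at D ?B (?M + i) = (i \<notin> D)" if i: "i < ?M" for i
  proof -
    have "value_at D ?B (?M + i) = (\<not> value_at D ?B i)"
      using v[of "?M + i" Pre ats] mbase_nth(2)[OF i, of Pre] mbase_nth(4)[of Pre ats] i by (simp add: value_at_def)
    then show ?thesis using 1[OF i] by simp
  qed
  show "value_at D ?B (2 * ?M + i) = (fst (mconflicts Pre ats ! i) \<notin> D \<or> snd (mconflicts Pre ats ! i) \<notin> D)"
    if i: "i < length (mconflicts Pre ats)" for i
  proof -
    let ?p = "mconflicts Pre ats ! i"
    have p: "fst ?p < ?M" "snd ?p < ?M" using nth_mem[OF i] unfolding set_mconflicts by simp_all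
    have "value_at D ?B (2 * ?M + i) = (value_at D ?B (?M + fst ?p) \<or> value_at D ?B (?M + snd ?p))"
      using v[of "2 * ?M + i" Pre ats] mbase_nth(3)[OF i] mbase_nth(4)[of Pre ats] i by (simp add: value_at_def)
    then show ?thesis unfolding 2[OF p(1)] 2[OF p(2)] .
  qed
qed

lemma height_mbase:
  "j < length (mbase Pre ats) \<Longrightarrow> depth_at (mbase Pre ats) j \<le> 2"
  "j < 2 * Suc (length ats) \<Longrightarrow> depth_at (mbase Pre ats) j \<le> 1"
  "j < length (mbase Pre ats) \<Longrightarrow> weft_at (mbase Pre ats) j = 0"
proof -
  let ?B = "mbase Pre ats" and ?M = "Suc (length ats)"
  have len: "?M + i < length ?B" "i < length ?B" if "i < ?M" for i using that mbase_nth(4)[of Pre ats] by simp_all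
  note d = depth_at_nth[OF is_circuit_mbase] and w = weft_at_nth[OF is_circuit_mbase]
  have l: "depth_at ?B i = 0" "weft_at ?B i = 0" if "i < ?M" for i
    using d[OF len(2)[OF that]] w[OF len(2)[OF that]] mbase_nth(1)[OF that, of Pre] by simp_all
  have n: "depth_at ?B (?M + i) = 1" "weft_at ?B (?M + i) = 0" if i: "i < ?M" for i
    using d[OF len(1)[OF i]] w[OF len(1)[OF i]] mbase_nth(2)[OF i, of Pre] l[OF i] by simp_all
  have all: "depth_at ?B j \<le> 2 \<and> weft_at ?B j = 0" if j: "j < length ?B" for j
    using j
  proof (cases rule: mbase_cases)
    case lit then show ?thesis using l by simp
  next
    case (neg i) then show ?thesis using n by simp
  next
    case (disj p i)
    have p: "fst p < ?M" "snd p < ?M" using disj(4) unfolding set_mconflicts by simp_all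
    have "card {?M + fst p, ?M + snd p} \<le> 2" by (simp add: card_insert_if)
    then show ?thesis using d[OF j] w[OF j] disj(5) n[OF p(1)] n[OF p(2)] by simp
  qed
  then show "j < length ?B \<Longrightarrow> depth_at ?B j \<le> 2" "j < length ?B \<Longrightarrow> weft_at ?B j = 0" by blast+
  show "depth_at ?B j \<le> 1" if "j < 2 * ?M"
  proof (cases "j < ?M")
    case True then show ?thesis using l by simp
  next
    case False then show ?thesis using n(1)[of "j - ?M"] that by simp
  qed
qed

text \<open>NOT-gates and binary clauses have at most two in-neighbours, so only the
  \<open>2 * m\<close> tree levels and the output gate can contribute to the weft.\<close>

lemma member_circuit:
  fixes Pre :: "nat list list" and ats :: "matom list"
  shows "weft_circuit (2 * m + 1) (2 * m + 3) (member_circuit m C Pre ats)"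
    "vars (member_circuit m C Pre ats) = {..<Suc (length ats)}"
    "satisfies D (member_circuit m C Pre ats) \<longleftrightarrow>
       (\<forall>t\<in>set (anti m C Pre ats (conj_args C (length C - 1))). ev (value_at D (mbase Pre ats)) False t) \<and>
       length ats \<notin> D \<and> (\<forall>p\<in>set (mconflicts Pre ats). fst p \<notin> D \<or> snd p \<notin> D)"
proof -
  let ?M = "Suc (length ats)" and ?B = "mbase Pre ats" and ?cf = "mconflicts Pre ats"
  let ?ts = "anti m C Pre ats (conj_args C (length C - 1))"
  define xs where "xs = [Suc (2 * length ats)..<2 * length ats + 2 + length ?cf]"
  have eq: "member_circuit m C Pre ats = assemble (2 * m) ?B ?ts xs" unfolding member_circuit_def xs_def ..
  have len: "length ?B = 2 * ?M + length ?cf" by (rule mbase_nth(4))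
  interpret assembly "2 * ?M" "2 * m" ?B ?ts xs
  proof
    show "is_circuit ?B" by (rule is_circuit_mbase)
    show "2 * ?M \<le> length ?B" using len by simp
    show "tok (2 * ?M) (2 * m) t" if "t \<in> set ?ts" for t using anti_tok[OF that] by simp
    show "set xs \<subseteq> {..<length ?B}" unfolding xs_def len by auto
    show "xs \<noteq> []" unfolding xs_def by simp
  qed
  have lit: "Literal b x \<in> set ?B \<longleftrightarrow> b \<and> x < ?M" for b x unfolding mbase_def by auto
  show "vars (member_circuit m C Pre ats) = {..<?M}" unfolding eq vars_assemble unfolding vars_def lit by auto
  have "depth (assemble (2 * m) ?B ?ts xs) \<le> Suc (2 * m + 2)"
  proof (rule depth_assemble)
    show "depth_at ?B a \<le> 1" if "a < 2 * ?M" for a by (rule height_mbase(2)[OF that])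
    show "depth_at ?B i \<le> 2 * m + 2" if "i \<in> set xs" for i using height_mbase(1)[OF xs_less[OF that]] by simp
  qed simp
  moreover have "weft (assemble (2 * m) ?B ?ts xs) \<le> Suc (2 * m)"
  proof (rule weft_assemble)
    show "weft_at ?B a \<le> 0" if "a < 2 * ?M" for a using height_mbase(3)[of a Pre ats] that len by simp
    show "weft_at ?B i \<le> 2 * m" if "i \<in> set xs" for i using height_mbase(3)[OF xs_less[OF that]] by simp
  qed simp
  moreover have "b" if l: "Literal b x \<in> set (assemble (2 * m) ?B ?ts xs)" for b x
  proof -
    obtain gs where gs: "C' = ?B @ gs" "\<forall>v\<in>set gs. \<not> is_literal v" using C'_ext by blast
    have "Literal b x \<in> set ?B" using l gs unfolding assemble_eq by (auto dest!: bspec)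
    then show b using lit by simp
  qed
  ultimately show "weft_circuit (2 * m + 1) (2 * m + 3) (member_circuit m C Pre ats)"
    unfolding weft_circuit_def eq using is_circuit_assemble by auto
  have "set xs = insert (?M + length ats) ((\<lambda>i. 2 * ?M + i) ` {..<length ?cf})"
  proof -
    have "{Suc (2 * n)..<2 * n + 2 + L} = insert (Suc n + n) ((\<lambda>i. 2 * Suc n + i) ` {..<L})" for n L :: nat
    proof (intro set_eqI iffI)
      fix j assume "j \<in> {Suc (2 * n)..<2 * n + 2 + L}"
      then have "j = Suc n + n \<or> 2 * Suc n \<le> j \<and> j - 2 * Suc n < L" by auto
      then show "j \<in> insert (Suc n + n) ((\<lambda>i. 2 * Suc n + i) ` {..<L})"
      proof
        assume "2 * Suc n \<le> j \<and> j - 2 * Suc n < L"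
        then show ?thesis by (intro insertI2 image_eqI[of _ _ "j - 2 * Suc n"]) auto
      qed simp
    qed auto
    then show ?thesis unfolding xs_def set_upt .
  qed
  then have "(\<forall>i\<in>set xs. value_at D ?B i) \<longleftrightarrow> length ats \<notin> D \<and> (\<forall>i<length ?cf. value_at D ?B (2 * ?M + i))"
    using value_mbase(2)[of "length ats" ats D Pre] by auto
  also have "\<dots> \<longleftrightarrow> length ats \<notin> D \<and> (\<forall>i<length ?cf. fst (?cf ! i) \<notin> D \<or> snd (?cf ! i) \<notin> D)"
    using value_mbase(3)[of _ Pre ats D] by blast
  also have "\<dots> \<longleftrightarrow> length ats \<notin> D \<and> (\<forall>p\<in>set ?cf. fst p \<notin> D \<or> snd p \<notin> D)" unfolding all_set_conv_all_nth ..
  finally show "satisfies D (member_circuit m C Pre ats) \<longleftrightarrow> (\<forall>t\<in>set ?ts. ev (value_at D ?B) False t) \<and>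
       length ats \<notin> D \<and> (\<forall>p\<in>set ?cf. fst p \<notin> D \<or> snd p \<notin> D)" unfolding eq satisfies_assemble by (simp only:)
qed

text \<open>A clause is violated iff some index set walks to its word, and this is visible at a
  single selected atom. The clause thus amounts to a conjunction of negated variables, and a clique
  of \<open>2 ^ k - 1\<close> atoms stands for the whole assignment.\<close>

lemma (in anti_pi) weighted_satisfiable_member_circuit:
  fixes m k :: nat
  assumes t: "t \<le> 2 * m + 2"
  defines "ats \<equiv> matoms (dlists k) (prefs C) (vlist C)"
  shows "weighted_satisfiable C k \<longleftrightarrow> weighted_satisfiable (member_circuit m C (prefs C) ats) (2 ^ k - 1)"
proof -
  let ?Pre = "prefs C" and ?M = "Suc (length ats)" and ?D = "set (dlists k) - {[]}"
  let ?ts = "anti m C ?Pre ats (conj_args C (length C - 1))"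
  have ats: "ats = matoms (dlists k) (prefs C) (vlist C)" unfolding ats_def ..
  have ne: "C \<noteq> []" using ic unfolding is_circuit_def by blast
  have key: "(\<forall>t\<in>set ?ts. ev (value_at D (mbase ?Pre ats)) False t) \<longleftrightarrow> satisfies (x ` {..<k}) C"
    if D: "D \<subseteq> {..<length ats}" "(!) ats ` D = matom_of ?Pre x ` ?D" and x: "\<And>i j. i < j \<Longrightarrow> j < k \<Longrightarrow> x i < x j" for D x
  proof -
    let ?I = "value_at D (mbase ?Pre ats)"
    have cl: "(\<forall>t\<in>set (clause_leaves C ?Pre ats i). ev ?I False t) \<longleftrightarrow> \<not> set (cvars C i) \<subseteq> x ` {..<k}"
      if i: "i < length C" "\<not> is_and (C ! i)" "pure C i" for i
    proof -
      let ?c = "canon (vbound C) (cvars C i)"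
      have cv: "cvars C i \<noteq> []" "set (cvars C i) \<subseteq> {..<vbound C}"
        using pure_value(2,3)[OF i] vbound_less[of _ C] by auto
      then have "set ?c \<noteq> {}" unfolding canon_def by (cases "cvars C i") auto
      then have c: "?c \<in> set ?Pre" unfolding set_prefs using i(1) by auto
      have "(\<forall>t\<in>set (clause_leaves C ?Pre ats i). ev ?I False t) \<longleftrightarrow>
        (\<forall>j<length ats. step ?Pre (fst (snd (ats ! j))) (snd (snd (ats ! j))) = ?c \<longrightarrow> ?I (?M + j))"
        unfolding clause_leaves_def by auto
      also have "\<dots> \<longleftrightarrow> (\<forall>j<length ats. step ?Pre (fst (snd (ats ! j))) (snd (snd (ats ! j))) = ?c \<longrightarrow> j \<notin> D)"
        using value_mbase(2)[of _ ats D ?Pre] by simp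
      also have "\<dots> \<longleftrightarrow> \<not> (\<exists>a\<in>(!) ats ` D. step ?Pre (fst (snd a)) (snd (snd a)) = ?c)" using D(1) by auto
      also have "\<dots> \<longleftrightarrow> \<not> (\<exists>J\<in>?D. trace ?Pre x J = ?c)"
      proof -
        have "step ?Pre (fst (snd (matom_of ?Pre x J))) (snd (snd (matom_of ?Pre x J))) = trace ?Pre x J" if "J \<in> ?D" for J
          by (rule step_matom_of) (use that in simp)
        then show ?thesis unfolding D(2) bex_simps(7) by (intro arg_cong[of _ _ Not] bex_cong refl) simp
      qed
      also have "\<dots> \<longleftrightarrow> \<not> set (cvars C i) \<subseteq> x ` {..<k}"
        using trace_canon[OF prefix_closed_prefs c cv x] by simp
      finally show ?thesis .
    qed
    have dummy: "?I (2 * length ats + 1)"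
    proof -
      have "length ats \<notin> D" using D(1) by auto
      then show ?thesis using value_mbase(2)[of "length ats" ats D ?Pre] by (simp add: mult_2)
    qed
    have last: "is_and (C ! (length C - 1))" "depth_at C (length C - 1) \<le> Suc (2 * m + 1)"
      using Pi t ne unfolding Pi_circuit_def last_conv_nth[OF ne] depth_conv[OF ne] by auto
    note ca = conj_args[of "length C - 1", OF _ _ last(2)]
    have "(\<forall>t\<in>set ?ts. ev ?I False t) \<longleftrightarrow> (\<forall>i\<in>set (conj_args C (length C - 1)). value_at (x ` {..<k}) C i)"
      by (rule anti_correct[OF cl dummy ca(2)]) (use ne last(1) in auto)
    also have "\<dots> \<longleftrightarrow> value_at (x ` {..<k}) C (length C - 1)" by (rule ca(1)[symmetric]) (use ne last(1) in auto)
    also have "\<dots> \<longleftrightarrow> satisfies (x ` {..<k}) C" by (rule satisfies_conv[OF ne, symmetric])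
    finally show ?thesis .
  qed
  note mc = member_circuit[where m = m and C = C and Pre = ?Pre and ats = ats]
  have cf: "(\<forall>p\<in>set (mconflicts ?Pre ats). fst p \<notin> D \<or> snd p \<notin> D) \<longleftrightarrow>
      (\<forall>i\<in>D. \<forall>j\<in>D. i \<noteq> j \<longrightarrow> mcompat ?Pre (ats ! i) (ats ! j))" if D: "D \<subseteq> {..<length ats}" for D
  proof
    assume L: "\<forall>p\<in>set (mconflicts ?Pre ats). fst p \<notin> D \<or> snd p \<notin> D"
    have lt: "mcompat ?Pre (ats ! i) (ats ! j)" if ij: "i \<in> D" "j \<in> D" "i < j" for i j
    proof (rule ccontr)
      assume "\<not> mcompat ?Pre (ats ! i) (ats ! j)"
      moreover have "j < length ats" using ij D by auto
      ultimately have "(i, j) \<in> set (mconflicts ?Pre ats)" unfolding set_mconflicts fst_conv snd_conv using ij(3) by blast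
      from bspec[OF L this] show False using ij by simp
    qed
    show "\<forall>i\<in>D. \<forall>j\<in>D. i \<noteq> j \<longrightarrow> mcompat ?Pre (ats ! i) (ats ! j)"
    proof (intro ballI impI)
      fix i j assume ij: "i \<in> D" "j \<in> D" "i \<noteq> j"
      show "mcompat ?Pre (ats ! i) (ats ! j)"
      proof (cases "i < j")
        case True then show ?thesis using lt ij by blast
      next
        case False then show ?thesis using lt[of j i] ij mcompat_sym by simp
      qed
    qed
  next
    assume R: "\<forall>i\<in>D. \<forall>j\<in>D. i \<noteq> j \<longrightarrow> mcompat ?Pre (ats ! i) (ats ! j)"
    show "\<forall>p\<in>set (mconflicts ?Pre ats). fst p \<notin> D \<or> snd p \<notin> D"
    proof
      fix p assume "p \<in> set (mconflicts ?Pre ats)"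
      then have p: "fst p \<noteq> snd p" "\<not> mcompat ?Pre (ats ! fst p) (ats ! snd p)" unfolding set_mconflicts by simp_all
      show "fst p \<notin> D \<or> snd p \<notin> D" using R p by blast
    qed
  qed
  show ?thesis
  proof
    assume "weighted_satisfiable C k"
    then obtain A where A: "A \<subseteq> vars C" "card A = k" "satisfies A C" unfolding weighted_satisfiable_def by blast
    have fin: "finite A" by (rule finite_subset[OF A(1)]) (simp add: vlist_vars[symmetric])
    define x where "x = (\<lambda>j. sorted_list_of_set A ! j)"
    have len: "length (sorted_list_of_set A) = k" using A(2) by simp
    have mono: "x i < x j" if "i < j" "j < k" for i j
      unfolding x_def by (rule sorted_wrt_nth_less[OF _ that(1)]) (use that len in simp_all)
    have "x ` {..<k} = set (sorted_list_of_set A)" unfolding set_conv_nth len x_def by auto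
    then have img: "x ` {..<k} = A" using fin by simp
    have mem: "x j \<in> set (vlist C)" if "j < k" for j using that img A(1) vlist_vars by blast
    have "\<exists>D\<subseteq>{..<length ats}. card D = 2 ^ k - 1 \<and>
      (\<forall>i\<in>D. \<forall>j\<in>D. i \<noteq> j \<longrightarrow> mcompat ?Pre (ats ! i) (ats ! j)) \<and> (!) ats ` D = matom_of ?Pre x ` ?D"
      by (rule clique_of_assignment[of k x "vlist C" ats ?Pre]; fact)
    then obtain D where D: "D \<subseteq> {..<length ats}" "card D = 2 ^ k - 1"
      "\<forall>i\<in>D. \<forall>j\<in>D. i \<noteq> j \<longrightarrow> mcompat ?Pre (ats ! i) (ats ! j)" "(!) ats ` D = matom_of ?Pre x ` ?D"
      by (elim exE conjE)
    have ky: "(\<forall>t\<in>set ?ts. ev (value_at D (mbase ?Pre ats)) False t) \<longleftrightarrow> satisfies (x ` {..<k}) C"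
      by (rule key[of D x]; fact)
    have "satisfies (x ` {..<k}) C" using A(3) img by simp
    then have e: "\<forall>t\<in>set ?ts. ev (value_at D (mbase ?Pre ats)) False t" unfolding ky .
    have "length ats \<notin> D" using D(1) by auto
    then have "satisfies D (member_circuit m C ?Pre ats)"
      using iffD2[OF mc(3) conjI[OF e conjI[OF _ iffD2[OF cf[OF D(1)] D(3)]]]] by blast
    then show "weighted_satisfiable (member_circuit m C ?Pre ats) (2 ^ k - 1)"
      unfolding weighted_satisfiable_def mc(2) using D(1,2) by (intro exI[of _ D]) auto
  next
    assume "weighted_satisfiable (member_circuit m C ?Pre ats) (2 ^ k - 1)"
    then obtain D where D: "D \<subseteq> {..<?M}" "card D = 2 ^ k - 1" "satisfies D (member_circuit m C ?Pre ats)"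
      unfolding weighted_satisfiable_def mc(2) by blast
    have s: "\<forall>t\<in>set ?ts. ev (value_at D (mbase ?Pre ats)) False t" "length ats \<notin> D"
      "\<forall>p\<in>set (mconflicts ?Pre ats). fst p \<notin> D \<or> snd p \<notin> D" using D(3) unfolding mc(3) by blast+
    have sub: "D \<subseteq> {..<length ats}"
    proof
      fix i assume "i \<in> D"
      then have "i < ?M" "i \<noteq> length ats" using D(1) s(2) by auto
      then show "i \<in> {..<length ats}" by simp
    qed
    have "\<exists>x. (\<forall>i j. i < j \<and> j < k \<longrightarrow> x i < x j) \<and> (\<forall>j<k. x j \<in> set (vlist C)) \<and> (!) ats ` D = matom_of ?Pre x ` ?D"
      by (rule assignment_of_matom_clique[OF sub D(2) _ ats]) (use iffD1[OF cf[OF sub] s(3)] in blast)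
    then obtain x where x: "\<forall>i j. i < j \<and> j < k \<longrightarrow> x i < x j" "\<forall>j<k. x j \<in> set (vlist C)"
      "(!) ats ` D = matom_of ?Pre x ` ?D" by (elim exE conjE)
    have mono: "x i < x j" if "i < j" "j < k" for i j using x(1) that by blast
    have "(\<forall>t\<in>set ?ts. ev (value_at D (mbase ?Pre ats)) False t) \<longleftrightarrow> satisfies (x ` {..<k}) C"
      by (rule key[of D x]; fact)
    from iffD1[OF this s(1)] have "satisfies (x ` {..<k}) C" .
    moreover have "x ` {..<k} \<subseteq> vars C" using x(2) vlist_vars by auto
    moreover have "inj_on x {..<k}"
    proof (rule inj_onI)
      fix i j assume ij: "i \<in> {..<k}" "j \<in> {..<k}" "x i = x j"
      then show "i = j" using mono[of i j] mono[of j i] by (cases i j rule: linorder_cases) auto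
    qed
    then have "card (x ` {..<k}) = k" by (simp add: card_image)
    ultimately show "weighted_satisfiable C k" unfolding weighted_satisfiable_def by blast
  qed
qed

section \<open>The membership reduction in fixed-parameter time\<close>

lemma ptime_hd [ptime_intros]: "ptime f \<Longrightarrow> ptime (\<lambda>x. hd (f x))"
proof (rule ptime_comp[of hd])
  have "ptime (\<lambda>l :: 'b list. case l of [] \<Rightarrow> hd [] | y # ys \<Rightarrow> y)" by (intro ptime_intros)
  moreover have "(\<lambda>l :: 'b list. case l of [] \<Rightarrow> hd [] | y # ys \<Rightarrow> y) = hd" by (rule ext) (simp split: list.split)
  ultimately show "ptime (hd :: 'b list \<Rightarrow> 'b)" by (simp only:)
qed

lemma ptime_tl [ptime_intros]: "ptime f \<Longrightarrow> ptime (\<lambda>x. tl (f x))"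
  using ptime_drop[OF ptime_const[of 1], of f] by (simp add: drop_Suc)

lemma ptime_take [ptime_intros]: "ptime n \<Longrightarrow> ptime l \<Longrightarrow> ptime (\<lambda>x. take (n x) (l x))"
proof -
  assume nl: "ptime n" "ptime l"
  have "ptime (\<lambda>x. rev (drop (length (l x) - n x) (rev (l x))))" by (intro ptime_intros nl)
  then show ?thesis by (simp add: rev_take[symmetric])
qed

lemma ptime_canon [ptime_intros]:
  assumes "ptime M" "ptime S" shows "ptime (\<lambda>x. canon (M x) (S x))"
  unfolding canon_def by (intro ptime_intros assms[THEN ptime_comp])

lemma ptime_step [ptime_intros]:
  assumes "ptime Pre" "ptime s" "ptime y" shows "ptime (\<lambda>x. step (Pre x) (s x) (y x))"
  unfolding step_def by (intro ptime_intros assms[THEN ptime_comp])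

lemma ptime_matoms [ptime_intros]:
  assumes "ptime Js" "ptime Pre" "ptime vs" shows "ptime (\<lambda>x. matoms (Js x) (Pre x) (vs x))"
  unfolding matoms_def by (intro ptime_intros assms[THEN ptime_comp])

lemma ptime_mcompat [ptime_intros]:
  assumes "ptime Pre" "ptime a" "ptime b" shows "ptime (\<lambda>x. mcompat (Pre x) (a x) (b x))"
  unfolding mcompat_def by (intro ptime_intros assms[THEN ptime_comp])

lemma ptime_pure [ptime_intros]:
  assumes "ptime C" "ptime i" shows "ptime (\<lambda>x. pure (C x) (i x))"
  unfolding pure_def by (intro ptime_intros assms[THEN ptime_comp])

lemma ptime_cvars [ptime_intros]:
  assumes "ptime C" "ptime i" shows "ptime (\<lambda>x. cvars (C x) (i x))"
  unfolding cvars_def by (intro ptime_intros assms[THEN ptime_comp])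

lemma ptime_conj_args [ptime_intros]:
  assumes "ptime C" "ptime i" shows "ptime (\<lambda>x. conj_args (C x) (i x))"
  unfolding conj_args_def by (intro ptime_intros assms[THEN ptime_comp])

lemma ptime_clause_leaves [ptime_intros]:
  assumes "ptime C" "ptime Pre" "ptime ats" "ptime i" shows "ptime (\<lambda>x. clause_leaves (C x) (Pre x) (ats x) (i x))"
  unfolding clause_leaves_def by (intro ptime_intros assms[THEN ptime_comp])

lemma ptime_anti_rule:
  assumes "ptime (\<lambda>p. anti m (fst p) (fst (snd p)) (fst (snd (snd p))) (snd (snd (snd p))))"
    "ptime C" "ptime Pre" "ptime ats" "ptime us"
  shows "ptime (\<lambda>x. anti m (C x) (Pre x) (ats x) (us x))"
  using ptime_comp[OF assms(1), of "\<lambda>x. (C x, Pre x, ats x, us x)"] assms(2-) by (simp add: ptime_pair)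

lemma ptime_anti_prim: "ptime (\<lambda>p. anti m (fst p) (fst (snd p)) (fst (snd (snd p))) (snd (snd (snd p))))"
proof (induction m)
  case 0
  show ?case unfolding anti.simps(1) by (intro ptime_intros)
next
  case (Suc m)
  show ?case unfolding anti.simps(2) by (intro ptime_intros ptime_anti_rule[OF Suc])
qed

lemmas ptime_anti [ptime_intros] = ptime_anti_rule[OF ptime_anti_prim]

lemma ptime_prefs [ptime_intros]:
  assumes "ptime C" shows "ptime (\<lambda>x. prefs (C x))"
  unfolding prefs_def by (intro ptime_intros assms[THEN ptime_comp])

lemma ptime_mconflicts [ptime_intros]:
  assumes "ptime Pre" "ptime ats" shows "ptime (\<lambda>x. mconflicts (Pre x) (ats x))"
  unfolding mconflicts_def by (intro ptime_intros assms[THEN ptime_comp])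

lemma ptime_mbase [ptime_intros]:
  assumes "ptime Pre" "ptime ats" shows "ptime (\<lambda>x. mbase (Pre x) (ats x))"
  unfolding mbase_def by (intro ptime_intros assms[THEN ptime_comp])

lemma ptime_member_circuit [ptime_intros]:
  assumes "ptime C" "ptime Pre" "ptime ats" shows "ptime (\<lambda>x. member_circuit m (C x) (Pre x) (ats x))"
  unfolding member_circuit_def by (intro ptime_intros assms)

lemma dlists_fold: "dlists k = fold (\<lambda>j L. L @ map ((#) j) L) [0..<k] [[]]"
  by (induction k) auto

lemma sz_dlists: "sz (dlists k) \<le> 2 ^ k * (k * (2 * k + 2) + 3)"
proof (induction k)
  case (Suc k)
  have "sz (map ((#) k) L) = sz L + length L * (2 * k + 2)" for L by (induction L) auto
  then have "sz (dlists (Suc k)) + 1 = 2 * sz (dlists k) + 2 ^ k * (2 * k + 2)"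
    using sz_append[of "dlists k" "map ((#) k) (dlists k)"] by (simp add: length_dlists)
  also have "\<dots> \<le> 2 * (2 ^ k * (k * (2 * k + 2) + 3)) + 2 ^ k * (2 * k + 2)" using Suc by simp
  also have "\<dots> = 2 ^ k * (2 * (k * (2 * k + 2) + 3) + (2 * k + 2))" by (simp add: algebra_simps)
  also have "\<dots> \<le> 2 ^ k * (2 * (Suc k * (2 * Suc k + 2) + 3))" by (intro mult_le_mono2) (simp add: algebra_simps)
  also have "\<dots> = 2 ^ Suc k * (Suc k * (2 * Suc k + 2) + 3)" by (simp only: power_Suc mult.assoc mult.left_commute)
  finally show ?case by linarith
qed simp

text \<open>There are exponentially many index sets, so this part of the reduction is not
  polynomial. Its time depends on the parameter alone, and what is needed is an explicit computable
  bound.\<close>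

lemma runs_dlists: "\<exists>F. runs dlists F \<and> comput F"
proof -
  let ?f = "\<lambda>p :: unit \<times> nat \<times> nat list list. snd (snd p) @ map ((#) (fst (snd p))) (snd (snd p))"
  have "ptime ?f" by (intro ptime_intros)
  then obtain \<tau> d where \<tau>: "runs ?f \<tau>" "\<And>x. \<tau> x \<le> (sz x + 2) ^ d" unfolding ptime_def polyb_def by blast
  have "ptime (\<lambda>k :: nat. ((), [0..<k], [[]] :: nat list list))" by (intro ptime_intros)
  then obtain \<rho> c where \<rho>: "runs (\<lambda>k :: nat. ((), [0..<k], [[]] :: nat list list)) \<rho>" "\<And>x. \<rho> x \<le> (sz x + 2) ^ c"
    unfolding ptime_def polyb_def by blast
  define X where "X = (\<lambda>k :: nat. (2 ^ k :: nat) * (k * (2 * k + 2) + 3))"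
  define N where "N = (\<lambda>k :: nat. 1 + k * (2 * k + 2))"
  define F where "F = (\<lambda>k :: nat. (2 * k + 3) ^ c + (17 + 2 * N k +
    (1 + k * (10 + 6 * N k + 6 * X k + (2 * N k + X k + 5) ^ d)) + X k))"
  have N: "sz [0..<k] \<le> N k" for k
  proof (induction k)
    case (Suc k)
    then show ?case using sz_append[of "[0..<k]" "[k]"] unfolding N_def by simp
  qed (simp add: N_def)
  have X: "sz (fold (\<lambda>y a. ?f ((), y, a)) zs [[]]) \<le> X k" if zs: "[0..<k] = zs @ zs'" for k zs zs'
  proof -
    have z: "zs = [0..<length zs]" using arg_cong[OF zs, of "take (length zs)"] arg_cong[OF zs, of length] by (simp add: take_upt)
    have "fold (\<lambda>y a. ?f ((), y, a)) zs [[]] = dlists (length zs)" by (subst z) (simp add: dlists_fold)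
    moreover have "X (length zs) \<le> X k" unfolding X_def using arg_cong[OF zs, of length]
      by (intro mult_le_mono add_mono power_increasing) auto
    ultimately show ?thesis using sz_dlists[of "length zs"] unfolding X_def by simp
  qed
  have "runs (\<lambda>k. (\<lambda>(e, l, a). fold (\<lambda>y a. ?f (e, y, a)) l a) ((), [0..<k], [[]])) F"
  proof (rule runs_mono[OF runs_comp[OF \<rho>(1) runs_fold[OF \<tau>(1)]]])
    fix k
    have "loop_time ?f \<tau> () [0..<k] [[]] \<le> 1 + length [0..<k] * (10 + 6 * N k + 6 * X k + (2 * N k + X k + 5) ^ d)"
      by (rule loop_time_bound[OF X \<tau>(2) _ N]) (simp_all add: N_def)
    moreover have "\<rho> k \<le> (2 * k + 3) ^ c" using \<rho>(2)[of k] by (simp add: eval_nat_numeral)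
    moreover have "sz (fold (\<lambda>y a. ?f ((), y, a)) [0..<k] [[]]) \<le> X k" by (rule X[of k _ "[]"]) simp
    ultimately show "\<rho> k + (case ((), [0..<k], [[]]) of (e, l, a) \<Rightarrow> 10 + sz e + 2 * sz l + 2 * sz a
        + loop_time ?f \<tau> e l a + sz (fold (\<lambda>y a. ?f (e, y, a)) l a)) \<le> F k"
      using N[of k] unfolding F_def by simp
  qed
  then have r: "runs dlists F" by (simp add: dlists_fold[abs_def])
  \<comment> \<open>That \<open>2 ^ k\<close> is computable, as the time bound requires, is read off
    from the program for \<open>dlists\<close> itself.\<close>
  have "comput (\<lambda>k. length (dlists k))"
    by (rule comput_comp[OF ptime_comput]) (intro ptime_intros, use r in \<open>auto simp: comput_def\<close>)
  then have p: "comput (\<lambda>k :: nat. 2 ^ k :: nat)" by (simp add: length_dlists)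
  have "comput F" unfolding F_def X_def N_def by (intro comput_intros p)
  with r show ?thesis by blast
qed

text \<open>A computable precomputation \<open>f\<close> on the parameter followed by a
  polynomial-time step on the circuit and its result. In the measure \<open>\<mu>\<close>, circuit
  size plus a function of the parameter, the whole is polynomial, and \<open>fpt_bound\<close>
  separates the two.\<close>

lemma fpt_reduction_WSAT_on:
  fixes G :: "circuit \<times> 'b::enc \<Rightarrow> circuit \<times> nat" and f :: "nat \<Rightarrow> 'b"
  assumes f: "runs f F" "comput F" and G: "ptime G" and h: "comput h"
    and corr: "\<And>C k C' k'. Q C \<Longrightarrow> G (C, f k) = (C', k') \<Longrightarrow>
      Q' C' \<and> k' \<le> h k \<and> (weighted_satisfiable C k \<longleftrightarrow> weighted_satisfiable C' k')"
  shows "WSAT_on Q \<le>\<^sub>f\<^sub>p\<^sub>t WSAT_on Q'"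
proof -
  obtain \<tau> where \<tau>: "runs G \<tau>" "polyb sz \<tau>" using G unfolding ptime_def by blast
  obtain \<rho> where \<rho>: "runs (fst :: circuit \<times> nat \<Rightarrow> circuit) \<rho>" "polyb sz \<rho>" using ptime_fst_prim unfolding ptime_def by blast
  obtain \<sigma> where \<sigma>: "runs (snd :: circuit \<times> nat \<Rightarrow> nat) \<sigma>" "polyb sz \<sigma>" using ptime_snd_prim unfolding ptime_def by blast
  define Y where "Y = (\<lambda>k. F k + 2 * k + 2)"
  define \<mu> where "\<mu> = (\<lambda>p :: circuit \<times> nat. sz (fst p) + Y (snd p))"
  define T where "T = (\<lambda>p. (4 + 2 * sz p + \<rho> p + (\<sigma> p + F (snd p)) + sz (fst p) + sz (f (snd p))) + \<tau> (fst p, f (snd p)))"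
  have run: "runs (\<lambda>p. G (fst p, f (snd p))) T" unfolding T_def
    by (rule runs_comp[OF runs_pair[OF \<rho>(1) runs_comp[OF \<sigma>(1) f(1)]] \<tau>(1)])
  have fsz: "sz (f k) \<le> 2 * k + 1 + F k" for k using runs_size[OF f(1), of k] by simp
  have szp: "polyb \<mu> sz" by (rule polyb_mono[OF polyb_base]) (auto simp: \<mu>_def Y_def)
  have pair: "polyb \<mu> (\<lambda>p. sz (fst p, f (snd p)))"
    by (rule polyb_mono[OF polyb_base]) (use fsz in \<open>auto simp: \<mu>_def Y_def add.commute add.left_commute intro: add_mono\<close>)
  have b: "polyb \<mu> (\<lambda>p. F (snd p))" "polyb \<mu> (\<lambda>p. sz (fst p))" "polyb \<mu> (\<lambda>p. sz (f (snd p)))"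
  proof -
    show "polyb \<mu> (\<lambda>p. F (snd p))" "polyb \<mu> (\<lambda>p. sz (fst p))"
      by (rule polyb_mono[OF polyb_base], simp add: \<mu>_def Y_def)+
    show "polyb \<mu> (\<lambda>p. sz (f (snd p)))" by (rule polyb_mono[OF pair]) simp
  qed
  have "polyb \<mu> T" unfolding T_def
    by (intro polyb_intros szp b polyb_comp[OF \<tau>(2) pair] polyb_comp[OF \<rho>(2), of \<mu> "\<lambda>p. p"] polyb_comp[OF \<sigma>(2), of \<mu> "\<lambda>p. p"])
  then obtain d where d: "\<And>p. T p \<le> (\<mu> p + 2) ^ d" unfolding polyb_def by blast
  show ?thesis
  proof (rule fpt_reducible_WSAT_on[OF run _ _ h])
    show "T (C, k) \<le> (Y k + 3) ^ d * sz C ^ d" for C k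
      using d[of "(C, k)"] fpt_bound[of C Y k d] unfolding \<mu>_def by simp
    show "comput (\<lambda>k. (Y k + 3) ^ d)" unfolding Y_def by (intro comput_intros f(2))
    show "Q' C' \<and> k' \<le> h k \<and> (weighted_satisfiable C k \<longleftrightarrow> weighted_satisfiable C' k')"
      if "Q C" "G (fst (C, k), f (snd (C, k))) = (C', k')" for C k C' k'
      using corr[of C k C' k'] that by simp
  qed
qed

theorem anti_genus_reducible_weft_circuit:
  assumes "t \<le> 2 * m + 2"
  shows "WSAT_anti_genus t g \<le>\<^sub>f\<^sub>p\<^sub>t WSAT_on (weft_circuit (2 * m + 1) (2 * m + 3))"
proof -
  obtain F where F: "runs dlists F" "comput F" using runs_dlists by blast
  define G where "G = (\<lambda>p. (member_circuit m (fst p) (prefs (fst p)) (matoms (snd p) (prefs (fst p)) (vlist (fst p))),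
    length (snd p) - 1))"
  have len: "comput (\<lambda>k. length (dlists k) - 1)"
    by (rule comput_comp[OF ptime_comput[of "\<lambda>l. length l - 1"], of dlists]) (intro ptime_intros, use F in \<open>auto simp: comput_def\<close>)
  show ?thesis unfolding WSAT_anti_genus_def
  proof (rule fpt_reduction_WSAT_on[OF F _ len])
    show "ptime G" unfolding G_def by (intro ptime_intros)
    fix C k C' k'
    assume C: "Pi_circuit t C \<and> antimonotone C \<and> real (circuit_genus C) \<le> g (card (vars C))"
      and eq: "G (C, dlists k) = (C', k')"
    interpret anti_pi C t using C by unfold_locales auto
    have C': "C' = member_circuit m C (prefs C) (matoms (dlists k) (prefs C) (vlist C))" "k' = 2 ^ k - 1"
      using eq unfolding G_def by (auto simp: length_dlists)
    show "weft_circuit (2 * m + 1) (2 * m + 3) C' \<and> k' \<le> length (dlists k) - 1 \<and>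
        (weighted_satisfiable C k \<longleftrightarrow> weighted_satisfiable C' k')"
    proof (intro conjI)
      show "weft_circuit (2 * m + 1) (2 * m + 3) C'" unfolding C'(1) by (rule member_circuit(1))
      show "k' \<le> length (dlists k) - 1" unfolding C'(2) length_dlists ..
      show "weighted_satisfiable C k \<longleftrightarrow> weighted_satisfiable C' k'"
        unfolding C' by (rule weighted_satisfiable_member_circuit[OF assms])
    qed
  qed
qed

section \<open>Completeness for both parities of the depth\<close>

theorem W_complete_anti_genus:
  fixes g :: "nat \<Rightarrow> real"
  assumes "c > 0" "\<And>n. g n \<ge> 0" "g \<in> \<Omega>(\<lambda>n. real n powr c)" "max (2 * m + 1) 2 \<le> t" "t \<le> 2 * m + 2"
  shows "W_complete (2 * m + 1) (WSAT_anti_genus t g)"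
  unfolding W_complete_def W_hard_def W_class_def
proof (intro conjI ballI)
  show "WSAT_anti_genus t g \<in> {P. \<exists>d. P \<le>\<^sub>f\<^sub>p\<^sub>t WSAT_on (weft_circuit (2 * m + 1) d)}"
    using anti_genus_reducible_weft_circuit[OF assms(5)] by blast
  fix Q assume "Q \<in> {P. \<exists>d. P \<le>\<^sub>f\<^sub>p\<^sub>t WSAT_on (weft_circuit (2 * m + 1) d)}"
  then obtain d where "Q \<le>\<^sub>f\<^sub>p\<^sub>t WSAT_on (weft_circuit (2 * m + 1) d)" by blast
  then show "Q \<le>\<^sub>f\<^sub>p\<^sub>t WSAT_anti_genus t g"
    by (rule fpt_reducible_trans[OF _ weft_circuit_reducible_anti_genus[OF assms(1-4)]])
qed

theorem theorem1:
  fixes c :: real and t :: nat and g :: "nat \<Rightarrow> real"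
  assumes "c > 0"
    and "t \<ge> 2"
    and "\<And>n. g n \<ge> 0"
    and "g \<in> \<Omega>(\<lambda>n. real n powr c)"
  shows "(odd t \<longrightarrow> W_complete t (WSAT_anti_genus t g)) \<and>
         (even t \<longrightarrow> W_complete (t - 1) (WSAT_anti_genus t g))"
proof (intro conjI impI)
  assume "odd t"
  then obtain m where m: "t = 2 * m + 1" by (rule oddE)
  have "W_complete (2 * m + 1) (WSAT_anti_genus t g)"
    by (rule W_complete_anti_genus[OF assms(1,3,4)]) (use m assms(2) in simp_all)
  then show "W_complete t (WSAT_anti_genus t g)" using m by simp
next
  assume "even t"
  then obtain n where "t = 2 * n" by (rule evenE)
  then obtain m where m: "t = 2 * m + 2" using assms(2) by (cases n) auto
  have "W_complete (2 * m + 1) (WSAT_anti_genus t g)"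
    by (rule W_complete_anti_genus[OF assms(1,3,4)]) (use m in simp_all)
  then show "W_complete (t - 1) (WSAT_anti_genus t g)" using m by simp
qed

end
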